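(* In the setting and notation described in the context, let $V_h\subseteq\mathbb P^p_d(\mathcal T_h)$ and $\epsilon\in\{-1,0,1\}$, and let $$\gamma_\epsilon=\begin{cases}0&\epsilon=1,\\ \|\boldsymbol K\|^2_{L^\infty(\Omega)}\frac{N_\partial C_{tr}}{4k_{min}}&\epsilon=0,\\ \|\boldsymbol K\|^2_{L^\infty(\Omega)}\frac{N_\partial C_{tr}}{k_{min}}&\epsilon=-1.\end{cases}$$ For all $\gamma>\gamma_\epsilon$ there exists $\alpha>0$, independent of $h$, such that $$a_h^{dar}(v_h,v_h)\ge\alpha\,|||v_h|||^2_{dar}\qquad\forall v_h\in V_h,$$ with $\alpha=\min\{1,\sigma_0,\alpha_d\}$, where $\alpha_d=1$ if $\epsilon=1$ and $\alpha_d=1+\frac12(\epsilon-1)\|\boldsymbol K\|_{L^\infty(\Omega)}\big(\frac{N_\partial C_{tr}}{\gamma k_{min}}\big)^{1/2}$ if $\epsilon\in\{0,-1\}$.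
   Context: **Coefficients.** $\Omega\subset\mathbb R^d$ ($d\ge1$) is an open, bounded, Lipschitz polytope with outward unit normal $\mathbf n$; $\partial\Omega=\Gamma_D\cup\Gamma_N$ with $\Gamma_D\cap\Gamma_N=\emptyset$, $\Gamma_D\ne\emptyset$. $\boldsymbol K\in[L^\infty(\Omega)]^{d\times d}$ with $\boldsymbol K|_T\in[W^{1,\infty}(T)]^{d\times d}$ for each mesh element $T$, $\boldsymbol\beta\in[W^{1,\infty}(\Omega)]^d$, $\sigma\in L^\infty(\Omega)$. There is $k_{min}>0$ with $\boldsymbol\xi^T\boldsymbol K(\mathbf x)\boldsymbol\xi\ge k_{min}|\boldsymbol\xi|^2$ for all $\boldsymbol\xi\in\mathbb R^d$, $\mathbf x\in\Omega$; there is $\sigma_0>0$ with $\sigma+\frac12\mathrm{div}\boldsymbol\beta\ge\sigma_0$ a.e. in $\Omega$; if $\boldsymbol\beta\not\equiv0$ then $\Gamma_D=\{\boldsymbol\beta\cdot\mathbf n<0\}$ and $\Gamma_N=\{\boldsymbol\beta\cdot\mathbf n\ge0\}$ (as subsets of $\partial\Omega$). **Mesh.** $\mathcal T_h$ is a member of a sequence of conforming polytopic meshes of $\Omega$ (finite families of disjoint open polytopes $T$ whose closures cover $\overline\Omega$). $h_T$, $\rho_T$ are the diameter and inradius of $T$; $h_e$ is the diameter of a facet $e$; $h=\max_Th_T$; $\mathbf n_T$ is the outward unit normal of $T$; $\mathbf n_e$ is a fixed unit normal to the facet $e$. Uniformly in $h$: $h_T\le C_{sr}\rho_T$; $h_T\le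 C_gh_e$ for every facet $e\subset\partial T$; each $T$ is star-shaped with respect to a ball of radius $rh_T$ ($0<r\le\frac12$) centred at some point of $T$. $\mathcal E_h^I,\mathcal E_h^D,\mathcal E_h^N$ are the sets of interior facets, boundary facets in $\Gamma_D$, boundary facets in $\Gamma_N$ (every boundary facet is in one of the last two); $\mathcal E_h$ is their union. On each facet $\boldsymbol\beta\cdot\mathbf n_e$ has constant sign. $N_\partial$ is the maximum number of facets of a mesh element (regarded as independent of $h$). $\mathbb P^p_d(T)$: polynomials of total degree $\le p$; $\mathbb P^p_d(\mathcal T_h)$: functions whose restriction to each $T$ is in $\mathbb P^p_d(T)$. $C_{tr}>0$ (independent of $h$) is the constant of the discrete trace inequality $\|v\|^2_{L^2(\partial T)}\le C_{tr}h_T^{-1}\|v\|^2_{L^2(T)}$ for all $T\in\mathcal T_h$, $v\in\mathbb P^p_d(T)$. **Averages and jumps.** On $e=\partial T_1\cap\partial T_2$: $\{\!\{w\}\!\}=\frac12(w|_{T_1}+w|_{T_2})$ (scalar or vector), $[\![v]\!]=v|_{T_1}\mathbf n_{T_1}+v|_{T_2}\mathbf n_{T_2}$ (scalar $v$). On boundary facets $\{\!\{w\}\!\}=w$, $[\![v]\!]=v\mathbf n$. $[\![v]\!]^2$ means $|[\![v]\!]|^2$. **DG form.** $a_h^{dar}=a_h^d+a_h^{ar}$ with $$a_h^d(w,v)=\sum_{T}\int_T\boldsymbol K\nabla w\cdot\nabla v-\sum_{e\in\mathcal E_h^I\cup\mathcal E_h^D}\int_e\{\!\{\boldsymbol K\nabla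 w\}\!\}\cdot[\![v]\!]+\epsilon\sum_{e\in\mathcal E_h^I\cup\mathcal E_h^D}\int_e[\![w]\!]\cdot\{\!\{\boldsymbol K\nabla v\}\!\}+\sum_{e\in\mathcal E_h^I\cup\mathcal E_h^D}\frac\gamma{h_e}\int_e[\![w]\!]\cdot[\![v]\!],$$ $$a_h^{ar}(w,v)=-\sum_T\int_T w\boldsymbol\beta\cdot\nabla v+\sum_T\int_T\sigma wv+\sum_{e\in\mathcal E_h^I}\int_e\{\!\{\boldsymbol\beta w\}\!\}\cdot[\![v]\!]+\frac12\sum_{e\in\mathcal E_h^I}\int_e|\boldsymbol\beta\cdot\mathbf n_e|[\![w]\!]\cdot[\![v]\!]+\sum_{e\in\mathcal E_h^N}\int_e(\boldsymbol\beta\cdot\mathbf n)wv.$$ **Norm.** $|||v|||_{dar}^2=\sum_T\int_T\boldsymbol K\nabla v\cdot\nabla v+\sum_{e\in\mathcal E_h^I\cup\mathcal E_h^D}\frac\gamma{h_e}\int_e[\![v]\!]^2+\|v\|^2_{L^2(\Omega)}+\frac12\sum_{e\in\mathcal E_h}\int_e|\boldsymbol\beta\cdot\mathbf n_e|[\![v]\!]^2$. $\|\boldsymbol K\|_{L^\infty}$ uses the spectral norm pointwise. *)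

theory Defs
  imports "HOL-Analysis.Analysis" "HOL-Probability.Essential_Supremum"
begin

section \<open>Polytopes, facets, normals\<close>

text \<open>Polytopes are not required to be convex: they are finite unions of the (convex) polytopes
  of the library.\<close>

definition open_polytope :: "(real^'n) set \<Rightarrow> bool" where
  "open_polytope U \<longleftrightarrow>
     U \<noteq> {} \<and> (\<exists>F. finite F \<and> (\<forall>P\<in>F. polytope P) \<and> U = interior (\<Union>F))"

text \<open>Locally, and up to a rigid motion, the set is the strict epigraph of a Lipschitz function
  \<open>g\<close> of the coordinates orthogonal to \<open>u\<close>.\<close>

definition lipschitz_domain :: "(real^'n) set \<Rightarrow> bool" where
  "lipschitz_domain U \<longleftrightarrow> open U \<and>
     (\<forall>x\<in>frontier U. \<exists>u r L g. norm u = 1 \<and> 0 < r \<and> L-lipschitz_on UNIV g \<and>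
        U \<inter> ball x r = {y \<in> ball x r. g ((y - x) - ((y - x) \<bullet> u) *\<^sub>R u) < (y - x) \<bullet> u})"

text \<open>The outward unit normal exists exactly at the boundary points near which the set is a
  half-space, i.e. off the lower-dimensional faces of a polytope.  The facets, taken relatively
  open, are the connected pieces of this part of the boundary.\<close>

definition is_outward_normal :: "(real^'n) set \<Rightarrow> real^'n \<Rightarrow> real^'n \<Rightarrow> bool" where
  "is_outward_normal U x \<nu> \<longleftrightarrow>
     norm \<nu> = 1 \<and> (\<exists>r>0. U \<inter> ball x r = {y \<in> ball x r. \<nu> \<bullet> (y - x) < 0})"

definition outward_normal :: "(real^'n) set \<Rightarrow> real^'n \<Rightarrow> real^'n" where
  "outward_normal U x = (THE \<nu>. is_outward_normal U x \<nu>)"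

definition flat_boundary :: "(real^'n) set \<Rightarrow> (real^'n) set" where
  "flat_boundary U = {x \<in> frontier U. \<exists>\<nu>. is_outward_normal U x \<nu>}"

definition facets :: "(real^'n) set \<Rightarrow> (real^'n) set set" where
  "facets U = components (flat_boundary U)"

definition inradius :: "(real^'n) set \<Rightarrow> real" where
  "inradius U = Sup {s. 0 < s \<and> (\<exists>x. ball x s \<subseteq> U)}"

definition star_shaped_wrt :: "(real^'n) set \<Rightarrow> (real^'n) set \<Rightarrow> bool" where
  "star_shaped_wrt U B \<longleftrightarrow> (\<forall>y\<in>B. \<forall>x\<in>U. closed_segment y x \<subseteq> U)"

section \<open>Integration over facets\<close>

definition facet_normal :: "(real^'n) set \<Rightarrow> real^'n" where
  "facet_normal e = (SOME \<nu>. norm \<nu> = 1 \<and> (\<exists>b. e \<subseteq> {x. \<nu> \<bullet> x = b}))"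

text \<open>The surface measure of the hyperplane \<open>\<nu> \<bullet> x = b\<close> with unit normal \<open>\<nu>\<close> is the image of the
  Lebesgue measure on the slab of thickness 1 over it under the orthogonal projection.  By Fubini
  this is the (d-1)-dimensional Lebesgue measure (the Dirac measure of a point if d = 1).\<close>

definition hyperplane_measure :: "real^'n \<Rightarrow> real \<Rightarrow> (real^'n) measure" where
  "hyperplane_measure \<nu> b =
     distr (restrict_space lborel {y. b \<le> \<nu> \<bullet> y \<and> \<nu> \<bullet> y \<le> b + 1}) borel
       (\<lambda>y. y - (\<nu> \<bullet> y - b) *\<^sub>R \<nu>)"

definition facet_measure :: "(real^'n) set \<Rightarrow> (real^'n) measure" where
  "facet_measure e =
     hyperplane_measure (facet_normal e) (THE b. e \<subseteq> {x. facet_normal e \<bullet> x = b})"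

definition facet_integral :: "(real^'n) set \<Rightarrow> (real^'n \<Rightarrow> real) \<Rightarrow> real" where
  "facet_integral e f = (LINT x:e|facet_measure e. f x)"

section \<open>Function spaces\<close>

definition grad :: "(real^'n \<Rightarrow> real) \<Rightarrow> real^'n \<Rightarrow> real^'n" where
  "grad f x = (\<chi> i. frechet_derivative f (at x) (axis i 1))"

definition Linf :: "(real^'n) set \<Rightarrow> (real^'n \<Rightarrow> 'b::real_normed_vector) \<Rightarrow> bool" where
  "Linf U f \<longleftrightarrow> f \<in> borel_measurable (lebesgue_on U) \<and>
     (\<exists>C. AE x in lebesgue_on U. norm (f x) \<le> C)"

text \<open>Weak first derivatives are tested with compactly supported functions of class C1, as e.g.
  in Gilbarg and Trudinger; by mollification this agrees with smooth test functions.\<close>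

definition test_function :: "(real^'n) set \<Rightarrow> (real^'n \<Rightarrow> real) \<Rightarrow> bool" where
  "test_function U \<phi> \<longleftrightarrow> (\<forall>x. \<phi> differentiable (at x)) \<and> continuous_on UNIV (grad \<phi>) \<and>
     (\<exists>C. compact C \<and> C \<subseteq> U \<and> (\<forall>x. x \<notin> C \<longrightarrow> \<phi> x = 0))"

definition is_weak_partial ::
    "(real^'n) set \<Rightarrow> 'n \<Rightarrow> (real^'n \<Rightarrow> real) \<Rightarrow> (real^'n \<Rightarrow> real) \<Rightarrow> bool" where
  "is_weak_partial U i f g \<longleftrightarrow>
     (\<forall>C. compact C \<and> C \<subseteq> U \<longrightarrow> set_integrable lebesgue C g) \<and>
     (\<forall>\<phi>. test_function U \<phi> \<longrightarrow>
        (LINT x|lebesgue_on U. f x * grad \<phi> x $ i) = - (LINT x|lebesgue_on U. g x * \<phi> x))"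

definition W1inf :: "(real^'n) set \<Rightarrow> (real^'n \<Rightarrow> real) \<Rightarrow> bool" where
  "W1inf U f \<longleftrightarrow> Linf U f \<and> (\<forall>i. \<exists>g. Linf U g \<and> is_weak_partial U i f g)"

definition weak_div :: "(real^'n) set \<Rightarrow> (real^'n \<Rightarrow> real^'n) \<Rightarrow> real^'n \<Rightarrow> real" where
  "weak_div U b x = (\<Sum>i\<in>UNIV. (SOME g. is_weak_partial U i (\<lambda>y. b y $ i) g) x)"

text \<open>Values on the closure, in particular boundary traces.  For a Lipschitz open set \<open>U\<close> a function
  of class \<open>W1inf U\<close> coincides almost everywhere with a function continuous on the closure, whose
  values there are uniquely determined.\<close>

definition cont_rep ::
    "(real^'n) set \<Rightarrow> (real^'n \<Rightarrow> 'b::topological_space) \<Rightarrow> real^'n \<Rightarrow> 'b" where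
  "cont_rep U f = (SOME g. continuous_on (closure U) g \<and> (AE x in lebesgue_on U. g x = f x))"

text \<open>The essential supremum of the pointwise spectral norm.\<close>

definition Linf_norm_matrix :: "(real^'n) set \<Rightarrow> (real^'n \<Rightarrow> real^'n^'n) \<Rightarrow> real" where
  "Linf_norm_matrix U K =
     real_of_ereal (esssup (lebesgue_on U) (\<lambda>x. ereal (onorm (\<lambda>\<xi>. K x *v \<xi>))))"

definition poly_space :: "nat \<Rightarrow> (real^'n \<Rightarrow> real) set" where
  "poly_space p = {f. \<exists>c :: ('n \<Rightarrow> nat) \<Rightarrow> real. \<forall>x.
     f x = (\<Sum>a | (\<Sum>i\<in>UNIV. a i) \<le> p. c a * (\<Prod>i\<in>UNIV. (x $ i) ^ a i))}"

definition broken_poly_space :: "nat \<Rightarrow> (real^'n) set set \<Rightarrow> (real^'n \<Rightarrow> real) set" where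
  "broken_poly_space p \<T> = {v. \<forall>T\<in>\<T>. \<exists>q\<in>poly_space p. \<forall>x\<in>T. v x = q x}"

section \<open>Meshes, averages and jumps\<close>

definition conforming_mesh :: "(real^'n) set \<Rightarrow> (real^'n) set set \<Rightarrow> bool" where
  "conforming_mesh \<Omega> \<T> \<longleftrightarrow>
     finite \<T> \<and> (\<forall>T\<in>\<T>. open_polytope T \<and> T \<subseteq> \<Omega>) \<and> disjoint \<T> \<and>
     (\<Union>T\<in>\<T>. closure T) = closure \<Omega> \<and>
     (\<forall>T\<in>\<T>. \<forall>e\<in>facets T. e \<subseteq> frontier \<Omega> \<or> (\<exists>T'\<in>\<T>. T' \<noteq> T \<and> e \<in> facets T'))"

definition interior_facets :: "(real^'n) set set \<Rightarrow> (real^'n) set set" where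
  "interior_facets \<T> = {e. \<exists>T\<in>\<T>. \<exists>T'\<in>\<T>. T \<noteq> T' \<and> e \<in> facets T \<and> e \<in> facets T'}"

definition boundary_facets :: "(real^'n) set set \<Rightarrow> (real^'n) set \<Rightarrow> (real^'n) set set" where
  "boundary_facets \<T> \<Gamma> = {e. \<exists>T\<in>\<T>. e \<in> facets T \<and> e \<subseteq> \<Gamma>}"

text \<open>The maximum over all elements of all meshes of the sequence, so that it does not depend on
  the mesh; used only when the set is bounded.\<close>

definition max_facets :: "(nat \<Rightarrow> (real^'n) set set) \<Rightarrow> nat" where
  "max_facets \<M> = Sup {card (facets T) | T n. T \<in> \<M> n}"

definition adjacent :: "(real^'n) set set \<Rightarrow> (real^'n) set \<Rightarrow> (real^'n) set set" where
  "adjacent \<T> e = {T \<in> \<T>. e \<in> facets T}"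

text \<open>The diameter of a facet.  If d = 1 facets are points, for which the diameter vanishes and
  neither the penalty nor the mesh regularity makes sense; then the usual local mesh size is taken.\<close>

definition facet_size :: "(real^'n) set set \<Rightarrow> (real^'n) set \<Rightarrow> real" where
  "facet_size \<T> e =
     (if CARD('n) = 1 then Min (diameter ` adjacent \<T> e) else diameter e)"

text \<open>An interior facet has two adjacent elements and a boundary facet has one, whose outward
  normal on that facet is the one of the domain.  So the next two definitions cover both kinds of
  facets.\<close>

definition average ::
    "(real^'n) set set \<Rightarrow> (real^'n) set \<Rightarrow> (real^'n \<Rightarrow> 'b::real_normed_vector) \<Rightarrow> real^'n \<Rightarrow> 'b" where
  "average \<T> e w x =
     (1 / real (card (adjacent \<T> e))) *\<^sub>R (\<Sum>T\<in>adjacent \<T> e. cont_rep T w x)"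

definition jump ::
    "(real^'n) set set \<Rightarrow> (real^'n) set \<Rightarrow> (real^'n \<Rightarrow> real) \<Rightarrow> real^'n \<Rightarrow> real^'n" where
  "jump \<T> e v x = (\<Sum>T\<in>adjacent \<T> e. cont_rep T v x *\<^sub>R outward_normal T x)"

section \<open>The discontinuous Galerkin form and norm\<close>

definition dg_diffusion ::
    "(real^'n) set \<Rightarrow> (real^'n \<Rightarrow> real^'n^'n) \<Rightarrow> real \<Rightarrow> real \<Rightarrow> (real^'n) set set \<Rightarrow>
     (real^'n \<Rightarrow> real) \<Rightarrow> (real^'n \<Rightarrow> real) \<Rightarrow> real" where
  "dg_diffusion \<Gamma>\<^sub>D K \<epsilon> \<gamma> \<T> w v =
     (\<Sum>T\<in>\<T>. LINT x|lebesgue_on T. (K x *v grad w x) \<bullet> grad v x)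
     - (\<Sum>e \<in> interior_facets \<T> \<union> boundary_facets \<T> \<Gamma>\<^sub>D.
          facet_integral e (\<lambda>x. average \<T> e (\<lambda>y. K y *v grad w y) x \<bullet> jump \<T> e v x))
     + \<epsilon> * (\<Sum>e \<in> interior_facets \<T> \<union> boundary_facets \<T> \<Gamma>\<^sub>D.
          facet_integral e (\<lambda>x. jump \<T> e w x \<bullet> average \<T> e (\<lambda>y. K y *v grad v y) x))
     + (\<Sum>e \<in> interior_facets \<T> \<union> boundary_facets \<T> \<Gamma>\<^sub>D.
          \<gamma> / facet_size \<T> e * facet_integral e (\<lambda>x. jump \<T> e w x \<bullet> jump \<T> e v x))"

definition dg_advection_reaction ::
    "(real^'n) set \<Rightarrow> (real^'n) set \<Rightarrow> (real^'n \<Rightarrow> real^'n) \<Rightarrow> (real^'n \<Rightarrow> real) \<Rightarrow>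
     (real^'n) set set \<Rightarrow> (real^'n \<Rightarrow> real) \<Rightarrow> (real^'n \<Rightarrow> real) \<Rightarrow> real" where
  "dg_advection_reaction \<Omega> \<Gamma>\<^sub>N \<beta> \<sigma> \<T> w v =
     - (\<Sum>T\<in>\<T>. LINT x|lebesgue_on T. w x * (\<beta> x \<bullet> grad v x))
     + (\<Sum>T\<in>\<T>. LINT x|lebesgue_on T. \<sigma> x * w x * v x)
     + (\<Sum>e \<in> interior_facets \<T>.
          facet_integral e (\<lambda>x. average \<T> e (\<lambda>y. w y *\<^sub>R \<beta> y) x \<bullet> jump \<T> e v x))
     + 1 / 2 * (\<Sum>e \<in> interior_facets \<T>.
          facet_integral e (\<lambda>x. \<bar>cont_rep \<Omega> \<beta> x \<bullet> facet_normal e\<bar> * (jump \<T> e w x \<bullet> jump \<T> e v x)))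
     + (\<Sum>e \<in> boundary_facets \<T> \<Gamma>\<^sub>N.
          facet_integral e (\<lambda>x. (cont_rep \<Omega> \<beta> x \<bullet> outward_normal \<Omega> x)
                                  * average \<T> e w x * average \<T> e v x))"

definition dg_form ::
    "(real^'n) set \<Rightarrow> (real^'n) set \<Rightarrow> (real^'n) set \<Rightarrow> (real^'n \<Rightarrow> real^'n^'n) \<Rightarrow>
     (real^'n \<Rightarrow> real^'n) \<Rightarrow> (real^'n \<Rightarrow> real) \<Rightarrow> real \<Rightarrow> real \<Rightarrow> (real^'n) set set \<Rightarrow>
     (real^'n \<Rightarrow> real) \<Rightarrow> (real^'n \<Rightarrow> real) \<Rightarrow> real" where
  "dg_form \<Omega> \<Gamma>\<^sub>D \<Gamma>\<^sub>N K \<beta> \<sigma> \<epsilon> \<gamma> \<T> w v =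
     dg_diffusion \<Gamma>\<^sub>D K \<epsilon> \<gamma> \<T> w v + dg_advection_reaction \<Omega> \<Gamma>\<^sub>N \<beta> \<sigma> \<T> w v"

definition dg_norm_sq ::
    "(real^'n) set \<Rightarrow> (real^'n) set \<Rightarrow> (real^'n) set \<Rightarrow> (real^'n \<Rightarrow> real^'n^'n) \<Rightarrow>
     (real^'n \<Rightarrow> real^'n) \<Rightarrow> real \<Rightarrow> (real^'n) set set \<Rightarrow> (real^'n \<Rightarrow> real) \<Rightarrow> real" where
  "dg_norm_sq \<Omega> \<Gamma>\<^sub>D \<Gamma>\<^sub>N K \<beta> \<gamma> \<T> v =
     (\<Sum>T\<in>\<T>. LINT x|lebesgue_on T. (K x *v grad v x) \<bullet> grad v x)
     + (\<Sum>e \<in> interior_facets \<T> \<union> boundary_facets \<T> \<Gamma>\<^sub>D.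
          \<gamma> / facet_size \<T> e * facet_integral e (\<lambda>x. (norm (jump \<T> e v x))\<^sup>2))
     + (LINT x|lebesgue_on \<Omega>. (v x)\<^sup>2)
     + 1 / 2 * (\<Sum>e \<in> interior_facets \<T> \<union> boundary_facets \<T> \<Gamma>\<^sub>D \<union> boundary_facets \<T> \<Gamma>\<^sub>N.
          facet_integral e (\<lambda>x. \<bar>cont_rep \<Omega> \<beta> x \<bullet> facet_normal e\<bar> * (norm (jump \<T> e v x))\<^sup>2))"

section \<open>The constants\<close>

definition gamma_threshold :: "real \<Rightarrow> real \<Rightarrow> nat \<Rightarrow> real \<Rightarrow> real \<Rightarrow> real" where
  "gamma_threshold \<epsilon> normK N C\<^sub>t\<^sub>r k\<^sub>m\<^sub>i\<^sub>n =
     (if \<epsilon> = 1 then 0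
      else if \<epsilon> = 0 then normK\<^sup>2 * (real N * C\<^sub>t\<^sub>r / (4 * k\<^sub>m\<^sub>i\<^sub>n))
      else normK\<^sup>2 * (real N * C\<^sub>t\<^sub>r / k\<^sub>m\<^sub>i\<^sub>n))"

definition alpha_diffusion :: "real \<Rightarrow> real \<Rightarrow> nat \<Rightarrow> real \<Rightarrow> real \<Rightarrow> real \<Rightarrow> real" where
  "alpha_diffusion \<epsilon> normK N C\<^sub>t\<^sub>r k\<^sub>m\<^sub>i\<^sub>n \<gamma> =
     (if \<epsilon> = 1 then 1
      else 1 + 1 / 2 * (\<epsilon> - 1) * normK * sqrt (real N * C\<^sub>t\<^sub>r / (\<gamma> * k\<^sub>m\<^sub>i\<^sub>n)))"

end

theory Submission imports Defs
begin

text \<open>Testing with \<open>v\<close> itself, the two consistency terms of the diffusive part combine to \<open>\<epsilon> - 1\<close> times the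
  sum of the fluxes \<open>{K grad v} \<bullet> [v]\<close>.  On a facet this flux is estimated by Young's inequality with weight
  \<open>\<theta> h\<^sub>e\<close>; summing over the elements, the trace inequality for the polynomials \<open>\<partial>\<^sub>i v\<close> and \<open>h\<^sub>e \<le> h\<^sub>T\<close>
  bound the gradient contribution by the elliptic energy, and the optimal \<open>\<theta>\<close> gives the constant \<open>\<alpha>\<^sub>d\<close>.

  For the advective part one integrates \<open>v \<beta> \<bullet> grad v = \<beta> \<bullet> grad (v\<^sup>2 / 2)\<close> by parts on each element.  The
  boundary terms cancel against the averaged fluxes in the interior, and on the boundary the signs of
  \<open>\<beta> \<bullet> n\<close> on the inflow and outflow parts leave \<open>\<bar>\<beta> \<bullet> n\<bar> v\<^sup>2 / 2\<close>.

  As \<open>\<beta>\<close> is only weakly differentiable, integration by parts tests the weak divergence with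
  \<open>v\<^sup>2 \<zeta>\<^sub>n\<close>, where the cut-offs \<open>\<zeta>\<^sub>n\<close> arise from the indicator function of the (star-shaped) element by
  mollification and contraction.  Their gradients converge to the surface measure by the divergence theorem on
  the polytope, which is obtained by counting the signed crossings of the boundary along generic lines in a fixed
  direction and applying Fubini's theorem.\<close>

section \<open>Polytopes and their facets\<close>

text \<open>Two obstacles shape the proof. The field \<open>\<beta>\<close> has a weak divergence on
  the whole domain only, whereas \<open>v\<close> jumps between elements, so its square is no
  admissible test function; cutting off inside each element makes the boundary integrals appear as a
  limit. Moreover, boundary values are given by \<open>cont_rep\<close>, a mere choice, which is
  meaningful only once a representative continuous up to the boundary is exhibited: bounded weak
  derivatives give a Lipschitz estimate along segments inside the set, and a field pointing inwards
  (towards the centre of star-shapedness, or along the axis of the Lipschitz graph) carries it to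
  the closure. Polytopes may be nonconvex; they are treated as unions of cells of a hyperplane
  arrangement, because the local picture is constant, up to translation, on each cell. With energy
  E, penalty J and flux sum F the balanced Young inequality reads |F| <= \<kappa>/2 s (E + J), where
  s is the square root in \<alpha>_d. For \<epsilon> = 0 and \<epsilon> = -1 the threshold is the
  value of \<gamma> at which 1 - (1 - \<epsilon>) \<kappa> s / 2 vanishes.\<close>

definition sgn_eq :: "((real^'n) \<times> real) set \<Rightarrow> real^'n \<Rightarrow> real^'n \<Rightarrow> bool" where
  "sgn_eq H x y \<longleftrightarrow> (\<forall>h\<in>H. sgn (fst h \<bullet> x - snd h) = sgn (fst h \<bullet> y - snd h))"

text \<open>The pair \<open>(a, b)\<close> stands for the hyperplane \<open>a \<bullet> x = b\<close>; the set \<open>U\<close> is a union of cells of all dimensions of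
  the arrangement \<open>H\<close>.\<close>

definition arranged :: "((real^'n) \<times> real) set \<Rightarrow> (real^'n) set \<Rightarrow> bool" where
  "arranged H U \<longleftrightarrow> finite H \<and> (\<forall>h\<in>H. fst h \<noteq> 0) \<and> (\<forall>x y. sgn_eq H x y \<longrightarrow> x \<in> U \<longrightarrow> y \<in> U)"

lemma sgn_eq_refl: "sgn_eq H x x"
  by (auto simp: sgn_eq_def)

lemma sgn_eq_sym: "sgn_eq H x y \<Longrightarrow> sgn_eq H y x"
  by (auto simp: sgn_eq_def)

lemma arranged_mono: "arranged H U \<Longrightarrow> H \<subseteq> H' \<Longrightarrow> finite H' \<Longrightarrow> (\<forall>h\<in>H'. fst h \<noteq> 0) \<Longrightarrow> arranged H' U"
  unfolding arranged_def sgn_eq_def by blast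

lemma arranged_polytope:
  fixes P :: "(real^'n) set"
  assumes "polytope P"
  shows "\<exists>H. arranged H P"
proof -
  obtain F where F: "finite F" "P = \<Inter>F" "\<And>h. h \<in> F \<Longrightarrow> \<exists>a b. a \<noteq> 0 \<and> h = {x. a \<bullet> x \<le> b}"
    using polytope_imp_polyhedron[OF assms] unfolding polyhedron_def by blast
  then obtain a b where ab: "\<And>h. h \<in> F \<Longrightarrow> a h \<noteq> 0 \<and> h = {x. a h \<bullet> x \<le> b h}"
    by metis
  define H where "H = (\<lambda>h. (a h, b h)) ` F"
  have "y \<in> P" if "sgn_eq H x y" "x \<in> P" for x y
  proof -
    have "y \<in> h" if h: "h \<in> F" for h
    proof -
      have "sgn (a h \<bullet> x - b h) = sgn (a h \<bullet> y - b h)"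
        using \<open>sgn_eq H x y\<close> h by (auto simp: sgn_eq_def H_def)
      moreover have "a h \<bullet> x - b h \<le> 0"
        using \<open>x \<in> P\<close> F(2) h ab[OF h] by auto
      ultimately have "a h \<bullet> y - b h \<le> 0"
        by (metis linorder_not_le sgn_1_pos zero_less_one sgn_less order_less_imp_le)
      then show ?thesis using ab[OF h] by auto
    qed
    then show ?thesis using F(2) by auto
  qed
  then show ?thesis
    using F(1) ab unfolding arranged_def H_def by (intro exI[of _ "(\<lambda>h. (a h, b h)) ` F"]) auto
qed

lemma arranged_Union:
  fixes F :: "(real^'n) set set"
  assumes "finite F" "\<And>P. P \<in> F \<Longrightarrow> \<exists>H. arranged H P"
  shows "\<exists>H. arranged H (\<Union>F)"
proof -
  obtain H where H: "\<And>P. P \<in> F \<Longrightarrow> arranged (H P) P" using assms(2) by metis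
  define H' where "H' = (\<Union>P\<in>F. H P)"
  have fin: "finite H'" using assms(1) H by (auto simp: H'_def arranged_def)
  have nz: "\<forall>h\<in>H'. fst h \<noteq> 0" using H by (fastforce simp: H'_def arranged_def)
  have "arranged H' P" if "P \<in> F" for P
    using arranged_mono[OF H[OF that] _ fin nz] that by (auto simp: H'_def)
  then show ?thesis
    using fin nz unfolding arranged_def by (intro exI[of _ H']) blast
qed

text \<open>Hyperplanes that miss \<open>x\<close> also miss \<open>y\<close> and keep their strict
  sign near both points; for a hyperplane containing both, the sign depends on the displacement
  \<open>v\<close> alone. Hence a union of cells looks the same, up to translation, near any two
  points of one cell.\<close>

lemma sgn_eq_translate:
  fixes H :: "((real^'n) \<times> real) set"
  assumes "finite H" "sgn_eq H x y"
  shows "\<exists>r>0. \<forall>v\<in>ball 0 r. sgn_eq H (x + v) (y + v)"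
proof -
  have "\<forall>\<^sub>F v in nhds 0. \<forall>h\<in>H. sgn (fst h \<bullet> (x + v) - snd h) = sgn (fst h \<bullet> (y + v) - snd h)"
  proof (rule eventually_ball_finite[OF assms(1)], rule ballI)
    fix h assume h: "h \<in> H"
    have eq: "sgn (fst h \<bullet> x - snd h) = sgn (fst h \<bullet> y - snd h)"
      using assms(2) h by (auto simp: sgn_eq_def)
    have lim: "((\<lambda>v. fst h \<bullet> (z + v) - snd h) \<longlongrightarrow> fst h \<bullet> z - snd h) (nhds 0)" for z
      by (auto intro!: tendsto_eq_intros filterlim_ident)
    consider "fst h \<bullet> x - snd h > 0" | "fst h \<bullet> x - snd h = 0" | "fst h \<bullet> x - snd h < 0"
      by linarith
    then show "\<forall>\<^sub>F v in nhds 0. sgn (fst h \<bullet> (x + v) - snd h) = sgn (fst h \<bullet> (y + v) - snd h)"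
    proof cases
      case 1
      then have "fst h \<bullet> y - snd h > 0" using eq by (metis sgn_greater)
      from order_tendstoD(1)[OF lim this] order_tendstoD(1)[OF lim 1]
      show ?thesis by eventually_elim simp
    next
      case 2
      then have "fst h \<bullet> y - snd h = 0" using eq by (metis sgn_zero_iff)
      with 2 show ?thesis by (simp add: inner_add_right)
    next
      case 3
      then have "fst h \<bullet> y - snd h < 0" using eq by (metis sgn_less)
      from order_tendstoD(2)[OF lim this] order_tendstoD(2)[OF lim 3]
      show ?thesis by eventually_elim simp
    qed
  qed
  then obtain r where "r > 0" "\<And>v. dist v 0 < r \<Longrightarrow> \<forall>h\<in>H. sgn (fst h \<bullet> (x + v) - snd h) = sgn (fst h \<bullet> (y + v) - snd h)"
    unfolding eventually_nhds_metric by blast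
  then show ?thesis by (intro exI[of _ r]) (auto simp: sgn_eq_def dist_norm)
qed

lemma arranged_translate:
  assumes "arranged H U" "sgn_eq H x y"
  shows "\<exists>r>0. \<forall>v\<in>ball 0 r. x + v \<in> U \<longleftrightarrow> y + v \<in> U"
  using sgn_eq_translate[of H x y] sgn_eq_sym assms unfolding arranged_def by metis

lemma mem_interior_translate: "x \<in> interior A \<longleftrightarrow> (\<exists>r>0. \<forall>v\<in>ball 0 r. x + v \<in> A)" for x :: "real^'n"
proof -
  have "ball x r \<subseteq> A \<longleftrightarrow> (\<forall>v\<in>ball 0 r. x + v \<in> A)" for r
  proof
    show "\<forall>v\<in>ball 0 r. x + v \<in> A" if "ball x r \<subseteq> A"
      using that by (auto simp: subset_eq dist_norm)
    show "ball x r \<subseteq> A" if "\<forall>v\<in>ball 0 r. x + v \<in> A"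
    proof
      fix y assume "y \<in> ball x r"
      then have "x + (y - x) \<in> A" using that by (intro bspec[OF that]) (auto simp: dist_norm norm_minus_commute)
      then show "y \<in> A" by simp
    qed
  qed
  then show ?thesis by (simp add: mem_interior)
qed

text \<open>Being interior is a property of a neighbourhood, and small neighbourhoods of two points
  of a cell meet \<open>A\<close> in translates of each other. This step is needed because an open
  polytope is the interior of a union of polytopes, not the union itself.\<close>

lemma arranged_interior:
  assumes "arranged H A"
  shows "arranged H (interior A)"
proof -
  have "y \<in> interior A" if xy: "sgn_eq H x y" and x: "x \<in> interior A" for x y
  proof -
    obtain r where r: "r > 0" "\<forall>v\<in>ball 0 r. x + v \<in> A \<longleftrightarrow> y + v \<in> A"
      using arranged_translate[OF assms xy] by blast
    obtain s where s: "s > 0" "\<forall>v\<in>ball 0 s. x + v \<in> A"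
      using x unfolding mem_interior_translate by blast
    show ?thesis unfolding mem_interior_translate
      using r s by (intro exI[of _ "min r s"]) auto
  qed
  then show ?thesis using assms unfolding arranged_def by blast
qed

locale polytopal =
  fixes U :: "(real^'n) set"
  assumes is_open: "open_polytope U"
begin

lemma arrangement: "\<exists>H. arranged H U"
proof -
  obtain F where "finite F" "\<forall>P\<in>F. polytope P" "U = interior (\<Union>F)"
    using is_open by (auto simp: open_polytope_def)
  then show ?thesis using arranged_interior arranged_Union arranged_polytope by metis
qed

text \<open>The closure of \<open>U\<close> stays inside the closed union whose interior is
  \<open>U\<close>, so \<open>U\<close> is regular open. In particular there are no slits, that is,
  no missing piece of a hyperplane with \<open>U\<close> on both sides.\<close>

lemma open_U: "open U" and bounded_U: "bounded U" and interior_closure_U: "interior (closure U) = U"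
  and nonempty_U: "U \<noteq> {}"
proof -
  obtain F where F: "finite F" "\<forall>P\<in>F. polytope P" "U = interior (\<Union>F)" "U \<noteq> {}"
    using is_open by (auto simp: open_polytope_def)
  show "open U" "U \<noteq> {}" using F by auto
  have "closed (\<Union>F)" using F polytope_imp_closed by blast
  then have "closure U \<subseteq> \<Union>F" using F closure_minimal interior_subset by metis
  then show "interior (closure U) = U"
    using F(3) \<open>open U\<close> by (metis closure_subset interior_eq interior_mono subset_antisym)
  have "bounded (\<Union>F)" using F polytope_imp_bounded by blast
  then show "bounded U" using F(3) bounded_subset interior_subset by metis
qed

end

section \<open>Outward normals at flat boundary points\<close>

lemma is_outward_normal_shrink:
  assumes "is_outward_normal U x \<nu>" "r0 > 0"
  shows "\<exists>r>0. r \<le> r0 \<and> (\<forall>y\<in>ball x r. y \<in> U \<longleftrightarrow> \<nu> \<bullet> (y - x) < 0)"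
proof -
  obtain r where "r > 0" "U \<inter> ball x r = {y \<in> ball x r. \<nu> \<bullet> (y - x) < 0}"
    using assms by (auto simp: is_outward_normal_def)
  then have "\<forall>y\<in>ball x (min r r0). y \<in> U \<longleftrightarrow> \<nu> \<bullet> (y - x) < 0" by fastforce
  then show ?thesis using assms(2) \<open>r > 0\<close> by (intro exI[of _ "min r r0"]) simp
qed

lemma is_outward_normal_translate:
  assumes "is_outward_normal U x \<nu>" "s > 0" "\<forall>v\<in>ball 0 s. x + v \<in> U \<longleftrightarrow> y + v \<in> V"
  shows "is_outward_normal V y \<nu>"
proof -
  obtain r where r: "r > 0" "r \<le> s" "\<forall>z\<in>ball x r. z \<in> U \<longleftrightarrow> \<nu> \<bullet> (z - x) < 0"
    using is_outward_normal_shrink[OF assms(1,2)] by blast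
  have "z \<in> V \<longleftrightarrow> \<nu> \<bullet> (z - y) < 0" if "z \<in> ball y r" for z
  proof -
    have "z - y \<in> ball 0 s" "x + (z - y) \<in> ball x r"
      using that r(2) by (auto simp: dist_norm norm_minus_commute)
    then show ?thesis using r(3) assms(3) by force
  qed
  then show ?thesis using r(1) assms(1) unfolding is_outward_normal_def by (intro conjI exI[of _ r]) auto
qed

lemma is_outward_normal_half_ball:
  assumes "norm \<nu> = 1" "r > 0" "\<forall>y\<in>ball x r. y \<in> U \<longleftrightarrow> \<nu> \<bullet> (y - x) < 0"
  shows "is_outward_normal U x \<nu>"
  using assms unfolding is_outward_normal_def by (intro conjI exI[of _ r]) auto

lemma is_outward_normal_unique:
  assumes "is_outward_normal U x \<nu>" "is_outward_normal U x \<mu>"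
  shows "\<nu> = \<mu>"
proof (rule ccontr)
  assume ne: "\<nu> \<noteq> \<mu>"
  have n: "norm \<nu> = 1" "norm \<mu> = 1" using assms by (auto simp: is_outward_normal_def)
  obtain r where r: "r > 0" "\<forall>y\<in>ball x r. y \<in> U \<longleftrightarrow> \<nu> \<bullet> (y - x) < 0"
    using is_outward_normal_shrink[OF assms(1) zero_less_one] by blast
  obtain s where s: "s > 0" "s \<le> r" "\<forall>y\<in>ball x s. y \<in> U \<longleftrightarrow> \<mu> \<bullet> (y - x) < 0"
    using is_outward_normal_shrink[OF assms(2) r(1)] by blast
  have "(\<nu> - \<mu>) \<bullet> (\<nu> - \<mu>) > 0" using ne by simp
  then have lt: "\<nu> \<bullet> \<mu> < 1" using n
    by (simp add: inner_diff_left inner_diff_right inner_commute norm_eq_1)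
  \<comment> \<open>A step from \<open>x\<close> along \<open>\<mu> - \<nu>\<close> enters the first
    half-space and leaves the second, since the inner product of distinct unit vectors is less than
    1; \<open>t\<close> keeps the step inside both balls.\<close>
  define t where "t = s / (2 * norm (\<mu> - \<nu>))"
  have t: "t > 0" using s ne by (simp add: t_def)
  define y where "y = x + t *\<^sub>R (\<mu> - \<nu>)"
  have "dist x y < s" using s ne by (simp add: y_def t_def dist_norm)
  then have "y \<in> ball x s" "y \<in> ball x r" using s by auto
  then have "\<nu> \<bullet> (y - x) < 0 \<longleftrightarrow> \<mu> \<bullet> (y - x) < 0" using r s by blast
  moreover have "\<nu> \<bullet> (y - x) < 0" using t lt n
    by (simp add: y_def inner_diff_right norm_eq_1 mult_less_0_iff)
  moreover have "\<not> \<mu> \<bullet> (y - x) < 0" using t lt n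
    by (simp add: y_def inner_diff_right norm_eq_1 inner_commute mult_less_0_iff)
  ultimately show False by simp
qed

lemma outward_normal_eq: "is_outward_normal U x \<nu> \<Longrightarrow> outward_normal U x = \<nu>"
  unfolding outward_normal_def by (rule the_equality) (auto intro: is_outward_normal_unique)

lemma is_outward_normal_frontier:
  assumes "is_outward_normal U x \<nu>"
  shows "x \<in> frontier U" "x \<notin> U"
proof -
  have n: "norm \<nu> = 1" using assms by (auto simp: is_outward_normal_def)
  show xU: "x \<notin> U" using is_outward_normal_shrink[OF assms zero_less_one] by auto
  have "\<exists>y\<in>U. dist y x < e" if "e > 0" for e
  proof -
    obtain r where r: "r > 0" "r \<le> e" "\<forall>y\<in>ball x r. y \<in> U \<longleftrightarrow> \<nu> \<bullet> (y - x) < 0"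
      using is_outward_normal_shrink[OF assms \<open>e > 0\<close>] by blast
    have "x - (r/2) *\<^sub>R \<nu> \<in> ball x r" "\<nu> \<bullet> (x - (r/2) *\<^sub>R \<nu> - x) < 0" "dist (x - (r/2) *\<^sub>R \<nu>) x < e"
      using r n by (simp_all add: dist_norm) (simp add: norm_eq_1)
    then have "x - (r/2) *\<^sub>R \<nu> \<in> U" "dist (x - (r/2) *\<^sub>R \<nu>) x < e" using r(3) by blast+
    then show ?thesis by blast
  qed
  then have "x \<in> closure U" by (simp add: closure_approachable)
  then show "x \<in> frontier U" using xU interior_subset by (auto simp: frontier_def)
qed

lemma flat_boundary_iff: "x \<in> flat_boundary U \<longleftrightarrow> (\<exists>\<nu>. is_outward_normal U x \<nu>)"
  using is_outward_normal_frontier by (auto simp: flat_boundary_def)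

lemma is_outward_normal_along:
  assumes "\<forall>y\<in>ball x r. y \<in> U \<longleftrightarrow> \<nu> \<bullet> (y - x) < 0" "norm \<nu> = 1" "y \<in> ball x r" "\<nu> \<bullet> (y - x) = 0"
  shows "is_outward_normal U y \<nu>"
proof (rule is_outward_normal_half_ball)
  show "0 < r - dist x y" using assms(3) by simp
  show "\<forall>z\<in>ball y (r - dist x y). z \<in> U \<longleftrightarrow> \<nu> \<bullet> (z - y) < 0"
  proof
    fix z assume "z \<in> ball y (r - dist x y)"
    then have "z \<in> ball x r" using dist_triangle[of x z y] by auto
    moreover have "\<nu> \<bullet> (z - x) = \<nu> \<bullet> (z - y)" using assms(4) by (simp add: inner_diff_right)
    ultimately show "z \<in> U \<longleftrightarrow> \<nu> \<bullet> (z - y) < 0" using assms(1) by simp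
  qed
qed fact

text \<open>On the strictly positive side of the plane the ball is open and misses \<open>U\<close>,
  so no point there can belong to the closure of \<open>U\<close>.\<close>

lemma flat_boundary_locally:
  assumes "\<forall>y\<in>ball x r. y \<in> U \<longleftrightarrow> \<nu> \<bullet> (y - x) < 0" "y \<in> frontier U" "y \<notin> U" "y \<in> ball x r"
  shows "\<nu> \<bullet> (y - x) = 0"
proof (rule ccontr)
  assume "\<nu> \<bullet> (y - x) \<noteq> 0"
  moreover have "\<not> \<nu> \<bullet> (y - x) < 0" using assms by auto
  ultimately have "\<nu> \<bullet> (y - x) > 0" by linarith
  then have "y \<in> {z \<in> ball x r. \<nu> \<bullet> (z - x) > 0}" using assms by auto
  moreover have "{z \<in> ball x r. \<nu> \<bullet> (z - x) > 0} = ball x r \<inter> {z. \<nu> \<bullet> z > \<nu> \<bullet> x}"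
    by (auto simp: inner_diff_right)
  then have "open {z \<in> ball x r. \<nu> \<bullet> (z - x) > 0}"
    by (simp add: open_Int open_halfspace_gt)
  moreover have "y \<in> closure U" using assms by (auto simp: frontier_def)
  ultimately obtain z where "z \<in> U" "z \<in> ball x r" "\<nu> \<bullet> (z - x) > 0"
    unfolding closure_iff_nhds_not_empty by blast
  then show False using assms(1) by auto
qed

text \<open>Normal and offset are locally constant along the flat boundary, hence constant on a
  component. Conversely, a small disc of the plane around a point of \<open>e\<close> consists of
  flat boundary points and is convex, so maximality of the component forces it into
  \<open>e\<close>: facets are relatively open in their planes.\<close>

lemma facet_structure:
  assumes "e \<in> facets U"
  obtains \<nu> b where "norm \<nu> = 1" "\<And>x. x \<in> e \<Longrightarrow> is_outward_normal U x \<nu>" "\<And>x. x \<in> e \<Longrightarrow> \<nu> \<bullet> x = b"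
    "\<And>x. x \<in> e \<Longrightarrow> \<exists>r>0. \<forall>y\<in>ball x r. \<nu> \<bullet> y = b \<longrightarrow> y \<in> e" "e \<noteq> {}"
proof -
  have con: "connected e" and sub: "e \<subseteq> flat_boundary U" and ne: "e \<noteq> {}"
    using assms in_components_connected in_components_subset in_components_nonempty
    unfolding facets_def by blast+
  have loc: "\<exists>r>0. (\<forall>y\<in>ball x r. y \<in> U \<longleftrightarrow> outward_normal U x \<bullet> (y - x) < 0) \<and> norm (outward_normal U x) = 1"
    if x: "x \<in> flat_boundary U" for x
  proof -
    obtain \<nu> where \<nu>: "is_outward_normal U x \<nu>" using x unfolding flat_boundary_iff by (elim exE)
    then have "outward_normal U x = \<nu>" "norm \<nu> = 1"
      using outward_normal_eq by (auto simp: is_outward_normal_def)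
    then show ?thesis using is_outward_normal_shrink[OF \<nu> zero_less_one] by auto
  qed
  have near: "outward_normal U y = outward_normal U x \<and> outward_normal U x \<bullet> (y - x) = 0"
    if x: "x \<in> flat_boundary U" and r: "\<forall>y\<in>ball x r. y \<in> U \<longleftrightarrow> outward_normal U x \<bullet> (y - x) < 0"
      and n: "norm (outward_normal U x) = 1" and y: "y \<in> flat_boundary U" "y \<in> ball x r" for x y r
  proof -
    have "y \<notin> U" "y \<in> frontier U" using y is_outward_normal_frontier unfolding flat_boundary_iff by blast+
    then have "outward_normal U x \<bullet> (y - x) = 0" using flat_boundary_locally[OF r] y by blast
    then show ?thesis using is_outward_normal_along[OF r n] y outward_normal_eq by blast
  qed
  have const1: "outward_normal U x = outward_normal U y" if "x \<in> e" "y \<in> e" for x y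
  proof (rule connected_local_const[OF con that], rule ballI)
    fix a assume a: "a \<in> e"
    obtain r where r: "r > 0" "\<forall>y\<in>ball a r. y \<in> U \<longleftrightarrow> outward_normal U a \<bullet> (y - a) < 0" "norm (outward_normal U a) = 1"
      using loc sub a by blast
    have "outward_normal U a = outward_normal U b" if "b \<in> e" "dist b a < r" for b
      using near[OF subsetD[OF sub a] r(2,3) subsetD[OF sub that(1)]] that(2) by (simp add: dist_commute)
    then show "\<forall>\<^sub>F b in at a within e. outward_normal U a = outward_normal U b"
      unfolding eventually_at using r(1) by blast
  qed
  obtain x0 where x0: "x0 \<in> e" using ne by blast
  define \<nu> where "\<nu> = outward_normal U x0"
  have nu: "outward_normal U x = \<nu>" if "x \<in> e" for x using const1 x0 that \<nu>_def by blast
  have isn: "is_outward_normal U x \<nu>" if "x \<in> e" for x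
  proof -
    obtain \<mu> where "is_outward_normal U x \<mu>" using sub \<open>x \<in> e\<close> flat_boundary_iff[of x U] by blast
    then show ?thesis using outward_normal_eq nu[OF that] by metis
  qed
  have n1: "norm \<nu> = 1" using isn[OF x0] by (simp add: is_outward_normal_def)
  have const2: "\<nu> \<bullet> x = \<nu> \<bullet> y" if "x \<in> e" "y \<in> e" for x y
  proof (rule connected_local_const[OF con that], rule ballI)
    fix a assume a: "a \<in> e"
    obtain r where r: "r > 0" "\<forall>y\<in>ball a r. y \<in> U \<longleftrightarrow> outward_normal U a \<bullet> (y - a) < 0" "norm (outward_normal U a) = 1"
      using loc sub a by blast
    have "\<nu> \<bullet> a = \<nu> \<bullet> b" if "b \<in> e" "dist b a < r" for b
      using near[OF subsetD[OF sub a] r(2,3) subsetD[OF sub that(1)]] that(2) nu[OF a]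
      by (simp add: dist_commute inner_diff_right)
    then show "\<forall>\<^sub>F b in at a within e. \<nu> \<bullet> a = \<nu> \<bullet> b"
      unfolding eventually_at using r(1) by blast
  qed
  have disc: "\<exists>r>0. \<forall>y\<in>ball x r. \<nu> \<bullet> y = \<nu> \<bullet> x0 \<longrightarrow> y \<in> e" if x: "x \<in> e" for x
  proof -
    obtain r where r: "r > 0" "\<forall>y\<in>ball x r. y \<in> U \<longleftrightarrow> \<nu> \<bullet> (y - x) < 0"
      using is_outward_normal_shrink[OF isn[OF x] zero_less_one] by blast
    define D where "D = ball x r \<inter> {y. \<nu> \<bullet> y = \<nu> \<bullet> x0}"
    have "convex D" unfolding D_def by (intro convex_Int convex_ball convex_hyperplane)
    then have "connected D" by (rule convex_connected)
    moreover have "D \<subseteq> flat_boundary U"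
    proof
      fix y assume "y \<in> D"
      then have "y \<in> ball x r" "\<nu> \<bullet> (y - x) = 0"
        using const2[OF x x0] by (auto simp: D_def inner_diff_right)
      then show "y \<in> flat_boundary U"
        using is_outward_normal_along[OF r(2) n1] unfolding flat_boundary_iff by blast
    qed
    moreover have "x \<in> D" using r const2[OF x x0] by (auto simp: D_def)
    ultimately have "D \<subseteq> e"
      using components_maximal[OF assms[unfolded facets_def], of D] x by blast
    then show ?thesis using r(1) by (auto simp: D_def)
  qed
  show ?thesis
    using that[of \<nu> "\<nu> \<bullet> x0", OF n1 isn const2[OF _ x0] disc ne] .
qed

text \<open>A component that meets a member of \<open>\<F>\<close> contains it, and is therefore
  recovered from the point chosen in that member; so there are at most as many components as
  members.\<close>

lemma finite_components_finite_Union: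
  fixes S :: "'a::topological_space set"
  assumes "finite \<F>" "\<And>C. C \<in> \<F> \<Longrightarrow> connected C" "S = \<Union>\<F>"
  shows "finite (components S)"
proof (rule finite_subset)
  show "components S \<subseteq> (\<lambda>C. connected_component_set S (SOME x. x \<in> C)) ` \<F>"
  proof
    fix e assume e: "e \<in> components S"
    then obtain x where x: "x \<in> S" "e = connected_component_set S x" by (auto simp: components_def)
    then obtain C where C: "C \<in> \<F>" "x \<in> C" using assms(3) by auto
    then have "(SOME x. x \<in> C) \<in> C" by (metis someI)
    then have "connected_component S x (SOME x. x \<in> C)"
      using assms C unfolding connected_component_def by blast
    then have "e = connected_component_set S (SOME x. x \<in> C)"
      using x(2) connected_component_eq by fastforce
    then show "e \<in> (\<lambda>C. connected_component_set S (SOME x. x \<in> C)) ` \<F>" using C by blast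
  qed
qed (use assms in simp)

lemma convex_sgn_cell: "convex {y::real^'n. sgn_eq H x y}"
proof -
  have "convex {y. sgn (fst h \<bullet> x - snd h) = sgn (fst h \<bullet> y - snd h)}" for h :: "(real^'n) \<times> real"
  proof -
    consider "sgn (fst h \<bullet> x - snd h) = 1" | "sgn (fst h \<bullet> x - snd h) = 0" | "sgn (fst h \<bullet> x - snd h) = -1"
      by (metis sgn_real_def)
    then show ?thesis
    proof cases
      case 1
      then have "{y. sgn (fst h \<bullet> x - snd h) = sgn (fst h \<bullet> y - snd h)} = {y. fst h \<bullet> y > snd h}"
        by (auto simp: sgn_if split: if_splits)
      then show ?thesis by (simp add: convex_halfspace_gt)
    next
      case 2
      then have "{y. sgn (fst h \<bullet> x - snd h) = sgn (fst h \<bullet> y - snd h)} = {y. fst h \<bullet> y = snd h}"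
        by (auto simp: sgn_if split: if_splits)
      then show ?thesis by (simp add: convex_hyperplane)
    next
      case 3
      then have "{y. sgn (fst h \<bullet> x - snd h) = sgn (fst h \<bullet> y - snd h)} = {y. fst h \<bullet> y < snd h}"
        by (auto simp: sgn_if split: if_splits)
      then show ?thesis by (simp add: convex_halfspace_lt)
    qed
  qed
  moreover have "{y. sgn_eq H x y} = (\<Inter>h\<in>H. {y. sgn (fst h \<bullet> x - snd h) = sgn (fst h \<bullet> y - snd h)})"
    by (auto simp: sgn_eq_def)
  ultimately show ?thesis by (metis (no_types, lifting) convex_INT)
qed

text \<open>Having an outward normal is invariant within a cell of the arrangement, so the flat
  boundary is a union of cells. Cells are convex, hence connected, and there are only finitely many
  sign vectors.\<close>

lemma (in polytopal) finite_facets: "finite (facets U)"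
proof -
  obtain H where H: "arranged H U" using arrangement by blast
  then have fin: "finite H" by (simp add: arranged_def)
  \<comment> \<open>Restricting the sign vector to \<open>H\<close> places it in a finite product of
    three-element sets.\<close>
  define s where "s x = restrict (\<lambda>h. sgn (fst h \<bullet> x - snd h)) H" for x :: "real^'n"
  have sgn: "sgn z \<in> {-1,0,1}" for z :: real by (auto simp: sgn_real_def)
  have "range s \<subseteq> (\<Pi>\<^sub>E h\<in>H. {-1,0,1::real})"
    unfolding s_def by (intro image_subsetI restrict_PiE_iff[THEN iffD2] ballI sgn)
  then have fr: "finite (range s)" using fin by (meson finite_PiE finite_subset finite.intros)
  have s_eq: "s x = s y \<longleftrightarrow> sgn_eq H x y" for x y
    by (auto simp: s_def sgn_eq_def restrict_def fun_eq_iff)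
  define \<F> where "\<F> = (\<lambda>v. {y. s y = v}) ` (s ` flat_boundary U)"
  have inv: "y \<in> flat_boundary U" if "sgn_eq H x y" "x \<in> flat_boundary U" for x y
    using that arranged_translate[OF H] is_outward_normal_translate unfolding flat_boundary_iff by metis
  have "flat_boundary U = \<Union>\<F>"
    unfolding \<F>_def using inv[OF sgn_eq_sym] by (auto simp: s_eq intro: sgn_eq_refl)
  moreover have "connected C" if C: "C \<in> \<F>" for C
  proof -
    obtain x where "C = {y. s y = s x}" using C by (auto simp: \<F>_def)
    then have "C = {y. sgn_eq H x y}" using s_eq sgn_eq_sym by auto
    then show ?thesis using convex_sgn_cell convex_connected by metis
  qed
  moreover have "finite \<F>" using fr unfolding \<F>_def by (meson finite_imageI finite_subset image_mono subset_UNIV)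
  ultimately show ?thesis using finite_components_finite_Union unfolding facets_def by metis
qed

section \<open>Crossing the boundary along a line\<close>

text \<open>Subtracting the jumps collected so far from the left limit gives a locally constant
  function: passing \<open>t\<close> changes both by \<open>R t - L t\<close>. On the connected line
  it is constant, and far to the left it vanishes.\<close>

lemma locally_constant_jump_sum:
  fixes \<phi> L R :: "real \<Rightarrow> real"
  assumes L: "\<And>t. \<exists>r>0. (\<forall>s. t - r < s \<and> s < t \<longrightarrow> \<phi> s = L t) \<and> (\<forall>s. t < s \<and> s < t + r \<longrightarrow> \<phi> s = R t)"
    and C: "finite C" "\<And>t. t \<notin> C \<Longrightarrow> L t = R t" and m: "\<And>t. t < m \<Longrightarrow> \<phi> t = 0"
  shows "L t = (\<Sum>c | c \<in> C \<and> c < t. R c - L c)"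
proof -
  define \<psi> where "\<psi> t = L t - (\<Sum>c | c \<in> C \<and> c < t. R c - L c)" for t
  \<comment> \<open>The left limit at \<open>s\<close> can be read off from any interval ending at
    \<open>s\<close> on which \<open>\<phi>\<close> is constant.\<close>
  have left: "L s = y" if r: "r > 0" "\<And>z. s - r < z \<Longrightarrow> z < s \<Longrightarrow> \<phi> z = y" for s r y
  proof -
    obtain q where q: "q > 0" "\<forall>z. s - q < z \<and> z < s \<longrightarrow> \<phi> z = L s" using L[of s] by blast
    define z where "z = s - min q r / 2"
    have z: "s - q < z" "s - r < z" "z < s" using q(1) r(1) by (auto simp: z_def min_def)
    have "\<phi> z = L s" "\<phi> z = y" using q(2) r(2) z by blast+
    then show ?thesis by simp
  qed
  have loc: "\<forall>\<^sub>F s in at t. \<psi> t = \<psi> s" for t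
  proof -
    obtain r where r: "r > 0" "\<And>s. t - r < s \<Longrightarrow> s < t \<Longrightarrow> \<phi> s = L t" "\<And>s. t < s \<Longrightarrow> s < t + r \<Longrightarrow> \<phi> s = R t"
      using L[of t] by blast
    have "finite (C - {t})" using C by simp
    then obtain d where d: "d > 0" "\<And>c. c \<in> C - {t} \<Longrightarrow> c \<noteq> t \<Longrightarrow> d \<le> dist t c"
      using finite_set_avoid[of "C - {t}" t] by blast
    have "\<psi> t = \<psi> s" if s: "s \<noteq> t" "dist s t < min r d" for s
    proof (cases "s < t")
      case True
      have "L s = L t" using r(2) s True
        by (intro left[of "r - (t - s)"]) (auto simp: dist_real_def)
      moreover have "{c. c \<in> C \<and> c < s} = {c. c \<in> C \<and> c < t}"
        using d s True by (force simp: dist_real_def)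
      ultimately show ?thesis by (simp add: \<psi>_def)
    next
      case False
      then have st: "t < s" using s by simp
      have Ls: "L s = R t" using r(3) s st
        by (intro left[of "s - t"]) (auto simp: dist_real_def)
      show ?thesis
      proof (cases "t \<in> C")
        case True
        have "{c. c \<in> C \<and> c < s} = insert t {c. c \<in> C \<and> c < t}"
          using d s st True by (force simp: dist_real_def)
        then have "(\<Sum>c | c \<in> C \<and> c < s. R c - L c) = R t - L t + (\<Sum>c | c \<in> C \<and> c < t. R c - L c)"
          using C(1) by simp
        then show ?thesis using Ls by (simp add: \<psi>_def)
      next
        case False
        have "{c. c \<in> C \<and> c < s} = {c. c \<in> C \<and> c < t}"
          using d s st False by (force simp: dist_real_def)
        then show ?thesis using Ls C(2)[OF False] by (simp add: \<psi>_def)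
      qed
    qed
    then show ?thesis unfolding eventually_at using r(1) d(1)
      by (intro exI[of _ "min r d"]) auto
  qed
  have const: "\<psi> a = \<psi> b" for a b
    by (rule connected_local_const[of UNIV]) (use loc in auto)
  \<comment> \<open>A parameter to the left of \<open>m\<close> and of every jump, where both the
    sum and the left limit vanish.\<close>
  define t0 where "t0 = Min (insert m C) - 1"
  have t0': "t0 < c" if "c \<in> insert m C" for c
    using Min_le[of "insert m C" c] C(1) that unfolding t0_def by (smt (verit) finite_insert)
  then have t0: "t0 < m" "\<And>c. c \<in> C \<Longrightarrow> t0 < c" by simp_all
  then have emp: "{c. c \<in> C \<and> c < t0} = {}" by force
  have "L t0 = 0" by (rule left[of 1]) (use m t0 in auto)
  then have "\<psi> t0 = 0" unfolding \<psi>_def emp by simp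
  then show ?thesis using const[of t t0] by (simp add: \<psi>_def)
qed

lemma inactive_sgn_stable:
  fixes H :: "((real^'n) \<times> real) set"
  assumes "finite H"
  shows "\<exists>r>0. \<forall>v. norm v < r \<longrightarrow> (\<forall>h\<in>H. fst h \<bullet> p \<noteq> snd h \<longrightarrow> sgn (fst h \<bullet> (p + v) - snd h) = sgn (fst h \<bullet> p - snd h))"
proof -
  have "\<forall>\<^sub>F v in nhds 0. \<forall>h\<in>H. fst h \<bullet> p \<noteq> snd h \<longrightarrow> sgn (fst h \<bullet> (p + v) - snd h) = sgn (fst h \<bullet> p - snd h)"
  proof (rule eventually_ball_finite[OF assms(1)], rule ballI)
    fix h assume h: "h \<in> H"
    have lim: "((\<lambda>v. fst h \<bullet> (p + v) - snd h) \<longlongrightarrow> fst h \<bullet> p - snd h) (nhds 0)"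
      by (auto intro!: tendsto_eq_intros filterlim_ident)
    consider "fst h \<bullet> p - snd h > 0" | "fst h \<bullet> p - snd h = 0" | "fst h \<bullet> p - snd h < 0"
      by linarith
    then show "\<forall>\<^sub>F v in nhds 0. fst h \<bullet> p \<noteq> snd h \<longrightarrow> sgn (fst h \<bullet> (p + v) - snd h) = sgn (fst h \<bullet> p - snd h)"
    proof cases
      case 1
      from order_tendstoD(1)[OF lim 1] show ?thesis by eventually_elim (use 1 in simp)
    next
      case 3
      from order_tendstoD(2)[OF lim 3] show ?thesis by eventually_elim (use 3 in simp)
    qed simp
  qed
  then obtain r where "r > 0" "\<And>v. dist v 0 < r \<Longrightarrow>
     \<forall>h\<in>H. fst h \<bullet> p \<noteq> snd h \<longrightarrow> sgn (fst h \<bullet> (p + v) - snd h) = sgn (fst h \<bullet> p - snd h)"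
    unfolding eventually_nhds_metric by blast
  then show ?thesis by (intro exI[of _ r]) (simp add: dist_norm)
qed

context polytopal begin

text \<open>All hyperplanes through \<open>p\<close> have normals parallel to \<open>a\<close>, so
  near \<open>p\<close> membership in \<open>U\<close> depends on the sign of
  \<open>a \<bullet> v\<close> only. Whether \<open>p\<close> is a flat boundary point is then
  decided by the two open sides: they differ exactly when there is a normal, and the normal points
  to the side outside \<open>U\<close>.\<close>

lemma transversal_crossing:
  fixes a u p :: "real^'n"
  assumes H: "arranged H U" and au: "a \<bullet> u = 1"
    and act: "\<And>h. h \<in> H \<Longrightarrow> fst h \<bullet> p = snd h \<Longrightarrow> \<exists>k. fst h = k *\<^sub>R a"
  shows "\<exists>L R. (\<exists>r>0. (\<forall>t. - r < t \<and> t < 0 \<longrightarrow> indicator U (p + t *\<^sub>R u) = L) \<and>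
                 (\<forall>t. 0 < t \<and> t < r \<longrightarrow> indicator U (p + t *\<^sub>R u) = R)) \<and>
               (if p \<in> flat_boundary U then outward_normal U p \<bullet> u \<noteq> 0 \<and> R - L = - sgn (outward_normal U p \<bullet> u)
                else R - L = (0::real))"
proof -
  have finH: "finite H" using H by (simp add: arranged_def)
  have u0: "u \<noteq> 0" and a0: "a \<noteq> 0" using au by auto
  obtain r where r: "r > 0" and st: "\<And>v h. norm v < r \<Longrightarrow> h \<in> H \<Longrightarrow> fst h \<bullet> p \<noteq> snd h \<Longrightarrow>
      sgn (fst h \<bullet> (p + v) - snd h) = sgn (fst h \<bullet> p - snd h)"
    using inactive_sgn_stable[OF finH, of p] by blast
  have same: "p + v \<in> U \<longleftrightarrow> p + w \<in> U" if v: "norm v < r" "norm w < r" "sgn (a \<bullet> v) = sgn (a \<bullet> w)" for v w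
  proof -
    have "sgn_eq H (p + v) (p + w)" unfolding sgn_eq_def
    proof
      fix h assume h: "h \<in> H"
      show "sgn (fst h \<bullet> (p + v) - snd h) = sgn (fst h \<bullet> (p + w) - snd h)"
      proof (cases "fst h \<bullet> p = snd h")
        case True
        then obtain k where "fst h = k *\<^sub>R a" using act h by blast
        then show ?thesis using True v(3) by (simp add: inner_add_right sgn_mult)
      next
        case False
        then show ?thesis using st[OF v(1) h] st[OF v(2) h] by simp
      qed
    qed
    then show ?thesis using H sgn_eq_sym unfolding arranged_def by blast
  qed
  \<comment> \<open>The three truth values \<open>B (-1)\<close>, \<open>B 0\<close>,
    \<open>B 1\<close> describe \<open>U\<close> completely within radius \<open>r\<close>.\<close>
  define B where "B s \<longleftrightarrow> (\<exists>v. norm v < r \<and> sgn (a \<bullet> v) = s \<and> p + v \<in> U)" for s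
  have BU: "p + v \<in> U \<longleftrightarrow> B (sgn (a \<bullet> v))" if "norm v < r" for v
    using same that unfolding B_def by metis
  define q where "q = r / norm u"
  have q: "q > 0" "\<And>t. \<bar>t\<bar> < q \<Longrightarrow> norm (t *\<^sub>R u) < r" using r u0 by (auto simp: q_def field_simps)
  have au': "a \<bullet> (t *\<^sub>R u) = t" for t using au by simp
  have ind: "indicator U (p + t *\<^sub>R u) = (if B (sgn t) then 1 else 0 :: real)" if "\<bar>t\<bar> < q" for t
    using BU[OF q(2)[OF that]] by (simp add: au indicator_def)
  \<comment> \<open>Since \<open>U\<close> is open, it cannot contain points of the plane through
    \<open>p\<close> without containing points on both sides.\<close>
  have B0: "B 1 \<and> B (-1)" if "B 0"
  proof -
    obtain v where v: "norm v < r" "a \<bullet> v = 0" "p + v \<in> U" using \<open>B 0\<close> sgn_zero_iff unfolding B_def by blast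
    then obtain d where d: "d > 0" "ball (p + v) d \<subseteq> U" using open_U by (meson openE)
    define m where "m = min d (r - norm v)"
    define c where "c = m / (2 * norm u)"
    have w: "m > 0" using d v by (simp add: m_def)
    then have c: "c > 0" using u0 by (simp add: c_def)
    have "norm (c *\<^sub>R u) = m / 2" using u0 w by (simp add: c_def)
    then have "norm (c *\<^sub>R u) < m" using w by linarith
    then have nc: "norm (c *\<^sub>R u) < min d (r - norm v)" by (simp add: m_def)
    have "norm (v + c *\<^sub>R u) < r" "norm (v - c *\<^sub>R u) < r"
      using nc norm_triangle_ineq[of v "c *\<^sub>R u"] norm_triangle_ineq4[of v "c *\<^sub>R u"] by linarith+
    moreover have "p + (v + c *\<^sub>R u) \<in> U" "p + (v - c *\<^sub>R u) \<in> U"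
      using nc by (intro subsetD[OF d(2)]; simp add: dist_norm)+
    moreover have "sgn (a \<bullet> (v + c *\<^sub>R u)) = 1" "sgn (a \<bullet> (v - c *\<^sub>R u)) = -1"
      using v c au by (simp_all add: inner_add_right inner_diff_right)
    ultimately show ?thesis unfolding B_def by blast
  qed
  have far: "q' \<in> U \<longleftrightarrow> B (sgn (a \<bullet> (q' - p)))" if "q' \<in> ball p r" for q'
    using BU[of "q' - p"] that by (simp add: dist_norm norm_minus_commute)
  \<comment> \<open>If exactly the side \<open>s\<close> lies outside, \<open>B0\<close> excludes
    the plane itself, and \<open>U\<close> is an open half-ball with normal \<open>a\<close>
    directed towards \<open>s\<close>.\<close>
  have flat: "is_outward_normal U p ((s / norm a) *\<^sub>R a)" if s: "\<bar>s\<bar> = 1" "B (- s)" "\<not> B s" for s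
  proof (rule is_outward_normal_half_ball[OF _ r], goal_cases)
    case 1 show ?case using a0 s by simp
  next
    case 2
    have "\<not> B 0" using B0 s by (auto simp: abs_if split: if_splits)
    have "B (sgn z) \<longleftrightarrow> s / norm a * z < 0" for z :: real
    proof -
      consider "s = 1" | "s = -1" using s by (auto simp: abs_if split: if_splits)
      then show ?thesis using s \<open>\<not> B 0\<close> a0
        by cases (auto simp: sgn_real_def divide_less_0_iff zero_less_divide_iff)
    qed
    then show ?case using far by simp
  qed
  consider (in_in) "B (-1)" "B 1" | (out_out) "\<not> B (-1)" "\<not> B 1" | (in_out) "B (-1)" "\<not> B 1" | (out_in) "\<not> B (-1)" "B 1"
    by blast
  then have "if p \<in> flat_boundary U then outward_normal U p \<bullet> u \<noteq> 0 \<and> (if B 1 then 1 else 0) - (if B (-1) then 1 else 0) = - sgn (outward_normal U p \<bullet> u)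
                else (if B 1 then 1 else 0) - (if B (-1) then 1 else 0) = (0::real)"
  proof cases
    \<comment> \<open>With \<open>U\<close> on both sides the ball lies in the closure of
      \<open>U\<close>, and regularity of \<open>U\<close> puts \<open>p\<close> into
      \<open>U\<close>: the only possible gap, the plane itself, is ruled out.\<close>
    case in_in
    have "ball p r \<subseteq> closure U"
    proof
      fix z assume z: "z \<in> ball p r"
      have "\<exists>y\<in>U. dist y z < d" if "d > 0" for d
      proof (cases "a \<bullet> (z - p) = 0")
        case True
        define m where "m = min d (r - dist p z)"
    define c where "c = m / (2 * norm u)"
        have w: "m > 0" using \<open>d > 0\<close> z by (simp add: m_def)
        then have c: "c > 0" using u0 by (simp add: c_def)
        have "norm (c *\<^sub>R u) = m / 2" using u0 w by (simp add: c_def)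
        then have "norm (c *\<^sub>R u) < m" using w by linarith
    then have nc: "norm (c *\<^sub>R u) < min d (r - dist p z)" by (simp add: m_def)
        have "dist p (z + c *\<^sub>R u) < r" using nc dist_triangle[of p "z + c *\<^sub>R u" z] by (simp add: dist_norm)
        moreover have "a \<bullet> (z + c *\<^sub>R u - p) = c" using True au by (simp add: inner_add_right inner_diff_right)
        ultimately have "z + c *\<^sub>R u \<in> U" using far[of "z + c *\<^sub>R u"] in_in c by simp
        then show ?thesis using nc by (intro bexI[of _ "z + c *\<^sub>R u"]) (auto simp: dist_norm)
      next
        case False
        then have "z \<in> U" using far[OF z] in_in by (auto simp: sgn_real_def)
        then show ?thesis using that by (intro bexI[of _ z]) auto
      qed
      then show "z \<in> closure U" by (simp add: closure_approachable)
    qed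
    then have "p \<in> U" using interior_closure_U r by (metis centre_in_ball interior_maximal open_ball subsetD)
    then have "p \<notin> flat_boundary U" using is_outward_normal_frontier unfolding flat_boundary_iff by blast
    then show ?thesis using in_in by simp
  next
    case out_out
    have "\<not> B 0" using B0 out_out by blast
    then have "\<not> B (sgn z)" for z :: real using out_out by (simp add: sgn_real_def)
    then have "U \<inter> ball p r = {}" using far by blast
    then have "p \<notin> closure U" using r by (metis Int_commute centre_in_ball open_Int_closure_eq_empty open_ball disjoint_iff)
    then have "p \<notin> flat_boundary U" by (auto simp: flat_boundary_def frontier_def)
    then show ?thesis using out_out by simp
  next
    case in_out
    have n: "is_outward_normal U p ((1 / norm a) *\<^sub>R a)" using flat[of 1] in_out by simp
    then have "p \<in> flat_boundary U" unfolding flat_boundary_iff by blast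
    then show ?thesis using outward_normal_eq[OF n] in_out au a0 by simp
  next
    case out_in
    have n: "is_outward_normal U p ((-1 / norm a) *\<^sub>R a)" using flat[of "-1"] out_in by simp
    then have "p \<in> flat_boundary U" unfolding flat_boundary_iff by blast
    then show ?thesis using outward_normal_eq[OF n] out_in au a0 by simp
  qed
  moreover have "\<exists>r>0. (\<forall>t. - r < t \<and> t < 0 \<longrightarrow> indicator U (p + t *\<^sub>R u) = (if B (-1) then 1 else 0 :: real)) \<and>
                 (\<forall>t. 0 < t \<and> t < r \<longrightarrow> indicator U (p + t *\<^sub>R u) = (if B 1 then 1 else 0 :: real))"
    using q(1) ind by (intro exI[of _ q]) simp
  ultimately show ?thesis by blast
qed

text \<open>The assumptions say that the line through \<open>x\<close> is generic: it lies in no hyperplane, does not start on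
  one, and never crosses two hyperplanes with different normal directions at once.\<close>

lemma good_line_jumps:
  assumes H: "arranged H U" and u: "u \<noteq> 0"
    and par: "\<And>h. h \<in> H \<Longrightarrow> fst h \<bullet> u = 0 \<Longrightarrow> fst h \<bullet> x \<noteq> snd h"
    and off: "\<And>h. h \<in> H \<Longrightarrow> fst h \<bullet> x \<noteq> snd h"
    and dbl: "\<And>h h'. h \<in> H \<Longrightarrow> h' \<in> H \<Longrightarrow> fst h \<bullet> u \<noteq> 0 \<Longrightarrow> fst h' \<bullet> u \<noteq> 0 \<Longrightarrow>
        (1 / (fst h \<bullet> u)) *\<^sub>R fst h \<noteq> (1 / (fst h' \<bullet> u)) *\<^sub>R fst h' \<Longrightarrow>
        (snd h - fst h \<bullet> x) / (fst h \<bullet> u) \<noteq> (snd h' - fst h' \<bullet> x) / (fst h' \<bullet> u)"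
  shows "finite {t. x + t *\<^sub>R u \<in> flat_boundary U}"
    and "\<And>t. x + t *\<^sub>R u \<in> flat_boundary U \<Longrightarrow> outward_normal U (x + t *\<^sub>R u) \<bullet> u \<noteq> 0"
    and "x \<notin> flat_boundary U"
    and "indicator U x = - (\<Sum>t | x + t *\<^sub>R u \<in> flat_boundary U \<and> t < 0. sgn (outward_normal U (x + t *\<^sub>R u) \<bullet> u))"
proof -
  have finH: "finite H" using H by (simp add: arranged_def)
  define \<phi> where "\<phi> t = (indicator U (x + t *\<^sub>R u) :: real)" for t
  define active where "active t h \<longleftrightarrow> h \<in> H \<and> fst h \<bullet> (x + t *\<^sub>R u) = snd h" for t h
  have act: "fst h \<bullet> u \<noteq> 0 \<and> t = (snd h - fst h \<bullet> x) / (fst h \<bullet> u)" if "active t h" for t h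
  proof -
    have e: "fst h \<bullet> x + t * (fst h \<bullet> u) = snd h" "h \<in> H" using that by (auto simp: active_def inner_add_right)
    then have "fst h \<bullet> u \<noteq> 0" using par by auto
    then show ?thesis using e by (simp add: field_simps)
  qed
  \<comment> \<open>By the genericity assumption all hyperplanes active at the parameter
    \<open>t\<close> have the same normal once it is scaled to \<open>a \<bullet> u = 1\<close>. If
    none is active, any vector with this normalisation will do.\<close>
  have ex_a: "\<exists>a. a \<bullet> u = 1 \<and> (\<forall>h. active t h \<longrightarrow> (\<exists>k. fst h = k *\<^sub>R a))" for t
  proof (cases "\<exists>h. active t h")
    case True
    then obtain h where h: "active t h" by blast
    have "\<exists>k. fst h' = k *\<^sub>R ((1 / (fst h \<bullet> u)) *\<^sub>R fst h)" if h': "active t h'" for h'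
    proof -
      have "(1 / (fst h \<bullet> u)) *\<^sub>R fst h = (1 / (fst h' \<bullet> u)) *\<^sub>R fst h'"
        using dbl[of h h'] act[OF h] act[OF h'] h h' unfolding active_def by metis
      then show ?thesis using act[OF h'] by (intro exI[of _ "fst h' \<bullet> u"]) simp
    qed
    then show ?thesis using act[OF h] by (intro exI[of _ "(1 / (fst h \<bullet> u)) *\<^sub>R fst h"]) auto
  next
    case False
    then show ?thesis using u by (intro exI[of _ "(1 / (u \<bullet> u)) *\<^sub>R u"]) auto
  qed
  have ex: "\<exists>L R. (\<exists>r>0. (\<forall>s. t - r < s \<and> s < t \<longrightarrow> \<phi> s = L) \<and> (\<forall>s. t < s \<and> s < t + r \<longrightarrow> \<phi> s = R)) \<and>
               (if x + t *\<^sub>R u \<in> flat_boundary U then outward_normal U (x + t *\<^sub>R u) \<bullet> u \<noteq> 0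
                  \<and> R - L = - sgn (outward_normal U (x + t *\<^sub>R u) \<bullet> u) else R - L = (0::real))" for t
  proof -
    obtain a where a: "a \<bullet> u = 1" "\<And>h. active t h \<Longrightarrow> \<exists>k. fst h = k *\<^sub>R a" using ex_a by blast
    obtain L R r where LR: "r > 0" "\<forall>s. - r < s \<and> s < 0 \<longrightarrow> indicator U ((x + t *\<^sub>R u) + s *\<^sub>R u) = L"
        "\<forall>s. 0 < s \<and> s < r \<longrightarrow> indicator U ((x + t *\<^sub>R u) + s *\<^sub>R u) = R"
        "(if x + t *\<^sub>R u \<in> flat_boundary U then outward_normal U (x + t *\<^sub>R u) \<bullet> u \<noteq> 0
                  \<and> R - L = - sgn (outward_normal U (x + t *\<^sub>R u) \<bullet> u) else R - L = (0::real))"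
      using transversal_crossing[OF H a(1), of "x + t *\<^sub>R u"] a(2) unfolding active_def by blast
    have tr: "\<phi> s = indicator U ((x + t *\<^sub>R u) + (s - t) *\<^sub>R u)" for s
      by (simp add: \<phi>_def algebra_simps)
    show ?thesis
      by (intro exI[of _ L] exI[of _ R] conjI exI[of _ r]) (use LR in \<open>auto simp: tr\<close>)
  qed
  then obtain L R where LR: "\<And>t. \<exists>r>0. (\<forall>s. t - r < s \<and> s < t \<longrightarrow> \<phi> s = L t) \<and> (\<forall>s. t < s \<and> s < t + r \<longrightarrow> \<phi> s = R t)"
     and jump: "\<And>t. if x + t *\<^sub>R u \<in> flat_boundary U then outward_normal U (x + t *\<^sub>R u) \<bullet> u \<noteq> 0
                  \<and> R t - L t = - sgn (outward_normal U (x + t *\<^sub>R u) \<bullet> u) else R t - L t = (0::real)"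
    by metis
  show "outward_normal U (x + t *\<^sub>R u) \<bullet> u \<noteq> 0" if "x + t *\<^sub>R u \<in> flat_boundary U" for t
    using jump[of t] that by simp
  \<comment> \<open>Away from all hyperplanes membership in \<open>U\<close> is constant near the
    point; as a flat boundary point is not in \<open>U\<close>, it would not even lie in the
    closure. Hence crossings occur only at the finitely many parameters given by
    \<open>H\<close>.\<close>
  have has_active: "\<exists>h. active t h" if fl: "x + t *\<^sub>R u \<in> flat_boundary U" for t
  proof (rule ccontr)
    assume no: "\<nexists>h. active t h"
    obtain r where r: "r > 0" "\<And>v h. norm v < r \<Longrightarrow> h \<in> H \<Longrightarrow> sgn (fst h \<bullet> (x + t *\<^sub>R u + v) - snd h) = sgn (fst h \<bullet> (x + t *\<^sub>R u) - snd h)"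
      using inactive_sgn_stable[OF finH, of "x + t *\<^sub>R u"] no unfolding active_def by blast
    have U: "x + t *\<^sub>R u + v \<notin> U" if "norm v < r" for v
    proof -
      have "sgn_eq H (x + t *\<^sub>R u + v) (x + t *\<^sub>R u)" using r(2)[OF that] by (simp add: sgn_eq_def)
      moreover have "x + t *\<^sub>R u \<notin> U" using fl is_outward_normal_frontier unfolding flat_boundary_iff by blast
      ultimately show ?thesis using H unfolding arranged_def by blast
    qed
    have "U \<inter> ball (x + t *\<^sub>R u) r = {}"
    proof -
      have "z \<notin> U" if "z \<in> ball (x + t *\<^sub>R u) r" for z
        using U[of "z - (x + t *\<^sub>R u)"] that by (simp add: dist_norm norm_minus_commute)
      then show ?thesis by blast
    qed
    then have "x + t *\<^sub>R u \<notin> closure U" using r(1)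
      by (metis Int_commute centre_in_ball open_Int_closure_eq_empty open_ball disjoint_iff)
    then show False using fl by (auto simp: flat_boundary_def frontier_def)
  qed
  have sub: "{t. x + t *\<^sub>R u \<in> flat_boundary U} \<subseteq> (\<lambda>h. (snd h - fst h \<bullet> x) / (fst h \<bullet> u)) ` H"
    using has_active act unfolding active_def by blast
  then show fin: "finite {t. x + t *\<^sub>R u \<in> flat_boundary U}" using finH finite_subset by blast
  have no0: "\<not> active 0 h" for h using off by (auto simp: active_def)
  then show x: "x \<notin> flat_boundary U" using has_active[of 0] by auto
  \<comment> \<open>Far out on the line the bounded set \<open>U\<close> has been left.\<close>
  obtain m where m: "\<And>t. t < m \<Longrightarrow> \<phi> t = 0"
  proof -
    obtain M where M: "\<And>y. y \<in> U \<Longrightarrow> norm y \<le> M" using bounded_U by (auto simp: bounded_iff)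
    have "\<phi> t = 0" if t: "t < - (\<bar>M\<bar> + norm x + 1) / norm u" for t
    proof -
      have "\<bar>t\<bar> * norm u > \<bar>M\<bar> + norm x"
      proof -
        have "t * norm u < - (\<bar>M\<bar> + norm x + 1)" using t u by (simp add: field_simps)
        moreover have "\<bar>t\<bar> * norm u \<ge> - (t * norm u)" by (metis abs_ge_minus_self abs_mult abs_norm_cancel)
        ultimately show ?thesis by linarith
      qed
      then have "norm (x + t *\<^sub>R u) > M" using norm_triangle_ineq2[of "t *\<^sub>R u" "- x"] by (simp add: add.commute)
      then show ?thesis using M[of "x + t *\<^sub>R u"] by (auto simp: \<phi>_def indicator_def)
    qed
    then show thesis using that by blast
  qed
  have nojump: "L t = R t" if "t \<notin> {t. x + t *\<^sub>R u \<in> flat_boundary U}" for t using jump[of t] that by simp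
  have "L 0 = (\<Sum>c | c \<in> {t. x + t *\<^sub>R u \<in> flat_boundary U} \<and> c < 0. R c - L c)"
    by (rule locally_constant_jump_sum[OF LR fin nojump m])
  also have "\<dots> = (\<Sum>c | c \<in> {t. x + t *\<^sub>R u \<in> flat_boundary U} \<and> c < 0. - sgn (outward_normal U (x + c *\<^sub>R u) \<bullet> u))"
    using jump by (intro sum.cong) auto
  finally have L0: "L 0 = - (\<Sum>t | x + t *\<^sub>R u \<in> flat_boundary U \<and> t < 0. sgn (outward_normal U (x + t *\<^sub>R u) \<bullet> u))"
    by (simp add: sum_negf)
  \<comment> \<open>No hyperplane passes through \<open>x\<close>, so the value at \<open>x\<close>
    agrees with the values shortly before it on the line.\<close>
  have "indicator U x = L 0"
  proof -
    obtain r where r: "r > 0" "\<And>v h. norm v < r \<Longrightarrow> h \<in> H \<Longrightarrow> sgn (fst h \<bullet> (x + v) - snd h) = sgn (fst h \<bullet> x - snd h)"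
      using inactive_sgn_stable[OF finH, of "x"] off by blast
    obtain q where q: "q > 0" "\<forall>s. 0 - q < s \<and> s < 0 \<longrightarrow> \<phi> s = L 0" using LR[of 0] by blast
    define s where "s = - min q (r / norm u) / 2"
    have s: "- q < s" "s < 0" using q r u by (auto simp: s_def min_def field_simps)
    have "norm (s *\<^sub>R u) < r"
    proof -
      have "\<bar>s\<bar> \<le> (r / norm u) / 2" using q r u by (auto simp: s_def min_def)
      then have "\<bar>s\<bar> * norm u \<le> r / 2" using u by (simp add: field_simps)
      then show ?thesis using r(1) by simp
    qed
    then have "sgn_eq H (x + s *\<^sub>R u) x" using r(2) by (simp add: sgn_eq_def)
    then have "x + s *\<^sub>R u \<in> U \<longleftrightarrow> x \<in> U" using H sgn_eq_sym unfolding arranged_def by blast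
    then have "indicator U x = \<phi> s" by (simp add: \<phi>_def indicator_def)
    then show ?thesis using q s by simp
  qed
  then show "indicator U x = - (\<Sum>t | x + t *\<^sub>R u \<in> flat_boundary U \<and> t < 0. sgn (outward_normal U (x + t *\<^sub>R u) \<bullet> u))"
    using L0 by simp
qed

end

section \<open>Integration over flat pieces\<close>

definition facet_offset :: "(real^'n) set \<Rightarrow> real" where
  "facet_offset e = (THE b. e \<subseteq> {x. facet_normal e \<bullet> x = b})"

definition facet_proj :: "(real^'n) set \<Rightarrow> real^'n \<Rightarrow> real^'n" where
  "facet_proj e y = y - (facet_normal e \<bullet> y - facet_offset e) *\<^sub>R facet_normal e"

text \<open>The slab is the facet times a unit interval in the normal direction, so that a facet integral becomes a
  Lebesgue integral.\<close>

definition facet_slab :: "(real^'n) set \<Rightarrow> (real^'n) set" where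
  "facet_slab e = {y. facet_offset e \<le> facet_normal e \<bullet> y \<and> facet_normal e \<bullet> y \<le> facet_offset e + 1 \<and> facet_proj e y \<in> e}"

text \<open>Such integrands are integrable over a bounded facet. Integrability has to be tracked
  because the integral of a non-integrable function is 0 by convention, which destroys additivity
  and monotonicity.\<close>

definition cont_bdd :: "(real^'n) set \<Rightarrow> (real^'n \<Rightarrow> real) \<Rightarrow> bool" where
  "cont_bdd e f \<longleftrightarrow> continuous_on e f \<and> bounded (f ` e)"

text \<open>What \<open>facet_structure\<close> provides about a facet, together with boundedness.
  The pair \<open>\<nu>\<close>, \<open>b\<close> is independent of the unspecified choices made in
  \<open>facet_normal\<close> and \<open>facet_measure\<close>.\<close>

locale flat_piece =
  fixes e :: "(real^'n) set" and \<nu> :: "real^'n" and b :: real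
  assumes unit: "norm \<nu> = 1" and plane: "\<And>x. x \<in> e \<Longrightarrow> \<nu> \<bullet> x = b"
    and rel_open: "\<And>x. x \<in> e \<Longrightarrow> \<exists>r>0. \<forall>y\<in>ball x r. \<nu> \<bullet> y = b \<longrightarrow> y \<in> e"
    and bdd: "bounded e" and nonempty: "e \<noteq> {}"
begin

lemma facet_normal_props: "norm (facet_normal e) = 1" "\<exists>b. e \<subseteq> {x. facet_normal e \<bullet> x = b}"
proof -
  have "norm \<nu> = 1 \<and> (\<exists>b. e \<subseteq> {x. \<nu> \<bullet> x = b})" using unit plane by auto
  then have "norm (facet_normal e) = 1 \<and> (\<exists>b. e \<subseteq> {x. facet_normal e \<bullet> x = b})"
    unfolding facet_normal_def by (rule someI)
  then show "norm (facet_normal e) = 1" "\<exists>b. e \<subseteq> {x. facet_normal e \<bullet> x = b}" by auto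
qed

lemma facet_offset: "x \<in> e \<Longrightarrow> facet_normal e \<bullet> x = facet_offset e"
proof -
  obtain c where c: "e \<subseteq> {x. facet_normal e \<bullet> x = c}" using facet_normal_props by blast
  have "facet_offset e = c" unfolding facet_offset_def
    by (rule the_equality) (use c nonempty in auto)
  then show "x \<in> e \<Longrightarrow> facet_normal e \<bullet> x = facet_offset e" using c by auto
qed

text \<open>\<open>facet_normal\<close> is an arbitrary unit normal of some hyperplane containing
  \<open>e\<close>. As \<open>e\<close> contains a disc of its plane, every vector orthogonal to
  \<open>\<nu>\<close> is orthogonal to \<open>facet_normal e\<close> as well, so only the sign is
  left open.\<close>

lemma facet_normal_eq: "facet_normal e = \<nu> \<or> facet_normal e = - \<nu>"
proof -
  let ?\<mu> = "facet_normal e"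
  obtain x where x: "x \<in> e" using nonempty by blast
  obtain r where r: "r > 0" "\<forall>y\<in>ball x r. \<nu> \<bullet> y = b \<longrightarrow> y \<in> e" using rel_open[OF x] by blast
  have perp: "?\<mu> \<bullet> v = 0" if v: "\<nu> \<bullet> v = 0" for v
  proof (cases "v = 0")
    case False
    define t where "t = r / (2 * norm v)"
    have t: "t > 0" using r False by (simp add: t_def)
    have "x + t *\<^sub>R v \<in> ball x r" using r False by (simp add: dist_norm t_def)
    moreover have "\<nu> \<bullet> (x + t *\<^sub>R v) = b" using plane[OF x] v by (simp add: inner_add_right)
    ultimately have "x + t *\<^sub>R v \<in> e" using r by blast
    from facet_offset[OF this] facet_offset[OF x] show ?thesis using t by (simp add: inner_add_right)
  qed simp
  define c where "c = \<nu> \<bullet> ?\<mu>"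
  have nn: "\<nu> \<bullet> \<nu> = 1" "?\<mu> \<bullet> ?\<mu> = 1" using unit facet_normal_props(1) by (simp_all add: norm_eq_1)
  have "\<nu> \<bullet> (?\<mu> - c *\<^sub>R \<nu>) = 0" using nn by (simp add: inner_diff_right c_def)
  then have "?\<mu> \<bullet> (?\<mu> - c *\<^sub>R \<nu>) = 0" by (rule perp)
  then have c1: "c * c = 1" using nn by (simp add: inner_diff_right c_def inner_commute)
  define w where "w = ?\<mu> - c *\<^sub>R \<nu>"
  have "?\<mu> \<bullet> w = 0" "\<nu> \<bullet> w = 0"
    using \<open>\<nu> \<bullet> (?\<mu> - c *\<^sub>R \<nu>) = 0\<close> \<open>?\<mu> \<bullet> (?\<mu> - c *\<^sub>R \<nu>) = 0\<close> by (simp_all add: w_def)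
  moreover have "w \<bullet> w = ?\<mu> \<bullet> w - c * (\<nu> \<bullet> w)"
    by (subst (1) w_def) (simp only: inner_diff_left inner_scaleR_left)
  ultimately have "w = 0" by simp
  then have "?\<mu> = c *\<^sub>R \<nu>" by (simp add: w_def)
  moreover have "c = 1 \<or> c = -1" using c1 by algebra
  ultimately show ?thesis by auto
qed

lemma facet_proj_plane: "facet_normal e \<bullet> facet_proj e y = facet_offset e"
  using facet_normal_props(1) by (simp add: facet_proj_def inner_diff_right norm_eq_1)

lemma mem_iff_ball: "\<exists>O'. open O' \<and> e = O' \<inter> {x. \<nu> \<bullet> x = b}"
proof -
  obtain r where r: "\<And>x. x \<in> e \<Longrightarrow> r x > 0 \<and> (\<forall>y\<in>ball x (r x). \<nu> \<bullet> y = b \<longrightarrow> y \<in> e)" using rel_open by metis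
  have "e = (\<Union>x\<in>e. ball x (r x)) \<inter> {x. \<nu> \<bullet> x = b}" using r plane by auto
  then show ?thesis by (metis open_UN open_ball)
qed

lemma borel_e [measurable]: "e \<in> sets borel"
proof -
  obtain O' where "open O'" "e = O' \<inter> {x. \<nu> \<bullet> x = b}" using mem_iff_ball by blast
  moreover have "closed {x. \<nu> \<bullet> x = b}" by (rule closed_hyperplane)
  ultimately show ?thesis by (metis borel_open borel_closed sets.Int)
qed

lemma measurable_facet_proj [measurable]: "facet_proj e \<in> borel_measurable borel"
  unfolding facet_proj_def by measurable

lemma borel_facet_slab [measurable]: "facet_slab e \<in> sets borel"
  unfolding facet_slab_def by measurable

lemma bounded_facet_slab: "bounded (facet_slab e)"
proof -
  obtain M where M: "\<And>x. x \<in> e \<Longrightarrow> norm x \<le> M" using bdd by (auto simp: bounded_iff)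
  have "norm y \<le> M + 1" if "y \<in> facet_slab e" for y
  proof -
    let ?t = "facet_normal e \<bullet> y - facet_offset e"
    have "y = facet_proj e y + ?t *\<^sub>R facet_normal e" by (simp add: facet_proj_def)
    then have "norm y \<le> norm (facet_proj e y) + \<bar>?t\<bar>"
      by (metis facet_normal_props(1) mult.right_neutral norm_scaleR norm_triangle_ineq)
    then show ?thesis using that M[of "facet_proj e y"] by (auto simp: facet_slab_def)
  qed
  then show ?thesis by (auto simp: bounded_iff)
qed

lemma finite_facet_slab: "emeasure lborel (facet_slab e) < \<infinity>"
  using bounded_facet_slab by (rule emeasure_bounded_finite)

lemma facet_integral_slab:
  fixes f :: "real^'n \<Rightarrow> real"
  assumes "(\<lambda>x. indicator e x *\<^sub>R f x) \<in> borel_measurable borel"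
  shows "facet_integral e f = (LINT y:facet_slab e|lborel. f (facet_proj e y))"
proof -
  let ?S = "{y. facet_offset e \<le> facet_normal e \<bullet> y \<and> facet_normal e \<bullet> y \<le> facet_offset e + 1}"
  have S: "?S \<in> sets lborel" by measurable
  have "facet_integral e f = (\<integral>x. indicator e x *\<^sub>R f x \<partial>distr (restrict_space lborel ?S) borel (facet_proj e))"
    unfolding facet_integral_def facet_measure_def hyperplane_measure_def set_lebesgue_integral_def
      facet_offset_def[symmetric] facet_proj_def[symmetric, abs_def] by simp
  also have "\<dots> = (\<integral>y. indicator e (facet_proj e y) *\<^sub>R f (facet_proj e y) \<partial>restrict_space lborel ?S)"
    by (rule integral_distr) (use assms in \<open>auto intro!: measurable_restrict_space1\<close>)
  also have "\<dots> = (\<integral>y. indicator ?S y *\<^sub>R (indicator e (facet_proj e y) *\<^sub>R f (facet_proj e y)) \<partial>lborel)"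
    by (rule integral_restrict_space) (use S in simp)
  also have "\<dots> = (LINT y:facet_slab e|lborel. f (facet_proj e y))"
    unfolding set_lebesgue_integral_def
    by (rule Bochner_Integration.integral_cong) (auto simp: facet_slab_def indicator_def)
  finally show ?thesis .
qed

lemma cont_bdd_measurable: "cont_bdd e f \<Longrightarrow> (\<lambda>x. indicator e x *\<^sub>R f x) \<in> borel_measurable borel"
  unfolding cont_bdd_def using borel_measurable_continuous_on_indicator[OF borel_e] by blast

lemma cont_bdd_integral: "cont_bdd e f \<Longrightarrow> facet_integral e f = (LINT y:facet_slab e|lborel. f (facet_proj e y))"
  using cont_bdd_measurable facet_integral_slab by blast

lemma cont_bdd_integrable:
  assumes "cont_bdd e f"
  shows "set_integrable lborel (facet_slab e) (\<lambda>y. f (facet_proj e y))"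
proof -
  obtain M where M: "\<And>x. x \<in> e \<Longrightarrow> \<bar>f x\<bar> \<le> M" using assms by (auto simp: cont_bdd_def bounded_iff)
  have [measurable]: "(\<lambda>x. indicator e x *\<^sub>R f x) \<in> borel_measurable borel" by (rule cont_bdd_measurable[OF assms])
  have "integrable lborel (\<lambda>y. indicator (facet_slab e) y *\<^sub>R ((\<lambda>x. indicator e x *\<^sub>R f x) (facet_proj e y)))"
  proof (rule integrableI_bounded_set_indicator[where B="\<bar>M\<bar>"])
    show "AE y in lborel. y \<in> facet_slab e \<longrightarrow> norm (indicator e (facet_proj e y) *\<^sub>R f (facet_proj e y)) \<le> \<bar>M\<bar>"
    proof (intro always_eventually allI impI)
      fix y assume "y \<in> facet_slab e"
      then have "facet_proj e y \<in> e" by (simp add: facet_slab_def)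
      with M[OF this] show "norm (indicator e (facet_proj e y) *\<^sub>R f (facet_proj e y)) \<le> \<bar>M\<bar>" by simp
    qed
    show "(\<lambda>y. indicator e (facet_proj e y) *\<^sub>R f (facet_proj e y)) \<in> borel_measurable lborel"
      using measurable_compose[OF measurable_facet_proj cont_bdd_measurable[OF assms]] by simp
  qed (use finite_facet_slab in auto)
  moreover have "(\<lambda>y. indicator (facet_slab e) y *\<^sub>R ((\<lambda>x. indicator e x *\<^sub>R f x) (facet_proj e y)))
      = (\<lambda>y. indicator (facet_slab e) y *\<^sub>R f (facet_proj e y))"
    by (auto simp: facet_slab_def indicator_def fun_eq_iff)
  ultimately show ?thesis unfolding set_integrable_def by simp
qed

lemma facet_integral_add:
  assumes "cont_bdd e f" "cont_bdd e g"
  shows "facet_integral e (\<lambda>x. f x + g x) = facet_integral e f + facet_integral e g"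
proof -
  have "cont_bdd e (\<lambda>x. f x + g x)" using assms by (auto simp: cont_bdd_def intro!: continuous_intros bounded_plus_comp)
  then show ?thesis using assms cont_bdd_integrable
    by (simp add: cont_bdd_integral set_integral_add)
qed

lemma facet_integral_mono:
  assumes "cont_bdd e f" "cont_bdd e g" "\<And>x. x \<in> e \<Longrightarrow> f x \<le> g x"
  shows "facet_integral e f \<le> facet_integral e g"
proof -
  have "(LINT y:facet_slab e|lborel. f (facet_proj e y)) \<le> (LINT y:facet_slab e|lborel. g (facet_proj e y))"
    by (rule set_integral_mono) (use assms cont_bdd_integrable in \<open>auto simp: facet_slab_def\<close>)
  then show ?thesis using assms by (simp add: cont_bdd_integral)
qed

end

lemma facet_integral_cong: "(\<And>x. x \<in> e \<Longrightarrow> f x = g x) \<Longrightarrow> facet_integral e f = facet_integral e g"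
  unfolding facet_integral_def set_lebesgue_integral_def
  by (rule Bochner_Integration.integral_cong) (auto simp: indicator_def)

lemma facet_integral_cmult: "facet_integral e (\<lambda>x. c * f x) = c * facet_integral e f"
  unfolding facet_integral_def by simp

lemma facet_integral_nonneg: "(\<And>x. x \<in> e \<Longrightarrow> 0 \<le> f x) \<Longrightarrow> 0 \<le> facet_integral e f"
  unfolding facet_integral_def set_lebesgue_integral_def
  by (rule Bochner_Integration.integral_nonneg) (auto simp: indicator_def)

lemma cont_bdd_cmult: "cont_bdd e f \<Longrightarrow> cont_bdd e (\<lambda>x. c * f x)"
  unfolding cont_bdd_def bounded_iff
  by (auto intro!: continuous_intros simp: abs_mult) (meson mult_left_mono abs_ge_zero)

lemma cont_bdd_add: "cont_bdd e f \<Longrightarrow> cont_bdd e g \<Longrightarrow> cont_bdd e (\<lambda>x. f x + g x)"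
  by (auto simp: cont_bdd_def intro!: continuous_intros bounded_plus_comp)

lemma cont_bdd_compact: "continuous_on S f \<Longrightarrow> compact S \<Longrightarrow> e \<subseteq> S \<Longrightarrow> cont_bdd e f"
  unfolding cont_bdd_def by (meson bounded_subset compact_continuous_image compact_imp_bounded continuous_on_subset image_mono)

section \<open>Slicing space by a hyperplane and a transversal direction\<close>

text \<open>The map splits into two translations and an affine substitution in one variable, so that
  Fubini's theorem replaces a Jacobian determinant.\<close>

lemma nn_integral_shear:
  fixes \<mu> u :: "real^'n" and c :: real and F :: "(real^'n) \<times> real \<Rightarrow> ennreal"
  assumes [measurable]: "F \<in> borel_measurable borel" and mu: "norm \<mu> = 1" and mu_u: "\<mu> \<bullet> u \<noteq> 0"
  shows "(\<integral>\<^sup>+ y. \<integral>\<^sup>+ s. F (y - (\<mu> \<bullet> y - c) *\<^sub>R \<mu> + s *\<^sub>R u, \<mu> \<bullet> y - c) \<partial>lborel \<partial>lborel)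
       = ennreal (1 / \<bar>\<mu> \<bullet> u\<bar>) * (\<integral>\<^sup>+ x. \<integral>\<^sup>+ \<tau>. F (x, \<tau>) \<partial>lborel \<partial>lborel)"
proof -
  have [measurable]: "F \<in> borel_measurable (borel \<Otimes>\<^sub>M borel)" by (simp add: borel_prod)
  have transl: "(\<integral>\<^sup>+ y. h (y + a) \<partial>lborel) = (\<integral>\<^sup>+ y. h y \<partial>lborel)"
    if [measurable]: "h \<in> borel_measurable borel" for h :: "real^'n \<Rightarrow> ennreal" and a
  proof -
    have "(\<integral>\<^sup>+ y. h y \<partial>lborel) = (\<integral>\<^sup>+ y. h y \<partial>distr lborel borel ((+) a))" by (simp add: lborel_distr_plus)
    also have "\<dots> = (\<integral>\<^sup>+ y. h (a + y) \<partial>lborel)" by (rule nn_integral_distr) auto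
    finally show ?thesis by (simp add: add.commute)
  qed
  have mm: "\<mu> \<bullet> \<mu> = 1" using mu by (simp add: norm_eq_1)
  define G where "G y \<tau> = F (y - \<tau> *\<^sub>R \<mu>, \<tau>)" for y \<tau>
  have [measurable]: "case_prod G \<in> borel_measurable (borel \<Otimes>\<^sub>M borel)" unfolding G_def by measurable
  have "(\<integral>\<^sup>+ y. \<integral>\<^sup>+ s. F (y - (\<mu> \<bullet> y - c) *\<^sub>R \<mu> + s *\<^sub>R u, \<mu> \<bullet> y - c) \<partial>lborel \<partial>lborel)
      = (\<integral>\<^sup>+ s. \<integral>\<^sup>+ y. F (y - (\<mu> \<bullet> y - c) *\<^sub>R \<mu> + s *\<^sub>R u, \<mu> \<bullet> y - c) \<partial>lborel \<partial>lborel)"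
    by (rule lborel_pair.Fubini') measurable
  \<comment> \<open>For fixed \<open>s\<close>, translating \<open>y\<close> by
    \<open>s *\<^sub>R u\<close> increases \<open>\<mu> \<bullet> y\<close> by
    \<open>s * (\<mu> \<bullet> u)\<close>; the second argument of \<open>G\<close> compensates for
    this.\<close>
  also have "\<dots> = (\<integral>\<^sup>+ s. \<integral>\<^sup>+ y. G y (\<mu> \<bullet> y - c - s * (\<mu> \<bullet> u)) \<partial>lborel \<partial>lborel)"
  proof (rule nn_integral_cong)
    fix s :: real
    have "(\<integral>\<^sup>+ y. F (y - (\<mu> \<bullet> y - c) *\<^sub>R \<mu> + s *\<^sub>R u, \<mu> \<bullet> y - c) \<partial>lborel)
       = (\<integral>\<^sup>+ y. (\<lambda>y. G y (\<mu> \<bullet> y - c - s * (\<mu> \<bullet> u))) (y + s *\<^sub>R u) \<partial>lborel)"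
      by (rule nn_integral_cong) (simp add: G_def algebra_simps inner_add_right)
    also have "\<dots> = (\<integral>\<^sup>+ y. G y (\<mu> \<bullet> y - c - s * (\<mu> \<bullet> u)) \<partial>lborel)"
      by (rule transl) measurable
    finally show "(\<integral>\<^sup>+ y. F (y - (\<mu> \<bullet> y - c) *\<^sub>R \<mu> + s *\<^sub>R u, \<mu> \<bullet> y - c) \<partial>lborel)
       = (\<integral>\<^sup>+ y. G y (\<mu> \<bullet> y - c - s * (\<mu> \<bullet> u)) \<partial>lborel)" .
  qed
  also have "\<dots> = (\<integral>\<^sup>+ y. \<integral>\<^sup>+ s. G y (\<mu> \<bullet> y - c - s * (\<mu> \<bullet> u)) \<partial>lborel \<partial>lborel)"
    by (rule lborel_pair.Fubini') measurable
  \<comment> \<open>For fixed \<open>y\<close> the height is an affine function of \<open>s\<close>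
    with slope \<open>- (\<mu> \<bullet> u)\<close>; this is where the factor originates.\<close>
  also have "\<dots> = (\<integral>\<^sup>+ y. ennreal (1 / \<bar>\<mu> \<bullet> u\<bar>) * (\<integral>\<^sup>+ \<tau>. G y \<tau> \<partial>lborel) \<partial>lborel)"
  proof (rule nn_integral_cong)
    fix y :: "real^'n"
    have "(\<integral>\<^sup>+ \<tau>. G y \<tau> \<partial>lborel) = \<bar>- (\<mu> \<bullet> u)\<bar> * (\<integral>\<^sup>+ s. G y (\<mu> \<bullet> y - c + - (\<mu> \<bullet> u) * s) \<partial>lborel)"
      by (rule nn_integral_real_affine) (use mu_u in auto)
    moreover have "ennreal (1 / \<bar>\<mu> \<bullet> u\<bar>) * ennreal \<bar>\<mu> \<bullet> u\<bar> = 1"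
      using mu_u by (simp flip: ennreal_mult)
    ultimately show "(\<integral>\<^sup>+ s. G y (\<mu> \<bullet> y - c - s * (\<mu> \<bullet> u)) \<partial>lborel) = ennreal (1 / \<bar>\<mu> \<bullet> u\<bar>) * (\<integral>\<^sup>+ \<tau>. G y \<tau> \<partial>lborel)"
      by (simp add: mult.assoc[symmetric] mult.commute[of "\<mu> \<bullet> u"])
  qed
  also have "\<dots> = ennreal (1 / \<bar>\<mu> \<bullet> u\<bar>) * (\<integral>\<^sup>+ y. \<integral>\<^sup>+ \<tau>. G y \<tau> \<partial>lborel \<partial>lborel)"
    by (rule nn_integral_cmult) measurable
  also have "(\<integral>\<^sup>+ y. \<integral>\<^sup>+ \<tau>. G y \<tau> \<partial>lborel \<partial>lborel) = (\<integral>\<^sup>+ \<tau>. \<integral>\<^sup>+ y. G y \<tau> \<partial>lborel \<partial>lborel)"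
    by (rule lborel_pair.Fubini') measurable
  \<comment> \<open>For fixed height the remaining map is a translation along
    \<open>\<mu>\<close>.\<close>
  also have "\<dots> = (\<integral>\<^sup>+ \<tau>. \<integral>\<^sup>+ x. F (x, \<tau>) \<partial>lborel \<partial>lborel)"
  proof (rule nn_integral_cong)
    fix \<tau> :: real
    have "(\<integral>\<^sup>+ y. G y \<tau> \<partial>lborel) = (\<integral>\<^sup>+ y. (\<lambda>x. F (x, \<tau>)) (y + (- \<tau> *\<^sub>R \<mu>)) \<partial>lborel)" by (simp add: G_def)
    also have "\<dots> = (\<integral>\<^sup>+ x. F (x, \<tau>) \<partial>lborel)" by (rule transl) measurable
    finally show "(\<integral>\<^sup>+ y. G y \<tau> \<partial>lborel) = (\<integral>\<^sup>+ x. F (x, \<tau>) \<partial>lborel)" .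
  qed
  also have "\<dots> = (\<integral>\<^sup>+ x. \<integral>\<^sup>+ \<tau>. F (x, \<tau>) \<partial>lborel \<partial>lborel)"
    by (rule lborel_pair.Fubini'[symmetric]) measurable
  finally show ?thesis .
qed

text \<open>Stated for measures, the identity for nonnegative functions carries over to signed
  integrable functions.\<close>

lemma distr_shear:
  fixes \<mu> u :: "real^'n" and c :: real
  assumes mu: "norm \<mu> = 1" and mu_u: "\<mu> \<bullet> u \<noteq> 0"
  shows "distr (lborel \<Otimes>\<^sub>M lborel) borel (\<lambda>(y, s). (y - (\<mu> \<bullet> y - c) *\<^sub>R \<mu> + s *\<^sub>R u, \<mu> \<bullet> y - c))
    = density (lborel :: ((real^'n) \<times> real) measure) (\<lambda>_. ennreal (1 / \<bar>\<mu> \<bullet> u\<bar>))" (is "distr ?M _ ?\<Theta> = _")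
proof (rule measure_eqI)
  have [measurable]: "?\<Theta> \<in> borel_measurable ?M" by measurable
  fix A assume "A \<in> sets (distr ?M borel ?\<Theta>)"
  then have A [measurable]: "A \<in> sets borel" by simp
  have Ap [measurable]: "A \<in> sets (borel \<Otimes>\<^sub>M borel)" by (subst borel_prod) (fact A)
  have "emeasure (distr ?M borel ?\<Theta>) A = (\<integral>\<^sup>+ p. indicator A p \<partial>distr ?M borel ?\<Theta>)"
    by (rule nn_integral_indicator[symmetric]) simp
  also have "\<dots> = (\<integral>\<^sup>+ p. indicator A (?\<Theta> p) \<partial>?M)"
    by (rule nn_integral_distr) (use A in measurable)
  also have "\<dots> = (\<integral>\<^sup>+ y. \<integral>\<^sup>+ s. indicator A (?\<Theta> (y, s)) \<partial>lborel \<partial>lborel)"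
    by (rule lborel.nn_integral_fst[symmetric]) measurable
  also have "\<dots> = ennreal (1 / \<bar>\<mu> \<bullet> u\<bar>) * (\<integral>\<^sup>+ x. \<integral>\<^sup>+ \<tau>. indicator A (x, \<tau>) \<partial>lborel \<partial>lborel)"
    using nn_integral_shear[OF _ mu mu_u, of "indicator A" c] by simp
  also have "(\<integral>\<^sup>+ x. \<integral>\<^sup>+ \<tau>. indicator A (x, \<tau>) \<partial>lborel \<partial>lborel) = (\<integral>\<^sup>+ p. indicator A p \<partial>?M)"
    by (rule lborel.nn_integral_fst) measurable
  also have "\<dots> = emeasure lborel A" by (simp add: lborel_prod)
  finally show "emeasure (distr ?M borel ?\<Theta>) A = emeasure (density lborel (\<lambda>_. ennreal (1 / \<bar>\<mu> \<bullet> u\<bar>))) A"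
    by (simp add: emeasure_density nn_integral_cmult)
qed simp

lemma open_not_AE_empty:
  fixes S :: "'a::euclidean_space set"
  assumes "open S" "S \<noteq> {}"
  shows "\<not> (AE x in lborel. x \<notin> S)"
proof
  assume "AE x in lborel. x \<notin> S"
  then have "AE x in lebesgue. x \<notin> S" by (simp add: AE_completion_iff)
  then have "S \<in> null_sets lebesgue" using assms(1) by (simp add: AE_iff_null_sets)
  then have "negligible S" by (simp add: negligible_iff_null_sets)
  then show False using open_not_negligible assms by blast
qed

section \<open>Mollification\<close>

lemma test_function_has_derivative:
  assumes "\<phi> differentiable (at x)"
  shows "(\<phi> has_derivative (\<lambda>w. grad \<phi> x \<bullet> w)) (at x)"
proof -
  have D: "(\<phi> has_derivative frechet_derivative \<phi> (at x)) (at x)"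
    using assms by (simp add: frechet_derivative_works)
  then have lin: "linear (frechet_derivative \<phi> (at x))" by (rule has_derivative_linear)
  have "frechet_derivative \<phi> (at x) w = grad \<phi> x \<bullet> w" for w
  proof -
    have "frechet_derivative \<phi> (at x) w = frechet_derivative \<phi> (at x) (\<Sum>i\<in>UNIV. (w $ i) *\<^sub>R axis i 1)"
      by (simp add: basis_expansion flip: scalar_mult_eq_scaleR)
    also have "\<dots> = grad \<phi> x \<bullet> w"
      by (simp add: linear_sum[OF lin] linear_cmul[OF lin] grad_def inner_vec_def mult.commute)
    finally show ?thesis .
  qed
  then have "frechet_derivative \<phi> (at x) = (\<lambda>w. grad \<phi> x \<bullet> w)" by blast
  then show ?thesis using D by metis
qed

lemma grad_unique:
  assumes "(\<phi> has_derivative (\<lambda>w. g \<bullet> w)) (at x)"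
  shows "grad \<phi> x = g" "\<phi> differentiable (at x)"
proof -
  have "frechet_derivative \<phi> (at x) = (\<lambda>w. g \<bullet> w)" using frechet_derivative_at[OF assms] by simp
  then show "grad \<phi> x = g" by (simp add: grad_def vec_eq_iff inner_axis)
  show "\<phi> differentiable (at x)" using assms by (auto simp: differentiable_def)
qed

lemma grad_cong_open:
  assumes "open S" "x \<in> S" "\<And>y. y \<in> S \<Longrightarrow> f y = g y"
  shows "grad f x = grad g x"
proof -
  have "(f has_derivative D) (at x) \<longleftrightarrow> (g has_derivative D) (at x)" for D
    using has_derivative_transform_within_open[of f D x UNIV S g]
      has_derivative_transform_within_open[of g D x UNIV S f] assms by auto
  then show ?thesis unfolding grad_def frechet_derivative_def by simp
qed

text \<open>The class for which the divergence theorem is proved. In contrast to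
  \<open>test_function\<close>, the support may cross the boundary of the set considered.\<close>

definition C1c :: "(real^'n \<Rightarrow> real) \<Rightarrow> bool" where
  "C1c \<phi> \<longleftrightarrow> (\<forall>x. \<phi> differentiable (at x)) \<and> continuous_on UNIV (grad \<phi>) \<and> (\<exists>R. \<forall>x. R < norm x \<longrightarrow> \<phi> x = 0)"

lemma C1c_grad_support:
  assumes "\<And>x. R < norm x \<Longrightarrow> \<phi> x = 0" "R < norm x"
  shows "grad \<phi> x = 0"
proof -
  have "grad \<phi> x = grad (\<lambda>_. 0) x"
    using assms by (intro grad_cong_open[of "{x. R < norm x}"]) (auto intro: open_Collect_less continuous_intros)
  also have "\<dots> = 0" by (simp add: grad_def vec_eq_iff frechet_derivative_const)
  finally show ?thesis .
qed

lemma C1c_grad_continuous: "C1c \<phi> \<Longrightarrow> continuous_on UNIV (grad \<phi>)"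
  by (simp add: C1c_def)

lemma C1c_continuous: "C1c \<phi> \<Longrightarrow> continuous_on UNIV \<phi>"
  unfolding C1c_def by (intro continuous_at_imp_continuous_on ballI differentiable_imp_continuous_within) auto

lemma compact_support_uniformly_continuous:
  fixes g :: "real^'n \<Rightarrow> 'b::metric_space"
  assumes "continuous_on UNIV g" "\<And>x. R < norm x \<Longrightarrow> g x = z" "e > 0"
  shows "\<exists>d>0. \<forall>x y. dist x y < d \<longrightarrow> dist (g x) (g y) < e"
proof -
  have "uniformly_continuous_on (cball 0 (R + 1)) g"
    by (rule compact_uniformly_continuous[OF continuous_on_subset[OF assms(1) subset_UNIV] compact_cball])
  then obtain d where d: "d > 0" "\<And>x y. x \<in> cball 0 (R+1) \<Longrightarrow> y \<in> cball 0 (R+1) \<Longrightarrow> dist y x < d \<Longrightarrow> dist (g y) (g x) < e"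
    using assms(3) unfolding uniformly_continuous_on_def by blast
  \<comment> \<open>At distance less than 1 either both points lie in the enlarged ball, or both lie
    where \<open>g\<close> is constant.\<close>
  have "dist (g x) (g y) < e" if xy: "dist x y < min d 1" for x y
  proof (cases "norm x \<le> R \<or> norm y \<le> R")
    case True
    have "\<bar>norm x - norm y\<bar> \<le> dist x y" by (metis dist_norm norm_triangle_ineq3)
    then have "x \<in> cball 0 (R+1)" "y \<in> cball 0 (R+1)" using True xy by auto
    then show ?thesis using d(2)[of y x] xy by simp
  next
    case False
    then show ?thesis using assms(2,3) by simp
  qed
  then show ?thesis using d(1) by (intro exI[of _ "min d 1"]) simp
qed

lemma integrable_compact_support:
  fixes g :: "real^'n \<Rightarrow> real"
  assumes "continuous_on UNIV g" "\<And>x. R < norm x \<Longrightarrow> g x = 0"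
  shows "integrable lborel g"
proof -
  have "(\<lambda>x. if x \<in> cball 0 R then g x else 0) = g" using assms(2) by (auto simp: fun_eq_iff)
  then show ?thesis
    using borel_integrable_compact[OF compact_cball[of 0 R] continuous_on_subset[OF assms(1) subset_UNIV]]
    by (simp only: indicator_def of_bool_def if_distrib[of "\<lambda>c. c *\<^sub>R _"] scaleR_one scaleR_zero_left cong: if_cong)
qed

lemma C1c_bounded:
  assumes "C1c \<phi>"
  shows "\<exists>B. \<forall>x. \<bar>\<phi> x\<bar> \<le> B" "\<exists>B. \<forall>x. norm (grad \<phi> x) \<le> B"
proof -
  obtain R where R: "\<And>x. R < norm x \<Longrightarrow> \<phi> x = 0" using assms unfolding C1c_def by blast
  have *: "\<exists>B. \<forall>x. norm (g x) \<le> B" if g: "continuous_on UNIV g" "\<And>x. R < norm x \<Longrightarrow> g x = 0"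
    for g :: "real^'n \<Rightarrow> 'b::real_normed_vector"
  proof -
    have "bounded (g ` cball 0 R)"
      by (meson compact_cball compact_continuous_image compact_imp_bounded continuous_on_subset g(1) subset_UNIV)
    then obtain B where B: "\<forall>x\<in>cball 0 R. norm (g x) \<le> B" by (auto simp: bounded_iff)
    have "norm (g x) \<le> max B 0" for x
    proof (cases "norm x \<le> R")
      case True
      then show ?thesis using B by (simp add: le_max_iff_disj)
    next
      case False
      then show ?thesis using g(2)[of x] by simp
    qed
    then show ?thesis by blast
  qed
  show "\<exists>B. \<forall>x. \<bar>\<phi> x\<bar> \<le> B" using *[OF C1c_continuous[OF assms] R] by simp
  have "continuous_on UNIV (grad \<phi>)" using assms by (simp add: C1c_def)
  from *[OF this C1c_grad_support[OF R]] show "\<exists>B. \<forall>x. norm (grad \<phi> x) \<le> B" by simp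
qed

text \<open>The mean value inequality for \<open>\<phi> x - grad \<phi> a \<bullet> x\<close>
  combined with uniform continuity of the gradient. Uniformity in \<open>a\<close> is what permits
  differentiation under the convolution integral.\<close>

lemma C1c_uniform_derivative:
  assumes "C1c \<phi>" "e > 0"
  shows "\<exists>d>0. \<forall>a w. norm w < d \<longrightarrow> \<bar>\<phi> (a + w) - \<phi> a - grad \<phi> a \<bullet> w\<bar> \<le> e * norm w"
proof -
  obtain R where R: "\<And>x. R < norm x \<Longrightarrow> \<phi> x = 0" using assms unfolding C1c_def by blast
  have "\<exists>d>0. \<forall>x y. dist x y < d \<longrightarrow> dist (grad \<phi> x) (grad \<phi> y) < e"
    by (rule compact_support_uniformly_continuous[OF C1c_grad_continuous[OF assms(1)] C1c_grad_support[OF R] assms(2)])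
  then obtain d where d: "d > 0" "\<And>x y. dist x y < d \<Longrightarrow> dist (grad \<phi> x) (grad \<phi> y) < e"
    by blast
  have "\<bar>\<phi> (a + w) - \<phi> a - grad \<phi> a \<bullet> w\<bar> \<le> e * norm w" if w: "norm w < d" for a w
  proof -
    have der: "((\<lambda>x. \<phi> x - grad \<phi> a \<bullet> x) has_derivative (\<lambda>w. (grad \<phi> x - grad \<phi> a) \<bullet> w)) (at x within ball a d)" for x
      using assms(1) unfolding C1c_def
      by (auto intro!: derivative_eq_intros test_function_has_derivative[THEN has_derivative_at_withinI] simp: inner_diff_left)
    have "norm ((\<phi> (a + w) - grad \<phi> a \<bullet> (a + w)) - (\<phi> a - grad \<phi> a \<bullet> a)) \<le> e * norm ((a + w) - a)"
    proof (rule differentiable_bound[OF convex_ball der])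
      fix x assume "x \<in> ball a d"
      then have "norm (grad \<phi> x - grad \<phi> a) < e" using d(2)[of x a] by (simp add: dist_norm norm_minus_commute)
      moreover have "onorm (\<lambda>w. (grad \<phi> x - grad \<phi> a) \<bullet> w) \<le> norm (grad \<phi> x - grad \<phi> a)"
        by (rule onorm_le) (simp add: Cauchy_Schwarz_ineq2)
      ultimately show "onorm (\<lambda>w. (grad \<phi> x - grad \<phi> a) \<bullet> w) \<le> e" by linarith
    qed (use w d in \<open>auto simp: dist_norm\<close>)
    then show ?thesis by (simp add: inner_add_right algebra_simps)
  qed
  then show ?thesis using d(1) by blast
qed

text \<open>\<open>k\<close> is the rough factor and \<open>\<rho>\<close> the smooth one. Values in
  a Euclidean space are allowed so that \<open>\<rho>\<close> can be a gradient.\<close>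

definition conv :: "(real^'n \<Rightarrow> real) \<Rightarrow> (real^'n \<Rightarrow> 'b::euclidean_space) \<Rightarrow> real^'n \<Rightarrow> 'b" where
  "conv k \<rho> x = (\<integral>y. k y *\<^sub>R \<rho> (x - y) \<partial>lborel)"

lemma conv_integrable:
  fixes \<rho> :: "real^'n \<Rightarrow> 'b::euclidean_space"
  assumes k: "integrable lborel k" and \<rho>: "\<rho> \<in> borel_measurable borel" "\<And>x. norm (\<rho> x) \<le> B"
  shows "integrable lborel (\<lambda>y. k y *\<^sub>R \<rho> (x - y))"
proof (rule Bochner_Integration.integrable_bound)
  show "integrable lborel (\<lambda>y. B * norm (k y))" using k by simp
  have [measurable]: "k \<in> borel_measurable borel" "\<rho> \<in> borel_measurable borel" using k \<rho> by auto
  show "(\<lambda>y. k y *\<^sub>R \<rho> (x - y)) \<in> borel_measurable lborel" by measurable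
  show "AE y in lborel. norm (k y *\<^sub>R \<rho> (x - y)) \<le> norm (B * norm (k y))"
  proof (rule AE_I2)
    fix y
    have "\<bar>k y\<bar> * norm (\<rho> (x - y)) \<le> \<bar>k y\<bar> * \<bar>B\<bar>" using \<rho>(2)[of "x - y"] by (intro mult_left_mono) auto
    then show "norm (k y *\<^sub>R \<rho> (x - y)) \<le> norm (B * norm (k y))" by (simp add: abs_mult mult.commute)
  qed
qed

lemma conv_continuous:
  fixes \<rho> :: "real^'n \<Rightarrow> 'b::euclidean_space"
  assumes k: "integrable lborel k" and \<rho>: "continuous_on UNIV \<rho>" "\<And>x. R < norm x \<Longrightarrow> \<rho> x = 0" "\<And>x. norm (\<rho> x) \<le> B"
  shows "continuous_on UNIV (conv k \<rho>)"
  unfolding continuous_on_iff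
proof (intro ballI allI impI)
  fix x :: "real^'n" and e :: real assume e: "e > 0"
  \<comment> \<open>Tolerances are divided by \<open>M + 1\<close>, which is positive even if
    \<open>k\<close> vanishes almost everywhere.\<close>
  define M where "M = (\<integral>y. \<bar>k y\<bar> \<partial>lborel)"
  have M: "M \<ge> 0" by (simp add: M_def)
  have int: "integrable lborel (\<lambda>y. k y *\<^sub>R \<rho> (x - y))" for x
    by (rule conv_integrable[OF k _ \<rho>(3)]) (use \<rho>(1) in \<open>auto intro: borel_measurable_continuous_onI\<close>)
  obtain d where d: "d > 0" "\<And>x y. dist x y < d \<Longrightarrow> dist (\<rho> x) (\<rho> y) < e / (M + 1)"
    using compact_support_uniformly_continuous[of \<rho> R 0 "e / (M + 1)"] \<rho> e M by (auto simp: field_simps)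
  have "dist (conv k \<rho> x') (conv k \<rho> x) < e" if "dist x' x < d" for x'
  proof -
    have "norm (conv k \<rho> x' - conv k \<rho> x) = norm (\<integral>y. k y *\<^sub>R \<rho> (x' - y) - k y *\<^sub>R \<rho> (x - y) \<partial>lborel)"
      unfolding conv_def by (simp add: Bochner_Integration.integral_diff[OF int int])
    also have "\<dots> \<le> (\<integral>y. \<bar>k y\<bar> * (e / (M + 1)) \<partial>lborel)"
    proof (rule Bochner_Integration.integral_norm_bound_integral)
      show "integrable lborel (\<lambda>y. \<bar>k y\<bar> * (e / (M + 1)))" using k by (intro integrable_mult_left) simp
      fix y
      have "norm (\<rho> (x' - y) - \<rho> (x - y)) \<le> e / (M + 1)"
        using d(2)[of "x' - y" "x - y"] that by (simp add: dist_norm)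
      then show "norm (k y *\<^sub>R \<rho> (x' - y) - k y *\<^sub>R \<rho> (x - y)) \<le> \<bar>k y\<bar> * (e / (M + 1))"
        unfolding scaleR_diff_right[symmetric] norm_scaleR by (intro mult_left_mono) auto
    qed (use int in simp)
    also have "\<dots> = M * (e / (M + 1))" by (simp only: M_def Bochner_Integration.integral_mult_left_zero)
    also have "\<dots> < e" using e M by (simp add: field_simps)
    finally show ?thesis by (simp add: dist_norm)
  qed
  then show "\<exists>d>0. \<forall>x'\<in>UNIV. dist x' x < d \<longrightarrow> dist (conv k \<rho> x') (conv k \<rho> x) < e" using d(1) by blast
qed

text \<open>The remainder of the first-order expansion of \<open>\<rho>\<close> is small uniformly
  in the base point, so it remains small after integration against \<open>k\<close>; no regularity
  of \<open>k\<close> enters.\<close>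

lemma conv_has_derivative:
  assumes k: "integrable lborel k" and \<rho>: "C1c \<rho>"
  shows "(conv k \<rho> has_derivative (\<lambda>w. conv k (grad \<rho>) x \<bullet> w)) (at x)"
  unfolding has_derivative_at_alt
proof (intro conjI allI impI)
  show "bounded_linear (\<lambda>w. conv k (grad \<rho>) x \<bullet> w)" by (rule bounded_linear_inner_right)
  fix e :: real assume e: "e > 0"
  define M where "M = (\<integral>y. \<bar>k y\<bar> \<partial>lborel)"
  have M: "M \<ge> 0" by (simp add: M_def)
  obtain B where B: "\<And>x. norm (\<rho> x) \<le> B" using C1c_bounded(1)[OF \<rho>] by auto
  obtain B' where B': "\<And>x. norm (grad \<rho> x) \<le> B'" using C1c_bounded(2)[OF \<rho>] by auto
  have mes: "\<rho> \<in> borel_measurable borel" "grad \<rho> \<in> borel_measurable borel"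
    using \<rho> C1c_continuous[OF \<rho>] by (auto simp: C1c_def intro: borel_measurable_continuous_onI)
  have int: "integrable lborel (\<lambda>y. k y *\<^sub>R \<rho> (x - y))" for x using conv_integrable[OF k mes(1) B] .
  have intg: "integrable lborel (\<lambda>y. k y *\<^sub>R grad \<rho> (x - y))" for x using conv_integrable[OF k mes(2) B'] .
  obtain d where d: "d > 0" "\<And>a w. norm w < d \<Longrightarrow> \<bar>\<rho> (a + w) - \<rho> a - grad \<rho> a \<bullet> w\<bar> \<le> e / (M + 1) * norm w"
    using C1c_uniform_derivative[OF \<rho>, of "e / (M + 1)"] e M by (auto simp: field_simps)
  have "norm (conv k \<rho> y - conv k \<rho> x - conv k (grad \<rho>) x \<bullet> (y - x)) \<le> e * norm (y - x)" if "norm (y - x) < d" for y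
  proof -
    define w where "w = y - x"
    have w: "norm w < d" and y: "y = x + w" using that by (auto simp: w_def)
    have int2: "integrable lborel (\<lambda>z. (k z *\<^sub>R grad \<rho> (x - z)) \<bullet> w)" by (rule integrable_inner_left) (rule intg)
    have "conv k (grad \<rho>) x \<bullet> w = (\<integral>z. (k z *\<^sub>R grad \<rho> (x - z)) \<bullet> w \<partial>lborel)"
      unfolding conv_def by (rule integral_inner_left[symmetric]) (use intg in simp)
    then have "conv k \<rho> y - conv k \<rho> x - conv k (grad \<rho>) x \<bullet> w
        = (\<integral>z. k z *\<^sub>R \<rho> (y - z) - k z *\<^sub>R \<rho> (x - z) - (k z *\<^sub>R grad \<rho> (x - z)) \<bullet> w \<partial>lborel)"
      unfolding conv_def using int int2 by simp
    also have "norm \<dots> \<le> (\<integral>z. \<bar>k z\<bar> * (e / (M + 1) * norm w) \<partial>lborel)"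
    proof (rule Bochner_Integration.integral_norm_bound_integral)
      show "integrable lborel (\<lambda>z. \<bar>k z\<bar> * (e / (M + 1) * norm w))" using k by (intro integrable_mult_left) simp
      fix z
      have "k z *\<^sub>R \<rho> (y - z) - k z *\<^sub>R \<rho> (x - z) - (k z *\<^sub>R grad \<rho> (x - z)) \<bullet> w
        = k z * (\<rho> ((x - z) + w) - \<rho> (x - z) - grad \<rho> (x - z) \<bullet> w)"
        by (simp add: y algebra_simps)
      also have "norm \<dots> \<le> \<bar>k z\<bar> * (e / (M + 1) * norm w)"
        unfolding real_norm_def abs_mult using d(2)[OF w] by (intro mult_left_mono) auto
      finally show "norm (k z *\<^sub>R \<rho> (y - z) - k z *\<^sub>R \<rho> (x - z) - (k z *\<^sub>R grad \<rho> (x - z)) \<bullet> w)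
          \<le> \<bar>k z\<bar> * (e / (M + 1) * norm w)" .
    qed (use int int2 in simp)
    also have "\<dots> = M * (e / (M + 1) * norm w)" by (simp only: M_def Bochner_Integration.integral_mult_left_zero)
    also have "\<dots> = (M * e / (M + 1)) * norm w" by simp
    also have "\<dots> \<le> e * norm w" using e M by (intro mult_right_mono) (auto simp: field_simps)
    finally show ?thesis by (simp add: w_def)
  qed
  then show "\<exists>d>0. \<forall>y. norm (y - x) < d \<longrightarrow> norm (conv k \<rho> y - conv k \<rho> x - conv k (grad \<rho>) x \<bullet> (y - x)) \<le> e * norm (y - x)"
    using d(1) by blast
qed

lemma conv_C1:
  assumes "integrable lborel k" "C1c \<rho>"
  shows "conv k \<rho> differentiable (at x)" "grad (conv k \<rho>) = conv k (grad \<rho>)" "continuous_on UNIV (grad (conv k \<rho>))"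
proof -
  show "conv k \<rho> differentiable (at x)" "grad (conv k \<rho>) = conv k (grad \<rho>)"
    using grad_unique[OF conv_has_derivative[OF assms]] by auto
  obtain R where R: "\<And>x. R < norm x \<Longrightarrow> \<rho> x = 0" using assms unfolding C1c_def by blast
  obtain B' where B': "\<And>x. norm (grad \<rho> x) \<le> B'" using C1c_bounded(2)[OF assms(2)] by auto
  show "continuous_on UNIV (grad (conv k \<rho>))"
    unfolding \<open>grad (conv k \<rho>) = conv k (grad \<rho>)\<close>
    by (rule conv_continuous[OF assms(1) C1c_grad_continuous[OF assms(2)] C1c_grad_support[OF R] B'])
qed

text \<open>Fubini's theorem with the majorant \<open>B * \<phi> x * k y\<close>. It moves the
  mollifier from \<open>k\<close> to the function that \<open>k\<close> is tested with.\<close>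

lemma conv_swap:
  fixes k \<phi> \<rho> :: "real^'n \<Rightarrow> real"
  assumes k: "integrable lborel k" and \<phi>: "integrable lborel \<phi>"
    and \<rho>: "\<rho> \<in> borel_measurable borel" "\<And>x. \<bar>\<rho> x\<bar> \<le> B"
  shows "(\<integral>x. \<phi> x * conv k \<rho> x \<partial>lborel) = (\<integral>y. k y * (\<integral>x. \<phi> x * \<rho> (x - y) \<partial>lborel) \<partial>lborel)"
    and "integrable lborel (\<lambda>x. \<phi> x * conv k \<rho> x)"
proof -
  have [measurable]: "k \<in> borel_measurable borel" "\<phi> \<in> borel_measurable borel" "\<rho> \<in> borel_measurable borel"
    using k \<phi> \<rho> by auto
  have int: "integrable (lborel \<Otimes>\<^sub>M lborel) (\<lambda>(x, y). \<phi> x * (k y * \<rho> (x - y)))"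
  proof (rule Bochner_Integration.integrable_bound)
    show "integrable (lborel \<Otimes>\<^sub>M lborel) (\<lambda>(x, y). (B * \<phi> x) * k y)"
      by (rule lborel_pair.Fubini_integrable) (use k \<phi> in \<open>auto simp: abs_mult\<close>)
    show "(\<lambda>(x, y). \<phi> x * (k y * \<rho> (x - y))) \<in> borel_measurable (lborel \<Otimes>\<^sub>M lborel)" by measurable
    show "AE p in lborel \<Otimes>\<^sub>M lborel. norm (case p of (x, y) \<Rightarrow> \<phi> x * (k y * \<rho> (x - y))) \<le> norm (case p of (x, y) \<Rightarrow> (B * \<phi> x) * k y)"
    proof (intro always_eventually allI)
      fix p :: "(real^'n) \<times> (real^'n)"
      obtain x y where p: "p = (x, y)" by (cases p)
      have "\<bar>\<phi> x * k y\<bar> * \<bar>\<rho> (x - y)\<bar> \<le> \<bar>\<phi> x * k y\<bar> * \<bar>B\<bar>" using \<rho>(2)[of "x - y"] by (intro mult_left_mono) auto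
      then show "norm (case p of (x, y) \<Rightarrow> \<phi> x * (k y * \<rho> (x - y))) \<le> norm (case p of (x, y) \<Rightarrow> (B * \<phi> x) * k y)"
        by (simp add: p abs_mult algebra_simps)
    qed
  qed
  have "(\<integral>x. \<phi> x * conv k \<rho> x \<partial>lborel) = (\<integral>x. \<integral>y. \<phi> x * (k y * \<rho> (x - y)) \<partial>lborel \<partial>lborel)"
    by (simp add: conv_def)
  also have "\<dots> = (\<integral>y. \<integral>x. \<phi> x * (k y * \<rho> (x - y)) \<partial>lborel \<partial>lborel)"
    by (rule lborel_pair.Fubini_integral[symmetric]) (use int in simp)
  also have "\<dots> = (\<integral>y. \<integral>x. k y * (\<phi> x * \<rho> (x - y)) \<partial>lborel \<partial>lborel)" by (simp add: mult.left_commute)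
  also have "\<dots> = (\<integral>y. k y * (\<integral>x. \<phi> x * \<rho> (x - y) \<partial>lborel) \<partial>lborel)" by simp
  finally show "(\<integral>x. \<phi> x * conv k \<rho> x \<partial>lborel) = (\<integral>y. k y * (\<integral>x. \<phi> x * \<rho> (x - y) \<partial>lborel) \<partial>lborel)" .
  show "integrable lborel (\<lambda>x. \<phi> x * conv k \<rho> x)"
    using lborel_pair.integrable_fst[OF int] by (simp add: conv_def)
qed

text \<open>Squaring the positive part yields a function of class C1, the regularity asked of test
  functions, with an explicit gradient.\<close>

definition bump :: "real^'n \<Rightarrow> real" where
  "bump x = (max 0 (1 - x \<bullet> x))\<^sup>2"

lemma has_real_derivative_max_sq: "((\<lambda>s::real. (max 0 s)\<^sup>2) has_real_derivative 2 * max 0 s) (at s)"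
proof -
  consider "s > 0" | "s < 0" | "s = 0" by linarith
  then show ?thesis
  proof cases
    case 1
    have "((\<lambda>s::real. s\<^sup>2) has_real_derivative 2 * max 0 s) (at s)"
      using 1 by (auto intro!: derivative_eq_intros)
    then show ?thesis
      by (rule has_field_derivative_transform_within_open[of _ _ _ "{0<..}"]) (use 1 in auto)
  next
    case 2
    have "((\<lambda>s::real. 0) has_real_derivative 2 * max 0 s) (at s)" using 2 by simp
    then show ?thesis
      by (rule has_field_derivative_transform_within_open[of _ _ _ "{..<0}"]) (use 2 in auto)
  next
    case 3
    have "((\<lambda>h::real. (max 0 h)\<^sup>2 / h) \<longlongrightarrow> 0) (at 0)"
    proof (rule Lim_null_comparison)
      show "\<forall>\<^sub>F h in at 0. norm ((max 0 h)\<^sup>2 / h) \<le> \<bar>h::real\<bar>"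
        by (intro always_eventually allI) (auto simp: max_def power2_eq_square)
      show "((\<lambda>h::real. \<bar>h\<bar>) \<longlongrightarrow> 0) (at 0)" by (auto intro!: tendsto_eq_intros)
    qed
    then show ?thesis using 3 by (simp add: has_field_derivative_iff)
  qed
qed

lemma bump_has_derivative: "(bump has_derivative (\<lambda>w. (- 4 * max 0 (1 - x \<bullet> x)) *\<^sub>R x \<bullet> w)) (at x)"
proof -
  have "((\<lambda>x. 1 - x \<bullet> x) has_derivative (\<lambda>w. - 2 * (x \<bullet> w))) (at x)"
    by (auto intro!: derivative_eq_intros simp: inner_commute)
  from has_derivative_compose[OF this has_real_derivative_max_sq[THEN has_field_derivative_imp_has_derivative]]
  show ?thesis unfolding bump_def[abs_def] by (simp add: mult_ac)
qed

lemma bump_zero: "norm x \<ge> 1 \<Longrightarrow> bump x = 0"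
proof -
  assume "norm x \<ge> 1"
  then have "x \<bullet> x \<ge> 1" by (simp add: dot_square_norm)
  then show ?thesis by (simp add: bump_def)
qed

lemma norm_ge_1_if_bump_zero: "bump x = 0 \<Longrightarrow> 1 \<le> norm x"
  using zero_less_power2[of "1 - x \<bullet> x"] by (auto simp: bump_def max_def norm_eq_sqrt_inner split: if_splits)

lemma bump_scaled_zero:
  assumes "\<delta> > 0" "\<delta> \<le> norm x"
  shows "bump ((1/\<delta>) *\<^sub>R x) = 0"
proof (rule bump_zero)
  have "norm ((1/\<delta>) *\<^sub>R x) = norm x / \<delta>" using assms by simp
  then show "1 \<le> norm ((1/\<delta>) *\<^sub>R x)" using assms by (metis pos_le_divide_eq mult_1)
qed

definition moll :: "real \<Rightarrow> real^'n \<Rightarrow> real" where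
  "moll \<delta> x = bump ((1/\<delta>) *\<^sub>R x) / (\<integral>y. bump ((1/\<delta>) *\<^sub>R (y::real^'n)) \<partial>lborel)"

lemma moll_C1c:
  assumes "\<delta> > 0"
  shows "C1c (moll \<delta> :: real^'n \<Rightarrow> real)"
proof -
  define m where "m = (\<integral>y. bump ((1/\<delta>) *\<^sub>R (y::real^'n)) \<partial>lborel)"
  have "((\<lambda>x. bump ((1/\<delta>) *\<^sub>R x)) has_derivative (\<lambda>w. (- 4 * max 0 (1 - ((1/\<delta>) *\<^sub>R x) \<bullet> ((1/\<delta>) *\<^sub>R x))) *\<^sub>R ((1/\<delta>) *\<^sub>R x) \<bullet> ((1/\<delta>) *\<^sub>R w))) (at x)"
    for x :: "real^'n"
    by (rule has_derivative_compose[OF _ bump_has_derivative]) (auto intro!: derivative_eq_intros)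
  from has_derivative_mult_right[OF this, of "1/m"]
  have D: "(moll \<delta> has_derivative (\<lambda>w. (((1/m) * (- 4 * max 0 (1 - ((1/\<delta>) *\<^sub>R x) \<bullet> ((1/\<delta>) *\<^sub>R x))) * (1/\<delta>) * (1/\<delta>)) *\<^sub>R x) \<bullet> w)) (at x)"
    for x :: "real^'n"
    unfolding moll_def[abs_def] m_def[symmetric] by (simp add: mult_ac)
  have gr: "grad (moll \<delta>) = (\<lambda>x::real^'n. (((1/m) * (- 4 * max 0 (1 - ((1/\<delta>) *\<^sub>R x) \<bullet> ((1/\<delta>) *\<^sub>R x))) * (1/\<delta>) * (1/\<delta>)) *\<^sub>R x))"
    using grad_unique[OF D] by (simp add: fun_eq_iff)
  have "continuous_on UNIV (grad (moll \<delta> :: real^'n \<Rightarrow> real))" unfolding gr by (intro continuous_intros)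
  moreover have "moll \<delta> x = 0" if "\<delta> < norm x" for x :: "real^'n"
    using that assms bump_scaled_zero[of \<delta> x] by (simp add: moll_def)
  ultimately show ?thesis using grad_unique(2)[OF D] unfolding C1c_def by blast
qed

lemma moll_props:
  assumes "\<delta> > 0"
  shows "0 \<le> moll \<delta> (x::real^'n)" "\<delta> \<le> norm x \<Longrightarrow> moll \<delta> x = 0" "moll \<delta> (- x) = moll \<delta> x"
    "integrable lborel (moll \<delta> :: real^'n \<Rightarrow> real)" "(\<integral>x. moll \<delta> (x::real^'n) \<partial>lborel) = 1"
proof -
  have nn: "0 \<le> (\<integral>y. bump ((1/\<delta>) *\<^sub>R (y::real^'n)) \<partial>lborel)"
    by (rule Bochner_Integration.integral_nonneg) (simp add: bump_def)
  then show "0 \<le> moll \<delta> x" by (simp add: moll_def bump_def)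
  show "\<delta> \<le> norm x \<Longrightarrow> moll \<delta> x = 0"
    using assms bump_scaled_zero[of \<delta> x] by (simp add: moll_def)
  show "moll \<delta> (- x) = moll \<delta> x" by (simp add: moll_def bump_def)
  have c: "continuous_on UNIV (\<lambda>y::real^'n. bump ((1/\<delta>) *\<^sub>R y))"
    unfolding bump_def by (intro continuous_intros)
  have int: "integrable lborel (\<lambda>y::real^'n. bump ((1/\<delta>) *\<^sub>R y))"
  proof (rule integrable_compact_support[OF c])
    show "bump ((1/\<delta>) *\<^sub>R y) = 0" if "\<delta> < norm y" for y :: "real^'n"
      using bump_scaled_zero[OF assms, of y] that by simp
  qed
  then show "integrable lborel (moll \<delta> :: real^'n \<Rightarrow> real)" unfolding moll_def[abs_def] by simp
  have "(\<integral>y. bump ((1/\<delta>) *\<^sub>R (y::real^'n)) \<partial>lborel) \<noteq> 0"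
  proof
    assume "(\<integral>y. bump ((1/\<delta>) *\<^sub>R (y::real^'n)) \<partial>lborel) = 0"
    then have ae: "AE y in lborel. bump ((1/\<delta>) *\<^sub>R (y::real^'n)) = 0"
      using integral_nonneg_eq_0_iff_AE[OF int] by (simp add: bump_def)
    have "y \<notin> ball (0::real^'n) \<delta>" if "bump ((1/\<delta>) *\<^sub>R y) = 0" for y :: "real^'n"
    proof -
      have "1 \<le> norm ((1/\<delta>) *\<^sub>R y)" using that by (rule norm_ge_1_if_bump_zero)
      moreover have "norm ((1/\<delta>) *\<^sub>R y) = norm y / \<delta>" using assms by simp
      ultimately have "\<delta> \<le> norm y" using assms by (simp only: pos_le_divide_eq)
      then show ?thesis by simp
    qed
    then have "AE y in lborel. y \<notin> ball (0::real^'n) \<delta>" using ae by (auto elim: eventually_mono)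
    then show False using open_not_AE_empty[of "ball (0::real^'n) \<delta>"] assms by simp
  qed
  then show "(\<integral>x. moll \<delta> (x::real^'n) \<partial>lborel) = 1" unfolding moll_def by simp
qed

text \<open>The points whose ray in direction \<open>-u\<close> hits the facet; the direction must not be tangential.\<close>

definition hit_set :: "real^'n \<Rightarrow> (real^'n) set \<Rightarrow> (real^'n) set" where
  "hit_set u e = {x. (facet_normal e \<bullet> x - facet_offset e) / (facet_normal e \<bullet> u) \<ge> 0 \<and>
     x - ((facet_normal e \<bullet> x - facet_offset e) / (facet_normal e \<bullet> u)) *\<^sub>R u \<in> e}"

context flat_piece begin

lemma borel_hit_set [measurable]: "hit_set u e \<in> sets borel"
  unfolding hit_set_def by measurable

text \<open>The shear with respect to the plane of the facet and the direction \<open>u\<close>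
  sends a slab point and a ray parameter to the point reached on the ray and the height in the slab.
  The heights fill a unit interval and integrate to 1; the points reached fill the hit set.\<close>

lemma facet_integral_along_rays:
  fixes u :: "real^'n" and k :: "real^'n \<Rightarrow> real"
  assumes mu_u: "facet_normal e \<bullet> u \<noteq> 0" and k: "integrable lborel k"
  shows "(LINT y:facet_slab e|lborel. (\<integral>s. indicator {0..} s * k (facet_proj e y + s *\<^sub>R u) \<partial>lborel))
       = (1 / \<bar>facet_normal e \<bullet> u\<bar>) * (\<integral>x. indicator (hit_set u e) x * k x \<partial>lborel)"
proof -
  let ?\<mu> = "facet_normal e" and ?c = "facet_offset e"
  let ?\<Theta> = "\<lambda>(y, s). (y - (?\<mu> \<bullet> y - ?c) *\<^sub>R ?\<mu> + s *\<^sub>R u, ?\<mu> \<bullet> y - ?c)"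
  let ?M = "(lborel :: (real^'n) measure) \<Otimes>\<^sub>M (lborel :: real measure)"
  \<comment> \<open>The second factor restricts the height to the thickness of the slab.\<close>
  define F where "F = (\<lambda>(x, \<tau>::real). (indicator (hit_set u e) x * k x) * indicator {0..1} \<tau>)"
  have [measurable]: "k \<in> borel_measurable borel" using k by auto
  have Fint: "integrable ?M F" unfolding F_def
  proof (rule lborel_pair.Fubini_integrable)
    have "integrable lborel (\<lambda>x. indicator (hit_set u e) x * k x)"
      using integrable_mult_indicator[OF _ k, of "hit_set u e"] by simp
    then have "integrable lborel (\<lambda>x. norm (indicator (hit_set u e) x * k x))" by (rule integrable_norm)
    then show "integrable lborel (\<lambda>x. \<integral>\<tau>. norm ((\<lambda>(x, \<tau>). (indicator (hit_set u e) x * k x) * indicator {0..1} \<tau>) (x, \<tau>)) \<partial>lborel)"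
      by (simp add: abs_mult)
    show "AE x in lborel. integrable lborel (\<lambda>\<tau>. (\<lambda>(x, \<tau>). (indicator (hit_set u e) x * k x) * indicator {0..1::real} \<tau>) (x, \<tau>))"
      by simp
  qed measurable
  have Fb [measurable]: "F \<in> borel_measurable borel" using Fint by (simp add: lborel_prod borel_measurable_integrable)
  have Tm: "?\<Theta> \<in> measurable ?M borel" by measurable
  have dens: "distr ?M borel ?\<Theta> = density lborel (\<lambda>_. ennreal (1 / \<bar>?\<mu> \<bullet> u\<bar>))"
    by (rule distr_shear[OF facet_normal_props(1) mu_u])
  have Fint': "integrable (distr ?M borel ?\<Theta>) F"
    unfolding dens using Fint by (subst integrable_density) (auto simp: lborel_prod)
  then have FT: "integrable ?M (\<lambda>p. F (?\<Theta> p))" by (rule integrable_distr[OF Tm])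
  have "(\<integral>p. F (?\<Theta> p) \<partial>?M) = integral\<^sup>L (distr ?M borel ?\<Theta>) F"
    by (rule integral_distr[OF Tm Fb, symmetric])
  also have "\<dots> = (1 / \<bar>?\<mu> \<bullet> u\<bar>) * integral\<^sup>L ?M F"
    unfolding dens by (subst integral_density) (auto simp: lborel_prod)
  also have "integral\<^sup>L ?M F = (\<integral>x. \<integral>\<tau>. F (x, \<tau>) \<partial>lborel \<partial>lborel)"
    by (rule lborel_pair.integral_fst'[symmetric, OF Fint])
  also have "\<dots> = (\<integral>x. indicator (hit_set u e) x * k x \<partial>lborel)" by (simp add: F_def)
  also have "(\<integral>p. F (?\<Theta> p) \<partial>?M) = (\<integral>y. \<integral>s. F (?\<Theta> (y, s)) \<partial>lborel \<partial>lborel)"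
    by (rule lborel_pair.integral_fst'[symmetric, OF FT])
  also have "\<dots> = (LINT y:facet_slab e|lborel. (\<integral>s. indicator {0..} s * k (facet_proj e y + s *\<^sub>R u) \<partial>lborel))"
    unfolding set_lebesgue_integral_def
  proof (intro Bochner_Integration.integral_cong refl, goal_cases)
    case (1 y)
    have hit: "facet_proj e y + s *\<^sub>R u \<in> hit_set u e \<longleftrightarrow> s \<ge> 0 \<and> facet_proj e y \<in> e" for s
    proof -
      have "(?\<mu> \<bullet> (facet_proj e y + s *\<^sub>R u) - ?c) / (?\<mu> \<bullet> u) = s"
        using mu_u facet_proj_plane by (simp add: inner_add_right)
      then show ?thesis by (simp add: hit_set_def)
    qed
    have "F (?\<Theta> (y, s)) = indicator (facet_slab e) y * (indicator {0..} s * k (facet_proj e y + s *\<^sub>R u))" for s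
      using hit[of s] by (auto simp: F_def facet_proj_def[symmetric] facet_slab_def indicator_def)
    then show ?case by simp
  qed
  finally show ?thesis .
qed

text \<open>By the fundamental theorem of calculus, integrating \<open>grad f \<bullet> u\<close>
  along the ray from a facet point \<open>p\<close> in direction \<open>u\<close> gives
  \<open>- f p\<close>, because \<open>f\<close> vanishes far out. The rays sweep out the hit
  set.\<close>

lemma facet_integral_C1c:
  assumes mu_u: "facet_normal e \<bullet> u \<noteq> 0" and f: "C1c f"
  shows "\<bar>facet_normal e \<bullet> u\<bar> * facet_integral e f = - (\<integral>x. indicator (hit_set u e) x * (grad f x \<bullet> u) \<partial>lborel)"
proof -
  obtain R where R: "\<And>x. R < norm x \<Longrightarrow> f x = 0" using f unfolding C1c_def by blast
  have R': "\<And>x. R < norm x \<Longrightarrow> grad f x = 0" using C1c_grad_support[of R f] R by blast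
  have u0: "u \<noteq> 0" using mu_u by auto
  have ck: "continuous_on UNIV (\<lambda>x. grad f x \<bullet> u)"
    by (intro continuous_intros C1c_grad_continuous[OF f])
  have k: "integrable lborel (\<lambda>x. grad f x \<bullet> u)"
    by (rule integrable_compact_support[OF ck, of R]) (simp add: R')
  have ray: "(\<integral>s. indicator {0..} s * (grad f (p + s *\<^sub>R u) \<bullet> u) \<partial>lborel) = - f p" for p
  proof -
    \<comment> \<open>At this parameter every ray from \<open>p\<close> has left the ball of radius
      \<open>R\<close>.\<close>
    define S where "S = (\<bar>R\<bar> + norm p + 1) / norm u"
    have S0: "S \<ge> 0" by (simp add: S_def)
    have far: "R < norm (p + s *\<^sub>R u)" if "s \<ge> S" for s
    proof -
      have "s * norm u \<ge> \<bar>R\<bar> + norm p + 1" using that u0 by (simp add: S_def field_simps)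
      moreover have "norm (s *\<^sub>R u) = s * norm u" using that S0 by simp
      moreover have "norm (s *\<^sub>R u) \<le> norm (p + s *\<^sub>R u) + norm p"
        by (metis add.commute norm_add_leD norm_minus_commute add_diff_cancel_left' norm_triangle_sub)
      ultimately show ?thesis by linarith
    qed
    have "(\<integral>s. indicator {0..} s * (grad f (p + s *\<^sub>R u) \<bullet> u) \<partial>lborel) = (\<integral>s. (grad f (p + s *\<^sub>R u) \<bullet> u) * indicator {0..S} s \<partial>lborel)"
    proof (intro Bochner_Integration.integral_cong refl)
      fix s :: real
      show "indicator {0..} s * (grad f (p + s *\<^sub>R u) \<bullet> u) = (grad f (p + s *\<^sub>R u) \<bullet> u) * indicator {0..S} s"
        using R'[OF far[of s]] by (cases "s \<ge> S") (auto simp: indicator_def)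
    qed
    also have "\<dots> = f (p + S *\<^sub>R u) - f (p + 0 *\<^sub>R u)"
    proof (rule integral_FTC_Icc_real)
      fix s :: real
      have "((\<lambda>s. p + s *\<^sub>R u) has_derivative (\<lambda>h. h *\<^sub>R u)) (at s)" by (auto intro!: derivative_eq_intros)
      from has_derivative_compose[OF this test_function_has_derivative]
      have "((\<lambda>s. f (p + s *\<^sub>R u)) has_derivative (\<lambda>h. grad f (p + s *\<^sub>R u) \<bullet> (h *\<^sub>R u))) (at s)"
        using f by (simp add: C1c_def)
      then show "((\<lambda>s. f (p + s *\<^sub>R u)) has_real_derivative (grad f (p + s *\<^sub>R u) \<bullet> u)) (at s)"
        by (simp add: has_field_derivative_def mult_commute_abs)
      have "continuous_on UNIV (\<lambda>s. grad f (p + s *\<^sub>R u) \<bullet> u)"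
        by (intro continuous_intros continuous_on_compose2[OF C1c_grad_continuous[OF f]]) auto
      then show "isCont (\<lambda>s. grad f (p + s *\<^sub>R u) \<bullet> u) s" by (simp add: continuous_on_eq_continuous_at)
    qed (use S0 in auto)
    also have "\<dots> = - f p" using R[OF far[of S]] by simp
    finally show ?thesis .
  qed
  have cb: "cont_bdd e f"
    unfolding cont_bdd_def bounded_iff
    using continuous_on_subset[OF C1c_continuous[OF f] subset_UNIV] C1c_bounded(1)[OF f] by auto
  have "(LINT y:facet_slab e|lborel. - f (facet_proj e y)) = (1 / \<bar>facet_normal e \<bullet> u\<bar>) * (\<integral>x. indicator (hit_set u e) x * (grad f x \<bullet> u) \<partial>lborel)"
    using facet_integral_along_rays[OF mu_u k] ray by simp
  then have "- facet_integral e f = (1 / \<bar>facet_normal e \<bullet> u\<bar>) * (\<integral>x. indicator (hit_set u e) x * (grad f x \<bullet> u) \<partial>lborel)"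
    using cont_bdd_integral[OF cb] cont_bdd_integrable[OF cb] by (simp add: set_lebesgue_integral_def)
  then show ?thesis using mu_u by (simp add: field_simps)
qed

end

section \<open>The divergence theorem on polytopes\<close>

text \<open>The outward normal is constant along a facet, so any of its points may be used.\<close>

definition normal_on :: "(real^'n) set \<Rightarrow> (real^'n) set \<Rightarrow> real^'n" where
  "normal_on U e = outward_normal U (SOME x. x \<in> e)"

context polytopal begin

lemma facet_props:
  assumes "e \<in> facets U"
  shows "\<exists>b. flat_piece e (normal_on U e) b" "\<And>x. x \<in> e \<Longrightarrow> is_outward_normal U x (normal_on U e)"
    "\<And>x. x \<in> e \<Longrightarrow> outward_normal U x = normal_on U e" "e \<subseteq> flat_boundary U" "e \<subseteq> frontier U" "e \<noteq> {}"
proof -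
  obtain \<nu> b where *: "norm \<nu> = 1" "\<And>x. x \<in> e \<Longrightarrow> is_outward_normal U x \<nu>" "\<And>x. x \<in> e \<Longrightarrow> \<nu> \<bullet> x = b"
    "\<And>x. x \<in> e \<Longrightarrow> \<exists>r>0. \<forall>y\<in>ball x r. \<nu> \<bullet> y = b \<longrightarrow> y \<in> e" "e \<noteq> {}"
    using facet_structure[OF assms] by blast
  have "(SOME x. x \<in> e) \<in> e" using *(5) by (simp add: some_in_eq)
  then have n: "normal_on U e = \<nu>" unfolding normal_on_def by (intro outward_normal_eq *(2))
  show "e \<subseteq> flat_boundary U" using assms unfolding facets_def by (rule in_components_subset)
  then show fr: "e \<subseteq> frontier U" by (auto simp: flat_boundary_def)
  then have "bounded e"
    using bounded_subset[OF bounded_closure[OF bounded_U]] by (auto simp: frontier_def)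
  then have "flat_piece e \<nu> b" using * by unfold_locales auto
  then show "\<exists>b. flat_piece e (normal_on U e) b" using n by blast
  show "\<And>x. x \<in> e \<Longrightarrow> is_outward_normal U x (normal_on U e)" using *(2) n by simp
  then show "\<And>x. x \<in> e \<Longrightarrow> outward_normal U x = normal_on U e" by (rule outward_normal_eq)
  show "e \<noteq> {}" by fact
qed

lemma AE_hyperplane: "a \<noteq> 0 \<Longrightarrow> AE x in lborel. a \<bullet> (x::real^'n) \<noteq> b"
proof -
  assume "a \<noteq> 0"
  then have "negligible {x. a \<bullet> x = b}" by (intro negligible_hyperplane) simp
  then have "{x. a \<bullet> x = b} \<in> null_sets lebesgue" by (simp add: negligible_iff_null_sets)
  then have "AE x in lebesgue. x \<notin> {x. a \<bullet> x = b}" by (rule AE_not_in)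
  then show ?thesis by (simp add: AE_completion_iff)
qed

text \<open>Almost every line in direction \<open>u\<close> is generic, so the indicator at
  \<open>x\<close> is the sum of the crossings met before \<open>x\<close>. A line meets a
  non-tangential facet at most once, hence crossings can be counted by facets, and the facets
  crossed before \<open>x\<close> are those with \<open>x\<close> in their hit set.\<close>

lemma AE_indicator_jumps:
  fixes u :: "real^'n"
  assumes u: "u \<noteq> 0"
  shows "AE x in lborel. indicator U x = - (\<Sum>e\<in>{e\<in>facets U. normal_on U e \<bullet> u \<noteq> 0}. sgn (normal_on U e \<bullet> u) * indicator (hit_set u e) x)"
proof -
  obtain H where H: "arranged H U" using arrangement by blast
  then have finH: "finite H" and nz: "\<And>h. h \<in> H \<Longrightarrow> fst h \<noteq> 0" by (auto simp: arranged_def)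
  have off: "AE x in lborel. \<forall>h\<in>H. fst h \<bullet> x \<noteq> snd h"
    by (rule AE_finite_allI[OF finH]) (use nz AE_hyperplane in blast)
  \<comment> \<open>Two hyperplanes are met at the same parameter only if \<open>x\<close> satisfies
    a linear equation with normal \<open>?n h - ?n h'\<close>; when this vector is nonzero the
    equation defines a null set.\<close>
  let ?n = "\<lambda>h. (1 / (fst h \<bullet> u)) *\<^sub>R fst h"
  have dbl: "AE x in lborel. \<forall>h\<in>H. \<forall>h'\<in>H. fst h \<bullet> u \<noteq> 0 \<longrightarrow> fst h' \<bullet> u \<noteq> 0 \<longrightarrow> ?n h \<noteq> ?n h' \<longrightarrow>
        (snd h - fst h \<bullet> x) / (fst h \<bullet> u) \<noteq> (snd h' - fst h' \<bullet> x) / (fst h' \<bullet> u)"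
  proof (intro AE_finite_allI[OF finH])
    fix h h' assume "h \<in> H" "h' \<in> H"
    show "AE x in lborel. fst h \<bullet> u \<noteq> 0 \<longrightarrow> fst h' \<bullet> u \<noteq> 0 \<longrightarrow> ?n h \<noteq> ?n h' \<longrightarrow>
        (snd h - fst h \<bullet> x) / (fst h \<bullet> u) \<noteq> (snd h' - fst h' \<bullet> x) / (fst h' \<bullet> u)"
    proof (cases "?n h = ?n h'")
      case False
      then have "AE x in lborel. (?n h - ?n h') \<bullet> x \<noteq> snd h / (fst h \<bullet> u) - snd h' / (fst h' \<bullet> u)"
        by (intro AE_hyperplane) simp
      then show ?thesis by eventually_elim (simp add: inner_diff_left diff_divide_distrib)
    qed simp
  qed
  show ?thesis using off dbl
  proof eventually_elim
    fix x assume x: "\<forall>h\<in>H. fst h \<bullet> x \<noteq> snd h" "\<forall>h\<in>H. \<forall>h'\<in>H. fst h \<bullet> u \<noteq> 0 \<longrightarrow> fst h' \<bullet> u \<noteq> 0 \<longrightarrow> ?n h \<noteq> ?n h' \<longrightarrow>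
        (snd h - fst h \<bullet> x) / (fst h \<bullet> u) \<noteq> (snd h' - fst h' \<bullet> x) / (fst h' \<bullet> u)"
    note jumps = good_line_jumps[OF H u, of x]
    have fin: "finite {t. x + t *\<^sub>R u \<in> flat_boundary U}"
      and tr: "\<And>t. x + t *\<^sub>R u \<in> flat_boundary U \<Longrightarrow> outward_normal U (x + t *\<^sub>R u) \<bullet> u \<noteq> 0"
      and xf: "x \<notin> flat_boundary U"
      and ind: "indicator U x = - (\<Sum>t | x + t *\<^sub>R u \<in> flat_boundary U \<and> t < 0. sgn (outward_normal U (x + t *\<^sub>R u) \<bullet> u))"
      by (rule jumps; use x in blast)+
    let ?E = "{e\<in>facets U. normal_on U e \<bullet> u \<noteq> 0}"
    let ?t = "\<lambda>e. (facet_normal e \<bullet> x - facet_offset e) / (facet_normal e \<bullet> u)"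
    let ?C = "\<lambda>t. connected_component_set (flat_boundary U) (x + t *\<^sub>R u)"
    have comp: "e = ?C t" if "e \<in> facets U" "x + t *\<^sub>R u \<in> e" for e t
      using that unfolding facets_def by (metis components_iff connected_component_eq)
    have tval: "?t e = - t" if e: "e \<in> facets U" "x + t *\<^sub>R u \<in> e" for e t
    proof -
      obtain b where fp: "flat_piece e (normal_on U e) b" using facet_props(1)[OF e(1)] by blast
      interpret flat_piece e "normal_on U e" b by fact
      have "outward_normal U (x + t *\<^sub>R u) = normal_on U e" using facet_props(3)[OF e] .
      moreover have "x + t *\<^sub>R u \<in> flat_boundary U" using facet_props(4)[OF e(1)] e(2) by blast
      ultimately have "normal_on U e \<bullet> u \<noteq> 0" using tr by metis
      then have "facet_normal e \<bullet> u \<noteq> 0" using facet_normal_eq by auto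
      moreover have "facet_normal e \<bullet> x + t * (facet_normal e \<bullet> u) = facet_offset e"
        using facet_offset[OF e(2)] by (simp add: inner_add_right)
      ultimately show ?thesis by (simp add: field_simps)
    qed
    have "(\<Sum>t | x + t *\<^sub>R u \<in> flat_boundary U \<and> t < 0. sgn (outward_normal U (x + t *\<^sub>R u) \<bullet> u))
       = (\<Sum>e\<in>{e\<in>?E. x \<in> hit_set u e}. sgn (normal_on U e \<bullet> u))"
    \<comment> \<open>A crossing parameter is sent to the component containing the crossing point; a
      facet is sent to the parameter at which the line meets its plane.\<close>
    proof (rule sum.reindex_bij_witness[where i="\<lambda>e. - ?t e" and j="?C"])
      fix t assume "t \<in> {t. x + t *\<^sub>R u \<in> flat_boundary U \<and> t < 0}"
      then have t: "x + t *\<^sub>R u \<in> flat_boundary U" "t < 0" by auto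
      then have e: "?C t \<in> facets U" "x + t *\<^sub>R u \<in> ?C t"
        by (auto simp: facets_def components_def)
      show "- ?t (?C t) = t" using tval[OF e] by simp
      have n: "outward_normal U (x + t *\<^sub>R u) = normal_on U (?C t)" using facet_props(3)[OF e] .
      then show "sgn (normal_on U (?C t) \<bullet> u) = sgn (outward_normal U (x + t *\<^sub>R u) \<bullet> u)" by simp
      have "x \<in> hit_set u (?C t)" using tval[OF e] e(2) t(2) by (simp add: hit_set_def)
      then show "?C t \<in> {e\<in>?E. x \<in> hit_set u e}" using e(1) tr[OF t(1)] n by simp
    next
      fix e assume "e \<in> {e\<in>?E. x \<in> hit_set u e}"
      then have e: "e \<in> facets U" "?t e \<ge> 0" "x + (- ?t e) *\<^sub>R u \<in> e" by (auto simp: hit_set_def)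
      then show "?C (- ?t e) = e" using comp by metis
      have fl: "x + (- ?t e) *\<^sub>R u \<in> flat_boundary U" using e facet_props(4) by blast
      then have "?t e \<noteq> 0" using xf by auto
      then have "0 < ?t e" using e(2) by (metis order_le_less)
      then show "- ?t e \<in> {t. x + t *\<^sub>R u \<in> flat_boundary U \<and> t < 0}"
        using fl by (simp only: mem_Collect_eq neg_less_0_iff_less)
    qed
    also have "\<dots> = (\<Sum>e\<in>?E. sgn (normal_on U e \<bullet> u) * indicator (hit_set u e) x)"
      by (rule sum.mono_neutral_cong_left) (use finite_facets in \<open>auto simp: indicator_def\<close>)
    finally show "indicator U x = - (\<Sum>e\<in>?E. sgn (normal_on U e \<bullet> u) * indicator (hit_set u e) x)"
      using ind by simp
  qed
qed

text \<open>The indicator of \<open>U\<close> is replaced by the signed sum of hit sets. The sign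
  \<open>sgn (n \<bullet> u)\<close> of a crossing and the factor
  \<open>\<bar>n \<bullet> u\<bar>\<close> from the ray integral multiply to
  \<open>n \<bullet> u\<close>; tangential facets have this factor 0 and are absent from the
  crossings.\<close>

theorem divergence_theorem:
  assumes f: "C1c f"
  shows "(\<integral>x. indicator U x * (grad f x \<bullet> u) \<partial>lborel) = (\<Sum>e\<in>facets U. (normal_on U e \<bullet> u) * facet_integral e f)"
proof (cases "u = 0")
  case False
  let ?E = "{e\<in>facets U. normal_on U e \<bullet> u \<noteq> 0}"
  obtain R where R: "\<And>x. R < norm x \<Longrightarrow> f x = 0" using f unfolding C1c_def by blast
  have k: "integrable lborel (\<lambda>x. grad f x \<bullet> u)"
  proof -
    have ck: "continuous_on UNIV (\<lambda>x. grad f x \<bullet> u)" by (intro continuous_intros C1c_grad_continuous[OF f])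
    show ?thesis
      by (rule integrable_compact_support[OF ck, of R]) (use C1c_grad_support[of R f] R in simp)
  qed
  have [measurable]: "(\<lambda>x. grad f x \<bullet> u) \<in> borel_measurable borel" using k by auto
  have [measurable]: "U \<in> sets borel" using open_U by simp
  have hb: "hit_set u e \<in> sets borel" if "e \<in> facets U" for e
    using facet_props(1)[OF that] flat_piece.borel_hit_set by blast
  have hk: "integrable lborel (\<lambda>x. indicator (hit_set u e) x * (grad f x \<bullet> u))" if "e \<in> facets U" for e
    using integrable_mult_indicator[OF _ k, of "hit_set u e"] hb[OF that] by simp
  have "(\<integral>x. indicator U x * (grad f x \<bullet> u) \<partial>lborel)
    = (\<integral>x. - (\<Sum>e\<in>?E. sgn (normal_on U e \<bullet> u) * (indicator (hit_set u e) x * (grad f x \<bullet> u))) \<partial>lborel)"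
  proof (rule integral_cong_AE)
    show "(\<lambda>x. - (\<Sum>e\<in>?E. sgn (normal_on U e \<bullet> u) * (indicator (hit_set u e) x * (grad f x \<bullet> u)))) \<in> borel_measurable lborel"
      using hk by (intro borel_measurable_uminus borel_measurable_sum borel_measurable_times borel_measurable_const borel_measurable_integrable) auto
    show "AE x in lborel. indicator U x * (grad f x \<bullet> u) = - (\<Sum>e\<in>?E. sgn (normal_on U e \<bullet> u) * (indicator (hit_set u e) x * (grad f x \<bullet> u)))"
      using AE_indicator_jumps[OF False] by eventually_elim (simp add: sum_distrib_right mult.assoc)
  qed measurable
  also have "\<dots> = - (\<Sum>e\<in>?E. sgn (normal_on U e \<bullet> u) * (\<integral>x. indicator (hit_set u e) x * (grad f x \<bullet> u) \<partial>lborel))"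
    using hk by simp
  also have "\<dots> = (\<Sum>e\<in>?E. (normal_on U e \<bullet> u) * facet_integral e f)"
    unfolding sum_negf[symmetric]
  proof (rule sum.cong[OF refl])
    fix e assume e: "e \<in> ?E"
    then obtain b where fp: "flat_piece e (normal_on U e) b" using facet_props(1) by blast
    interpret flat_piece e "normal_on U e" b by fact
    have a: "\<bar>facet_normal e \<bullet> u\<bar> = \<bar>normal_on U e \<bullet> u\<bar>" using facet_normal_eq by auto
    then have "facet_normal e \<bullet> u \<noteq> 0" using e by auto
    from facet_integral_C1c[OF this f] a
    have "\<bar>normal_on U e \<bullet> u\<bar> * facet_integral e f = - (\<integral>x. indicator (hit_set u e) x * (grad f x \<bullet> u) \<partial>lborel)" by simp
    then have "- (sgn (normal_on U e \<bullet> u) * (\<integral>x. indicator (hit_set u e) x * (grad f x \<bullet> u) \<partial>lborel))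
      = (sgn (normal_on U e \<bullet> u) * \<bar>normal_on U e \<bullet> u\<bar>) * facet_integral e f" by (simp add: mult.assoc)
    then show "- (sgn (normal_on U e \<bullet> u) * (\<integral>x. indicator (hit_set u e) x * (grad f x \<bullet> u) \<partial>lborel))
      = (normal_on U e \<bullet> u) * facet_integral e f" by (simp add: sgn_mult_abs)
  qed
  also have "\<dots> = (\<Sum>e\<in>facets U. (normal_on U e \<bullet> u) * facet_integral e f)"
    by (rule sum.mono_neutral_left) (use finite_facets in auto)
  finally show ?thesis .
qed simp

end

section \<open>Substitutions, interior cut-offs and Borel representatives\<close>

lemma lborel_integral_affine:
  fixes h :: "real^'n \<Rightarrow> real"
  assumes [measurable]: "h \<in> borel_measurable borel" and c: "c \<noteq> 0"
  shows "(\<integral>z. h z \<partial>lborel) = \<bar>c\<bar> ^ CARD('n) * (\<integral>z. h (t + c *\<^sub>R z) \<partial>lborel)"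
proof -
  have "(\<integral>z. h z \<partial>lborel) = (\<integral>z. h z \<partial>density (distr lborel borel (\<lambda>x. t + c *\<^sub>R x)) (\<lambda>_. ennreal (\<bar>c\<bar>^CARD('n))))"
    by (subst lborel_affine[OF c, of t]) simp
  also have "\<dots> = \<bar>c\<bar> ^ CARD('n) * (\<integral>z. h z \<partial>distr lborel borel (\<lambda>x. t + c *\<^sub>R x))"
    by (subst integral_density) auto
  also have "(\<integral>z. h z \<partial>distr lborel borel (\<lambda>x. t + c *\<^sub>R x)) = (\<integral>z. h (t + c *\<^sub>R z) \<partial>lborel)"
    by (subst integral_distr) auto
  finally show ?thesis .
qed

lemma lborel_integral_reflect:
  fixes h :: "real^'n \<Rightarrow> real"
  assumes "h \<in> borel_measurable borel"
  shows "(\<integral>z. h (t - z) \<partial>lborel) = (\<integral>z. h z \<partial>lborel)"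
  using lborel_integral_affine[OF assms, of "-1" t] by simp

text \<open>The function rises from 0 at distance 1/m from the complement to 1 at distance 2/m.
  Keeping the distance 1/m makes the support compact in \<open>U\<close>, and every point of
  \<open>U\<close> is reached for large \<open>m\<close>.\<close>

lemma continuous_cutoff:
  fixes U :: "(real^'n) set"
  assumes U: "open U" "bounded U"
  defines "\<psi> \<equiv> \<lambda>m x. min 1 (max 0 (real m * infdist x (- U) - 1))"
  shows "continuous_on UNIV (\<psi> m)" "compact {x. 1 \<le> real m * infdist x (- U)}" "{x. 1 \<le> real m * infdist x (- U)} \<subseteq> U"
    "\<not> 1 \<le> real m * infdist x (- U) \<Longrightarrow> \<psi> m x = 0" "0 \<le> \<psi> m x" "\<psi> m x \<le> 1" "x \<in> U \<Longrightarrow> \<exists>m. \<psi> m x > 0"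
proof -
  show "continuous_on UNIV (\<psi> m)" unfolding \<psi>_def by (intro continuous_intros)
  show sub: "{x. 1 \<le> real m * infdist x (- U)} \<subseteq> U"
  proof
    fix x assume "x \<in> {x. 1 \<le> real m * infdist x (- U)}"
    then have "infdist x (- U) \<noteq> 0" by auto
    then show "x \<in> U" by (metis ComplI infdist_zero)
  qed
  have "closed {x. 1 \<le> real m * infdist x (- U)}"
    by (intro closed_Collect_le continuous_intros)
  then show "compact {x. 1 \<le> real m * infdist x (- U)}"
    using bounded_subset[OF U(2) sub] by (simp add: compact_eq_bounded_closed)
  show "\<not> 1 \<le> real m * infdist x (- U) \<Longrightarrow> \<psi> m x = 0" "0 \<le> \<psi> m x" "\<psi> m x \<le> 1"
    by (auto simp: \<psi>_def)
  show "\<exists>m. \<psi> m x > 0" if x: "x \<in> U"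
  proof -
    have "- U \<noteq> {}" using U(2) not_bounded_UNIV by (metis Compl_empty_eq double_complement)
    then have d: "infdist x (- U) > 0"
      using x U(1) by (metis ComplD closed_Compl in_closed_iff_infdist_zero infdist_nonneg order_le_less)
    obtain m where m: "real m > 2 / infdist x (- U)" using reals_Archimedean2 by blast
    then have "real m * infdist x (- U) > 2" using d by (simp add: field_simps)
    then show ?thesis by (intro exI[of _ m]) (simp add: \<psi>_def)
  qed
qed

text \<open>The fundamental lemma of the calculus of variations. The ideal test function
  \<open>sgn h\<close> is an almost everywhere limit of continuous functions; clipped and cut off
  they become admissible, and dominated convergence shows that
  \<open>\<psi> m * \<bar>h\<bar>\<close> has integral 0.\<close>

lemma AE_zero_if_orthogonal:
  fixes h :: "real^'n \<Rightarrow> real"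
  assumes U: "open U" "bounded U" and h: "integrable lborel h" "\<And>x. x \<notin> U \<Longrightarrow> h x = 0"
    and orth: "\<And>\<phi> C. continuous_on UNIV \<phi> \<Longrightarrow> compact C \<Longrightarrow> C \<subseteq> U \<Longrightarrow> (\<And>x. x \<notin> C \<Longrightarrow> \<phi> x = 0) \<Longrightarrow>
        (\<integral>x. h x * \<phi> x \<partial>lborel) = 0"
  shows "AE x in lborel. h x = 0"
proof -
  have hb [measurable]: "h \<in> borel_measurable borel" using h(1) by auto
  have "(\<lambda>x. sgn (h x)) \<in> borel_measurable lebesgue"
    by (intro measurable_completion) simp
  then have "(\<lambda>x. sgn (h x)) measurable_on UNIV" by (intro lebesgue_measurable_imp_measurable_on_real) auto
  then obtain N g where N: "negligible N" and g: "\<And>n. continuous_on UNIV (g n)"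
     and lim: "\<And>x. x \<notin> N \<Longrightarrow> (\<lambda>n. g n x) \<longlonglongrightarrow> sgn (h x)"
    unfolding measurable_on_def by auto
  \<comment> \<open>Clipping to [-1, 1] does not disturb the limit \<open>sgn h\<close> and provides
    the majorant \<open>\<bar>h\<bar>\<close>.\<close>
  define c where "c n x = max (-1) (min 1 (g n x))" for n x
  have c: "continuous_on UNIV (c n)" "\<bar>c n x\<bar> \<le> 1" for n x
    unfolding c_def by (auto intro!: continuous_intros g)
  have climx: "(\<lambda>n. c n x) \<longlonglongrightarrow> sgn (h x)" if "x \<notin> N" for x
  proof -
    have "(\<lambda>n. c n x) \<longlonglongrightarrow> max (-1) (min 1 (sgn (h x)))"
      unfolding c_def by (intro tendsto_intros lim that)
    moreover have "max (-1) (min 1 (sgn (h x))) = sgn (h x)" by (auto simp: sgn_real_def)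
    ultimately show ?thesis by simp
  qed
  have "N \<in> null_sets lebesgue" using N by (simp add: negligible_iff_null_sets)
  then have "AE x in lebesgue. x \<notin> N" by (rule AE_not_in)
  then have AEN: "AE x in lborel. x \<notin> N" by (simp add: AE_completion_iff)
  define \<psi> where "\<psi> m x = min 1 (max 0 (real m * infdist x (- U) - 1))" for m x
  note cut = continuous_cutoff[OF U, folded \<psi>_def]
  have zero: "AE x in lborel. \<psi> m x * \<bar>h x\<bar> = 0" for m
  proof -
    have m1 [measurable]: "\<psi> m \<in> borel_measurable borel" "c n \<in> borel_measurable borel" for n
      using cut(1) c(1) by (auto intro: borel_measurable_continuous_onI)
    have "(\<lambda>n. \<integral>x. h x * (\<psi> m x * c n x) \<partial>lborel) \<longlonglongrightarrow> (\<integral>x. h x * (\<psi> m x * sgn (h x)) \<partial>lborel)"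
    proof (rule integral_dominated_convergence[where w="\<lambda>x. \<bar>h x\<bar>"])
      show "AE x in lborel. (\<lambda>n. h x * (\<psi> m x * c n x)) \<longlonglongrightarrow> h x * (\<psi> m x * sgn (h x))"
        using AEN by eventually_elim (intro tendsto_intros climx)
      fix n
      show "AE x in lborel. norm (h x * (\<psi> m x * c n x)) \<le> \<bar>h x\<bar>"
      proof (rule AE_I2)
        fix x
        have "\<bar>\<psi> m x\<bar> * \<bar>c n x\<bar> \<le> 1 * 1" using cut(5,6)[of m x] c(2)[of n x] by (intro mult_mono) auto
        then have "\<bar>h x\<bar> * (\<bar>\<psi> m x\<bar> * \<bar>c n x\<bar>) \<le> \<bar>h x\<bar> * 1" by (intro mult_left_mono) auto
        then show "norm (h x * (\<psi> m x * c n x)) \<le> \<bar>h x\<bar>" by (simp add: abs_mult)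
      qed
    qed (use h(1) in auto)
    moreover have "(\<integral>x. h x * (\<psi> m x * c n x) \<partial>lborel) = 0" for n
    proof (rule orth[OF _ cut(2)[of m] cut(3)])
      show "continuous_on UNIV (\<lambda>x. \<psi> m x * c n x)" by (intro continuous_intros cut(1) c(1))
    qed (use cut(4) in simp)
    ultimately have "(\<lambda>n::nat. 0::real) \<longlonglongrightarrow> (\<integral>x. h x * (\<psi> m x * sgn (h x)) \<partial>lborel)" by simp
    then have "(\<integral>x. h x * (\<psi> m x * sgn (h x)) \<partial>lborel) = 0" using LIMSEQ_unique tendsto_const by blast
    moreover have "h x * (\<psi> m x * sgn (h x)) = \<psi> m x * \<bar>h x\<bar>" for x by (simp add: sgn_real_def)
    ultimately have i0: "(\<integral>x. \<psi> m x * \<bar>h x\<bar> \<partial>lborel) = 0" by simp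
    have "integrable lborel (\<lambda>x. \<psi> m x * \<bar>h x\<bar>)"
    proof (rule Bochner_Integration.integrable_bound[OF h(1)])
      show "AE x in lborel. norm (\<psi> m x * \<bar>h x\<bar>) \<le> norm (h x)"
        using cut(5,6)[of m] by (intro AE_I2) (simp add: abs_mult mult_left_le_one_le)
    qed measurable
    then show ?thesis
      using integral_nonneg_eq_0_iff_AE[of lborel "\<lambda>x. \<psi> m x * \<bar>h x\<bar>"] i0 cut(5) by simp
  qed
  have "AE x in lborel. \<forall>m. \<psi> m x * \<bar>h x\<bar> = 0" using zero by (subst AE_all_countable) blast
  then show ?thesis
  proof eventually_elim
    fix x assume x: "\<forall>m. \<psi> m x * \<bar>h x\<bar> = 0"
    show "h x = 0"
    proof (cases "x \<in> U")
      case True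
      then obtain m where "\<psi> m x > 0" using cut(7) by blast
      then show ?thesis using x by (metis abs_eq_0 mult_eq_0_iff less_irrefl)
    qed (use h(2) in simp)
  qed
qed

text \<open>Fubini's theorem and convolution are used with the Borel measure \<open>lborel\<close>,
  whereas coefficients are Lebesgue measurable and only essentially bounded on \<open>U\<close>.
  This representative is Borel, bounded everywhere and extended by 0.\<close>

lemma Linf_borel_rep:
  fixes f :: "real^'n \<Rightarrow> real"
  assumes U: "open U" "bounded U" and f: "Linf U f"
  shows "\<exists>k C. k \<in> borel_measurable borel \<and> 0 \<le> C \<and> (\<forall>x. \<bar>k x\<bar> \<le> C) \<and> (\<forall>x. x \<notin> U \<longrightarrow> k x = 0) \<and> integrable lborel k \<and>
     (AE x in lebesgue_on U. f x = k x)"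
proof -
  have Ub [measurable]: "U \<in> sets borel" using U by simp
  obtain C where fm: "f \<in> borel_measurable (lebesgue_on U)" and C: "AE x in lebesgue_on U. \<bar>f x\<bar> \<le> C"
    using f unfolding Linf_def by auto
  have "(\<lambda>x. if x \<in> U then f x else 0) \<in> borel_measurable lebesgue" using fm by (rule borel_measurable_if_I) simp
  then obtain k0 where k0 [measurable]: "k0 \<in> borel_measurable lborel" and ae: "AE x in lborel. (if x \<in> U then f x else 0) = k0 x"
    using completion_ex_borel_measurable_real by blast
  \<comment> \<open>Discarding the values above \<open>C\<close> changes \<open>k0\<close> on a null
    subset of \<open>U\<close> and turns the essential bound into a pointwise one.\<close>
  define k where "k x = (if x \<in> U \<and> \<bar>k0 x\<bar> \<le> C then k0 x else 0)" for x
  have [measurable]: "k0 \<in> borel_measurable borel" using k0 by simp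
  have km [measurable]: "k \<in> borel_measurable borel" unfolding k_def by measurable
  have kC: "\<bar>k x\<bar> \<le> \<bar>C\<bar>" for x by (auto simp: k_def)
  have "integrable lborel (\<lambda>x. indicator U x *\<^sub>R k x)"
    by (rule integrableI_bounded_set_indicator[where B="\<bar>C\<bar>"]) (use kC emeasure_bounded_finite[OF U(2)] in auto)
  moreover have "(\<lambda>x. indicator U x *\<^sub>R k x) = k" by (auto simp: k_def indicator_def)
  ultimately have "integrable lborel k" by simp
  moreover have "AE x in lebesgue_on U. f x = k x"
  proof -
    have "AE x in lebesgue. (if x \<in> U then f x else 0) = k0 x" using ae by (simp add: AE_completion_iff)
    moreover have "AE x in lebesgue. x \<in> U \<longrightarrow> \<bar>f x\<bar> \<le> C" using C by (simp add: AE_restrict_space_iff)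
    ultimately have "AE x in lebesgue. x \<in> U \<longrightarrow> f x = k x" by eventually_elim (auto simp: k_def)
    then show ?thesis by (simp add: AE_restrict_space_iff)
  qed
  moreover have "\<forall>x. x \<notin> U \<longrightarrow> k x = 0" by (simp add: k_def)
  ultimately show ?thesis using km kC by (intro exI[of _ k] exI[of _ "\<bar>C\<bar>"]) auto
qed

lemma lebesgue_on_integral_borel_rep:
  fixes f k \<psi> :: "real^'n \<Rightarrow> real"
  assumes U: "open U" and f: "f \<in> borel_measurable (lebesgue_on U)" and [measurable]: "k \<in> borel_measurable borel" "\<psi> \<in> borel_measurable borel"
    and k: "\<And>x. x \<notin> U \<Longrightarrow> k x = 0" "AE x in lebesgue_on U. f x = k x"
  shows "(LINT x|lebesgue_on U. f x * \<psi> x) = (\<integral>x. k x * \<psi> x \<partial>lborel)"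
proof -
  have [measurable]: "k \<in> borel_measurable (lebesgue_on U)" "\<psi> \<in> borel_measurable (lebesgue_on U)"
    by (auto intro!: measurable_restrict_space1 measurable_completion)
  have "(LINT x|lebesgue_on U. f x * \<psi> x) = (LINT x|lebesgue_on U. k x * \<psi> x)"
  proof (rule integral_cong_AE)
    show "AE x in lebesgue_on U. f x * \<psi> x = k x * \<psi> x" using k(2) by eventually_elim simp
  qed (use f in measurable)
  also have "\<dots> = (\<integral>x. indicator U x *\<^sub>R (k x * \<psi> x) \<partial>lebesgue)" using U by (intro integral_restrict_space) simp
  also have "\<dots> = (\<integral>x. k x * \<psi> x \<partial>lebesgue)"
    by (intro Bochner_Integration.integral_cong refl) (use k(1) in \<open>auto simp: indicator_def\<close>)
  also have "\<dots> = (\<integral>x. k x * \<psi> x \<partial>lborel)" by (rule integral_completion) simp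
  finally show ?thesis .
qed

lemma grad_reflect:
  assumes "C1c \<rho>"
  shows "((\<lambda>y. \<rho> (x - y)) has_derivative (\<lambda>w. (- grad \<rho> (x - y)) \<bullet> w)) (at y)"
proof -
  have "((\<lambda>y. x - y) has_derivative (\<lambda>w. - w)) (at y)" by (auto intro!: derivative_eq_intros)
  from has_derivative_compose[OF this test_function_has_derivative, of \<rho>] assms
  show ?thesis by (simp add: C1c_def)
qed

lemma test_function_reflect:
  assumes \<rho>: "C1c \<rho>" "\<And>z. \<delta> < norm z \<Longrightarrow> \<rho> z = 0" and sub: "cball x \<delta> \<subseteq> U"
  shows "test_function U (\<lambda>y. \<rho> (x - y))" "grad (\<lambda>y. \<rho> (x - y)) = (\<lambda>y. - grad \<rho> (x - y))"
proof -
  show gr: "grad (\<lambda>y. \<rho> (x - y)) = (\<lambda>y. - grad \<rho> (x - y))"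
    using grad_unique(1)[OF grad_reflect[OF \<rho>(1)]] by (simp add: fun_eq_iff)
  have "continuous_on UNIV (grad (\<lambda>y. \<rho> (x - y)))" unfolding gr
    by (intro continuous_intros continuous_on_compose2[OF C1c_grad_continuous[OF \<rho>(1)]]) auto
  moreover have "\<rho> (x - y) = 0" if "y \<notin> cball x \<delta>" for y
    using \<rho>(2)[of "x - y"] that by (simp add: dist_norm)
  ultimately show "test_function U (\<lambda>y. \<rho> (x - y))"
    using grad_unique(2)[OF grad_reflect[OF \<rho>(1)]] sub unfolding test_function_def
    by (intro conjI allI exI[of _ "cball x \<delta>"]) auto
qed

lemma moll_bounded: "\<delta> > 0 \<Longrightarrow> \<exists>B. \<forall>x. \<bar>moll \<delta> (x::real^'n)\<bar> \<le> B"
  using C1c_bounded(1)[OF moll_C1c] by blast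

lemma moll_borel: "\<delta> > 0 \<Longrightarrow> moll \<delta> \<in> borel_measurable (borel :: (real^'n) measure)"
  using borel_measurable_integrable[OF moll_props(4)] by simp

lemma conv_moll_continuous:
  fixes f :: "real^'n \<Rightarrow> real"
  assumes "integrable lborel f" "\<delta> > 0"
  shows "continuous_on UNIV (conv f (moll \<delta>))"
proof -
  obtain B where B: "\<And>z. norm (moll \<delta> (z::real^'n)) \<le> B" using moll_bounded[OF assms(2)] by auto
  show ?thesis
  proof (rule conv_continuous[where R=\<delta> and B=B, OF assms(1) C1c_continuous[OF moll_C1c[OF assms(2)]]])
    show "moll \<delta> x = 0" if "\<delta> < norm x" for x :: "real^'n" using that by (simp add: moll_props(2)[OF assms(2)])
  qed (rule B)
qed

lemma moll_translate:
  assumes "\<delta> > 0"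
  shows "continuous_on UNIV (\<lambda>z. moll \<delta> (x - z :: real^'n))" "integrable lborel (\<lambda>z. moll \<delta> (x - z :: real^'n))"
    "(\<integral>z. moll \<delta> (x - z :: real^'n) \<partial>lborel) = 1"
proof -
  show c: "continuous_on UNIV (\<lambda>z. moll \<delta> (x - z))"
    by (intro continuous_on_compose2[OF C1c_continuous[OF moll_C1c[OF assms]]] continuous_intros) auto
  show "integrable lborel (\<lambda>z. moll \<delta> (x - z))"
  proof (rule integrable_compact_support[OF c, where R="norm x + \<delta>"])
    fix y :: "real^'n" assume "norm x + \<delta> < norm y"
    then have "\<delta> \<le> norm (x - y)" using norm_triangle_ineq2[of y x] by (simp add: norm_minus_commute)
    then show "moll \<delta> (x - y) = 0" by (rule moll_props(2)[OF assms])
  qed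
  show "(\<integral>z. moll \<delta> (x - z) \<partial>lborel) = 1"
    using lborel_integral_reflect[OF moll_borel[OF assms], of x] moll_props(5)[OF assms] by simp
qed

lemma conv_moll_bound:
  fixes f :: "real^'n \<Rightarrow> real"
  assumes "\<delta> > 0" "integrable lborel f" "\<And>x. \<bar>f x\<bar> \<le> B"
  shows "\<bar>conv f (moll \<delta>) x\<bar> \<le> B"
proof -
  obtain B' where B': "\<And>x. norm (moll \<delta> (x::real^'n)) \<le> B'" using moll_bounded[OF assms(1)] by auto
  have int: "integrable lborel (\<lambda>y. moll \<delta> (x - y))" by (rule moll_translate(2)[OF assms(1)])
  have "norm (conv f (moll \<delta>) x) \<le> (\<integral>y. B * moll \<delta> (x - y) \<partial>lborel)"
    unfolding conv_def
  proof (rule Bochner_Integration.integral_norm_bound_integral)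
    show "integrable lborel (\<lambda>y. f y *\<^sub>R moll \<delta> (x - y))"
      by (rule conv_integrable[OF assms(2) moll_borel[OF assms(1)] B'])
    show "integrable lborel (\<lambda>y. B * moll \<delta> (x - y))" using int by simp
    fix y
    show "norm (f y *\<^sub>R moll \<delta> (x - y)) \<le> B * moll \<delta> (x - y)"
      using moll_props(1)[OF assms(1), of "x - y"] assms(3)[of y] by (simp add: abs_mult mult_right_mono)
  qed
  also have "\<dots> = B * (\<integral>y. moll \<delta> (x - y) \<partial>lborel)" by simp
  also have "(\<integral>y. moll \<delta> (x - y) \<partial>lborel) = 1" by (rule moll_translate(3)[OF assms(1)])
  finally show ?thesis by simp
qed

text \<open>The mollification at \<open>x\<close> is an average, with weights of total mass 1, of
  values of \<open>f\<close> at distance less than \<open>\<delta>\<close> from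
  \<open>x\<close>.\<close>

lemma conv_moll_close:
  fixes f :: "real^'n \<Rightarrow> real"
  assumes \<delta>: "\<delta> > 0" and f: "integrable lborel f" and close: "\<And>z. norm (x - z) < \<delta> \<Longrightarrow> \<bar>f z - a\<bar> \<le> e"
  shows "\<bar>conv f (moll \<delta>) x - a\<bar> \<le> e"
proof -
  have int: "integrable lborel (\<lambda>z. moll \<delta> (x - z))" by (rule moll_translate(2)[OF \<delta>])
  obtain B' where B': "\<And>x. norm (moll \<delta> (x::real^'n)) \<le> B'" using moll_bounded[OF \<delta>] by auto
  have int2: "integrable lborel (\<lambda>z. f z * moll \<delta> (x - z))"
    using conv_integrable[OF f moll_borel[OF \<delta>] B', of x] by simp
  have one: "(\<integral>z. moll \<delta> (x - z) \<partial>lborel) = 1" by (rule moll_translate(3)[OF \<delta>])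
  have "conv f (moll \<delta>) x - a = (\<integral>z. f z * moll \<delta> (x - z) - a * moll \<delta> (x - z) \<partial>lborel)"
    using int int2 one by (simp add: conv_def)
  also have "norm \<dots> \<le> (\<integral>z. e * moll \<delta> (x - z) \<partial>lborel)"
  proof (rule Bochner_Integration.integral_norm_bound_integral)
    fix z
    show "norm (f z * moll \<delta> (x - z) - a * moll \<delta> (x - z)) \<le> e * moll \<delta> (x - z)"
    proof (cases "norm (x - z) < \<delta>")
      case True
      then have "\<bar>f z - a\<bar> * moll \<delta> (x - z) \<le> e * moll \<delta> (x - z)"
        using moll_props(1)[OF \<delta>] close by (intro mult_right_mono) auto
      moreover have "norm (f z * moll \<delta> (x - z) - a * moll \<delta> (x - z)) = \<bar>f z - a\<bar> * moll \<delta> (x - z)"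
        using moll_props(1)[OF \<delta>, of "x - z"] by (simp add: abs_mult left_diff_distrib[symmetric])
      ultimately show ?thesis by simp
    next
      case False
      then show ?thesis using moll_props(2)[OF \<delta>, of "x - z"] by simp
    qed
  qed (use int int2 in simp_all)
  also have "\<dots> = e" using one by simp
  finally show ?thesis by simp
qed

lemma inverse_Suc_tendsto: "(\<lambda>n. 1 / real (Suc n)) \<longlonglongrightarrow> 0"
  using LIMSEQ_inverse_real_of_nat by (simp add: inverse_eq_divide)

section \<open>Bounded weak derivatives give Lipschitz functions\<close>

text \<open>A function of class \<open>W1inf\<close> after passage to Borel representatives:
  \<open>k\<close> for the function and \<open>h i\<close> for its weak partial derivatives.\<close>

locale weakly_lipschitz =
  fixes U :: "(real^'n) set" and k :: "real^'n \<Rightarrow> real" and h :: "'n \<Rightarrow> real^'n \<Rightarrow> real" and C :: real and D :: "'n \<Rightarrow> real"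
  assumes open_U: "open U" and bounded_U: "bounded U"
    and k: "integrable lborel k" "\<And>x. \<bar>k x\<bar> \<le> C" "\<And>x. x \<notin> U \<Longrightarrow> k x = 0"
    and h: "\<And>i. integrable lborel (h i)" "\<And>i x. \<bar>h i x\<bar> \<le> D i"
    and weak: "\<And>i \<phi>. test_function U \<phi> \<Longrightarrow> (\<integral>x. k x * grad \<phi> x $ i \<partial>lborel) = - (\<integral>x. h i x * \<phi> x \<partial>lborel)"
begin

definition L :: real where "L = (\<Sum>i\<in>UNIV. D i)"

lemma D_nonneg: "0 \<le> D i" using h(2)[of i undefined] by linarith
lemma L_nonneg: "0 \<le> L" unfolding L_def using D_nonneg by (simp add: sum_nonneg)

abbreviation smoothed :: "real \<Rightarrow> real^'n \<Rightarrow> real" where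
  "smoothed \<delta> \<equiv> conv k (moll \<delta>)"

text \<open>As long as the ball of radius \<open>\<delta>\<close> lies in \<open>U\<close>, the
  reflected kernel is a test function, so the gradient of the mollification is the mollification of
  the weak gradient and inherits its bounds. \<open>L\<close> bounds the Euclidean norm through the
  sum of the components.\<close>

lemma norm_grad_smoothed:
  assumes \<delta>: "\<delta> > 0" and sub: "cball x \<delta> \<subseteq> U"
  shows "norm (grad (smoothed \<delta>) x) \<le> L"
proof -
  have \<rho>: "C1c (moll \<delta> :: real^'n \<Rightarrow> real)" by (rule moll_C1c[OF \<delta>])
  have \<rho>0: "moll \<delta> z = 0" if "\<delta> < norm z" for z :: "real^'n" using moll_props(2)[OF \<delta>, of z] that by simp
  obtain B where B: "\<And>z. norm (grad (moll \<delta>) (z::real^'n)) \<le> B" using C1c_bounded(2)[OF \<rho>] by blast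
  have int: "integrable lborel (\<lambda>y. k y *\<^sub>R grad (moll \<delta>) (x - y))"
    by (rule conv_integrable[OF k(1) _ B]) (intro borel_measurable_continuous_onI C1c_grad_continuous \<rho>)
  have "grad (smoothed \<delta>) x $ i = conv (h i) (moll \<delta>) x" for i
  proof -
    have "grad (smoothed \<delta>) x $ i = conv k (grad (moll \<delta>)) x \<bullet> axis i 1"
      by (simp add: conv_C1(2)[OF k(1) \<rho>] inner_axis)
    also have "\<dots> = (\<integral>y. (k y *\<^sub>R grad (moll \<delta>) (x - y)) \<bullet> axis i 1 \<partial>lborel)"
      unfolding conv_def by (rule integral_inner_left[symmetric]) (use int in simp)
    also have "\<dots> = - (\<integral>y. k y * grad (\<lambda>y. moll \<delta> (x - y)) y $ i \<partial>lborel)"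
    proof -
      have "grad (\<lambda>y. moll \<delta> (x - y)) y = - grad (moll \<delta>) (x - y)" for y
        using fun_cong[OF test_function_reflect(2)[OF \<rho> \<rho>0 sub], of y] .
      then show ?thesis by (simp add: inner_axis)
    qed
    also have "\<dots> = (\<integral>y. h i y * moll \<delta> (x - y) \<partial>lborel)"
      using weak[OF test_function_reflect(1)[OF \<rho> \<rho>0 sub]] by simp
    finally show ?thesis by (simp add: conv_def)
  qed
  then have "\<bar>grad (smoothed \<delta>) x $ i\<bar> \<le> D i" for i using conv_moll_bound[OF \<delta> h(1) h(2)] by simp
  then have "(\<Sum>i\<in>UNIV. \<bar>grad (smoothed \<delta>) x $ i\<bar>) \<le> L" unfolding L_def by (rule sum_mono)
  then show ?thesis using norm_le_l1_cart[of "grad (smoothed \<delta>) x"] by simp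
qed

lemma smoothed_lipschitz:
  assumes \<delta>: "\<delta> > 0" and sub: "\<And>z. z \<in> closed_segment x y \<Longrightarrow> cball z \<delta> \<subseteq> U"
  shows "\<bar>smoothed \<delta> x - smoothed \<delta> y\<bar> \<le> L * norm (x - y)"
proof -
  have "norm (smoothed \<delta> x - smoothed \<delta> y) \<le> L * norm (x - y)"
  proof (rule differentiable_bound[of "closed_segment x y"])
    fix z assume z: "z \<in> closed_segment x y"
    show "(smoothed \<delta> has_derivative (\<lambda>w. grad (smoothed \<delta>) z \<bullet> w)) (at z within closed_segment x y)"
      using test_function_has_derivative[OF conv_C1(1)[OF k(1) moll_C1c[OF \<delta>]]] by (rule has_derivative_at_withinI)
    have "onorm (\<lambda>w. grad (smoothed \<delta>) z \<bullet> w) \<le> norm (grad (smoothed \<delta>) z)"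
      by (rule onorm_le) (simp add: Cauchy_Schwarz_ineq2)
    then show "onorm (\<lambda>w. grad (smoothed \<delta>) z \<bullet> w) \<le> L" using norm_grad_smoothed[OF \<delta> sub[OF z]] by simp
  qed auto
  then show ?thesis by simp
qed

text \<open>Both sides are integrals of \<open>k\<close> against a product of two kernels, and the
  products are interchanged by the reflection taking \<open>z\<close> to
  \<open>x + y - z\<close>.\<close>

lemma double_conv_commute:
  assumes \<delta>: "\<delta> > 0" "\<epsilon> > 0"
  shows "(\<integral>z. moll \<epsilon> (x - z) * smoothed \<delta> z \<partial>lborel) = (\<integral>z. moll \<delta> (x - z) * smoothed \<epsilon> z \<partial>lborel)"
proof -
  have cont: "continuous_on UNIV (\<lambda>z. moll d (z - a))" if "d > 0" for d and a :: "real^'n"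
    by (intro continuous_on_compose2[OF C1c_continuous[OF moll_C1c[OF that]]] continuous_intros; simp)+
  have sw: "(\<integral>z. moll a (x - z) * smoothed b z \<partial>lborel) = (\<integral>y. k y * (\<integral>z. moll a (x - z) * moll b (z - y) \<partial>lborel) \<partial>lborel)"
    if a: "a > 0" and b: "b > 0" for a b
  proof -
    obtain B where "\<And>z. \<bar>moll b (z::real^'n)\<bar> \<le> B" using moll_bounded[OF b] by blast
    then show ?thesis using conv_swap(1)[OF k(1) moll_translate(2)[OF a] moll_borel[OF b]] by blast
  qed
  have "(\<integral>z. moll \<epsilon> (x - z) * moll \<delta> (z - y) \<partial>lborel) = (\<integral>z. moll \<delta> (x - z) * moll \<epsilon> (z - y) \<partial>lborel)" for y
  proof -
    have m: "(\<lambda>z. moll \<epsilon> (x - z) * moll \<delta> (z - y)) \<in> borel_measurable borel"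
      by (intro borel_measurable_times borel_measurable_continuous_onI moll_translate(1) cont \<delta>)
    have "(\<integral>z. moll \<epsilon> (x - z) * moll \<delta> (z - y) \<partial>lborel) = (\<integral>z. moll \<epsilon> (x - ((x + y) - z)) * moll \<delta> (((x + y) - z) - y) \<partial>lborel)"
      using lborel_integral_reflect[OF m, of "x + y"] by simp
    then show ?thesis by (simp add: algebra_simps)
  qed
  then show ?thesis by (simp add: sw \<delta>)
qed

lemma smoothed_average:
  assumes \<delta>: "\<delta> > 0" "\<epsilon> > 0" and sub: "cball x (\<delta> + \<epsilon>) \<subseteq> U"
  shows "\<bar>(\<integral>z. moll \<epsilon> (x - z) * smoothed \<delta> z \<partial>lborel) - smoothed \<delta> x\<bar> \<le> L * \<epsilon>"
proof -
  have cont: "continuous_on UNIV (\<lambda>z. moll \<epsilon> (x - z))" by (rule moll_translate(1)[OF \<delta>(2)])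
  have int: "integrable lborel (\<lambda>z. moll \<epsilon> (x - z))" by (rule moll_translate(2)[OF \<delta>(2)])
  have vanish: "moll \<epsilon> (x - y) = 0" if "norm x + \<epsilon> < norm y" for y
  proof -
    have "\<epsilon> \<le> norm (x - y)" using that norm_triangle_ineq2[of y x] by (simp add: norm_minus_commute)
    then show ?thesis by (rule moll_props(2)[OF \<delta>(2)])
  qed
  have csm: "continuous_on UNIV (smoothed \<delta>)" by (rule conv_moll_continuous[OF k(1) \<delta>(1)])
  have int2: "integrable lborel (\<lambda>z. moll \<epsilon> (x - z) * smoothed \<delta> z)"
    by (rule integrable_compact_support[where R="norm x + \<epsilon>"]) (use vanish in \<open>auto intro!: continuous_intros cont csm\<close>)
  have one: "(\<integral>z. moll \<epsilon> (x - z) \<partial>lborel) = 1" by (rule moll_translate(3)[OF \<delta>(2)])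
  have "(\<integral>z. moll \<epsilon> (x - z) * smoothed \<delta> z \<partial>lborel) - smoothed \<delta> x = (\<integral>z. moll \<epsilon> (x - z) * smoothed \<delta> z - moll \<epsilon> (x - z) * smoothed \<delta> x \<partial>lborel)"
    using int int2 one by simp
  also have "norm \<dots> \<le> (\<integral>z. moll \<epsilon> (x - z) * (L * \<epsilon>) \<partial>lborel)"
  proof (rule Bochner_Integration.integral_norm_bound_integral)
    fix z
    show "norm (moll \<epsilon> (x - z) * smoothed \<delta> z - moll \<epsilon> (x - z) * smoothed \<delta> x) \<le> moll \<epsilon> (x - z) * (L * \<epsilon>)"
    proof (cases "norm (x - z) < \<epsilon>")
      case True
      have "\<bar>smoothed \<delta> z - smoothed \<delta> x\<bar> \<le> L * norm (z - x)"
      proof (rule smoothed_lipschitz[OF \<delta>(1)])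
        fix y assume "y \<in> closed_segment z x"
        then have "dist y x \<le> \<epsilon>" using True segment_bound(2)[of y z x] by (simp add: dist_norm norm_minus_commute)
        then have "cball y \<delta> \<subseteq> cball x (\<delta> + \<epsilon>)"
          by (simp add: cball_subset_cball_iff dist_commute)
        then show "cball y \<delta> \<subseteq> U" using sub by blast
      qed
      also have "\<dots> \<le> L * \<epsilon>" using True L_nonneg by (intro mult_left_mono) (auto simp: norm_minus_commute)
      finally have "moll \<epsilon> (x - z) * \<bar>smoothed \<delta> z - smoothed \<delta> x\<bar> \<le> moll \<epsilon> (x - z) * (L * \<epsilon>)"
        using moll_props(1)[OF \<delta>(2)] by (intro mult_left_mono) auto
      moreover have "norm (moll \<epsilon> (x - z) * smoothed \<delta> z - moll \<epsilon> (x - z) * smoothed \<delta> x) = moll \<epsilon> (x - z) * \<bar>smoothed \<delta> z - smoothed \<delta> x\<bar>"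
        using moll_props(1)[OF \<delta>(2), of "x - z"] by (simp add: abs_mult right_diff_distrib[symmetric])
      ultimately show ?thesis by simp
    next
      case False
      then show ?thesis using moll_props(2)[OF \<delta>(2), of "x - z"] by simp
    qed
  qed (use int int2 in simp_all)
  also have "\<dots> = L * \<epsilon>" using one by simp
  finally show ?thesis by simp
qed

text \<open>Both sides are compared with the double mollification, in which \<open>\<delta>\<close> and \<open>\<epsilon>\<close> may be exchanged.\<close>

lemma smoothed_Cauchy:
  assumes "\<delta> > 0" "\<epsilon> > 0" "cball x (\<delta> + \<epsilon>) \<subseteq> U"
  shows "\<bar>smoothed \<delta> x - smoothed \<epsilon> x\<bar> \<le> L * (\<delta> + \<epsilon>)"
  using smoothed_average[OF assms] smoothed_average[of \<epsilon> \<delta> x] double_conv_commute[OF assms(1,2), of x] assms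
  by (simp add: add.commute distrib_left)

text \<open>The limit is shown to exist at points of \<open>U\<close>; elsewhere the value is
  arbitrary.\<close>

definition rep :: "real^'n \<Rightarrow> real" where
  "rep x = lim (\<lambda>n. smoothed (1 / real (Suc n)) x)"

lemma seq_tendsto_rep:
  assumes "x \<in> U"
  shows "(\<lambda>n. smoothed (1 / real (Suc n)) x) \<longlonglongrightarrow> rep x"
proof -
  obtain r where r: "r > 0" "cball x r \<subseteq> U" using open_U assms open_contains_cball by blast
  have "Cauchy (\<lambda>n. smoothed (1 / real (Suc n)) x)"
  proof (rule metric_CauchyI)
    fix e :: real assume e: "e > 0"
    \<comment> \<open>Radii with sum below \<open>c\<close> keep the balls inside \<open>U\<close>
      and make the Cauchy bound smaller than \<open>e\<close>.\<close>
    define c where "c = min r (e / (L + 1))"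
    have c: "c > 0" using r e L_nonneg by (simp add: c_def)
    then obtain M where M: "real M > 2 / c" using reals_Archimedean2 by blast
    have small: "1 / real (Suc n) < c / 2" if "n \<ge> M" for n
    proof -
      have "2 / c < real (Suc n)" using M that by linarith
      then show ?thesis using c by (simp add: field_simps)
    qed
    have "dist (smoothed (1 / real (Suc m)) x) (smoothed (1 / real (Suc n)) x) < e" if mn: "m \<ge> M" "n \<ge> M" for m n
    proof -
      have s: "1 / real (Suc m) + 1 / real (Suc n) < c" using small[OF mn(1)] small[OF mn(2)] by linarith
      then have "cball x (1 / real (Suc m) + 1 / real (Suc n)) \<subseteq> U" using r c_def by fastforce
      then have "\<bar>smoothed (1 / real (Suc m)) x - smoothed (1 / real (Suc n)) x\<bar> \<le> L * (1 / real (Suc m) + 1 / real (Suc n))"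
        by (intro smoothed_Cauchy) auto
      also have "\<dots> \<le> L * c" using s L_nonneg by (intro mult_left_mono) auto
      also have "\<dots> \<le> L * (e / (L + 1))" using L_nonneg by (intro mult_left_mono) (auto simp: c_def)
      also have "\<dots> < e" using e L_nonneg by (simp add: field_simps)
      finally show ?thesis by (simp add: dist_real_def)
    qed
    then show "\<exists>M. \<forall>m\<ge>M. \<forall>n\<ge>M. dist (smoothed (1 / real (Suc m)) x) (smoothed (1 / real (Suc n)) x) < e" by blast
  qed
  then show ?thesis unfolding rep_def using Cauchy_convergent convergent_LIMSEQ_iff by blast
qed

lemma rep_lipschitz:
  assumes "closed_segment x y \<subseteq> U"
  shows "\<bar>rep x - rep y\<bar> \<le> L * norm (x - y)"
proof -
  obtain d where d: "d > 0" "(\<Union>z\<in>closed_segment x y. cball z d) \<subseteq> U"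
    using compact_subset_open_imp_cball_epsilon_subset[OF compact_segment open_U assms] by blast
  have "(\<lambda>n. \<bar>smoothed (1 / real (Suc n)) x - smoothed (1 / real (Suc n)) y\<bar>) \<longlonglongrightarrow> \<bar>rep x - rep y\<bar>"
    using assms by (intro tendsto_intros seq_tendsto_rep) auto
  moreover have "\<forall>\<^sub>F n in sequentially. \<bar>smoothed (1 / real (Suc n)) x - smoothed (1 / real (Suc n)) y\<bar> \<le> L * norm (x - y)"
    using order_tendstoD(2)[OF inverse_Suc_tendsto d(1)]
  proof eventually_elim
    case (elim n)
    have "cball z (1 / real (Suc n)) \<subseteq> U" if "z \<in> closed_segment x y" for z
      using d(2) that subset_cball[of "1 / real (Suc n)" d z] elim by fastforce
    then show ?case by (intro smoothed_lipschitz) auto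
  qed
  ultimately show ?thesis by (rule tendsto_upperbound) simp
qed

lemma rep_continuous: "continuous_on U rep"
proof -
  have "\<exists>d>0. \<forall>y\<in>U. dist y x < d \<longrightarrow> dist (rep y) (rep x) < e" if x: "x \<in> U" and e: "e > 0" for x e
  proof -
    obtain r where r: "r > 0" "cball x r \<subseteq> U" using open_U x open_contains_cball by blast
    have "dist (rep y) (rep x) < e" if y: "dist y x < min r (e / (L + 1))" for y
    proof -
      have "closed_segment y x \<subseteq> cball x r" using y r by (intro closed_segment_subset) (auto simp: dist_commute)
      then have "\<bar>rep y - rep x\<bar> \<le> L * norm (y - x)" using r by (intro rep_lipschitz) auto
      also have "\<dots> \<le> L * (e / (L + 1))" using y L_nonneg by (intro mult_left_mono) (auto simp: dist_norm)
      also have "\<dots> < e" using e L_nonneg by (simp add: field_simps)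
      finally show ?thesis by (simp add: dist_real_def)
    qed
    then show ?thesis using r e L_nonneg by (intro exI[of _ "min r (e / (L + 1))"]) auto
  qed
  then show ?thesis unfolding continuous_on_iff by blast
qed

lemma rep_bound: "x \<in> U \<Longrightarrow> \<bar>rep x\<bar> \<le> C"
  by (rule tendsto_upperbound[OF tendsto_rabs[OF seq_tendsto_rep]])
    (auto intro!: always_eventually conv_moll_bound k)

text \<open>The kernel is even, so the inner integral is a mollification of \<open>\<phi>\<close>;
  it converges by continuity of \<open>\<phi>\<close> and is bounded by a bound of
  \<open>\<phi>\<close>, which gives the majorant.\<close>

lemma mollify_test:
  assumes \<phi>: "continuous_on UNIV \<phi>" "\<And>x. R < norm x \<Longrightarrow> \<phi> x = 0"
  shows "(\<lambda>n. \<integral>y. k y * (\<integral>x. \<phi> x * moll (1 / real (Suc n)) (x - y) \<partial>lborel) \<partial>lborel) \<longlonglongrightarrow> (\<integral>y. k y * \<phi> y \<partial>lborel)"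
proof -
  have \<phi>int: "integrable lborel \<phi>" by (rule integrable_compact_support[OF \<phi>])
  have [measurable]: "\<phi> \<in> borel_measurable borel" "k \<in> borel_measurable borel" using \<phi>int k(1) by auto
  obtain B where B: "\<And>x. \<bar>\<phi> x\<bar> \<le> B" "0 \<le> B"
  proof -
    have "bounded (\<phi> ` cball 0 R)"
      by (meson compact_cball compact_continuous_image compact_imp_bounded continuous_on_subset \<phi>(1) subset_UNIV)
    then obtain B where "\<forall>x\<in>cball 0 R. \<bar>\<phi> x\<bar> \<le> B" by (auto simp: bounded_iff)
    then have "\<bar>\<phi> x\<bar> \<le> max B 0" for x using \<phi>(2)[of x] by (cases "norm x \<le> R") (auto simp: le_max_iff_disj)
    then show thesis using that[of "max B 0"] by simp
  qed
  let ?\<phi> = "\<lambda>n. conv \<phi> (moll (1 / real (Suc n)))"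
  have eq: "(\<integral>x. \<phi> x * moll (1 / real (Suc n)) (x - y) \<partial>lborel) = ?\<phi> n y" for n y
  proof -
    have "moll (1 / real (Suc n)) (x - y) = moll (1 / real (Suc n)) (y - x)" for x
      using moll_props(3)[of "1 / real (Suc n)" "y - x"] by simp
    then show ?thesis by (simp add: conv_def)
  qed
  have cm: "continuous_on UNIV (?\<phi> n)" for n by (rule conv_moll_continuous[OF \<phi>int]) simp
  have [measurable]: "?\<phi> n \<in> borel_measurable borel" for n using cm by (rule borel_measurable_continuous_onI)
  have lim: "(\<lambda>n. ?\<phi> n y) \<longlonglongrightarrow> \<phi> y" for y
  proof (rule LIMSEQ_I)
    fix e :: real assume e: "e > 0"
    obtain d where d: "d > 0" "\<And>x y. dist x y < d \<Longrightarrow> dist (\<phi> x) (\<phi> y) < e / 2"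
      using compact_support_uniformly_continuous[where e="e/2", OF \<phi>] e by (metis half_gt_zero)
    obtain M where M: "\<And>n. n \<ge> M \<Longrightarrow> 1 / real (Suc n) < d"
      using order_tendstoD(2)[OF inverse_Suc_tendsto d(1)] unfolding eventually_sequentially by blast
    have "norm (?\<phi> n y - \<phi> y) < e" if n: "n \<ge> M" for n
    proof -
      have "\<bar>?\<phi> n y - \<phi> y\<bar> \<le> e / 2"
      proof (rule conv_moll_close[OF _ \<phi>int])
        fix z assume "norm (y - z) < 1 / real (Suc n)"
        then show "\<bar>\<phi> z - \<phi> y\<bar> \<le> e / 2"
          using d(2)[of z y] M[OF n] by (simp add: dist_norm norm_minus_commute dist_real_def)
      qed simp
      then show ?thesis using e by simp
    qed
    then show "\<exists>M. \<forall>n\<ge>M. norm (?\<phi> n y - \<phi> y) < e" by blast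
  qed
  show ?thesis unfolding eq
  proof (rule integral_dominated_convergence[where w="\<lambda>y. B * \<bar>k y\<bar>"])
    show "(\<lambda>y. k y * ?\<phi> n y) \<in> borel_measurable lborel" for n by measurable
    show "AE y in lborel. (\<lambda>n. k y * ?\<phi> n y) \<longlonglongrightarrow> k y * \<phi> y" by (intro AE_I2 tendsto_intros lim)
    fix n
    show "AE y in lborel. norm (k y * ?\<phi> n y) \<le> B * \<bar>k y\<bar>"
    proof (rule AE_I2)
      fix y
      have "\<bar>?\<phi> n y\<bar> \<le> B" by (rule conv_moll_bound) (use \<phi>int B in auto)
      then have "\<bar>k y\<bar> * \<bar>?\<phi> n y\<bar> \<le> \<bar>k y\<bar> * B" by (intro mult_left_mono) auto
      then show "norm (k y * ?\<phi> n y) \<le> B * \<bar>k y\<bar>" by (simp add: abs_mult mult.commute)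
    qed
  qed (use k(1) in simp_all)
qed

text \<open>Tested with a continuous \<open>\<phi>\<close> of compact support in \<open>U\<close>,
  the mollifications of \<open>k\<close> converge to the integral of \<open>\<phi> * rep\<close> by
  domination, and to that of \<open>\<phi> * k\<close> after the mollifier has been moved onto
  \<open>\<phi>\<close>. The fundamental lemma then identifies the two, without Lebesgue
  points.\<close>

lemma rep_AE: "AE x in lborel. x \<in> U \<longrightarrow> rep x = k x"
proof -
  have [measurable]: "U \<in> sets borel" "k \<in> borel_measurable borel" using open_U k(1) by auto
  define g where "g x = indicator U x *\<^sub>R rep x" for x
  have gm [measurable]: "g \<in> borel_measurable borel"
    unfolding g_def by (rule borel_measurable_continuous_on_indicator[OF _ rep_continuous]) simp
  have C0: "0 \<le> C" using k(2)[of undefined] by linarith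
  have gC: "\<bar>g x\<bar> \<le> C" for x using rep_bound[of x] C0 by (auto simp: g_def indicator_def)
  have gint: "integrable lborel g"
  proof -
    have "integrable lborel (\<lambda>x. indicator U x *\<^sub>R g x)"
      by (rule integrableI_bounded_set_indicator[where B=C]) (use gC emeasure_bounded_finite[OF bounded_U] in auto)
    moreover have "(\<lambda>x. indicator U x *\<^sub>R g x) = g" by (auto simp: g_def indicator_def)
    ultimately show ?thesis by simp
  qed
  have "AE x in lborel. g x - k x = 0"
  proof (rule AE_zero_if_orthogonal[OF open_U bounded_U])
    show "integrable lborel (\<lambda>x. g x - k x)" using gint k(1) by simp
    show "\<And>x. x \<notin> U \<Longrightarrow> g x - k x = 0" using k(3) by (simp add: g_def)
    fix \<phi> Q assume \<phi>: "continuous_on UNIV \<phi>" "compact Q" "Q \<subseteq> U" "\<And>x. x \<notin> Q \<Longrightarrow> \<phi> x = (0::real)"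
    obtain R where R: "\<And>x. x \<in> Q \<Longrightarrow> norm x \<le> R" using compact_imp_bounded[OF \<phi>(2)] by (auto simp: bounded_iff)
    have \<phi>R: "\<phi> x = 0" if "R < norm x" for x using \<phi>(4)[of x] R[of x] that by fastforce
    have \<phi>int: "integrable lborel \<phi>" by (rule integrable_compact_support[OF \<phi>(1) \<phi>R])
    have [measurable]: "\<phi> \<in> borel_measurable borel" using \<phi>int by auto
    have "continuous_on UNIV (smoothed (1 / real (Suc n)))" for n by (rule conv_moll_continuous[OF k(1)]) simp
    then have [measurable]: "smoothed (1 / real (Suc n)) \<in> borel_measurable borel" for n
      by (rule borel_measurable_continuous_onI)
    have "(\<lambda>n. \<integral>x. \<phi> x * smoothed (1 / real (Suc n)) x \<partial>lborel) \<longlonglongrightarrow> (\<integral>x. \<phi> x * g x \<partial>lborel)"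
    proof (rule integral_dominated_convergence[where w="\<lambda>x. C * \<bar>\<phi> x\<bar>"])
      show "(\<lambda>x. \<phi> x * smoothed (1 / real (Suc n)) x) \<in> borel_measurable lborel" for n by measurable
      show "AE x in lborel. (\<lambda>n. \<phi> x * smoothed (1 / real (Suc n)) x) \<longlonglongrightarrow> \<phi> x * g x"
      proof (rule AE_I2)
        fix x
        show "(\<lambda>n. \<phi> x * smoothed (1 / real (Suc n)) x) \<longlonglongrightarrow> \<phi> x * g x"
        proof (cases "x \<in> U")
          case True
          then show ?thesis using seq_tendsto_rep[OF True] by (auto simp: g_def intro!: tendsto_intros)
        next
          case False
          then have "x \<notin> Q" using \<phi>(3) by blast
          then show ?thesis using \<phi>(4)[of x] by simp
        qed
      qed
      fix n
      show "AE x in lborel. norm (\<phi> x * smoothed (1 / real (Suc n)) x) \<le> C * \<bar>\<phi> x\<bar>"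
      proof (rule AE_I2)
        fix x
        have "\<bar>smoothed (1 / real (Suc n)) x\<bar> \<le> C" by (rule conv_moll_bound) (use k in auto)
        then have "\<bar>\<phi> x\<bar> * \<bar>smoothed (1 / real (Suc n)) x\<bar> \<le> \<bar>\<phi> x\<bar> * C" by (intro mult_left_mono) auto
        then show "norm (\<phi> x * smoothed (1 / real (Suc n)) x) \<le> C * \<bar>\<phi> x\<bar>" by (simp add: abs_mult mult.commute)
      qed
    qed (use \<phi>int in simp_all)
    moreover have "(\<integral>x. \<phi> x * smoothed (1 / real (Suc n)) x \<partial>lborel) = (\<integral>y. k y * (\<integral>x. \<phi> x * moll (1 / real (Suc n)) (x - y) \<partial>lborel) \<partial>lborel)" for n
    proof -
      have d: "1 / real (Suc n) > 0" by simp
      obtain B where "\<And>z. \<bar>moll (1 / real (Suc n)) (z::real^'n)\<bar> \<le> B" using moll_bounded[OF d] by blast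
      then show ?thesis by (rule conv_swap(1)[OF k(1) \<phi>int moll_borel[OF d]])
    qed
    ultimately have "(\<integral>x. \<phi> x * g x \<partial>lborel) = (\<integral>y. k y * \<phi> y \<partial>lborel)"
      using mollify_test[OF \<phi>(1) \<phi>R] LIMSEQ_unique by fastforce
    moreover have "integrable lborel (\<lambda>x. \<phi> x * g x)"
    proof (rule Bochner_Integration.integrable_bound[of _ "\<lambda>x. C * \<phi> x"])
      show "AE x in lborel. norm (\<phi> x * g x) \<le> norm (C * \<phi> x)"
        using mult_right_mono[OF gC abs_ge_zero] C0 by (intro AE_I2) (simp add: abs_mult mult.commute)
    qed (use \<phi>int in simp_all)
    moreover have "integrable lborel (\<lambda>x. k x * \<phi> x)"
    proof (rule Bochner_Integration.integrable_bound[of _ "\<lambda>x. C * \<phi> x"])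
      show "AE x in lborel. norm (k x * \<phi> x) \<le> norm (C * \<phi> x)"
        using mult_right_mono[OF k(2) abs_ge_zero] C0 by (intro AE_I2) (simp add: abs_mult)
    qed (use \<phi>int in simp_all)
    ultimately show "(\<integral>x. (g x - k x) * \<phi> x \<partial>lborel) = 0"
      by (simp add: left_diff_distrib mult.commute[of "g _"])
  qed
  then show ?thesis by eventually_elim (auto simp: g_def indicator_def)
qed

end

text \<open>On a nonconvex set the estimate can only be expected along segments inside
  \<open>U\<close>: the mollified gradients are controlled just where a small ball fits into
  \<open>U\<close>.\<close>

lemma W1inf_lipschitz_rep:
  fixes f :: "real^'n \<Rightarrow> real"
  assumes U: "open U" "bounded U" and f: "W1inf U f"
  shows "\<exists>F L. 0 \<le> L \<and> continuous_on U F \<and> (AE x in lebesgue_on U. F x = f x) \<and>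
     (\<forall>x y. closed_segment x y \<subseteq> U \<longrightarrow> \<bar>F x - F y\<bar> \<le> L * norm (x - y))"
proof -
  obtain k C where kk: "k \<in> borel_measurable borel" "0 \<le> C" "\<And>x. \<bar>k x\<bar> \<le> C" "\<And>x. x \<notin> U \<Longrightarrow> k x = 0" "integrable lborel k"
     "AE x in lebesgue_on U. f x = k x"
    using Linf_borel_rep[OF U conjunct1[OF f[unfolded W1inf_def]]] by auto
  obtain g where g: "\<And>i. Linf U (g i)" "\<And>i. is_weak_partial U i f (g i)" using f unfolding W1inf_def by metis
  define Q where "Q i h D \<longleftrightarrow> h \<in> borel_measurable borel \<and> (\<forall>x. \<bar>h x\<bar> \<le> D) \<and> (\<forall>x. x \<notin> U \<longrightarrow> h x = 0) \<and>
      integrable lborel h \<and> (AE x in lebesgue_on U. g i x = h x)" for i h and D :: real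
  have "\<exists>h D. Q i h D" for i using Linf_borel_rep[OF U g(1)[of i]] unfolding Q_def by auto
  then obtain h D where "\<And>i. Q i (h i) (D i)" by metis
  then have h: "\<And>i. h i \<in> borel_measurable borel" "\<And>i x. \<bar>h i x\<bar> \<le> D i" "\<And>i x. x \<notin> U \<Longrightarrow> h i x = 0"
     "\<And>i. integrable lborel (h i)" "\<And>i. AE x in lebesgue_on U. g i x = h i x"
    unfolding Q_def by auto
  have fm: "f \<in> borel_measurable (lebesgue_on U)" using f by (auto simp: W1inf_def Linf_def)
  have gm: "g i \<in> borel_measurable (lebesgue_on U)" for i using g(1)[of i] by (auto simp: Linf_def)
  interpret weakly_lipschitz U k h C D
  proof
    fix i \<phi> assume \<phi>: "test_function U \<phi>"
    have d: "\<phi> differentiable (at x)" for x using \<phi> by (auto simp: test_function_def)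
    have "continuous_on UNIV \<phi>"
      by (intro continuous_at_imp_continuous_on ballI differentiable_imp_continuous_within d)
    then have \<phi>b: "\<phi> \<in> borel_measurable borel" by (rule borel_measurable_continuous_onI)
    have "continuous_on UNIV (\<lambda>x. grad \<phi> x $ i)" using \<phi> by (auto simp: test_function_def intro!: continuous_intros)
    then have gb: "(\<lambda>x. grad \<phi> x $ i) \<in> borel_measurable borel" by (rule borel_measurable_continuous_onI)
    show "(\<integral>x. k x * grad \<phi> x $ i \<partial>lborel) = - (\<integral>x. h i x * \<phi> x \<partial>lborel)"
      using g(2)[of i] \<phi> lebesgue_on_integral_borel_rep[OF U(1) fm kk(1) gb kk(4,6)]
        lebesgue_on_integral_borel_rep[OF U(1) gm[of i] h(1) \<phi>b h(3,5)]
      unfolding is_weak_partial_def by simp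
  qed (use U kk h in auto)
  have "AE x in lebesgue. x \<in> U \<longrightarrow> rep x = k x" using rep_AE by (simp add: AE_completion_iff)
  then have "AE x in lebesgue_on U. rep x = k x" using U by (simp add: AE_restrict_space_iff)
  with kk(6) have "AE x in lebesgue_on U. rep x = f x" by eventually_elim simp
  then show ?thesis using L_nonneg rep_continuous rep_lipschitz by blast
qed

section \<open>Continuous representatives up to the boundary\<close>

text \<open>Near a boundary point the field \<open>w\<close> pushes the closure into \<open>U\<close>, and the continuous functions
  \<open>F (y + t w(y))\<close> converge uniformly as \<open>t\<close> tends to \<open>0\<close>.\<close>

lemma continuous_extension_if_inward:
  fixes F :: "real^'n \<Rightarrow> real"
  assumes U: "open U" and F: "0 \<le> L" "continuous_on U F" "\<And>x y. closed_segment x y \<subseteq> U \<Longrightarrow> \<bar>F x - F y\<bar> \<le> L * norm (x - y)"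
    and inward: "\<And>x. x \<in> frontier U \<Longrightarrow> \<exists>r>0. \<exists>w M. \<exists>s>0. continuous_on (closure U \<inter> cball x r) w \<and>
        (\<forall>y\<in>closure U \<inter> cball x r. norm (w y) \<le> M \<and> (\<forall>t. 0 < t \<and> t < s \<longrightarrow> y + t *\<^sub>R w y \<in> U \<and>
            (y \<in> U \<longrightarrow> closed_segment y (y + t *\<^sub>R w y) \<subseteq> U)))"
  shows "\<exists>G. continuous_on (closure U) G \<and> (\<forall>x\<in>U. G x = F x)"
proof -
  \<comment> \<open>It suffices to extend \<open>F\<close> continuously to one closure point at a
    time.\<close>
  have ex: "\<exists>g. continuous_on (insert x U) g \<and> (\<forall>y\<in>U. g y = F y)" if x: "x \<in> closure U" for x
  proof (cases "x \<in> U")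
    case True
    then show ?thesis using F(2) by (metis insert_absorb)
  next
    case False
    then have "x \<in> frontier U" using x U by (simp add: frontier_def interior_open)
    from inward[OF this] obtain r w M s where r: "r > 0" and s: "s > 0" and w: "continuous_on (closure U \<inter> cball x r) w"
      and all: "\<forall>y\<in>closure U \<inter> cball x r. norm (w y) \<le> M \<and> (\<forall>t. 0 < t \<and> t < s \<longrightarrow> y + t *\<^sub>R w y \<in> U \<and>
            (y \<in> U \<longrightarrow> closed_segment y (y + t *\<^sub>R w y) \<subseteq> U))"
      by blast
    have wM: "norm (w y) \<le> M" if "y \<in> closure U \<inter> cball x r" for y using all that by blast
    have inU: "y + t *\<^sub>R w y \<in> U" if "y \<in> closure U \<inter> cball x r" "0 < t" "t < s" for y t using all that by blast
    have seg: "closed_segment y (y + t *\<^sub>R w y) \<subseteq> U" if y: "y \<in> U \<inter> cball x r" and t: "0 < t" "t < s" for y t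
    proof -
      have "y \<in> closure U \<inter> cball x r" using y closure_subset by blast
      then show ?thesis using all y t by blast
    qed
    let ?K = "closure U \<inter> cball x r"
    have K: "compact ?K" by (simp add: closed_Int_compact)
    have M0: "0 \<le> M" using wM[of x] x r by (metis IntI centre_in_cball less_imp_le norm_ge_zero order_trans)
    have uc: "uniformly_continuous_on (U \<inter> ball x r) F"
      unfolding uniformly_continuous_on_def
    proof (intro allI impI)
      fix e :: real assume e: "e > 0"
      \<comment> \<open>The shift is admissible below \<open>s\<close>, and it changes
        \<open>F\<close> by at most \<open>L * t * M\<close>, less than a third of the
        tolerance.\<close>
      define t where "t = min (s / 2) (e / (4 * (L * M + 1)))"
      have LM: "L * M + 1 > 0" using F(1) M0 by (simp add: add_nonneg_pos)
      have "t \<le> s / 2" by (simp only: t_def min.cobounded1)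
      moreover have "0 < t" using s e LM by (simp add: t_def)
      ultimately have t: "0 < t" "t < s" using s by linarith+
      have tLM: "L * (t * M) < e / 3"
      proof -
        have "t * (L * M) \<le> (e / (4 * (L * M + 1))) * (L * M)" using F(1) M0 by (intro mult_right_mono) (auto simp: t_def)
        also have "\<dots> \<le> e / 4" using e LM by (simp add: field_simps)
        also have "\<dots> < e / 3" using e by simp
        finally show ?thesis by (simp add: mult.left_commute)
      qed
      \<comment> \<open>For this fixed \<open>t\<close> the pushed points lie in \<open>U\<close>
        even when \<open>y\<close> is a boundary point, so the shifted function is continuous, hence
        uniformly continuous, on the compact set \<open>?K\<close>.\<close>
      have "continuous_on ?K (\<lambda>y. F (y + t *\<^sub>R w y))"
        by (rule continuous_on_compose2[OF F(2)]) (use inU t in \<open>auto intro!: continuous_intros w\<close>)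
      then have "uniformly_continuous_on ?K (\<lambda>y. F (y + t *\<^sub>R w y))" using K by (rule compact_uniformly_continuous)
      then have "\<exists>d>0. \<forall>y\<in>?K. \<forall>z\<in>?K. dist z y < d \<longrightarrow> dist (F (z + t *\<^sub>R w z)) (F (y + t *\<^sub>R w y)) < e / 3"
        unfolding uniformly_continuous_on_def using divide_pos_pos[OF e zero_less_numeral] by blast
      then obtain d where d: "d > 0" "\<forall>y\<in>?K. \<forall>z\<in>?K. dist z y < d \<longrightarrow> dist (F (z + t *\<^sub>R w z)) (F (y + t *\<^sub>R w y)) < e / 3"
        by (elim exE conjE)
      have near: "\<bar>F y - F (y + t *\<^sub>R w y)\<bar> < e / 3" if y: "y \<in> U \<inter> ball x r" for y
      proof -
        have yK: "y \<in> U \<inter> cball x r" "y \<in> ?K" using y closure_subset by auto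
        have "\<bar>F y - F (y + t *\<^sub>R w y)\<bar> \<le> L * norm (y - (y + t *\<^sub>R w y))" by (rule F(3)[OF seg[OF yK(1) t]])
        also have "\<dots> = L * (t * norm (w y))" using t by simp
        also have "\<dots> \<le> L * (t * M)" using wM[OF yK(2)] F(1) t by (intro mult_left_mono) auto
        finally show ?thesis using tLM by simp
      qed
      have arith: "\<bar>z' - y'\<bar> < e" if "\<bar>a - b\<bar> < e / 3" "\<bar>y' - b\<bar> < e / 3" "\<bar>z' - a\<bar> < e / 3" for a b y' z' :: real
        using that by (simp add: abs_if split: if_splits)
      have "dist (F z) (F y) < e" if "y \<in> U \<inter> ball x r" "z \<in> U \<inter> ball x r" "dist z y < d" for y z
      proof -
        have "y \<in> ?K" "z \<in> ?K" using that closure_subset by auto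
        then have "\<bar>F (z + t *\<^sub>R w z) - F (y + t *\<^sub>R w y)\<bar> < e / 3" using d(2) that(3) by (simp add: dist_real_def)
        from arith[OF this near[OF that(1)] near[OF that(2)]] show ?thesis by (simp add: dist_real_def)
      qed
      then show "\<exists>d>0. \<forall>y\<in>U \<inter> ball x r. \<forall>z\<in>U \<inter> ball x r. dist z y < d \<longrightarrow> dist (F z) (F y) < e" using d(1) by blast
    qed
    have "x \<in> closure (U \<inter> ball x r)"
      using x r open_Int_closure_subset[of "ball x r" U] by (auto simp: Int_commute)
    then obtain l where l: "(F \<longlongrightarrow> l) (at x within (U \<inter> ball x r))"
      using uniformly_continuous_on_extension_at_closure[OF uc] by blast
    then have l': "(F \<longlongrightarrow> l) (at x within U)"
      using at_within_nhd[of x "ball x r" "U \<inter> ball x r" U] r by auto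
    define g where "g = F(x := l)"
    have "continuous_on (insert x U) g"
      unfolding continuous_on_def
    proof
      fix y assume y: "y \<in> insert x U"
      show "(g \<longlongrightarrow> g y) (at y within insert x U)"
      proof (cases "y = x")
        case True
        have "(g \<longlongrightarrow> l) (at x within U)"
          using l' by (rule Lim_transform_eventually) (simp add: g_def eventually_at_filter)
        moreover have "at x within insert x U = at x within U" by (rule at_within_nhd[of x UNIV]) auto
        ultimately show ?thesis using True by (simp add: g_def)
      next
        case ne: False
        then have yU: "y \<in> U" using y by simp
        have "(F \<longlongrightarrow> F y) (at y)" using F(2) U yU by (simp add: continuous_on_eq_continuous_at isCont_def)
        moreover have "\<forall>\<^sub>F z in at y. F z = g z"
          using eventually_at_topological[of "\<lambda>z. F z = g z" y UNIV] ne U yU False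
          by (auto simp: g_def intro!: exI[of _ U])
        ultimately have "(g \<longlongrightarrow> F y) (at y)" by (rule Lim_transform_eventually)
        then show ?thesis using ne by (simp add: g_def tendsto_within_subset[where S=UNIV])
      qed
    qed
    moreover have "\<forall>y\<in>U. g y = F y" using False by (auto simp: g_def)
    ultimately show ?thesis by blast
  qed
  \<comment> \<open>The target space is regular, so the pointwise extensions from \<open>U\<close>
    combine to one continuous extension.\<close>
  obtain G where "continuous_map (subtopology euclidean (closure U)) (euclidean :: real topology) G" "\<And>x. x \<in> U \<Longrightarrow> G x = F x"
  proof (rule continuous_map_extension_pointwise[where X=euclidean and Y="euclidean :: real topology" and S=U and T="closure U" and f=F])
    show "regular_space (euclidean :: real topology)" by (simp add: metrizable_imp_regular_space metrizable_space_euclidean)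
    show "U \<subseteq> closure U" by (rule closure_subset)
    show "closure U \<subseteq> euclidean closure_of U" by simp
    show "\<exists>g. continuous_map (top_of_set (insert x U)) euclideanreal g \<and> (\<forall>x\<in>U. g x = F x)" if "x \<in> closure U" for x
      using ex[OF that] by simp
  qed (rule that)
  then show ?thesis by auto
qed

text \<open>The set of disagreement inside \<open>U\<close> is open and null, hence empty;
  continuity carries the equality to the closure.\<close>

lemma continuous_AE_eq_closure:
  fixes G G' :: "real^'n \<Rightarrow> 'b::metric_space"
  assumes U: "open U" and G: "continuous_on (closure U) G" "continuous_on (closure U) G'"
    and ae: "AE x in lebesgue_on U. G x = G' x" and x: "x \<in> closure U"
  shows "G x = G' x"
proof -
  let ?N = "{x\<in>U. dist (G x) (G' x) \<noteq> 0}"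
  have cont: "continuous_on (closure U) (\<lambda>x. dist (G x) (G' x))" by (intro continuous_intros G)
  have "openin (top_of_set U) (U \<inter> (\<lambda>x. dist (G x) (G' x)) -` (- {0}))"
    using continuous_on_subset[OF cont closure_subset] by (intro continuous_openin_preimage_gen) auto
  moreover have "U \<inter> (\<lambda>x. dist (G x) (G' x)) -` (- {0}) = ?N" by auto
  ultimately have "open ?N" using U openin_open_eq by metis
  moreover have "AE x in lebesgue. x \<in> U \<longrightarrow> G x = G' x" using ae U by (simp add: AE_restrict_space_iff)
  then have "AE x in lborel. x \<notin> ?N" by (simp add: AE_completion_iff)
  ultimately have "?N = {}" using open_not_AE_empty by blast
  then have "dist (G y) (G' y) = 0" if "y \<in> U" for y using that by blast
  then have "dist (G x) (G' x) = 0"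
    using continuous_constant_on_closure[OF cont _ x, of 0] by blast
  then show ?thesis by simp
qed

lemma cont_rep_props:
  fixes f :: "real^'n \<Rightarrow> 'b::metric_space"
  assumes "continuous_on (closure U) G" "AE x in lebesgue_on U. G x = f x"
  shows "continuous_on (closure U) (cont_rep U f)" "AE x in lebesgue_on U. cont_rep U f x = f x"
proof -
  have "continuous_on (closure U) (cont_rep U f) \<and> (AE x in lebesgue_on U. cont_rep U f x = f x)"
    unfolding cont_rep_def by (rule someI[of _ G]) (use assms in simp)
  then show "continuous_on (closure U) (cont_rep U f)" "AE x in lebesgue_on U. cont_rep U f x = f x" by auto
qed

text \<open>This removes the choice from \<open>cont_rep\<close>: any continuous representative that
  can be exhibited gives its values on the closure.\<close>

lemma cont_rep_eq:
  fixes f :: "real^'n \<Rightarrow> 'b::metric_space"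
  assumes "open U" "continuous_on (closure U) G" "AE x in lebesgue_on U. G x = f x" "x \<in> closure U"
  shows "cont_rep U f x = G x"
proof (rule continuous_AE_eq_closure[OF assms(1) cont_rep_props(1)[OF assms(2,3)] assms(2) _ assms(4)])
  show "AE x in lebesgue_on U. cont_rep U f x = G x"
    using cont_rep_props(2)[OF assms(2,3)] assms(3) by eventually_elim simp
qed

section \<open>Cut-off functions whose gradients converge to the surface measure\<close>

text \<open>Tietze's theorem, followed by a radial factor equal to 1 on a ball containing
  \<open>S\<close>. The compact support makes the extension uniformly continuous on the whole
  space.\<close>

lemma compactly_supported_extension:
  fixes G :: "real^'n \<Rightarrow> real^'n"
  assumes S: "compact S" and G: "continuous_on S G"
  shows "\<exists>H R. continuous_on UNIV H \<and> (\<forall>x\<in>S. H x = G x) \<and> (\<forall>x. R < norm x \<longrightarrow> H x = 0)"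
proof -
  have "bounded (G ` S)" using compact_continuous_image[OF G S] by (rule compact_imp_bounded)
  then obtain B where B: "\<forall>x\<in>S. norm (G x) \<le> B" by (auto simp: bounded_iff)
  obtain E where E: "continuous_on UNIV E" "\<And>x. x \<in> S \<Longrightarrow> E x = G x"
  proof (rule Tietze[OF G, of UNIV "max B 0"])
    show "closedin (top_of_set UNIV) S" using compact_imp_closed[OF S] by simp
  qed (use B in \<open>auto simp: le_max_iff_disj\<close>)
  obtain M where M: "\<forall>x\<in>S. norm x \<le> M" using compact_imp_bounded[OF S] by (auto simp: bounded_iff)
  define H where "H x = max 0 (min 1 (\<bar>M\<bar> + 1 - norm x)) *\<^sub>R E x" for x
  have "continuous_on UNIV H" unfolding H_def by (intro continuous_intros E(1))
  moreover have "H x = G x" if "x \<in> S" for x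
  proof -
    have "norm x \<le> \<bar>M\<bar>" using M that by fastforce
    then show ?thesis using E(2)[OF that] by (simp add: H_def)
  qed
  moreover have "H x = 0" if "\<bar>M\<bar> + 1 < norm x" for x using that by (simp add: H_def)
  ultimately show ?thesis by blast
qed

context flat_piece begin

text \<open>Fubini's theorem on the product with the slab, and evenness of the kernel.\<close>

lemma facet_integral_conv:
  fixes g :: "real^'n \<Rightarrow> real"
  assumes g: "integrable lborel g" and \<delta>: "\<delta> > 0"
  shows "(\<integral>z. g z * facet_integral e (\<lambda>p. moll \<delta> (z - p)) \<partial>lborel) = facet_integral e (conv g (moll \<delta>))"
    and "integrable lborel (\<lambda>z. g z * facet_integral e (\<lambda>p. moll \<delta> (z - p)))"
proof -
  obtain B where B: "\<And>z. \<bar>moll \<delta> (z::real^'n)\<bar> \<le> B" using moll_bounded[OF \<delta>] by blast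
  have [measurable]: "g \<in> borel_measurable borel" "moll \<delta> \<in> borel_measurable (borel :: (real^'n) measure)"
    using g moll_borel[OF \<delta>] by auto
  let ?\<Phi> = "\<lambda>z y. g z * (indicator (facet_slab e) y * moll \<delta> (z - facet_proj e y))"
  have ind: "integrable lborel (indicator (facet_slab e) :: real^'n \<Rightarrow> real)"
    using finite_facet_slab by (intro integrable_real_indicator) auto
  have int: "integrable (lborel \<Otimes>\<^sub>M lborel) (\<lambda>(z, y). ?\<Phi> z y)"
  proof (rule Bochner_Integration.integrable_bound)
    show "integrable (lborel \<Otimes>\<^sub>M lborel) (\<lambda>(z, y). (B * g z) * (indicator (facet_slab e) y :: real))"
      by (rule lborel_pair.Fubini_integrable) (use g ind in \<open>auto simp: abs_mult\<close>)
    show "(\<lambda>(z, y). ?\<Phi> z y) \<in> borel_measurable (lborel \<Otimes>\<^sub>M lborel)" by measurable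
    show "AE p in lborel \<Otimes>\<^sub>M lborel. norm (case p of (z, y) \<Rightarrow> ?\<Phi> z y) \<le> norm (case p of (z, y) \<Rightarrow> (B * g z) * (indicator (facet_slab e) y :: real))"
    proof (intro always_eventually allI)
      fix p :: "(real^'n) \<times> (real^'n)"
      obtain z y where p: "p = (z, y)" by (cases p)
      have "(\<bar>g z\<bar> * indicator (facet_slab e) y) * \<bar>moll \<delta> (z - facet_proj e y)\<bar> \<le> (\<bar>g z\<bar> * indicator (facet_slab e) y) * \<bar>B\<bar>"
        using B[of "z - facet_proj e y"] by (intro mult_left_mono) auto
      then show "norm (case p of (z, y) \<Rightarrow> ?\<Phi> z y) \<le> norm (case p of (z, y) \<Rightarrow> (B * g z) * (indicator (facet_slab e) y :: real))"
        by (simp add: p abs_mult mult_ac)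
    qed
  qed
  have cb: "cont_bdd e (\<lambda>p. moll \<delta> (z - p))" for z
    using continuous_on_subset[OF moll_translate(1)[OF \<delta>] subset_UNIV] B by (auto simp: cont_bdd_def bounded_iff)
  have fi: "facet_integral e (\<lambda>p. moll \<delta> (z - p)) = (\<integral>y. indicator (facet_slab e) y * moll \<delta> (z - facet_proj e y) \<partial>lborel)" for z
    using cont_bdd_integral[OF cb] by (simp add: set_lebesgue_integral_def)
  show "integrable lborel (\<lambda>z. g z * facet_integral e (\<lambda>p. moll \<delta> (z - p)))"
    using lborel_pair.integrable_fst[OF int] by (simp add: fi)
  have cc: "cont_bdd e (conv g (moll \<delta>))"
    by (rule cont_bdd_compact[OF continuous_on_subset[OF conv_moll_continuous[OF g \<delta>] subset_UNIV], of "closure e"])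
      (use bdd closure_subset in \<open>auto simp: compact_closure\<close>)
  have "(\<integral>z. g z * facet_integral e (\<lambda>p. moll \<delta> (z - p)) \<partial>lborel) = (\<integral>z. \<integral>y. ?\<Phi> z y \<partial>lborel \<partial>lborel)"
    by (simp add: fi)
  also have "\<dots> = (\<integral>y. \<integral>z. ?\<Phi> z y \<partial>lborel \<partial>lborel)"
    by (rule lborel_pair.Fubini_integral[symmetric]) (use int in simp)
  also have "\<dots> = (\<integral>y. indicator (facet_slab e) y * conv g (moll \<delta>) (facet_proj e y) \<partial>lborel)"
  proof (intro Bochner_Integration.integral_cong refl)
    fix y
    have "moll \<delta> (z - facet_proj e y) = moll \<delta> (facet_proj e y - z)" for z
      using moll_props(3)[OF \<delta>, of "facet_proj e y - z"] by simp
    then have "(\<integral>z. ?\<Phi> z y \<partial>lborel) = (\<integral>z. indicator (facet_slab e) y * (g z * moll \<delta> (facet_proj e y - z)) \<partial>lborel)"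
      by (simp add: mult_ac)
    then show "(\<integral>z. ?\<Phi> z y \<partial>lborel) = indicator (facet_slab e) y * conv g (moll \<delta>) (facet_proj e y)"
      by (simp add: conv_def)
  qed
  also have "\<dots> = facet_integral e (conv g (moll \<delta>))"
    using cont_bdd_integral[OF cc] by (simp add: set_lebesgue_integral_def)
  finally show "(\<integral>z. g z * facet_integral e (\<lambda>p. moll \<delta> (z - p)) \<partial>lborel) = facet_integral e (conv g (moll \<delta>))" .
qed

lemma facet_integral_tendsto:
  assumes f: "\<And>n. cont_bdd e (f n)" "cont_bdd e g"
    and unif: "\<And>\<epsilon>. \<epsilon> > 0 \<Longrightarrow> \<forall>\<^sub>F n in sequentially. \<forall>x\<in>e. \<bar>f n x - g x\<bar> \<le> \<epsilon>"
  shows "(\<lambda>n. facet_integral e (f n)) \<longlonglongrightarrow> facet_integral e g"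
proof -
  define A where "A = facet_integral e (\<lambda>_. 1)"
  have A: "A \<ge> 0" unfolding A_def by (rule facet_integral_nonneg) simp
  have one: "cont_bdd e (\<lambda>_. c)" for c :: real by (auto simp: cont_bdd_def bounded_iff)
  have const: "facet_integral e (\<lambda>_. c) = c * A" for c
    using facet_integral_cmult[of e c "\<lambda>_. 1"] by (simp add: A_def)
  show ?thesis
  proof (rule tendstoI)
    fix \<epsilon> :: real assume "\<epsilon> > 0"
    define \<eta> where "\<eta> = (\<epsilon> / 2) / (A + 1)"
    have A1: "A + 1 \<noteq> 0" using A by linarith
    have \<eta>: "\<eta> > 0" using \<open>\<epsilon> > 0\<close> A by (simp add: \<eta>_def)
    have "\<eta> * A \<le> \<eta> * (A + 1)" using \<eta> by simp
    also have "\<dots> = \<epsilon> / 2" using A1 unfolding \<eta>_def by (metis nonzero_divide_eq_eq)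
    also have "\<dots> < \<epsilon>" using \<open>\<epsilon> > 0\<close> by simp
    finally have \<eta>A: "\<eta> * A < \<epsilon>" .
    show "\<forall>\<^sub>F n in sequentially. dist (facet_integral e (f n)) (facet_integral e g) < \<epsilon>"
      using unif[OF \<eta>]
    proof eventually_elim
      case (elim n)
      have "facet_integral e (f n) \<le> facet_integral e (\<lambda>x. g x + \<eta>)"
        by (rule facet_integral_mono[OF f(1) cont_bdd_add[OF f(2) one]]) (use elim in fastforce)
      moreover have "facet_integral e g \<le> facet_integral e (\<lambda>x. f n x + \<eta>)"
        by (rule facet_integral_mono[OF f(2) cont_bdd_add[OF f(1) one]]) (use elim in fastforce)
      ultimately have "\<bar>facet_integral e (f n) - facet_integral e g\<bar> \<le> \<eta> * A"
        by (simp add: facet_integral_add[OF f(1) one] facet_integral_add[OF f(2) one] const abs_le_iff)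
      then show ?case using \<eta>A by (simp add: dist_real_def)
    qed
  qed
qed

end

context polytopal begin

lemma borel_U [measurable]: "U \<in> sets borel" using open_U by simp

lemma integrable_indicator_U: "integrable lborel (indicator U :: real^'n \<Rightarrow> real)"
  using emeasure_bounded_finite[OF bounded_U] by (intro integrable_real_indicator) auto

text \<open>The gradient in \<open>z\<close> of the kernel is minus its gradient in the integration
  variable, and the divergence theorem turns the latter, integrated over \<open>U\<close>, into
  facet integrals. The result is the mollified surface measure weighted by the inward
  normal.\<close>

lemma grad_conv_indicator:
  fixes g :: "real^'n"
  assumes \<delta>: "\<delta> > 0"
  shows "grad (conv (indicator U) (moll \<delta>)) z \<bullet> g
    = - (\<Sum>e\<in>facets U. (normal_on U e \<bullet> g) * facet_integral e (\<lambda>p. moll \<delta> (z - p)))"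
proof -
  have \<rho>: "C1c (moll \<delta> :: real^'n \<Rightarrow> real)" by (rule moll_C1c[OF \<delta>])
  have \<rho>0: "moll \<delta> w = 0" if "\<delta> < norm w" for w :: "real^'n" using that by (simp add: moll_props(2)[OF \<delta>])
  have gr: "grad (\<lambda>p. moll \<delta> (z - p)) = (\<lambda>p. - grad (moll \<delta>) (z - p))"
    by (rule test_function_reflect(2)[OF \<rho> \<rho>0 subset_UNIV])
  have tf: "test_function UNIV (\<lambda>p. moll \<delta> (z - p))"
    by (rule test_function_reflect(1)[OF \<rho> \<rho>0 subset_UNIV])
  have c1: "C1c (\<lambda>p. moll \<delta> (z - p))"
  proof -
    have "moll \<delta> (z - p) = 0" if "norm z + \<delta> < norm p" for p
      using that norm_triangle_ineq2[of p z] by (intro \<rho>0) (simp add: norm_minus_commute)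
    then show ?thesis using tf unfolding C1c_def test_function_def by blast
  qed
  obtain B where B: "\<And>w. norm (grad (moll \<delta>) (w::real^'n)) \<le> B" using C1c_bounded(2)[OF \<rho>] by blast
  have int: "integrable lborel (\<lambda>y. indicator U y *\<^sub>R grad (moll \<delta>) (z - y))"
    by (rule conv_integrable[OF integrable_indicator_U _ B]) (intro borel_measurable_continuous_onI C1c_grad_continuous \<rho>)
  have "grad (conv (indicator U) (moll \<delta>)) z \<bullet> g = (\<integral>y. (indicator U y *\<^sub>R grad (moll \<delta>) (z - y)) \<bullet> g \<partial>lborel)"
    unfolding conv_C1(2)[OF integrable_indicator_U \<rho>] conv_def
    by (rule integral_inner_left[symmetric]) (use int in simp)
  also have "\<dots> = - (\<integral>y. indicator U y * (grad (\<lambda>p. moll \<delta> (z - p)) y \<bullet> g) \<partial>lborel)"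
    unfolding gr by simp
  also have "\<dots> = - (\<Sum>e\<in>facets U. (normal_on U e \<bullet> g) * facet_integral e (\<lambda>p. moll \<delta> (z - p)))"
    using divergence_theorem[OF c1, of g] by simp
  finally show ?thesis .
qed

lemma integral_grad_conv_indicator:
  fixes H :: "real^'n \<Rightarrow> real^'n"
  assumes \<delta>: "\<delta> > 0" and H: "\<And>n. integrable lborel (\<lambda>z. n \<bullet> H z)"
  shows "(\<integral>z. H z \<bullet> grad (conv (indicator U) (moll \<delta>)) z \<partial>lborel)
    = - (\<Sum>e\<in>facets U. facet_integral e (conv (\<lambda>z. normal_on U e \<bullet> H z) (moll \<delta>)))"
proof -
  have "(\<integral>z. H z \<bullet> grad (conv (indicator U) (moll \<delta>)) z \<partial>lborel)
    = (\<integral>z. - (\<Sum>e\<in>facets U. (normal_on U e \<bullet> H z) * facet_integral e (\<lambda>p. moll \<delta> (z - p))) \<partial>lborel)"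
    by (simp add: inner_commute[of "H _"] grad_conv_indicator[OF \<delta>])
  also have "\<dots> = - (\<Sum>e\<in>facets U. \<integral>z. (normal_on U e \<bullet> H z) * facet_integral e (\<lambda>p. moll \<delta> (z - p)) \<partial>lborel)"
  proof -
    have "integrable lborel (\<lambda>z. (normal_on U e \<bullet> H z) * facet_integral e (\<lambda>p. moll \<delta> (z - p)))" if "e \<in> facets U" for e
      using facet_props(1)[OF that] flat_piece.facet_integral_conv(2)[OF _ H \<delta>] by blast
    then show ?thesis by simp
  qed
  also have "\<dots> = - (\<Sum>e\<in>facets U. facet_integral e (conv (\<lambda>z. normal_on U e \<bullet> H z) (moll \<delta>)))"
  proof -
    have "(\<integral>z. (normal_on U e \<bullet> H z) * facet_integral e (\<lambda>p. moll \<delta> (z - p)) \<partial>lborel)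
      = facet_integral e (conv (\<lambda>z. normal_on U e \<bullet> H z) (moll \<delta>))" if "e \<in> facets U" for e
      using facet_props(1)[OF that] flat_piece.facet_integral_conv(1)[OF _ H \<delta>] by blast
    then show ?thesis by simp
  qed
  finally show ?thesis .
qed

text \<open>The indicator function of \<open>U\<close> is mollified and then contracted towards \<open>c\<close>, which moves its
  support into \<open>U\<close>.\<close>

definition contracted_cutoff :: "real^'n \<Rightarrow> real \<Rightarrow> real \<Rightarrow> real^'n \<Rightarrow> real" where
  "contracted_cutoff c \<mu> \<delta> x = conv (indicator U) (moll \<delta>) ((c - \<mu> *\<^sub>R c) + \<mu> *\<^sub>R x)"

lemma contracted_cutoff_derivative:
  assumes \<delta>: "\<delta> > 0"
  shows "(contracted_cutoff c \<mu> \<delta> has_derivative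
     (\<lambda>w. (\<mu> *\<^sub>R grad (conv (indicator U) (moll \<delta>)) ((c - \<mu> *\<^sub>R c) + \<mu> *\<^sub>R x)) \<bullet> w)) (at x)"
proof -
  have "((\<lambda>x. (c - \<mu> *\<^sub>R c) + \<mu> *\<^sub>R x) has_derivative (\<lambda>w. \<mu> *\<^sub>R w)) (at x)"
    by (auto intro!: derivative_eq_intros)
  from has_derivative_compose[OF this test_function_has_derivative[OF conv_C1(1)[OF integrable_indicator_U moll_C1c[OF \<delta>]]]]
  show ?thesis unfolding contracted_cutoff_def[abs_def] by simp
qed

lemma conv_indicator_bounds:
  assumes \<delta>: "\<delta> > 0"
  shows "0 \<le> conv (indicator U) (moll \<delta>) z" "conv (indicator U) (moll \<delta>) z \<le> 1"
    "conv (indicator U) (moll \<delta>) z \<noteq> 0 \<Longrightarrow> \<exists>y\<in>U. norm (z - y) < \<delta>"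
    "cball z \<delta> \<subseteq> U \<Longrightarrow> conv (indicator U) (moll \<delta>) z = 1"
proof -
  show "0 \<le> conv (indicator U) (moll \<delta>) z"
    unfolding conv_def by (rule Bochner_Integration.integral_nonneg) (simp add: moll_props(1)[OF \<delta>])
  have "\<bar>conv (indicator U) (moll \<delta>) z\<bar> \<le> 1"
    by (rule conv_moll_bound[OF \<delta> integrable_indicator_U]) (simp add: indicator_def)
  then show "conv (indicator U) (moll \<delta>) z \<le> 1" by simp
  show "\<exists>y\<in>U. norm (z - y) < \<delta>" if ne: "conv (indicator U) (moll \<delta>) z \<noteq> 0"
  proof (rule ccontr)
    assume no: "\<not> (\<exists>y\<in>U. norm (z - y) < \<delta>)"
    have "\<bar>conv (indicator U) (moll \<delta>) z - 0\<bar> \<le> 0"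
      by (rule conv_moll_close[OF \<delta> integrable_indicator_U]) (use no in \<open>auto simp: indicator_def\<close>)
    then show False using ne by simp
  qed
  show "conv (indicator U) (moll \<delta>) z = 1" if sub: "cball z \<delta> \<subseteq> U"
  proof -
    have "\<bar>conv (indicator U) (moll \<delta>) z - 1\<bar> \<le> 0"
    proof (rule conv_moll_close[OF \<delta> integrable_indicator_U])
      fix y assume "norm (z - y) < \<delta>"
      then have "y \<in> U" using sub by (auto simp: dist_norm)
      then show "\<bar>indicator U y - 1\<bar> \<le> (0::real)" by simp
    qed
    then show ?thesis by simp
  qed
qed

text \<open>Mollifying the indicator produces the correct gradient in the limit but a support that
  leaks out of \<open>U\<close>; the dilation by \<open>\<mu> n > 1\<close> inside the argument
  pulls it back. Substituting in the integral costs \<open>\<mu> n\<close> from the chain rule and a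
  negative power of \<open>\<mu> n\<close> from the volume, both tending to 1.\<close>

lemma cutoff_sequence:
  assumes contract: "\<And>x t. x \<in> closure U \<Longrightarrow> 0 < t \<Longrightarrow> t \<le> 1 \<Longrightarrow> x + t *\<^sub>R (c - x) \<in> U"
  shows "\<exists>\<zeta>. (\<forall>n. test_function U (\<zeta> n)) \<and> (\<forall>n x. 0 \<le> \<zeta> n x \<and> \<zeta> n x \<le> 1) \<and> (\<forall>x\<in>U. (\<lambda>n. \<zeta> n x) \<longlonglongrightarrow> 1) \<and>
    (\<forall>G :: real^'n \<Rightarrow> real^'n. continuous_on (closure U) G \<longrightarrow>
       (\<lambda>n. \<integral>x. indicator U x * (G x \<bullet> grad (\<zeta> n) x) \<partial>lborel) \<longlonglongrightarrow>
         - (\<Sum>e\<in>facets U. facet_integral e (\<lambda>x. normal_on U e \<bullet> G x)))"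
proof -
  define \<mu> where "\<mu> n = 1 + 1 / real (Suc n)" for n
  have \<mu>: "\<mu> n > 1" for n by (simp add: \<mu>_def)
  have \<mu>lim: "\<mu> \<longlonglongrightarrow> 1" unfolding \<mu>_def using tendsto_add[OF tendsto_const inverse_Suc_tendsto, of 1] by simp
  have cU: "compact (closure U)" using bounded_U by (simp add: compact_closure)
  \<comment> \<open>The inverse of the dilation in the cut-off; it maps the closure of
    \<open>U\<close> into \<open>U\<close> because of the contraction hypothesis.\<close>
  define s where "s n z = c + (1 / \<mu> n) *\<^sub>R (z - c)" for n z
  have s_inv: "s n ((c - \<mu> n *\<^sub>R c) + \<mu> n *\<^sub>R x) = x" "(c - \<mu> n *\<^sub>R c) + \<mu> n *\<^sub>R s n x = x" for n x
    using \<mu>[of n] by (simp_all add: s_def algebra_simps)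
  have s_cont: "continuous_on A (s n)" for n A unfolding s_def by (intro continuous_intros)
  have s_in: "s n ` closure U \<subseteq> U" for n
  proof
    fix y assume "y \<in> s n ` closure U"
    then obtain x where x: "x \<in> closure U" "y = s n x" by blast
    have "y = x + (1 - 1 / \<mu> n) *\<^sub>R (c - x)" using x by (simp add: s_def algebra_simps)
    then show "y \<in> U" using contract[OF x(1), of "1 - 1 / \<mu> n"] \<mu>[of n] by simp
  qed
  have "\<exists>d>0. (\<Union>x\<in>s n ` closure U. cball x d) \<subseteq> U" for n
    using compact_subset_open_imp_cball_epsilon_subset[OF compact_continuous_image[OF s_cont cU] open_U s_in] by metis
  then obtain d where d: "\<And>n. d n > 0" "\<And>n. (\<Union>x\<in>s n ` closure U. cball x (d n)) \<subseteq> U" by metis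
  \<comment> \<open>\<open>d n\<close> is the room left around the contracted closure, so the
    mollified support still fits into \<open>U\<close>; the other bound lets the radius tend to
    0.\<close>
  define \<delta> where "\<delta> n = min (d n) (1 / real (Suc n))" for n
  have \<delta>: "\<delta> n > 0" "\<delta> n \<le> d n" "\<delta> n \<le> 1 / real (Suc n)" for n using d(1)[of n] by (auto simp: \<delta>_def)
  define \<zeta> where "\<zeta> n = contracted_cutoff c (\<mu> n) (\<delta> n)" for n
  have D: "(\<zeta> n has_derivative (\<lambda>w. (\<mu> n *\<^sub>R grad (conv (indicator U) (moll (\<delta> n))) ((c - \<mu> n *\<^sub>R c) + \<mu> n *\<^sub>R x)) \<bullet> w)) (at x)" for n x
    unfolding \<zeta>_def by (rule contracted_cutoff_derivative[OF \<delta>(1)])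
  note gr = grad_unique[OF D]
  have grc: "continuous_on UNIV (grad (\<zeta> n))" for n
    unfolding gr(1)[abs_def]
    by (intro continuous_intros continuous_on_compose2[OF conv_C1(3)[OF integrable_indicator_U moll_C1c[OF \<delta>(1)]]]) auto
  \<comment> \<open>The contracted \<open>\<delta> n\<close>-neighbourhood of the closure: a compact
    set in \<open>U\<close> outside which the cut-off vanishes.\<close>
  define Q where "Q n = s n ` {x + y |x y. x \<in> closure U \<and> y \<in> cball 0 (\<delta> n)}" for n
  have Qc: "compact (Q n)" for n
    unfolding Q_def by (intro compact_continuous_image s_cont compact_sums cU compact_cball)
  have QU: "Q n \<subseteq> U" for n
  proof
    fix w assume "w \<in> Q n"
    then obtain x y where xy: "x \<in> closure U" "norm y \<le> \<delta> n" "w = s n (x + y)" unfolding Q_def by auto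
    have "w - s n x = (1 / \<mu> n) *\<^sub>R y" using xy(3) by (simp add: s_def algebra_simps)
    then have "norm (w - s n x) = norm y / \<mu> n" using \<mu>[of n] by simp
    also have "\<dots> \<le> norm y" using mult_left_mono[of 1 "\<mu> n" "norm y"] \<mu>[of n] by (simp add: divide_le_eq)
    finally have "norm (w - s n x) \<le> d n" using xy(2) \<delta>(2)[of n] by simp
    then have "w \<in> cball (s n x) (d n)" by (simp add: dist_norm norm_minus_commute)
    then show "w \<in> U" using d(2)[of n] xy(1) by blast
  qed
  have \<zeta>Q: "\<zeta> n x = 0" if "x \<notin> Q n" for n x
  proof (rule ccontr)
    assume "\<zeta> n x \<noteq> 0"
    then obtain y where y: "y \<in> U" "norm (((c - \<mu> n *\<^sub>R c) + \<mu> n *\<^sub>R x) - y) < \<delta> n"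
      using conv_indicator_bounds(3)[OF \<delta>(1)] unfolding \<zeta>_def contracted_cutoff_def by blast
    let ?z = "(c - \<mu> n *\<^sub>R c) + \<mu> n *\<^sub>R x"
    have "?z = y + (?z - y)" by simp
    moreover have "y \<in> closure U" "?z - y \<in> cball 0 (\<delta> n)" using y closure_subset by auto
    ultimately have "?z \<in> {x + y |x y. x \<in> closure U \<and> y \<in> cball 0 (\<delta> n)}" by blast
    then have "s n ?z \<in> Q n" unfolding Q_def by blast
    then show False using that s_inv(1) by simp
  qed
  have test: "test_function U (\<zeta> n)" for n
    unfolding test_function_def using Qc QU \<zeta>Q
    by (intro conjI allI gr(2) grc exI[of _ "Q n"] impI) auto
  have bounds: "0 \<le> \<zeta> n x \<and> \<zeta> n x \<le> 1" for n x
    unfolding \<zeta>_def contracted_cutoff_def using conv_indicator_bounds(1,2)[OF \<delta>(1)] by blast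
  have to1: "(\<lambda>n. \<zeta> n x) \<longlonglongrightarrow> 1" if x: "x \<in> U" for x
  proof -
    obtain r where r: "r > 0" "cball x r \<subseteq> U" using open_U x open_contains_cball by blast
    have "(\<lambda>n. 1 / real (Suc n) * (norm (x - c) + 1)) \<longlonglongrightarrow> 0 * (norm (x - c) + 1)"
      by (intro tendsto_intros inverse_Suc_tendsto)
    then have "\<forall>\<^sub>F n in sequentially. 1 / real (Suc n) * (norm (x - c) + 1) < r"
      using order_tendstoD(2) r(1) by fastforce
    then have "\<forall>\<^sub>F n in sequentially. \<zeta> n x = 1"
    proof eventually_elim
      case (elim n)
      let ?z = "(c - \<mu> n *\<^sub>R c) + \<mu> n *\<^sub>R x"
      have "?z - x = (1 / real (Suc n)) *\<^sub>R (x - c)" by (simp add: \<mu>_def algebra_simps)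
      then have "norm (?z - x) = 1 / real (Suc n) * norm (x - c)" by simp
      then have "dist ?z x + \<delta> n \<le> r" using elim \<delta>(3)[of n] by (simp add: dist_norm distrib_left)
      then have "cball ?z (\<delta> n) \<subseteq> cball x r" by (simp add: cball_subset_cball_iff)
      then have "cball ?z (\<delta> n) \<subseteq> U" using r(2) by blast
      then show ?case unfolding \<zeta>_def contracted_cutoff_def by (rule conv_indicator_bounds(4)[OF \<delta>(1)])
    qed
    then show ?thesis by (rule tendsto_eventually)
  qed
  have limit: "(\<lambda>n. \<integral>x. indicator U x * (G x \<bullet> grad (\<zeta> n) x) \<partial>lborel) \<longlonglongrightarrow>
         - (\<Sum>e\<in>facets U. facet_integral e (\<lambda>x. normal_on U e \<bullet> G x))"
    if G: "continuous_on (closure U) G" for G :: "real^'n \<Rightarrow> real^'n"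
  proof -
    obtain H R where H: "continuous_on UNIV H" "\<And>x. x \<in> closure U \<Longrightarrow> H x = G x" "\<And>x. R < norm x \<Longrightarrow> H x = 0"
      using compactly_supported_extension[OF cU G] by blast
    \<comment> \<open>\<open>H\<close> expressed in the dilated variable, in which the cut-off is a
      plain mollified indicator.\<close>
    define Hn where "Hn n z = H (s n z)" for n z
    have Hnc: "continuous_on UNIV (Hn n)" for n
      unfolding Hn_def by (rule continuous_on_compose2[OF H(1) s_cont]) auto
    have Hn0: "Hn n z = 0" if z: "\<mu> n * (\<bar>R\<bar> + norm c) + norm c < norm z" for n z
    proof -
      have "\<mu> n *\<^sub>R (s n z - c) = z - c" using \<mu>[of n] by (simp add: s_def)
      then have "\<mu> n * norm (s n z - c) = norm (z - c)" using \<mu>[of n] by (metis abs_of_pos less_trans norm_scaleR zero_less_one)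
      moreover have "norm (z - c) \<ge> norm z - norm c" by (rule norm_triangle_ineq2)
      ultimately have "\<mu> n * (\<bar>R\<bar> + norm c) < \<mu> n * norm (s n z - c)" using z by linarith
      then have "\<bar>R\<bar> + norm c < norm (s n z - c)" using \<mu>[of n] by simp
      moreover have "norm (s n z - c) \<le> norm (s n z) + norm c" by (rule norm_triangle_ineq4)
      ultimately show ?thesis using H(3)[of "s n z"] by (simp add: Hn_def)
    qed
    have Hnint: "integrable lborel (\<lambda>z. w \<bullet> Hn n z)" for w n
      by (rule integrable_compact_support[where R="\<mu> n * (\<bar>R\<bar> + norm c) + norm c"])
        (use Hn0 in \<open>auto intro!: continuous_intros Hnc\<close>)
    let ?\<theta> = "\<lambda>n. conv (indicator U) (moll (\<delta> n))"
    have \<theta>c: "continuous_on UNIV (grad (?\<theta> n))" for n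
      by (rule conv_C1(3)[OF integrable_indicator_U moll_C1c[OF \<delta>(1)]])
    have expr: "(\<integral>x. indicator U x * (G x \<bullet> grad (\<zeta> n) x) \<partial>lborel)
       = (\<mu> n / (\<mu> n) ^ CARD('n)) * - (\<Sum>e\<in>facets U. facet_integral e (conv (\<lambda>z. normal_on U e \<bullet> Hn n z) (moll (\<delta> n))))" for n
    proof -
      have "indicator U x * (G x \<bullet> grad (\<zeta> n) x) = H x \<bullet> grad (\<zeta> n) x" for x
      proof (cases "x \<in> U")
        case True
        then show ?thesis using H(2)[of x] closure_subset[of U] by auto
      next
        case False
        then have "x \<in> - Q n" using QU by blast
        then have "grad (\<zeta> n) x = grad (\<lambda>_. 0) x"
          by (intro grad_cong_open[of "- Q n"]) (use Qc compact_imp_closed \<zeta>Q in \<open>auto simp: open_Compl\<close>)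
        also have "\<dots> = 0" by (simp add: grad_def vec_eq_iff frechet_derivative_const)
        finally show ?thesis using False by simp
      qed
      then have "(\<integral>x. indicator U x * (G x \<bullet> grad (\<zeta> n) x) \<partial>lborel) = (\<integral>x. H x \<bullet> grad (\<zeta> n) x \<partial>lborel)"
        by simp
      also have "\<dots> = (\<integral>x. (\<lambda>z. \<mu> n * (Hn n z \<bullet> grad (?\<theta> n) z)) ((c - \<mu> n *\<^sub>R c) + \<mu> n *\<^sub>R x) \<partial>lborel)"
        by (simp add: gr(1) Hn_def s_inv(1))
      also have "\<dots> = (1 / (\<mu> n) ^ CARD('n)) * (\<integral>z. \<mu> n * (Hn n z \<bullet> grad (?\<theta> n) z) \<partial>lborel)"
      proof -
        have "(\<lambda>z. \<mu> n * (Hn n z \<bullet> grad (?\<theta> n) z)) \<in> borel_measurable borel"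
          by (intro borel_measurable_continuous_onI continuous_intros Hnc \<theta>c)
        from lborel_integral_affine[OF this, of "\<mu> n" "c - \<mu> n *\<^sub>R c"] \<mu>[of n]
        show ?thesis by simp
      qed
      also have "(\<integral>z. \<mu> n * (Hn n z \<bullet> grad (?\<theta> n) z) \<partial>lborel) = \<mu> n * (\<integral>z. Hn n z \<bullet> grad (?\<theta> n) z \<partial>lborel)" by simp
      finally show ?thesis unfolding integral_grad_conv_indicator[OF \<delta>(1) Hnint] by simp
    qed
    have flim: "(\<lambda>n. facet_integral e (conv (\<lambda>z. normal_on U e \<bullet> Hn n z) (moll (\<delta> n)))) \<longlonglongrightarrow> facet_integral e (\<lambda>x. normal_on U e \<bullet> G x)"
      if e: "e \<in> facets U" for e
    proof -
      obtain b where fp: "flat_piece e (normal_on U e) b" using facet_props(1)[OF e] by blast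
      interpret flat_piece e "normal_on U e" b by fact
      have eU: "e \<subseteq> closure U" using facet_props(5)[OF e] by (auto simp: frontier_def)
      obtain M where M: "\<And>x. x \<in> closure U \<Longrightarrow> norm (x - c) \<le> M"
      proof -
        have "bounded ((\<lambda>x. x - c) ` closure U)"
          by (intro compact_imp_bounded compact_continuous_image cU continuous_intros)
        then show thesis using that by (auto simp: bounded_iff)
      qed
      show ?thesis
      proof (rule facet_integral_tendsto)
        show "cont_bdd e (conv (\<lambda>z. normal_on U e \<bullet> Hn n z) (moll (\<delta> n)))" for n
          by (rule cont_bdd_compact[OF continuous_on_subset[OF conv_moll_continuous[OF Hnint \<delta>(1)] subset_UNIV] cU eU])
        show "cont_bdd e (\<lambda>x. normal_on U e \<bullet> G x)"
          by (rule cont_bdd_compact[OF _ cU eU]) (intro continuous_intros G)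
        fix \<epsilon> :: real assume \<epsilon>: "\<epsilon> > 0"
        obtain \<eta> where \<eta>: "\<eta> > 0" "\<And>x y. dist x y < \<eta> \<Longrightarrow> dist (H x) (H y) < \<epsilon>"
          using compact_support_uniformly_continuous[OF H(1) H(3) \<epsilon>] by blast
        have "(\<lambda>n. 1 / real (Suc n) * (1 + M)) \<longlonglongrightarrow> 0 * (1 + M)"
          by (intro tendsto_intros inverse_Suc_tendsto)
        then have "\<forall>\<^sub>F n in sequentially. 1 / real (Suc n) * (1 + M) < \<eta>"
          using order_tendstoD(2) \<eta>(1) by fastforce
        then show "\<forall>\<^sub>F n in sequentially. \<forall>x\<in>e. \<bar>conv (\<lambda>z. normal_on U e \<bullet> Hn n z) (moll (\<delta> n)) x - normal_on U e \<bullet> G x\<bar> \<le> \<epsilon>"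
        proof eventually_elim
          case (elim n)
          show ?case
          proof
            fix p assume p: "p \<in> e"
            then have pU: "p \<in> closure U" using eU by blast
            show "\<bar>conv (\<lambda>z. normal_on U e \<bullet> Hn n z) (moll (\<delta> n)) p - normal_on U e \<bullet> G p\<bar> \<le> \<epsilon>"
            proof (rule conv_moll_close[OF \<delta>(1) Hnint])
              fix z assume z: "norm (p - z) < \<delta> n"
              \<comment> \<open>The displacement splits into the mollification error
                \<open>z - p\<close> and the effect of the contraction on \<open>p\<close>; both are
                of order 1/(n+1), uniformly over the facet.\<close>
              have "s n z - p = (1 / \<mu> n) *\<^sub>R ((z - p) - (\<mu> n - 1) *\<^sub>R (p - c))"
                using \<mu>[of n] by (simp add: s_def algebra_simps)
              then have "norm (s n z - p) = norm ((z - p) - (\<mu> n - 1) *\<^sub>R (p - c)) / \<mu> n" using \<mu>[of n] by simp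
              also have "\<dots> \<le> norm ((z - p) - (\<mu> n - 1) *\<^sub>R (p - c)) / 1"
                using \<mu>[of n] by (intro divide_left_mono) auto
              also have "\<dots> = norm ((z - p) - (\<mu> n - 1) *\<^sub>R (p - c))" by simp
              also have "\<dots> \<le> norm (z - p) + norm ((\<mu> n - 1) *\<^sub>R (p - c))"
                by (rule norm_triangle_ineq4)
              also have "norm ((\<mu> n - 1) *\<^sub>R (p - c)) = 1 / real (Suc n) * norm (p - c)" by (simp add: \<mu>_def)
              also have "\<dots> \<le> 1 / real (Suc n) * M" using M[OF pU] by (intro mult_left_mono) auto
              also have "norm (z - p) \<le> 1 / real (Suc n)" using z \<delta>(3)[of n] by (simp add: norm_minus_commute)
              finally have "norm (s n z - p) \<le> 1 / real (Suc n) * (1 + M)" by (simp add: distrib_left)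
              then have "dist (s n z) p < \<eta>" using elim by (simp add: dist_norm)
              then have "dist (H (s n z)) (H p) < \<epsilon>" by (rule \<eta>(2))
              then have "norm (Hn n z - G p) \<le> \<epsilon>" using H(2)[OF pU] by (simp add: Hn_def dist_norm)
              moreover have "\<bar>normal_on U e \<bullet> (Hn n z - G p)\<bar> \<le> norm (Hn n z - G p)"
                using Cauchy_Schwarz_ineq2[of "normal_on U e" "Hn n z - G p"] unit by simp
              ultimately show "\<bar>normal_on U e \<bullet> Hn n z - normal_on U e \<bullet> G p\<bar> \<le> \<epsilon>"
                by (simp add: inner_diff_right)
            qed
          qed
        qed
      qed
    qed
    have "(\<lambda>n. (\<mu> n / (\<mu> n) ^ CARD('n)) * - (\<Sum>e\<in>facets U. facet_integral e (conv (\<lambda>z. normal_on U e \<bullet> Hn n z) (moll (\<delta> n)))))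
       \<longlonglongrightarrow> (1 / 1 ^ CARD('n)) * - (\<Sum>e\<in>facets U. facet_integral e (\<lambda>x. normal_on U e \<bullet> G x))"
      by (intro tendsto_intros \<mu>lim flim) auto
    then show ?thesis unfolding expr by simp
  qed
  show ?thesis by (intro exI[of _ \<zeta>] conjI allI ballI impI test to1 limit) (use bounds in auto)
qed

end

section \<open>Polynomials\<close>

lemma finite_multi_indices: "finite {a :: 'n::finite \<Rightarrow> nat. (\<Sum>i\<in>UNIV. a i) \<le> p}"
proof (rule finite_subset)
  show "{a :: 'n \<Rightarrow> nat. (\<Sum>i\<in>UNIV. a i) \<le> p} \<subseteq> PiE UNIV (\<lambda>_. {..p})"
  proof
    fix a :: "'n \<Rightarrow> nat" assume "a \<in> {a. (\<Sum>i\<in>UNIV. a i) \<le> p}"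
    moreover have "a i \<le> (\<Sum>i\<in>UNIV. a i)" for i by (rule member_le_sum) auto
    ultimately show "a \<in> PiE UNIV (\<lambda>_. {..p})" by (auto intro: order_trans)
  qed
  show "finite (PiE (UNIV :: 'n set) (\<lambda>_. {..p}))" by (rule finite_PiE) auto
qed

lemma poly_space_add:
  assumes "f \<in> poly_space p" "g \<in> poly_space p"
  shows "(\<lambda>x. f x + g x) \<in> poly_space p"
proof -
  obtain c d where "\<And>x. f x = (\<Sum>a | (\<Sum>i\<in>UNIV. a i) \<le> p. c a * (\<Prod>i\<in>UNIV. (x $ i) ^ a i))"
     "\<And>x. g x = (\<Sum>a | (\<Sum>i\<in>UNIV. a i) \<le> p. d a * (\<Prod>i\<in>UNIV. (x $ i) ^ a i))"
    using assms unfolding poly_space_def by blast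
  then have "f x + g x = (\<Sum>a | (\<Sum>i\<in>UNIV. a i) \<le> p. (c a + d a) * (\<Prod>i\<in>UNIV. (x $ i) ^ a i))" for x
    by (simp add: distrib_right sum.distrib)
  then show ?thesis unfolding poly_space_def by (intro CollectI exI[of _ "\<lambda>a. c a + d a"]) simp
qed

lemma poly_space_cmult:
  assumes "f \<in> poly_space p"
  shows "(\<lambda>x. k * f x) \<in> poly_space p"
proof -
  obtain c where "\<And>x. f x = (\<Sum>a | (\<Sum>i\<in>UNIV. a i) \<le> p. c a * (\<Prod>i\<in>UNIV. (x $ i) ^ a i))"
    using assms unfolding poly_space_def by blast
  then have "k * f x = (\<Sum>a | (\<Sum>i\<in>UNIV. a i) \<le> p. (k * c a) * (\<Prod>i\<in>UNIV. (x $ i) ^ a i))" for x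
    by (simp add: sum_distrib_left mult.assoc)
  then show ?thesis unfolding poly_space_def by (intro CollectI exI[of _ "\<lambda>a. k * c a"]) simp
qed

lemma monomial_in_poly_space:
  assumes "(\<Sum>i\<in>UNIV. a i) \<le> p"
  shows "(\<lambda>x. \<Prod>i\<in>UNIV. (x $ i) ^ a i) \<in> poly_space p"
  unfolding poly_space_def
proof (intro CollectI exI[of _ "\<lambda>b. if b = a then 1 else 0"] allI)
  fix x :: "real^'a"
  have "(\<Sum>b | (\<Sum>i\<in>UNIV. b i) \<le> p. (if b = a then 1 else 0) * (\<Prod>i\<in>UNIV. (x $ i) ^ b i))
      = (\<Sum>b | (\<Sum>i\<in>UNIV. b i) \<le> p. if b = a then (\<Prod>i\<in>UNIV. (x $ i) ^ b i) else 0)"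
    by (rule sum.cong) auto
  also have "\<dots> = (\<Prod>i\<in>UNIV. (x $ i) ^ a i)" using assms by (simp add: sum.delta finite_multi_indices)
  finally show "(\<Prod>i\<in>UNIV. (x $ i) ^ a i) = (\<Sum>b | (\<Sum>i\<in>UNIV. b i) \<le> p. (if b = a then 1 else 0) * (\<Prod>i\<in>UNIV. (x $ i) ^ b i))" ..
qed

lemma zero_in_poly_space: "(\<lambda>x. 0) \<in> poly_space p"
  unfolding poly_space_def by (intro CollectI exI[of _ "\<lambda>a. 0"]) simp

lemma poly_space_sum:
  assumes "finite A" "\<And>a. a \<in> A \<Longrightarrow> F a \<in> poly_space p"
  shows "(\<lambda>x. \<Sum>a\<in>A. F a x) \<in> poly_space p"
  using assms by (induction A) (auto intro: zero_in_poly_space poly_space_add)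

text \<open>The partial derivative lowers one exponent; the coefficient vanishes when it cannot be lowered.\<close>

lemma monomial_has_derivative:
  fixes a :: "'n::finite \<Rightarrow> nat"
  shows "((\<lambda>x::real^'n. \<Prod>i\<in>UNIV. (x $ i) ^ a i) has_derivative
     (\<lambda>w. (\<chi> j. real (a j) * (\<Prod>i\<in>UNIV. (x $ i) ^ (a(j := a j - 1)) i)) \<bullet> w)) (at x)"
proof -
  have "((\<lambda>x::real^'n. \<Prod>i\<in>UNIV. (x $ i) ^ a i) has_derivative
     (\<lambda>w. \<Sum>j\<in>UNIV. (real (a j) * (w $ j) * (x $ j) ^ (a j - 1)) * (\<Prod>i\<in>UNIV - {j}. (x $ i) ^ a i))) (at x)"
    by (rule has_derivative_prod) (auto intro!: derivative_eq_intros bounded_linear.has_derivative[OF bounded_linear_vec_nth])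
  moreover have "(\<Prod>i\<in>UNIV. (x $ i) ^ (a(j := a j - 1)) i) = (x $ j) ^ (a j - 1) * (\<Prod>i\<in>UNIV - {j}. (x $ i) ^ a i)" for j
    by (subst prod.remove[of UNIV j]) auto
  ultimately show ?thesis by (simp add: inner_vec_def mult_ac)
qed

text \<open>Partial derivatives stay in the same polynomial space, which makes the discrete trace
  inequality applicable to the components of the gradient.\<close>

lemma poly_space_C1:
  assumes "q \<in> poly_space p"
  shows "q differentiable (at x)" "continuous_on UNIV q" "continuous_on UNIV (grad q)" "(\<lambda>x. grad q x $ i) \<in> poly_space p"
proof -
  let ?A = "{a :: 'a \<Rightarrow> nat. (\<Sum>i\<in>UNIV. a i) \<le> p}"
  obtain c where c: "\<And>x. q x = (\<Sum>a\<in>?A. c a * (\<Prod>i\<in>UNIV. (x $ i) ^ a i))"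
    using assms unfolding poly_space_def by blast
  have "(q has_derivative (\<lambda>w. \<Sum>a\<in>?A. c a * ((\<chi> j. real (a j) * (\<Prod>i\<in>UNIV. (x $ i) ^ (a(j := a j - 1)) i)) \<bullet> w))) (at x)" for x
    unfolding c[abs_def] by (intro has_derivative_sum has_derivative_mult_right monomial_has_derivative)
  then have D: "(q has_derivative (\<lambda>w. (\<Sum>a\<in>?A. c a *\<^sub>R (\<chi> j. real (a j) * (\<Prod>i\<in>UNIV. (x $ i) ^ (a(j := a j - 1)) i))) \<bullet> w)) (at x)" for x
    by (simp add: inner_sum_left)
  note g = grad_unique[OF D]
  show d: "q differentiable (at x)" for x by (rule g(2))
  show "continuous_on UNIV q"
    by (intro continuous_at_imp_continuous_on ballI differentiable_imp_continuous_within d)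
  have gi: "grad q x $ i = (\<Sum>a\<in>?A. (c a * real (a i)) * (\<Prod>k\<in>UNIV. (x $ k) ^ (a(i := a i - 1)) k))" for x i
    by (simp add: g(1) sum_component mult.assoc)
  show "(\<lambda>x. grad q x $ i) \<in> poly_space p"
    unfolding gi
  proof (rule poly_space_sum[OF finite_multi_indices])
    fix a :: "'a \<Rightarrow> nat" assume "a \<in> ?A"
    moreover have "(\<Sum>k\<in>UNIV. (a(i := a i - 1)) k) \<le> (\<Sum>k\<in>UNIV. a k)" by (rule sum_mono) auto
    ultimately show "(\<lambda>x. (c a * real (a i)) * (\<Prod>k\<in>UNIV. (x $ k) ^ (a(i := a i - 1)) k)) \<in> poly_space p"
      by (intro poly_space_cmult monomial_in_poly_space) auto
  qed
  have gq: "grad q = (\<lambda>x. \<chi> i. \<Sum>a\<in>?A. (c a * real (a i)) * (\<Prod>k\<in>UNIV. (x $ k) ^ (a(i := a i - 1)) k))"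
    by (simp add: fun_eq_iff vec_eq_iff gi)
  show "continuous_on UNIV (grad q)"
    unfolding gq by (intro continuous_on_vec_lambda continuous_intros continuous_on_prod)
qed

section \<open>Facets of a conforming mesh\<close>

text \<open>A frontier point of a finite closed union lies in some member but not in its interior,
  and frontiers of convex sets are null.\<close>

lemma (in polytopal) negligible_frontier_U: "negligible (frontier U)"
proof -
  obtain F where F: "finite F" "\<And>P. P \<in> F \<Longrightarrow> polytope P" "U = interior (\<Union>F)"
    using is_open by (auto simp: open_polytope_def)
  have "frontier U \<subseteq> (\<Union>P\<in>F. frontier P)"
  proof
    fix x assume "x \<in> frontier U"
    then have x: "x \<in> frontier (\<Union>F)" using F(3) frontier_interior_subset by blast
    have "closed (\<Union>F)" using F by (auto intro: polytope_imp_closed)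
    then have "x \<in> \<Union>F" using x frontier_subset_closed by blast
    then obtain P where P: "P \<in> F" "x \<in> P" by blast
    have "x \<notin> interior P" using x P interior_mono[of P "\<Union>F"] by (auto simp: frontier_def)
    then have "x \<in> frontier P" using P(2) closure_subset by (auto simp: frontier_def)
    then show "x \<in> (\<Union>P\<in>F. frontier P)" using P(1) by blast
  qed
  moreover have "negligible (\<Union>P\<in>F. frontier P)"
    by (rule negligible_Union) (use F in \<open>auto intro: negligible_convex_frontier polytope_imp_convex\<close>)
  ultimately show ?thesis by (rule negligible_subset[rotated])
qed

text \<open>If the normals were not opposite, a small step along \<open>- (\<nu> + \<mu>)\<close>
  would enter both half-spaces and thus both sets.\<close>

lemma disjoint_outward_normals:
  assumes "U \<inter> V = {}" "is_outward_normal U x \<nu>" "is_outward_normal V x \<mu>"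
  shows "\<mu> = - \<nu>"
proof (rule ccontr)
  assume "\<mu> \<noteq> - \<nu>"
  then have ne: "\<nu> + \<mu> \<noteq> 0" by (metis add.commute add_eq_0_iff)
  obtain r where r: "r > 0" "\<forall>y\<in>ball x r. y \<in> U \<longleftrightarrow> \<nu> \<bullet> (y - x) < 0"
    using is_outward_normal_shrink[OF assms(2) zero_less_one] by blast
  obtain s where s: "s > 0" "s \<le> r" "\<forall>y\<in>ball x s. y \<in> V \<longleftrightarrow> \<mu> \<bullet> (y - x) < 0"
    using is_outward_normal_shrink[OF assms(3) r(1)] by blast
  have n: "\<nu> \<bullet> \<nu> = 1" "\<mu> \<bullet> \<mu> = 1" using assms by (auto simp: is_outward_normal_def norm_eq_1)
  have "(\<nu> + \<mu>) \<bullet> (\<nu> + \<mu>) > 0" using ne by simp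
  then have lt: "1 + \<nu> \<bullet> \<mu> > 0" using n by (simp add: inner_add_left inner_add_right inner_commute)
  define t where "t = s / (2 * norm (\<nu> + \<mu>))"
  have t: "t > 0" using s ne by (simp add: t_def)
  define y where "y = x - t *\<^sub>R (\<nu> + \<mu>)"
  have "dist x y < s" using s ne by (simp add: y_def t_def dist_norm)
  then have y: "y \<in> ball x s" "y \<in> ball x r" using s by auto
  have "\<nu> \<bullet> (y - x) = - (t * (1 + \<nu> \<bullet> \<mu>))" "\<mu> \<bullet> (y - x) = - (t * (1 + \<nu> \<bullet> \<mu>))"
    by (simp_all add: y_def inner_add_right n inner_commute[of \<mu> \<nu>])
  then have "\<nu> \<bullet> (y - x) < 0" "\<mu> \<bullet> (y - x) < 0" using t lt by simp_all
  then have "y \<in> U" "y \<in> V" using y r s by blast+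
  then show False using assms(1) by blast
qed

text \<open>A Lipschitz graph containing a flat disc coincides with it near the centre of the disc, so
  only one side of the disc belongs to the domain.\<close>

lemma lipschitz_domain_flat:
  assumes lip: "lipschitz_domain \<Omega>" and x: "is_outward_normal T x \<nu>" and T: "T \<subseteq> \<Omega>"
    and disc: "0 < d" "\<And>y. y \<in> ball x d \<Longrightarrow> \<nu> \<bullet> (y - x) = 0 \<Longrightarrow> y \<in> frontier \<Omega>"
  shows "is_outward_normal \<Omega> x \<nu>"
proof -
  have op: "open \<Omega>" using lip by (simp add: lipschitz_domain_def)
  have n: "norm \<nu> = 1" "\<nu> \<bullet> \<nu> = 1" using x by (auto simp: is_outward_normal_def norm_eq_1)
  have fr: "y \<notin> \<Omega>" if "y \<in> frontier \<Omega>" for y using that op by (simp add: frontier_def interior_open)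
  have "x \<in> frontier \<Omega>" using disc by simp
  then obtain u r L g where u: "norm u = 1" and r: "0 < r" and "L-lipschitz_on UNIV g"
    and epi: "\<Omega> \<inter> ball x r = {y \<in> ball x r. g ((y - x) - ((y - x) \<bullet> u) *\<^sub>R u) < (y - x) \<bullet> u}"
    using lip unfolding lipschitz_domain_def by blast
  have gc: "continuous_on UNIV g" using \<open>L-lipschitz_on UNIV g\<close> by (rule lipschitz_on_continuous_on)
  have uu: "u \<bullet> u = 1" using u by (simp add: norm_eq_1)
  define P where "P v = v - (v \<bullet> u) *\<^sub>R u" for v
  have Pu: "P (v + t *\<^sub>R u) = P v" for v t by (simp add: P_def inner_add_left uu algebra_simps)
  have mem: "y \<in> \<Omega> \<longleftrightarrow> g (P (y - x)) < (y - x) \<bullet> u" if "y \<in> ball x r" for y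
    using epi that unfolding P_def by blast
  \<comment> \<open>A frontier point strictly below the graph would have a neighbourhood missing the
    domain.\<close>
  have graph: "g (P (y - x)) = (y - x) \<bullet> u" if y: "y \<in> frontier \<Omega>" "y \<in> ball x r" for y
  proof (rule ccontr)
    assume "g (P (y - x)) \<noteq> (y - x) \<bullet> u"
    moreover have "\<not> g (P (y - x)) < (y - x) \<bullet> u" using fr[OF y(1)] mem[OF y(2)] by simp
    ultimately have gt: "g (P (y - x)) > (y - x) \<bullet> u" by simp
    have "open {z. g (P (z - x)) > (z - x) \<bullet> u}"
      unfolding P_def by (intro open_Collect_less continuous_intros continuous_on_compose2[OF gc]) auto
    then have "open ({z. g (P (z - x)) > (z - x) \<bullet> u} \<inter> ball x r)" by (rule open_Int[OF _ open_ball])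
    moreover have "y \<in> {z. g (P (z - x)) > (z - x) \<bullet> u} \<inter> ball x r" using gt y(2) by simp
    moreover have "y \<in> closure \<Omega>" using y(1) by (simp add: frontier_def)
    ultimately obtain z where "z \<in> \<Omega>" "g (P (z - x)) > (z - x) \<bullet> u" "z \<in> ball x r"
      unfolding closure_iff_nhds_not_empty by blast
    then show False using mem by fastforce
  qed
  \<comment> \<open>A disc containing the direction \<open>u\<close> would place two points with the
    same projection on the graph.\<close>
  have nu_u: "\<nu> \<bullet> u \<noteq> 0"
  proof
    assume z: "\<nu> \<bullet> u = 0"
    define t where "t = min d r / 2"
    have t: "0 < t" "t < d" "t < r" using disc(1) r by (auto simp: t_def)
    have "x + t *\<^sub>R u \<in> frontier \<Omega>" using t u z by (intro disc(2)) (auto simp: dist_norm)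
    moreover have "x + t *\<^sub>R u \<in> ball x r" using t u by (simp add: dist_norm)
    ultimately have "g (P (t *\<^sub>R u)) = t" using graph[of "x + t *\<^sub>R u"] uu by simp
    moreover have "g (P 0) = 0" using graph[OF \<open>x \<in> frontier \<Omega>\<close>] r by simp
    ultimately show False using Pu[of 0 t] t by simp
  qed
  obtain q where q: "q > 0" "\<forall>y\<in>ball x q. y \<in> T \<longleftrightarrow> \<nu> \<bullet> (y - x) < 0"
    using is_outward_normal_shrink[OF x zero_less_one] by blast
  \<comment> \<open>Sliding \<open>y\<close> along \<open>u\<close> onto the plane of the disc
    multiplies the distance from \<open>x\<close> by at most \<open>k\<close>; the radius
    \<open>s\<close> is shrunk accordingly.\<close>
  define k where "k = 1 + 1 / \<bar>\<nu> \<bullet> u\<bar>"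
  have k: "k > 0" "k \<ge> 1" using nu_u by (simp_all add: k_def add_pos_pos)
  define s where "s = min d (min r q) / k"
  have s: "s > 0" using disc r q k by (simp add: s_def)
  have "s * k = min d (min r q)" using k by (simp add: s_def)
  moreover have "s \<le> s * k" using mult_left_mono[of 1 k s] k s by simp
  ultimately have sk: "s * k \<le> d" "s * k \<le> r" "s * k \<le> q" "s \<le> s * k" by auto
  \<comment> \<open>The point \<open>p\<close> lies in the disc and hence on the graph, so
    \<open>y\<close> is in the domain exactly if it lies above \<open>p\<close> in direction
    \<open>u\<close>.\<close>
  have main: "y \<in> \<Omega> \<longleftrightarrow> 0 < (\<nu> \<bullet> (y - x)) / (\<nu> \<bullet> u)" if y: "y \<in> ball x s" for y
  proof -
    define a where "a = (\<nu> \<bullet> (y - x)) / (\<nu> \<bullet> u)"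
    define p where "p = y - a *\<^sub>R u"
    have ny: "norm (y - x) < s" using y by (simp add: dist_norm norm_minus_commute)
    have "\<bar>a\<bar> \<le> norm (y - x) / \<bar>\<nu> \<bullet> u\<bar>"
      unfolding a_def abs_divide using Cauchy_Schwarz_ineq2[of \<nu> "y - x"] n(1) by (intro divide_right_mono) auto
    moreover have "norm (p - x) \<le> norm (y - x) + \<bar>a\<bar>"
      using norm_triangle_ineq4[of "y - x" "a *\<^sub>R u"] u by (simp add: p_def algebra_simps)
    ultimately have "norm (p - x) \<le> norm (y - x) * k" by (simp add: k_def distrib_left)
    also have "\<dots> < s * k" using ny k by simp
    finally have np: "norm (p - x) < s * k" .
    have "\<nu> \<bullet> (p - x) = 0" using nu_u by (simp add: p_def a_def inner_diff_right)
    moreover have "p \<in> ball x d" "p \<in> ball x r" using np sk by (auto simp: dist_norm norm_minus_commute)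
    ultimately have pg: "g (P (p - x)) = (p - x) \<bullet> u" using disc(2) graph by blast
    have yp: "y - x = (p - x) + a *\<^sub>R u" by (simp add: p_def)
    have "y \<in> ball x r" using ny sk by (simp add: dist_norm norm_minus_commute)
    then have "y \<in> \<Omega> \<longleftrightarrow> g (P (y - x)) < (y - x) \<bullet> u" by (rule mem)
    also have "P (y - x) = P (p - x)" by (subst yp) (rule Pu)
    also have "(y - x) \<bullet> u = (p - x) \<bullet> u + a" using uu by (simp add: yp inner_add_left)
    finally show ?thesis using pg by (simp add: a_def)
  qed
  \<comment> \<open>The side on which the domain lies is decided by \<open>T\<close>, which is
    contained in it and lies on the negative side of \<open>\<nu>\<close>.\<close>
  have neg: "\<nu> \<bullet> u < 0"
  proof (rule ccontr)
    assume "\<not> \<nu> \<bullet> u < 0"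
    then have pos: "\<nu> \<bullet> u > 0" using nu_u by simp
    define y where "y = x - (s / 2) *\<^sub>R \<nu>"
    have "s \<le> q" using sk by linarith
    then have y: "y \<in> ball x s" "y \<in> ball x q" "\<nu> \<bullet> (y - x) < 0" using s n by (auto simp: y_def dist_norm)
    then have "y \<in> \<Omega>" using q T by blast
    then show False using main[OF y(1)] y(3) pos by (simp add: zero_less_divide_iff)
  qed
  show ?thesis
    by (rule is_outward_normal_half_ball[OF n(1) s]) (use main neg in \<open>simp add: zero_less_divide_iff\<close>)
qed

locale conforming =
  fixes \<Omega> :: "(real^'n) set" and \<Gamma>\<^sub>D \<Gamma>\<^sub>N :: "(real^'n) set" and \<T> :: "(real^'n) set set"
  assumes \<Omega>_open_polytope: "open_polytope \<Omega>" and \<Omega>_lipschitz: "lipschitz_domain \<Omega>"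
    and \<Gamma>: "frontier \<Omega> = \<Gamma>\<^sub>D \<union> \<Gamma>\<^sub>N" "\<Gamma>\<^sub>D \<inter> \<Gamma>\<^sub>N = {}"
    and mesh: "conforming_mesh \<Omega> \<T>"
    and resolve: "\<And>T e. T \<in> \<T> \<Longrightarrow> e \<in> facets T \<Longrightarrow> e \<subseteq> frontier \<Omega> \<Longrightarrow> e \<subseteq> \<Gamma>\<^sub>D \<or> e \<subseteq> \<Gamma>\<^sub>N"
begin

sublocale \<Omega>: polytopal \<Omega> using \<Omega>_open_polytope by unfold_locales

lemma finite_mesh: "finite \<T>"
  using mesh by (simp add: conforming_mesh_def)

lemma element_polytopal: "T \<in> \<T> \<Longrightarrow> polytopal T"
  using mesh by (auto simp: conforming_mesh_def polytopal_def)

lemma element_subset: "T \<in> \<T> \<Longrightarrow> T \<subseteq> \<Omega>"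
  using mesh by (auto simp: conforming_mesh_def)

lemma elements_disjoint: "T \<in> \<T> \<Longrightarrow> T' \<in> \<T> \<Longrightarrow> T \<noteq> T' \<Longrightarrow> T \<inter> T' = {}"
  using mesh by (simp add: conforming_mesh_def pairwise_def disjnt_def)

lemma normals_opposite:
  assumes "T \<in> \<T>" "T' \<in> \<T>" "T \<noteq> T'" "e \<in> facets T" "e \<in> facets T'"
  shows "normal_on T' e = - normal_on T e"
proof -
  interpret T: polytopal T by (rule element_polytopal[OF assms(1)])
  interpret T': polytopal T' by (rule element_polytopal[OF assms(2)])
  obtain x where x: "x \<in> e" using T.facet_props(6)[OF assms(4)] by blast
  show ?thesis
    by (rule disjoint_outward_normals[OF elements_disjoint[OF assms(1-3)] T.facet_props(2)[OF assms(4) x] T'.facet_props(2)[OF assms(5) x]])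
qed

lemma normal_on_nonzero: "T \<in> \<T> \<Longrightarrow> e \<in> facets T \<Longrightarrow> norm (normal_on T e) = 1"
  using polytopal.facet_props(1)[OF element_polytopal] flat_piece.unit by blast

text \<open>Normals of two different elements at a common facet are opposite. A third element would
  make a unit vector equal to its own negative.\<close>

lemma adjacent_interior:
  assumes "e \<in> interior_facets \<T>"
  obtains T T' where "T \<in> \<T>" "T' \<in> \<T>" "T \<noteq> T'" "adjacent \<T> e = {T, T'}" "e \<in> facets T" "e \<in> facets T'"
    "normal_on T' e = - normal_on T e"
proof -
  obtain T T' where T: "T \<in> \<T>" "T' \<in> \<T>" "T \<noteq> T'" "e \<in> facets T" "e \<in> facets T'"
    using assms by (auto simp: interior_facets_def)
  have "S = T \<or> S = T'" if S: "S \<in> \<T>" "e \<in> facets S" for S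
  proof (rule ccontr)
    assume ne: "\<not> (S = T \<or> S = T')"
    have "normal_on S e = - normal_on T e" using normals_opposite[OF T(1) S(1) _ T(4) S(2)] ne by blast
    moreover have "normal_on S e = - normal_on T' e" using normals_opposite[OF T(2) S(1) _ T(5) S(2)] ne by blast
    moreover have "normal_on T' e = - normal_on T e" by (rule normals_opposite[OF T])
    ultimately have "normal_on T e = - normal_on T e" by simp
    then have "2 *\<^sub>R normal_on T e = 0" by (metis add.right_inverse scaleR_2)
    then show False using normal_on_nonzero[OF T(1,4)] by simp
  qed
  then have "adjacent \<T> e = {T, T'}" using T by (auto simp: adjacent_def)
  then show ?thesis using that T normals_opposite[OF T] by blast
qed

text \<open>Around a point of the facet the two elements fill opposite half-balls, and the disc in
  between lies in their closures. So a ball lies in the closure of the domain, which is regular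
  open.\<close>

lemma interior_facet_subset:
  assumes "e \<in> interior_facets \<T>"
  shows "e \<subseteq> \<Omega>"
proof
  fix x assume x: "x \<in> e"
  obtain T T' where T: "T \<in> \<T>" "T' \<in> \<T>" "e \<in> facets T" "e \<in> facets T'" and opp: "normal_on T' e = - normal_on T e"
    using adjacent_interior[OF assms] by metis
  interpret T: polytopal T by (rule element_polytopal[OF T(1)])
  interpret T': polytopal T' by (rule element_polytopal[OF T(2)])
  let ?\<nu> = "normal_on T e"
  have n: "is_outward_normal T x ?\<nu>" "is_outward_normal T' x (- ?\<nu>)"
    using T.facet_props(2)[OF T(3) x] T'.facet_props(2)[OF T(4) x] opp by auto
  obtain r where r: "r > 0" "\<forall>y\<in>ball x r. y \<in> T \<longleftrightarrow> ?\<nu> \<bullet> (y - x) < 0"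
    using is_outward_normal_shrink[OF n(1) zero_less_one] by blast
  obtain s where s: "s > 0" "s \<le> r" "\<forall>y\<in>ball x s. y \<in> T' \<longleftrightarrow> - ?\<nu> \<bullet> (y - x) < 0"
    using is_outward_normal_shrink[OF n(2) r(1)] by blast
  have cl: "closure T \<subseteq> closure \<Omega>" "T' \<subseteq> closure \<Omega>" "T \<subseteq> closure \<Omega>"
    using element_subset[OF T(1)] element_subset[OF T(2)] closure_mono closure_subset by blast+
  have "ball x s \<subseteq> closure \<Omega>"
  proof
    fix y assume y: "y \<in> ball x s"
    then have yr: "y \<in> ball x r" using s by simp
    consider "?\<nu> \<bullet> (y - x) < 0" | "?\<nu> \<bullet> (y - x) > 0" | "?\<nu> \<bullet> (y - x) = 0" by linarith
    then show "y \<in> closure \<Omega>"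
    proof cases
      case 1 then show ?thesis using r yr cl by blast
    next
      case 2
      then have "- ?\<nu> \<bullet> (y - x) < 0" by simp
      then show ?thesis using s y cl by blast
    next
      case 3
      have "is_outward_normal T y ?\<nu>"
        using is_outward_normal_along[OF r(2) normal_on_nonzero[OF T(1,3)] yr 3] .
      then show ?thesis using is_outward_normal_frontier(1) cl(1) by (auto simp: frontier_def)
    qed
  qed
  then have "x \<in> interior (closure \<Omega>)" using s(1) by (meson centre_in_ball interior_maximal open_ball subsetD)
  then show "x \<in> \<Omega>" using \<Omega>.interior_closure_U by simp
qed

lemma frontier_facet_not_interior:
  assumes "T \<in> \<T>" "e \<in> facets T" "e \<subseteq> frontier \<Omega>"
  shows "e \<notin> interior_facets \<T>" "adjacent \<T> e = {T}"
proof -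
  interpret T: polytopal T by (rule element_polytopal[OF assms(1)])
  have "\<Omega> \<inter> frontier \<Omega> = {}" using \<Omega>.open_U by (simp add: frontier_def interior_open)
  then show ni: "e \<notin> interior_facets \<T>"
    using interior_facet_subset assms(3) T.facet_props(6)[OF assms(2)] by blast
  then show "adjacent \<T> e = {T}" using assms(1,2) by (auto simp: adjacent_def interior_facets_def)
qed

text \<open>A facet contains a disc around each of its points, here a disc of the domain's frontier,
  so \<open>lipschitz_domain_flat\<close> applies. The inflow condition and the Neumann term use the
  normal of the domain, integration by parts that of the element.\<close>

lemma frontier_facet_normal:
  assumes "T \<in> \<T>" "e \<in> facets T" "e \<subseteq> frontier \<Omega>" "x \<in> e"
  shows "is_outward_normal \<Omega> x (normal_on T e)" "outward_normal \<Omega> x = normal_on T e"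
proof -
  interpret T: polytopal T by (rule element_polytopal[OF assms(1)])
  obtain b where fp: "flat_piece e (normal_on T e) b" using T.facet_props(1)[OF assms(2)] by blast
  obtain d where d: "d > 0" "\<forall>y\<in>ball x d. normal_on T e \<bullet> y = b \<longrightarrow> y \<in> e"
    using flat_piece.rel_open[OF fp assms(4)] by blast
  show "is_outward_normal \<Omega> x (normal_on T e)"
  proof (rule lipschitz_domain_flat[OF \<Omega>_lipschitz T.facet_props(2)[OF assms(2,4)] element_subset[OF assms(1)] d(1)])
    fix y assume "y \<in> ball x d" "normal_on T e \<bullet> (y - x) = 0"
    then have "y \<in> e" using d(2) flat_piece.plane[OF fp assms(4)] by (simp add: inner_diff_right)
    then show "y \<in> frontier \<Omega>" using assms(3) by blast
  qed
  then show "outward_normal \<Omega> x = normal_on T e" by (rule outward_normal_eq)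
qed

lemma boundary_facetE:
  assumes "e \<in> boundary_facets \<T> \<Gamma>\<^sub>D \<or> e \<in> boundary_facets \<T> \<Gamma>\<^sub>N"
  obtains T where "T \<in> \<T>" "e \<in> facets T" "e \<subseteq> frontier \<Omega>" "adjacent \<T> e = {T}" "e \<notin> interior_facets \<T>"
proof -
  obtain T where T: "T \<in> \<T>" "e \<in> facets T" "e \<subseteq> frontier \<Omega>" using assms \<Gamma>(1) by (auto simp: boundary_facets_def)
  then show ?thesis using that frontier_facet_not_interior by metis
qed

lemma finite_facet_sets:
  "finite (interior_facets \<T>)" "finite (boundary_facets \<T> \<Gamma>)"
proof -
  have fin: "finite (\<Union>T\<in>\<T>. facets T)"
    using finite_mesh polytopal.finite_facets[OF element_polytopal] by blast
  show "finite (interior_facets \<T>)" by (rule finite_subset[OF _ fin]) (auto simp: interior_facets_def)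
  show "finite (boundary_facets \<T> \<Gamma>)" by (rule finite_subset[OF _ fin]) (auto simp: boundary_facets_def)
qed

lemma facet_sets_disjoint:
  "interior_facets \<T> \<inter> boundary_facets \<T> \<Gamma>\<^sub>D = {}" "interior_facets \<T> \<inter> boundary_facets \<T> \<Gamma>\<^sub>N = {}"
  "boundary_facets \<T> \<Gamma>\<^sub>D \<inter> boundary_facets \<T> \<Gamma>\<^sub>N = {}"
proof -
  show "interior_facets \<T> \<inter> boundary_facets \<T> \<Gamma>\<^sub>D = {}" "interior_facets \<T> \<inter> boundary_facets \<T> \<Gamma>\<^sub>N = {}"
    using boundary_facetE by blast+
  have False if e: "e \<in> boundary_facets \<T> \<Gamma>\<^sub>D" "e \<in> boundary_facets \<T> \<Gamma>\<^sub>N" for e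
  proof -
    obtain T where T: "T \<in> \<T>" "e \<in> facets T" using e(1) by (auto simp: boundary_facets_def)
    have "e \<noteq> {}" by (rule polytopal.facet_props(6)[OF element_polytopal[OF T(1)] T(2)])
    moreover have "e \<subseteq> \<Gamma>\<^sub>D" "e \<subseteq> \<Gamma>\<^sub>N" using e by (auto simp: boundary_facets_def)
    ultimately show False using \<Gamma>(2) by blast
  qed
  then show "boundary_facets \<T> \<Gamma>\<^sub>D \<inter> boundary_facets \<T> \<Gamma>\<^sub>N = {}" by blast
qed

lemma facet_cases:
  assumes "T \<in> \<T>" "e \<in> facets T"
  shows "e \<in> interior_facets \<T> \<or> e \<in> boundary_facets \<T> \<Gamma>\<^sub>D \<or> e \<in> boundary_facets \<T> \<Gamma>\<^sub>N"
proof (cases "e \<subseteq> frontier \<Omega>")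
  case True
  then show ?thesis using resolve[OF assms True] assms by (auto simp: boundary_facets_def)
next
  case False
  have "\<forall>T\<in>\<T>. \<forall>e\<in>facets T. e \<subseteq> frontier \<Omega> \<or> (\<exists>T'\<in>\<T>. T' \<noteq> T \<and> e \<in> facets T')"
    using mesh by (simp add: conforming_mesh_def)
  then obtain T' where "T' \<in> \<T>" "T' \<noteq> T" "e \<in> facets T'"
    using False assms by blast
  then show ?thesis using assms by (auto simp: interior_facets_def)
qed

lemma sum_over_element_facets:
  fixes \<phi> :: "(real^'n) set \<Rightarrow> (real^'n) set \<Rightarrow> real"
  shows "(\<Sum>T\<in>\<T>. \<Sum>e\<in>facets T. \<phi> T e)
   = (\<Sum>e\<in>interior_facets \<T>. \<Sum>T\<in>adjacent \<T> e. \<phi> T e) + (\<Sum>e\<in>boundary_facets \<T> \<Gamma>\<^sub>D. \<Sum>T\<in>adjacent \<T> e. \<phi> T e)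
     + (\<Sum>e\<in>boundary_facets \<T> \<Gamma>\<^sub>N. \<Sum>T\<in>adjacent \<T> e. \<phi> T e)"
proof -
  let ?E = "interior_facets \<T> \<union> boundary_facets \<T> \<Gamma>\<^sub>D \<union> boundary_facets \<T> \<Gamma>\<^sub>N"
  have fin: "finite ?E" using finite_facet_sets by blast
  have "facets T = {e \<in> ?E. e \<in> facets T}" if "T \<in> \<T>" for T using facet_cases[OF that] by blast
  then have "(\<Sum>T\<in>\<T>. \<Sum>e\<in>facets T. \<phi> T e) = (\<Sum>T\<in>\<T>. \<Sum>e\<in>{e \<in> ?E. e \<in> facets T}. \<phi> T e)" by simp
  also have "\<dots> = (\<Sum>e\<in>?E. \<Sum>T\<in>{T \<in> \<T>. e \<in> facets T}. \<phi> T e)"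
    by (rule sum.swap_restrict[OF finite_mesh fin])
  also have "\<dots> = (\<Sum>e\<in>?E. \<Sum>T\<in>adjacent \<T> e. \<phi> T e)" by (simp add: adjacent_def)
  also have "\<dots> = (\<Sum>e\<in>interior_facets \<T> \<union> boundary_facets \<T> \<Gamma>\<^sub>D. \<Sum>T\<in>adjacent \<T> e. \<phi> T e) + (\<Sum>e\<in>boundary_facets \<T> \<Gamma>\<^sub>N. \<Sum>T\<in>adjacent \<T> e. \<phi> T e)"
    by (rule sum.union_disjoint) (use finite_facet_sets facet_sets_disjoint in auto)
  also have "(\<Sum>e\<in>interior_facets \<T> \<union> boundary_facets \<T> \<Gamma>\<^sub>D. \<Sum>T\<in>adjacent \<T> e. \<phi> T e)
     = (\<Sum>e\<in>interior_facets \<T>. \<Sum>T\<in>adjacent \<T> e. \<phi> T e) + (\<Sum>e\<in>boundary_facets \<T> \<Gamma>\<^sub>D. \<Sum>T\<in>adjacent \<T> e. \<phi> T e)"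
    by (rule sum.union_disjoint) (use finite_facet_sets facet_sets_disjoint in auto)
  finally show ?thesis .
qed

lemma AE_in_element: "AE x in lebesgue. x \<in> \<Omega> \<longrightarrow> x \<in> \<Union>\<T>"
proof -
  have "negligible (\<Union>T\<in>\<T>. frontier T)"
    by (rule negligible_Union) (use finite_mesh polytopal.negligible_frontier_U[OF element_polytopal] in auto)
  then have "AE x in lebesgue. x \<notin> (\<Union>T\<in>\<T>. frontier T)" by (intro AE_not_in) (simp add: negligible_iff_null_sets)
  then show ?thesis
  proof eventually_elim
    fix x assume x: "x \<notin> (\<Union>T\<in>\<T>. frontier T)"
    show "x \<in> \<Omega> \<longrightarrow> x \<in> \<Union>\<T>"
    proof
      assume "x \<in> \<Omega>"
      then have "x \<in> (\<Union>T\<in>\<T>. closure T)" using mesh closure_subset[of \<Omega>] by (auto simp: conforming_mesh_def)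
      then obtain T where T: "T \<in> \<T>" "x \<in> closure T" by blast
      then have "x \<in> interior T" using x by (auto simp: frontier_def)
      then show "x \<in> \<Union>\<T>" using T(1) interior_subset by blast
    qed
  qed
qed

end

section \<open>Essentially bounded functions\<close>

lemma Linf_subset:
  assumes "Linf U f" "open U" "open T" "T \<subseteq> U"
  shows "Linf T f"
proof -
  obtain C where f: "f \<in> borel_measurable (lebesgue_on U)" and C: "AE x in lebesgue_on U. norm (f x) \<le> C"
    using assms(1) unfolding Linf_def by blast
  have "AE x in lebesgue. x \<in> U \<longrightarrow> norm (f x) \<le> C" using C assms(2) by (simp add: AE_restrict_space_iff)
  then have "AE x in lebesgue. x \<in> T \<longrightarrow> norm (f x) \<le> C" by eventually_elim (use assms(4) in blast)
  then have "AE x in lebesgue_on T. norm (f x) \<le> C" using assms(3) by (simp add: AE_restrict_space_iff)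
  moreover have "f \<in> borel_measurable (lebesgue_on T)" using f assms(4) by (rule measurable_restrict_mono)
  ultimately show ?thesis unfolding Linf_def by blast
qed

lemma Linf_continuous:
  fixes f :: "real^'n \<Rightarrow> real"
  assumes "open T" "bounded T" "continuous_on (closure T) f"
  shows "Linf T f"
proof -
  have "compact (closure T)" using assms(2) by (simp add: compact_closure)
  then have "bounded (f ` closure T)" using assms(3) compact_continuous_image compact_imp_bounded by blast
  then obtain C where "\<forall>x\<in>closure T. norm (f x) \<le> C" by (auto simp: bounded_iff)
  then have "\<forall>x\<in>T. norm (f x) \<le> C" using closure_subset by blast
  then have "AE x in lebesgue_on T. norm (f x) \<le> C" by (intro AE_I2) (simp add: space_restrict_space)
  moreover have "f \<in> borel_measurable (lebesgue_on T)"
    using continuous_imp_measurable_on_sets_lebesgue[OF continuous_on_subset[OF assms(3) closure_subset]] assms(1) by simp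
  ultimately show ?thesis unfolding Linf_def by blast
qed

lemma Linf_add: "Linf T f \<Longrightarrow> Linf T g \<Longrightarrow> Linf T (\<lambda>x. f x + g x)"
  for f g :: "real^'n \<Rightarrow> real"
proof -
  assume "Linf T f" "Linf T g"
  then obtain C D where f: "f \<in> borel_measurable (lebesgue_on T)" "AE x in lebesgue_on T. norm (f x) \<le> C"
    and g: "g \<in> borel_measurable (lebesgue_on T)" "AE x in lebesgue_on T. norm (g x) \<le> D" unfolding Linf_def by blast
  have "AE x in lebesgue_on T. norm (f x + g x) \<le> C + D" using f(2) g(2) by eventually_elim (rule norm_triangle_le, simp)
  then show ?thesis unfolding Linf_def by (intro conjI exI[of _ "C + D"] borel_measurable_add f(1) g(1))
qed

lemma Linf_mult: "Linf T f \<Longrightarrow> Linf T g \<Longrightarrow> Linf T (\<lambda>x. f x * g x)"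
  for f g :: "real^'n \<Rightarrow> real"
proof -
  assume "Linf T f" "Linf T g"
  then obtain C D where f: "f \<in> borel_measurable (lebesgue_on T)" "AE x in lebesgue_on T. norm (f x) \<le> C"
    and g: "g \<in> borel_measurable (lebesgue_on T)" "AE x in lebesgue_on T. norm (g x) \<le> D" unfolding Linf_def by blast
  have "AE x in lebesgue_on T. norm (f x * g x) \<le> C * D"
    using f(2) g(2)
  proof eventually_elim
    fix x assume "norm (f x) \<le> C" "norm (g x) \<le> D"
    then show "norm (f x * g x) \<le> C * D"
      unfolding norm_mult by (intro mult_mono) (auto intro: order_trans[OF norm_ge_zero])
  qed
  then show ?thesis unfolding Linf_def by (intro conjI exI[of _ "C * D"] borel_measurable_times f(1) g(1))
qed

lemma Linf_const: "Linf T (\<lambda>x. c)" for c :: real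
  unfolding Linf_def by (intro conjI exI[of _ "\<bar>c\<bar>"]) auto

lemma Linf_sum: "finite I \<Longrightarrow> (\<And>i. i \<in> I \<Longrightarrow> Linf T (f i)) \<Longrightarrow> Linf T (\<lambda>x. \<Sum>i\<in>I. f i x)"
  for f :: "'i \<Rightarrow> real^'n \<Rightarrow> real"
  by (induction I rule: finite_induct) (auto intro: Linf_const Linf_add)

lemma Linf_inner:
  fixes f g :: "real^'n \<Rightarrow> real^'n"
  assumes "\<And>i. Linf T (\<lambda>x. f x $ i)" "\<And>i. Linf T (\<lambda>x. g x $ i)"
  shows "Linf T (\<lambda>x. f x \<bullet> g x)"
  unfolding inner_vec_def inner_real_def by (intro Linf_sum Linf_mult assms) simp

lemma Linf_integrable:
  fixes f :: "real^'n \<Rightarrow> real"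
  assumes "Linf T f" "open T" "bounded T"
  shows "integrable (lebesgue_on T) f"
proof -
  obtain C where f: "f \<in> borel_measurable (lebesgue_on T)" and C: "AE x in lebesgue_on T. norm (f x) \<le> C"
    using assms(1) unfolding Linf_def by blast
  have "T \<in> lmeasurable" using assms by (simp add: bounded_set_imp_lmeasurable)
  then have "finite_measure (lebesgue_on T)" by (rule finite_measure_lebesgue_on)
  then show ?thesis using C f by (rule finite_measure.integrable_const_bound)
qed

lemma lebesgue_on_integral_support:
  fixes f :: "real^'n \<Rightarrow> real"
  assumes "open U" "open T" "T \<subseteq> U" "\<And>x. x \<in> U \<Longrightarrow> x \<notin> T \<Longrightarrow> f x = 0"
  shows "(LINT x|lebesgue_on U. f x) = (LINT x|lebesgue_on T. f x)"
proof -
  have "(LINT x|lebesgue_on U. f x) = (LINT x|lebesgue. indicator U x *\<^sub>R f x)"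
    using assms(1) by (intro integral_restrict_space) simp
  also have "\<dots> = (LINT x|lebesgue. indicator T x *\<^sub>R f x)"
    by (intro Bochner_Integration.integral_cong refl) (use assms(3,4) in \<open>auto simp: indicator_def\<close>)
  also have "\<dots> = (LINT x|lebesgue_on T. f x)"
    using assms(2) by (intro integral_restrict_space[symmetric]) simp
  finally show ?thesis .
qed

text \<open>The spectral norm is a 1-Lipschitz function of the matrix, which gives measurability,
  and it is dominated by the Euclidean norm of the entries, which keeps the essential supremum below
  infinity.\<close>

lemma Linf_norm_matrix_bound:
  fixes K :: "real^'n \<Rightarrow> real^'n^'n"
  assumes \<Omega>: "open \<Omega>" "\<Omega> \<noteq> {}" and K: "Linf \<Omega> K"
  shows "AE x in lebesgue_on \<Omega>. \<forall>\<xi>. norm (K x *v \<xi>) \<le> Linf_norm_matrix \<Omega> K * norm \<xi>" "0 \<le> Linf_norm_matrix \<Omega> K"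
proof -
  let ?on = "\<lambda>A::real^'n^'n. onorm (\<lambda>\<xi>. A *v \<xi>)"
  have bl: "bounded_linear (\<lambda>\<xi>. A *v \<xi>)" for A :: "real^'n^'n" by (rule matrix_vector_mul_bounded_linear)
  have le: "?on A \<le> norm A" for A :: "real^'n^'n"
  proof (rule onorm_le)
    fix \<xi> :: "real^'n"
    have "norm (A *v \<xi>) = L2_set (\<lambda>i. norm ((A $ i) \<bullet> \<xi>)) UNIV"
      by (simp add: norm_vec_def matrix_vector_mult_def inner_vec_def)
    also have "\<dots> \<le> L2_set (\<lambda>i. norm (A $ i) * norm \<xi>) UNIV"
      by (rule L2_set_mono) (auto simp: Cauchy_Schwarz_ineq2)
    also have "\<dots> = norm A * norm \<xi>" unfolding norm_vec_def[of A] by (rule L2_set_left_distrib[symmetric]) simp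
    finally show "norm (A *v \<xi>) \<le> norm A * norm \<xi>" .
  qed
  have "continuous_on UNIV ?on"
  proof (rule lipschitz_on_continuous_on[of 1])
    have *: "?on A \<le> ?on B + norm (A - B)" for A B :: "real^'n^'n"
    proof -
      have "(\<lambda>\<xi>. A *v \<xi>) = (\<lambda>\<xi>. B *v \<xi> + (A - B) *v \<xi>)" by (simp add: matrix_vector_mult_diff_rdistrib)
      then have "?on A \<le> ?on B + ?on (A - B)" using onorm_triangle[OF bl bl, of B "A - B"] by simp
      then show ?thesis using le[of "A - B"] by simp
    qed
    show "1-lipschitz_on UNIV ?on"
    proof (rule lipschitz_onI)
      fix A B :: "real^'n^'n"
      show "dist (?on A) (?on B) \<le> 1 * dist A B"
        using *[of A B] *[of B A] by (simp add: dist_real_def dist_norm norm_minus_commute abs_le_iff)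
    qed simp
  qed
  then have onb: "?on \<in> borel_measurable borel" by (rule borel_measurable_continuous_onI)
  obtain C where Km: "K \<in> borel_measurable (lebesgue_on \<Omega>)" and C: "AE x in lebesgue_on \<Omega>. norm (K x) \<le> C"
    using K unfolding Linf_def by blast
  let ?f = "\<lambda>x. ereal (?on (K x))"
  have fm: "?f \<in> borel_measurable (lebesgue_on \<Omega>)"
    using measurable_compose[OF Km onb] by simp
  have "AE x in lebesgue_on \<Omega>. ?f x \<le> ereal C" using C
  proof eventually_elim
    fix x assume "norm (K x) \<le> C"
    then show "?f x \<le> ereal C" using le[of "K x"] by simp
  qed
  then have ub: "esssup (lebesgue_on \<Omega>) ?f \<le> ereal C" using fm by (intro esssup_I)
  \<comment> \<open>A finite upper bound, and a real value below the supremum, exclude the infinite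
    cases for which \<open>real_of_ereal\<close> would return 0.\<close>
  have ae: "AE x in lebesgue_on \<Omega>. ?on (K x) \<le> Linf_norm_matrix \<Omega> K"
    using esssup_AE[where M="lebesgue_on \<Omega>" and f="?f"]
  proof eventually_elim
    fix x assume x: "?f x \<le> esssup (lebesgue_on \<Omega>) ?f"
    then obtain r where "esssup (lebesgue_on \<Omega>) ?f = ereal r"
      using ub by (cases "esssup (lebesgue_on \<Omega>) ?f") auto
    then show "?on (K x) \<le> Linf_norm_matrix \<Omega> K" using x by (simp add: Linf_norm_matrix_def)
  qed
  then show "AE x in lebesgue_on \<Omega>. \<forall>\<xi>. norm (K x *v \<xi>) \<le> Linf_norm_matrix \<Omega> K * norm \<xi>"
  proof eventually_elim
    fix x assume x: "?on (K x) \<le> Linf_norm_matrix \<Omega> K"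
    show "\<forall>\<xi>. norm (K x *v \<xi>) \<le> Linf_norm_matrix \<Omega> K * norm \<xi>"
      using onorm[OF bl, of "K x"] x by (meson mult_right_mono norm_ge_zero order_trans)
  qed
  \<comment> \<open>A negative bound could hold almost everywhere only on a null set, but the domain
    is open and nonempty.\<close>
  show "0 \<le> Linf_norm_matrix \<Omega> K"
  proof (rule ccontr)
    assume neg: "\<not> 0 \<le> Linf_norm_matrix \<Omega> K"
    have "AE x in lebesgue_on \<Omega>. False" using ae
    proof eventually_elim
      fix x assume "?on (K x) \<le> Linf_norm_matrix \<Omega> K"
      then show False using neg onorm_pos_le[OF bl, of "K x"] by linarith
    qed
    then have "AE x in lebesgue. x \<notin> \<Omega>" using \<Omega>(1) by (simp add: AE_restrict_space_iff)
    then have "AE x in lborel. x \<notin> \<Omega>" by (simp add: AE_completion_iff)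
    then show False using open_not_AE_empty[OF \<Omega>] by blast
  qed
qed

section \<open>Traces on star-shaped and on Lipschitz domains\<close>

lemma star_shaped_contract:
  assumes T: "open T" "0 < s" "star_shaped_wrt T (ball c s)" and x: "x \<in> closure T" and t: "0 < t" "t \<le> (1::real)"
  shows "x + t *\<^sub>R (c - x) \<in> T"
proof -
  have star: "closed_segment y z \<subseteq> T" if "y \<in> ball c s" "z \<in> T" for y z
    using T(3) that unfolding star_shaped_wrt_def by blast
  obtain z where z: "z \<in> T" "dist z x < t * s"
    using x T(2) t(1) closure_approachable[of x T] by (metis mult_pos_pos)
  \<comment> \<open>The solution of x + t (c - x) = t y + (1 - t) z. It lies in the ball of
    star-shapedness because \<open>z\<close> was chosen within \<open>t * s\<close> of
    \<open>x\<close>.\<close>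
  define y where "y = c + ((1 - t) / t) *\<^sub>R (x - z)"
  have "norm (y - c) = (1 - t) / t * norm (z - x)" using t by (simp add: y_def norm_minus_commute)
  also have "\<dots> \<le> 1 / t * norm (z - x)" using t by (intro mult_right_mono divide_right_mono) auto
  also have "\<dots> < s" using z(2) t by (simp add: dist_norm field_simps)
  finally have "y \<in> ball c s" by (simp add: dist_norm norm_minus_commute)
  then have "closed_segment y z \<subseteq> T" using star z(1) by blast
  moreover have "x + t *\<^sub>R (c - x) = (1 - (1 - t)) *\<^sub>R y + (1 - t) *\<^sub>R z"
  proof -
    have "t *\<^sub>R y = t *\<^sub>R c + (1 - t) *\<^sub>R (x - z)" using t by (simp add: y_def scaleR_add_right)
    then show ?thesis by (simp add: algebra_simps)
  qed
  then have "x + t *\<^sub>R (c - x) \<in> closed_segment y z"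
    unfolding closed_segment_def using t by (intro CollectI exI[of _ "1 - t"]) simp
  ultimately show ?thesis by blast
qed

text \<open>The inward field is \<open>c - y\<close>. It works on the whole closure by
  \<open>star_shaped_contract\<close>, so the radius of localisation is arbitrary.\<close>

lemma star_shaped_rep:
  fixes f :: "real^'n \<Rightarrow> real"
  assumes T: "open T" "bounded T" "0 < s" "star_shaped_wrt T (ball c s)" and f: "W1inf T f"
  shows "\<exists>G. continuous_on (closure T) G \<and> (AE x in lebesgue_on T. G x = f x)"
proof -
  obtain F L where F: "0 \<le> L" "continuous_on T F" "AE x in lebesgue_on T. F x = f x"
     "\<And>x y. closed_segment x y \<subseteq> T \<Longrightarrow> \<bar>F x - F y\<bar> \<le> L * norm (x - y)"
    using W1inf_lipschitz_rep[OF T(1,2) f] by blast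
  have "\<exists>G. continuous_on (closure T) G \<and> (\<forall>x\<in>T. G x = F x)"
  proof (rule continuous_extension_if_inward[OF T(1) F(1,2,4)])
    fix x
    obtain M where M: "\<And>y. y \<in> closure T \<Longrightarrow> norm (c - y) \<le> M"
    proof -
      have "bounded ((\<lambda>y. c - y) ` closure T)"
        using T(2) by (intro compact_imp_bounded compact_continuous_image continuous_intros) (simp add: compact_closure)
      then show thesis using that by (auto simp: bounded_iff)
    qed
    have "y + t *\<^sub>R (c - y) \<in> T \<and> (y \<in> T \<longrightarrow> closed_segment y (y + t *\<^sub>R (c - y)) \<subseteq> T)"
      if y: "y \<in> closure T" and t: "0 < t" "t < 1" for y t
    proof (intro conjI impI)
      show "y + t *\<^sub>R (c - y) \<in> T" using star_shaped_contract[OF T(1,3,4) y t(1)] t by simp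
      assume yT: "y \<in> T"
      have "closed_segment c y \<subseteq> T" using T(3,4) yT unfolding star_shaped_wrt_def by auto
      moreover have "y + t *\<^sub>R (c - y) \<in> closed_segment c y"
        unfolding closed_segment_def using t by (intro CollectI exI[of _ "1 - t"]) (simp add: algebra_simps)
      ultimately show "closed_segment y (y + t *\<^sub>R (c - y)) \<subseteq> T"
        by (meson convex_contains_segment convex_closed_segment ends_in_segment(2) order_trans)
    qed
    then show "\<exists>r>0. \<exists>w M. \<exists>s>0. continuous_on (closure T \<inter> cball x r) w \<and>
        (\<forall>y\<in>closure T \<inter> cball x r. norm (w y) \<le> M \<and> (\<forall>t. 0 < t \<and> t < s \<longrightarrow> y + t *\<^sub>R w y \<in> T \<and>
            (y \<in> T \<longrightarrow> closed_segment y (y + t *\<^sub>R w y) \<subseteq> T)))"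
      using M by (intro exI[of _ 1] exI[of _ "\<lambda>y. c - y"] exI[of _ M] conjI) (auto intro!: continuous_intros)
  qed
  then obtain G where G: "continuous_on (closure T) G" "\<And>x. x \<in> T \<Longrightarrow> G x = F x" by blast
  have "AE x in lebesgue. x \<in> T \<longrightarrow> F x = f x" using F(3) T(1) by (simp add: AE_restrict_space_iff)
  then have "AE x in lebesgue. x \<in> T \<longrightarrow> G x = f x" by eventually_elim (simp add: G(2))
  then have "AE x in lebesgue_on T. G x = f x" using T(1) by (simp add: AE_restrict_space_iff)
  then show ?thesis using G(1) by blast
qed

text \<open>The inward field is the constant axis \<open>u\<close> of the local graph: moving along
  \<open>u\<close> leaves the argument of \<open>g\<close> unchanged and increases the
  height.\<close>

lemma lipschitz_domain_rep:
  fixes f :: "real^'n \<Rightarrow> real"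
  assumes lip: "lipschitz_domain U" and bdd: "bounded U" and f: "W1inf U f"
  shows "\<exists>G. continuous_on (closure U) G \<and> (AE x in lebesgue_on U. G x = f x)"
proof -
  have U: "open U" using lip by (simp add: lipschitz_domain_def)
  obtain F L where F: "0 \<le> L" "continuous_on U F" "AE x in lebesgue_on U. F x = f x"
     "\<And>x y. closed_segment x y \<subseteq> U \<Longrightarrow> \<bar>F x - F y\<bar> \<le> L * norm (x - y)"
    using W1inf_lipschitz_rep[OF U bdd f] by blast
  have "\<exists>G. continuous_on (closure U) G \<and> (\<forall>x\<in>U. G x = F x)"
  proof (rule continuous_extension_if_inward[OF U F(1,2,4)])
    fix x assume "x \<in> frontier U"
    then obtain u r K g where u: "norm u = 1" and r: "0 < r" and "K-lipschitz_on UNIV g"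
      and epi: "U \<inter> ball x r = {y \<in> ball x r. g ((y - x) - ((y - x) \<bullet> u) *\<^sub>R u) < (y - x) \<bullet> u}"
      using lip unfolding lipschitz_domain_def by blast
    have gc: "continuous_on UNIV g" using \<open>K-lipschitz_on UNIV g\<close> by (rule lipschitz_on_continuous_on)
    have uu: "u \<bullet> u = 1" using u by (simp add: norm_eq_1)
    define P where "P v = v - (v \<bullet> u) *\<^sub>R u" for v
    have Pu: "P (v + t *\<^sub>R u) = P v" for v t by (simp add: P_def inner_add_left uu algebra_simps)
    have mem: "y \<in> U \<longleftrightarrow> g (P (y - x)) < (y - x) \<bullet> u" if "y \<in> ball x r" for y
      using epi that unfolding P_def by blast
    \<comment> \<open>Points of the closure lie on or above the graph, so any positive shift along
      \<open>u\<close> puts them strictly above it.\<close>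
    have cl: "g (P (y - x)) \<le> (y - x) \<bullet> u" if y: "y \<in> closure U" "y \<in> ball x r" for y
    proof (rule ccontr)
      assume gt: "\<not> g (P (y - x)) \<le> (y - x) \<bullet> u"
      have "open {z. g (P (z - x)) > (z - x) \<bullet> u}"
        unfolding P_def by (intro open_Collect_less continuous_intros continuous_on_compose2[OF gc]) auto
      then have "open ({z. g (P (z - x)) > (z - x) \<bullet> u} \<inter> ball x r)" by (rule open_Int[OF _ open_ball])
      moreover have "y \<in> {z. g (P (z - x)) > (z - x) \<bullet> u} \<inter> ball x r" using gt y(2) by simp
      ultimately obtain z where "z \<in> U" "g (P (z - x)) > (z - x) \<bullet> u" "z \<in> ball x r"
        using y(1) unfolding closure_iff_nhds_not_empty by blast
      then show False using mem by fastforce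
    qed
    have up: "y + t *\<^sub>R u \<in> U" if y: "y \<in> closure U \<inter> cball x (r/2)" and t: "0 < t" "t < r / 2" for y t
    proof -
      have yr: "y \<in> ball x r" using y r by auto
      have "dist x (y + t *\<^sub>R u) \<le> dist x y + dist y (y + t *\<^sub>R u)" by (rule dist_triangle)
      also have "dist y (y + t *\<^sub>R u) = t" using t u by (simp add: dist_norm)
      finally have "y + t *\<^sub>R u \<in> ball x r" using y t by simp
      moreover have "P ((y + t *\<^sub>R u) - x) = P (y - x)" using Pu[of "y - x" t] by (simp add: algebra_simps)
      moreover have "((y + t *\<^sub>R u) - x) \<bullet> u = (y - x) \<bullet> u + t"
        using uu by (simp add: inner_add_left inner_diff_left)
      ultimately show ?thesis using mem[of "y + t *\<^sub>R u"] cl[of y] y yr t by simp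
    qed
    have seg: "closed_segment y (y + t *\<^sub>R u) \<subseteq> U" if y: "y \<in> U" "y \<in> closure U \<inter> cball x (r/2)" and t: "0 < t" "t < r / 2" for y t
    proof
      fix z assume "z \<in> closed_segment y (y + t *\<^sub>R u)"
      then obtain k where k: "0 \<le> k" "k \<le> 1" "z = (1 - k) *\<^sub>R y + k *\<^sub>R (y + t *\<^sub>R u)" unfolding closed_segment_def by blast
      then have z: "z = y + (k * t) *\<^sub>R u" by (simp add: algebra_simps)
      show "z \<in> U"
      proof (cases "k = 0")
        case False
        have "k * t \<le> t" using k t by (simp add: mult_left_le_one_le)
        then have "k * t < r / 2" using t by linarith
        moreover have "0 < k * t" using False k t by simp
        ultimately show ?thesis unfolding z by (intro up[OF y(2)])
      qed (use z y in simp)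
    qed
    show "\<exists>r>0. \<exists>w M. \<exists>s>0. continuous_on (closure U \<inter> cball x r) w \<and>
        (\<forall>y\<in>closure U \<inter> cball x r. norm (w y) \<le> M \<and> (\<forall>t. 0 < t \<and> t < s \<longrightarrow> y + t *\<^sub>R w y \<in> U \<and>
            (y \<in> U \<longrightarrow> closed_segment y (y + t *\<^sub>R w y) \<subseteq> U)))"
      using r u up seg
      by (intro exI[of _ "r/2"] exI[of _ "\<lambda>_. u"] exI[of _ 1] conjI ballI allI impI) auto
  qed
  then obtain G where G: "continuous_on (closure U) G" "\<And>x. x \<in> U \<Longrightarrow> G x = F x" by blast
  have "AE x in lebesgue. x \<in> U \<longrightarrow> F x = f x" using F(3) U by (simp add: AE_restrict_space_iff)
  then have "AE x in lebesgue. x \<in> U \<longrightarrow> G x = f x" by eventually_elim (simp add: G(2))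
  then have "AE x in lebesgue_on U. G x = f x" using U by (simp add: AE_restrict_space_iff)
  then show ?thesis using G(1) by blast
qed

section \<open>Integration by parts on an element\<close>

lemma test_function_weighted_square:
  assumes \<zeta>: "test_function T \<zeta>" and q: "q \<in> poly_space p" and T: "T \<subseteq> U"
  shows "test_function U (\<lambda>x. (q x)\<^sup>2 * \<zeta> x)"
    "grad (\<lambda>x. (q x)\<^sup>2 * \<zeta> x) x = (2 * q x * \<zeta> x) *\<^sub>R grad q x + (q x)\<^sup>2 *\<^sub>R grad \<zeta> x"
proof -
  have \<zeta>d: "\<zeta> differentiable (at x)" for x using \<zeta> by (simp add: test_function_def)
  have D: "((\<lambda>x. (q x)\<^sup>2 * \<zeta> x) has_derivative (\<lambda>w. ((2 * q x * \<zeta> x) *\<^sub>R grad q x + (q x)\<^sup>2 *\<^sub>R grad \<zeta> x) \<bullet> w)) (at x)" for x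
    using test_function_has_derivative[OF poly_space_C1(1)[OF q], of x] test_function_has_derivative[OF \<zeta>d, of x]
    by (auto intro!: derivative_eq_intros simp: inner_add_left algebra_simps)
  show g: "grad (\<lambda>x. (q x)\<^sup>2 * \<zeta> x) x = (2 * q x * \<zeta> x) *\<^sub>R grad q x + (q x)\<^sup>2 *\<^sub>R grad \<zeta> x" for x
    using grad_unique(1)[OF D] .
  have "continuous_on UNIV \<zeta>"
    by (intro continuous_at_imp_continuous_on ballI differentiable_imp_continuous_within \<zeta>d)
  then have "continuous_on UNIV (grad (\<lambda>x. (q x)\<^sup>2 * \<zeta> x))"
    unfolding g[abs_def] using \<zeta> by (intro continuous_intros poly_space_C1(2,3)[OF q]) (auto simp: test_function_def)
  moreover obtain C where "compact C" "C \<subseteq> T" "\<And>x. x \<notin> C \<Longrightarrow> \<zeta> x = 0" using \<zeta> unfolding test_function_def by blast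
  ultimately show "test_function U (\<lambda>x. (q x)\<^sup>2 * \<zeta> x)"
    unfolding test_function_def using grad_unique(2)[OF D] T by (intro conjI allI exI[of _ C]) auto
qed

text \<open>The test functions \<open>(q x)\<^sup>2 * \<zeta> n x\<close> are supported in
  \<open>U\<close>, hence admissible in the weak divergence over the whole domain. They are
  nonnegative, so the lower bound on the reaction coefficient may be multiplied by them, and this
  bound is why an inequality results. The facet terms arise from the gradients of the cut-offs in
  the limit.\<close>

lemma (in polytopal) green_inequality:
  fixes \<beta> b :: "real^'n \<Rightarrow> real^'n" and G :: "'n \<Rightarrow> real^'n \<Rightarrow> real"
  assumes contract: "\<And>x t. x \<in> closure U \<Longrightarrow> 0 < t \<Longrightarrow> t \<le> 1 \<Longrightarrow> x + t *\<^sub>R (c - x) \<in> U"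
    and \<Omega>: "open \<Omega>" "bounded \<Omega>" "U \<subseteq> \<Omega>"
    and \<sigma>: "Linf \<Omega> \<sigma>" and \<beta>: "\<And>i. Linf \<Omega> (\<lambda>x. \<beta> x $ i)"
    and G: "\<And>i. is_weak_partial \<Omega> i (\<lambda>x. \<beta> x $ i) (G i)"
    and react: "AE x in lebesgue_on \<Omega>. \<sigma>\<^sub>0 \<le> \<sigma> x + 1 / 2 * (\<Sum>i\<in>UNIV. G i x)"
    and b: "continuous_on (closure U) b" "AE x in lebesgue_on U. b x = \<beta> x"
    and q: "q \<in> poly_space p"
  shows "\<sigma>\<^sub>0 * (LINT x|lebesgue_on U. (q x)\<^sup>2) - 1 / 2 * (\<Sum>e\<in>facets U. facet_integral e (\<lambda>x. (b x \<bullet> normal_on U e) * (q x)\<^sup>2))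
    \<le> (LINT x|lebesgue_on U. \<sigma> x * (q x)\<^sup>2) - (LINT x|lebesgue_on U. q x * (\<beta> x \<bullet> grad q x))"
proof -
  obtain \<zeta> where \<zeta>: "\<And>n. test_function U (\<zeta> n)" "\<And>n x. 0 \<le> \<zeta> n x \<and> \<zeta> n x \<le> 1" "\<And>x. x \<in> U \<Longrightarrow> (\<lambda>n. \<zeta> n x) \<longlonglongrightarrow> 1"
    and \<zeta>lim: "\<And>H :: real^'n \<Rightarrow> real^'n. continuous_on (closure U) H \<Longrightarrow>
       (\<lambda>n. \<integral>x. indicator U x * (H x \<bullet> grad (\<zeta> n) x) \<partial>lborel) \<longlonglongrightarrow>
         - (\<Sum>e\<in>facets U. facet_integral e (\<lambda>x. normal_on U e \<bullet> H x))"
    using cutoff_sequence[of c] contract by blast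
  have qc: "continuous_on S q" "continuous_on S (grad q)" for S
    using poly_space_C1(2,3)[OF q] continuous_on_subset by blast+
  have \<zeta>c: "continuous_on S (\<zeta> n)" "continuous_on S (grad (\<zeta> n))" for S n
  proof -
    have "continuous_on UNIV (\<zeta> n)"
      using \<zeta>(1)[of n] by (intro continuous_at_imp_continuous_on ballI differentiable_imp_continuous_within) (simp add: test_function_def)
    then show "continuous_on S (\<zeta> n)" using continuous_on_subset by blast
    show "continuous_on S (grad (\<zeta> n))" using \<zeta>(1)[of n] continuous_on_subset unfolding test_function_def by blast
  qed
  have \<beta>U: "Linf U (\<lambda>x. \<beta> x $ i)" for i by (rule Linf_subset[OF \<beta> \<Omega>(1) open_U \<Omega>(3)])
  have \<sigma>U: "Linf U \<sigma>" by (rule Linf_subset[OF \<sigma> \<Omega>(1) open_U \<Omega>(3)])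
  note LC = Linf_continuous[OF open_U bounded_U]
  have \<beta>q: "Linf U (\<lambda>x. \<beta> x \<bullet> grad q x)"
    by (intro Linf_inner \<beta>U LC continuous_intros qc)
  have lim: "(\<lambda>n. LINT x|lebesgue_on U. f x * \<zeta> n x) \<longlonglongrightarrow> (LINT x|lebesgue_on U. f x)" if f: "Linf U f" for f
  proof (rule integral_dominated_convergence[where w="\<lambda>x. \<bar>f x\<bar>"])
    have fi: "integrable (lebesgue_on U) f" by (rule Linf_integrable[OF f open_U bounded_U])
    then show "f \<in> borel_measurable (lebesgue_on U)" "integrable (lebesgue_on U) (\<lambda>x. \<bar>f x\<bar>)" by auto
    show "(\<lambda>x. f x * \<zeta> n x) \<in> borel_measurable (lebesgue_on U)" for n
      using Linf_mult[OF f LC[OF \<zeta>c(1)]] by (simp add: Linf_def)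
    show "AE x in lebesgue_on U. (\<lambda>n. f x * \<zeta> n x) \<longlonglongrightarrow> f x"
      by (intro AE_I2) (use tendsto_mult[OF tendsto_const \<zeta>(3)] in \<open>fastforce simp: space_restrict_space\<close>)
    show "AE x in lebesgue_on U. norm (f x * \<zeta> n x) \<le> \<bar>f x\<bar>" for n
      by (intro AE_I2) (use \<zeta>(2)[of n] in \<open>simp add: abs_mult mult_left_le\<close>)
  qed
  have key: "\<sigma>\<^sub>0 * (LINT x|lebesgue_on U. (q x)\<^sup>2 * \<zeta> n x)
     \<le> (LINT x|lebesgue_on U. (\<sigma> x * (q x)\<^sup>2) * \<zeta> n x) - (LINT x|lebesgue_on U. (q x * (\<beta> x \<bullet> grad q x)) * \<zeta> n x)
        - 1 / 2 * (\<integral>x. indicator U x * (((q x)\<^sup>2 *\<^sub>R b x) \<bullet> grad (\<zeta> n) x) \<partial>lborel)" for n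
  proof -
    let ?\<phi> = "\<lambda>x. (q x)\<^sup>2 * \<zeta> n x"
    have test: "test_function \<Omega> ?\<phi>" and gr: "\<And>x. grad ?\<phi> x = (2 * q x * \<zeta> n x) *\<^sub>R grad q x + (q x)\<^sup>2 *\<^sub>R grad (\<zeta> n) x"
      using test_function_weighted_square[OF \<zeta>(1) q \<Omega>(3)] by blast+
    obtain C where C: "compact C" "C \<subseteq> U" "\<And>x. x \<notin> C \<Longrightarrow> \<zeta> n x = 0" using \<zeta>(1)[of n] unfolding test_function_def by blast
    have \<zeta>g0: "grad (\<zeta> n) x = 0" if "x \<notin> C" for x
    proof -
      have "grad (\<zeta> n) x = grad (\<lambda>_. 0) x"
        by (intro grad_cong_open[of "- C"]) (use C that compact_imp_closed in \<open>auto simp: open_Compl\<close>)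
      also have "\<dots> = 0" by (simp add: grad_def vec_eq_iff frechet_derivative_const)
      finally show ?thesis .
    qed
    have \<phi>c: "continuous_on S ?\<phi>" for S by (intro continuous_intros qc \<zeta>c)
    have g0: "grad ?\<phi> x = 0" if "x \<notin> U" for x
    proof -
      have "x \<notin> C" using C(2) that by blast
      then show ?thesis using C(3) \<zeta>g0 by (simp add: gr)
    qed
    have gc: "continuous_on S (\<lambda>x. grad ?\<phi> x $ i)" for S i
      unfolding gr by (intro continuous_intros qc \<zeta>c)
    \<comment> \<open>\<open>G i\<close> is known to be integrable over compact subsets only; the
      compact support \<open>C\<close> of the cut-off makes this sufficient.\<close>
    have Gint: "integrable (lebesgue_on \<Omega>) (\<lambda>x. G i x * ?\<phi> x)" for i
    proof -
      have "compact C \<and> C \<subseteq> \<Omega>" using C \<Omega>(3) by blast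
      then have s: "integrable lebesgue (\<lambda>x. indicator C x *\<^sub>R G i x)"
        using G[of i] unfolding is_weak_partial_def set_integrable_def by blast
      have "bounded (?\<phi> ` C)" by (intro compact_imp_bounded compact_continuous_image \<phi>c C)
      then obtain B where B: "\<forall>x\<in>C. \<bar>?\<phi> x\<bar> \<le> B" by (auto simp: bounded_iff)
      have "integrable lebesgue (\<lambda>x. (indicator C x *\<^sub>R G i x) * ?\<phi> x)"
      proof (rule Bochner_Integration.integrable_bound)
        show "integrable lebesgue (\<lambda>x. B * (indicator C x *\<^sub>R G i x))" using s by simp
        have "?\<phi> \<in> borel_measurable lebesgue"
          using borel_measurable_continuous_onI[OF \<phi>c] by (intro measurable_completion) simp
        then show "(\<lambda>x. (indicator C x *\<^sub>R G i x) * ?\<phi> x) \<in> borel_measurable lebesgue"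
          using borel_measurable_integrable[OF s] by (rule borel_measurable_times[rotated])
        show "AE x in lebesgue. norm ((indicator C x *\<^sub>R G i x) * ?\<phi> x) \<le> norm (B * (indicator C x *\<^sub>R G i x))"
        proof (intro AE_I2)
          fix x
          show "norm ((indicator C x *\<^sub>R G i x) * ?\<phi> x) \<le> norm (B * (indicator C x *\<^sub>R G i x))"
          proof (cases "x \<in> C")
            case True
            then have "\<bar>G i x\<bar> * \<bar>?\<phi> x\<bar> \<le> \<bar>G i x\<bar> * \<bar>B\<bar>" using B by (intro mult_left_mono) force+
            then show ?thesis using True by (simp add: abs_mult mult_ac)
          qed simp
        qed
      qed
      moreover have "(\<lambda>x. (indicator C x *\<^sub>R G i x) * ?\<phi> x) = (\<lambda>x. indicator \<Omega> x *\<^sub>R (G i x * ?\<phi> x))"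
        using C \<Omega>(3) by (auto simp: indicator_def fun_eq_iff)
      ultimately show ?thesis using \<Omega>(1) by (simp add: integrable_restrict_space)
    qed
    have \<phi>\<Omega>: "Linf \<Omega> ?\<phi>" by (rule Linf_continuous[OF \<Omega>(1,2) \<phi>c])
    \<comment> \<open>The weak identity lives on the whole domain, but the gradient of the test
      function vanishes outside \<open>U\<close>.\<close>
    have weak: "(\<Sum>i\<in>UNIV. LINT x|lebesgue_on \<Omega>. G i x * ?\<phi> x) = - (LINT x|lebesgue_on U. \<beta> x \<bullet> grad ?\<phi> x)"
    proof -
      have "(LINT x|lebesgue_on \<Omega>. G i x * ?\<phi> x) = - (LINT x|lebesgue_on U. \<beta> x $ i * grad ?\<phi> x $ i)" for i
      proof -
        have "(LINT x|lebesgue_on \<Omega>. \<beta> x $ i * grad ?\<phi> x $ i) = - (LINT x|lebesgue_on \<Omega>. G i x * ?\<phi> x)"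
          using G[of i] test unfolding is_weak_partial_def by blast
        moreover have "(LINT x|lebesgue_on \<Omega>. \<beta> x $ i * grad ?\<phi> x $ i) = (LINT x|lebesgue_on U. \<beta> x $ i * grad ?\<phi> x $ i)"
          by (rule lebesgue_on_integral_support[OF \<Omega>(1) open_U \<Omega>(3)]) (simp add: g0)
        ultimately show ?thesis by simp
      qed
      moreover have "(LINT x|lebesgue_on U. \<beta> x \<bullet> grad ?\<phi> x) = (\<Sum>i\<in>UNIV. LINT x|lebesgue_on U. \<beta> x $ i * grad ?\<phi> x $ i)"
        unfolding inner_vec_def inner_real_def
        by (rule Bochner_Integration.integral_sum) (intro Linf_integrable Linf_mult \<beta>U LC gc open_U bounded_U)
      ultimately show ?thesis by (simp add: sum_negf)
    qed
    have step: "\<sigma>\<^sub>0 * (LINT x|lebesgue_on \<Omega>. ?\<phi> x) \<le> (LINT x|lebesgue_on \<Omega>. \<sigma> x * ?\<phi> x) + 1 / 2 * (\<Sum>i\<in>UNIV. LINT x|lebesgue_on \<Omega>. G i x * ?\<phi> x)"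
    proof -
      have i1: "integrable (lebesgue_on \<Omega>) (\<lambda>x. \<sigma> x * ?\<phi> x)"
        by (intro Linf_integrable Linf_mult \<sigma> \<phi>\<Omega> \<Omega>)
      have i2: "integrable (lebesgue_on \<Omega>) (\<lambda>x. \<Sum>i\<in>UNIV. G i x * ?\<phi> x)" using Gint by simp
      have "(LINT x|lebesgue_on \<Omega>. \<sigma>\<^sub>0 * ?\<phi> x) \<le> (LINT x|lebesgue_on \<Omega>. \<sigma> x * ?\<phi> x + 1 / 2 * (\<Sum>i\<in>UNIV. G i x * ?\<phi> x))"
      proof (rule integral_mono_AE)
        show "integrable (lebesgue_on \<Omega>) (\<lambda>x. \<sigma>\<^sub>0 * ?\<phi> x)"
          using Linf_integrable[OF \<phi>\<Omega> \<Omega>(1,2)] by (rule integrable_mult_right)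
        show "integrable (lebesgue_on \<Omega>) (\<lambda>x. \<sigma> x * ?\<phi> x + 1 / 2 * (\<Sum>i\<in>UNIV. G i x * ?\<phi> x))"
          by (intro Bochner_Integration.integrable_add i1 integrable_mult_right i2)
        show "AE x in lebesgue_on \<Omega>. \<sigma>\<^sub>0 * ?\<phi> x \<le> \<sigma> x * ?\<phi> x + 1 / 2 * (\<Sum>i\<in>UNIV. G i x * ?\<phi> x)"
          using react
        proof eventually_elim
          fix x assume "\<sigma>\<^sub>0 \<le> \<sigma> x + 1 / 2 * (\<Sum>i\<in>UNIV. G i x)"
          then have "\<sigma>\<^sub>0 * ?\<phi> x \<le> (\<sigma> x + 1 / 2 * (\<Sum>i\<in>UNIV. G i x)) * ?\<phi> x"
            using \<zeta>(2)[of n x] by (intro mult_right_mono) auto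
          then show "\<sigma>\<^sub>0 * ?\<phi> x \<le> \<sigma> x * ?\<phi> x + 1 / 2 * (\<Sum>i\<in>UNIV. G i x * ?\<phi> x)"
            by (simp only: distrib_right mult.assoc sum_distrib_right)
        qed
      qed
      also have "\<dots> = (LINT x|lebesgue_on \<Omega>. \<sigma> x * ?\<phi> x) + 1 / 2 * (LINT x|lebesgue_on \<Omega>. (\<Sum>i\<in>UNIV. G i x * ?\<phi> x))"
        by (subst Bochner_Integration.integral_add[OF i1 integrable_mult_right[OF i2]]) (simp only: integral_mult_right_zero)
      also have "(LINT x|lebesgue_on \<Omega>. (\<Sum>i\<in>UNIV. G i x * ?\<phi> x)) = (\<Sum>i\<in>UNIV. LINT x|lebesgue_on \<Omega>. G i x * ?\<phi> x)"
        by (rule Bochner_Integration.integral_sum) (rule Gint)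
      finally show ?thesis by (simp only: integral_mult_right_zero)
    qed
    have restr: "(LINT x|lebesgue_on \<Omega>. ?\<phi> x) = (LINT x|lebesgue_on U. ?\<phi> x)"
      "(LINT x|lebesgue_on \<Omega>. \<sigma> x * ?\<phi> x) = (LINT x|lebesgue_on U. \<sigma> x * ?\<phi> x)"
    proof -
      have "?\<phi> x = 0" if "x \<notin> U" for x using C(2) C(3)[of x] that by auto
      then show "(LINT x|lebesgue_on \<Omega>. ?\<phi> x) = (LINT x|lebesgue_on U. ?\<phi> x)"
        "(LINT x|lebesgue_on \<Omega>. \<sigma> x * ?\<phi> x) = (LINT x|lebesgue_on U. \<sigma> x * ?\<phi> x)"
        by (intro lebesgue_on_integral_support[OF \<Omega>(1) open_U \<Omega>(3)]; simp)+
    qed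
    \<comment> \<open>Product rule. In the term with the gradient of the cut-off
      \<open>\<beta>\<close> is replaced by \<open>b\<close>, since the limit formula for cut-offs
      requires continuity up to the boundary.\<close>
    have flux: "(LINT x|lebesgue_on U. \<beta> x \<bullet> grad ?\<phi> x)
       = 2 * (LINT x|lebesgue_on U. (q x * (\<beta> x \<bullet> grad q x)) * \<zeta> n x) + (\<integral>x. indicator U x * (((q x)\<^sup>2 *\<^sub>R b x) \<bullet> grad (\<zeta> n) x) \<partial>lborel)"
    proof -
      have l1: "Linf U (\<lambda>x. (q x * (\<beta> x \<bullet> grad q x)) * \<zeta> n x)"
        by (intro Linf_mult \<beta>q LC qc \<zeta>c)
      have l2: "Linf U (\<lambda>x. (q x)\<^sup>2 * (\<beta> x \<bullet> grad (\<zeta> n) x))"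
        by (intro Linf_mult Linf_inner \<beta>U LC continuous_intros qc \<zeta>c)
      have "(LINT x|lebesgue_on U. \<beta> x \<bullet> grad ?\<phi> x)
         = (LINT x|lebesgue_on U. 2 * ((q x * (\<beta> x \<bullet> grad q x)) * \<zeta> n x) + (q x)\<^sup>2 * (\<beta> x \<bullet> grad (\<zeta> n) x))"
        by (intro Bochner_Integration.integral_cong refl) (simp add: gr inner_add_right)
      also have "\<dots> = (LINT x|lebesgue_on U. 2 * ((q x * (\<beta> x \<bullet> grad q x)) * \<zeta> n x)) + (LINT x|lebesgue_on U. (q x)\<^sup>2 * (\<beta> x \<bullet> grad (\<zeta> n) x))"
        by (intro Bochner_Integration.integral_add integrable_mult_right Linf_integrable l1 l2 open_U bounded_U)
      also have "(LINT x|lebesgue_on U. 2 * ((q x * (\<beta> x \<bullet> grad q x)) * \<zeta> n x)) = 2 * (LINT x|lebesgue_on U. (q x * (\<beta> x \<bullet> grad q x)) * \<zeta> n x)"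
        by (rule integral_mult_right_zero)
      also have "(LINT x|lebesgue_on U. (q x)\<^sup>2 * (\<beta> x \<bullet> grad (\<zeta> n) x)) = (LINT x|lebesgue_on U. ((q x)\<^sup>2 *\<^sub>R b x) \<bullet> grad (\<zeta> n) x)"
      proof (rule integral_cong_AE)
        show "(\<lambda>x. (q x)\<^sup>2 * (\<beta> x \<bullet> grad (\<zeta> n) x)) \<in> borel_measurable (lebesgue_on U)" using l2 by (simp add: Linf_def)
        have "Linf U (\<lambda>x. ((q x)\<^sup>2 *\<^sub>R b x) \<bullet> grad (\<zeta> n) x)" by (intro LC continuous_intros qc \<zeta>c b)
        then show "(\<lambda>x. ((q x)\<^sup>2 *\<^sub>R b x) \<bullet> grad (\<zeta> n) x) \<in> borel_measurable (lebesgue_on U)" by (simp add: Linf_def)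
        show "AE x in lebesgue_on U. (q x)\<^sup>2 * (\<beta> x \<bullet> grad (\<zeta> n) x) = ((q x)\<^sup>2 *\<^sub>R b x) \<bullet> grad (\<zeta> n) x"
          using b(2) by eventually_elim simp
      qed
      also have "\<dots> = (\<integral>x. indicator U x *\<^sub>R (((q x)\<^sup>2 *\<^sub>R b x) \<bullet> grad (\<zeta> n) x) \<partial>lebesgue)"
        using open_U by (intro integral_restrict_space) simp
      also have "\<dots> = (\<integral>x. indicator U x *\<^sub>R (((q x)\<^sup>2 *\<^sub>R b x) \<bullet> grad (\<zeta> n) x) \<partial>lborel)"
      proof (rule integral_completion)
        have "continuous_on U (\<lambda>x. ((q x)\<^sup>2 *\<^sub>R b x) \<bullet> grad (\<zeta> n) x)"
          by (intro continuous_intros qc \<zeta>c continuous_on_subset[OF b(1) closure_subset])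
        then have "(\<lambda>x. indicator U x *\<^sub>R (((q x)\<^sup>2 *\<^sub>R b x) \<bullet> grad (\<zeta> n) x)) \<in> borel_measurable borel"
          by (rule borel_measurable_continuous_on_indicator[OF borel_U])
        then show "(\<lambda>x. indicator U x *\<^sub>R (((q x)\<^sup>2 *\<^sub>R b x) \<bullet> grad (\<zeta> n) x)) \<in> borel_measurable lborel"
          by simp
      qed
      finally show ?thesis by simp
    qed
    have "(LINT x|lebesgue_on U. (\<sigma> x * (q x)\<^sup>2) * \<zeta> n x) = (LINT x|lebesgue_on U. \<sigma> x * ?\<phi> x)" by (simp only: mult.assoc)
    moreover have "l \<le> s' - d - 1 / 2 * w" if "s' = s" "l \<le> s + 1 / 2 * - (2 * d + w)" for l s s' d w :: real
      using that by (simp add: field_simps)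
    ultimately show ?thesis using step unfolding restr weak flux by blast
  qed
  have Hc: "continuous_on (closure U) (\<lambda>x. (q x)\<^sup>2 *\<^sub>R b x)" by (intro continuous_intros qc b)
  have "\<sigma>\<^sub>0 * (LINT x|lebesgue_on U. (q x)\<^sup>2)
     \<le> (LINT x|lebesgue_on U. \<sigma> x * (q x)\<^sup>2) - (LINT x|lebesgue_on U. q x * (\<beta> x \<bullet> grad q x))
        - 1 / 2 * - (\<Sum>e\<in>facets U. facet_integral e (\<lambda>x. normal_on U e \<bullet> ((q x)\<^sup>2 *\<^sub>R b x)))"
  proof (rule LIMSEQ_le)
    show "(\<lambda>n. \<sigma>\<^sub>0 * (LINT x|lebesgue_on U. (q x)\<^sup>2 * \<zeta> n x)) \<longlonglongrightarrow> \<sigma>\<^sub>0 * (LINT x|lebesgue_on U. (q x)\<^sup>2)"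
      by (intro tendsto_intros lim LC qc continuous_intros)
    show "(\<lambda>n. (LINT x|lebesgue_on U. (\<sigma> x * (q x)\<^sup>2) * \<zeta> n x) - (LINT x|lebesgue_on U. (q x * (\<beta> x \<bullet> grad q x)) * \<zeta> n x)
        - 1 / 2 * (\<integral>x. indicator U x * (((q x)\<^sup>2 *\<^sub>R b x) \<bullet> grad (\<zeta> n) x) \<partial>lborel))
       \<longlonglongrightarrow> (LINT x|lebesgue_on U. \<sigma> x * (q x)\<^sup>2) - (LINT x|lebesgue_on U. q x * (\<beta> x \<bullet> grad q x))
        - 1 / 2 * - (\<Sum>e\<in>facets U. facet_integral e (\<lambda>x. normal_on U e \<bullet> ((q x)\<^sup>2 *\<^sub>R b x)))"
      by (intro tendsto_diff tendsto_mult_left lim Linf_mult \<sigma>U \<beta>q LC qc continuous_intros \<zeta>lim Hc)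
    show "\<exists>N. \<forall>n\<ge>N. \<sigma>\<^sub>0 * (LINT x|lebesgue_on U. (q x)\<^sup>2 * \<zeta> n x)
     \<le> (LINT x|lebesgue_on U. (\<sigma> x * (q x)\<^sup>2) * \<zeta> n x) - (LINT x|lebesgue_on U. (q x * (\<beta> x \<bullet> grad q x)) * \<zeta> n x)
        - 1 / 2 * (\<integral>x. indicator U x * (((q x)\<^sup>2 *\<^sub>R b x) \<bullet> grad (\<zeta> n) x) \<partial>lborel)"
      using key by blast
  qed
  moreover have "(\<Sum>e\<in>facets U. facet_integral e (\<lambda>x. normal_on U e \<bullet> ((q x)\<^sup>2 *\<^sub>R b x)))
     = (\<Sum>e\<in>facets U. facet_integral e (\<lambda>x. (b x \<bullet> normal_on U e) * (q x)\<^sup>2))"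
    by (intro sum.cong refl facet_integral_cong) (simp add: inner_commute)
  ultimately show ?thesis by linarith
qed

section \<open>Coercivity on a single mesh\<close>

text \<open>The polynomial \<open>q T\<close> is the restriction of \<open>v\<close> to \<open>T\<close>, the functions \<open>Kt T\<close> and \<open>b\<close> are the continuous
  representatives of \<open>K\<close> on \<open>T\<close> and of \<open>\<beta>\<close>, and \<open>c T\<close> is a centre of star-shapedness.\<close>

locale dg_function = conforming \<Omega> \<Gamma>\<^sub>D \<Gamma>\<^sub>N \<T>
  for \<Omega> \<Gamma>\<^sub>D \<Gamma>\<^sub>N :: "(real^'n) set" and \<T> :: "(real^'n) set set" +
  fixes K :: "real^'n \<Rightarrow> real^'n^'n" and \<beta> :: "real^'n \<Rightarrow> real^'n" and \<sigma> :: "real^'n \<Rightarrow> real"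
    and k\<^sub>m\<^sub>i\<^sub>n \<sigma>\<^sub>0 C\<^sub>t\<^sub>r \<kappa> :: real and p N :: nat
    and v :: "real^'n \<Rightarrow> real" and q :: "(real^'n) set \<Rightarrow> real^'n \<Rightarrow> real"
    and Kt :: "(real^'n) set \<Rightarrow> real^'n \<Rightarrow> real^'n^'n" and b :: "real^'n \<Rightarrow> real^'n" and c :: "(real^'n) set \<Rightarrow> real^'n"
  assumes q: "\<And>T. T \<in> \<T> \<Longrightarrow> q T \<in> poly_space p" and vq: "\<And>T x. T \<in> \<T> \<Longrightarrow> x \<in> T \<Longrightarrow> v x = q T x"
    and contract: "\<And>T x t. T \<in> \<T> \<Longrightarrow> x \<in> closure T \<Longrightarrow> 0 < t \<Longrightarrow> t \<le> 1 \<Longrightarrow> x + t *\<^sub>R (c T - x) \<in> T"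
    and K: "\<And>T i j. T \<in> \<T> \<Longrightarrow> Linf T (\<lambda>x. K x $ i $ j)"
    and Kt: "\<And>T. T \<in> \<T> \<Longrightarrow> continuous_on (closure T) (Kt T)" "\<And>T. T \<in> \<T> \<Longrightarrow> AE x in lebesgue_on T. Kt T x = K x"
    and \<kappa>: "0 \<le> \<kappa>" "\<And>T x \<xi>. T \<in> \<T> \<Longrightarrow> x \<in> closure T \<Longrightarrow> norm (Kt T x *v \<xi>) \<le> \<kappa> * norm \<xi>"
    and b: "continuous_on (closure \<Omega>) b" "AE x in lebesgue_on \<Omega>. b x = \<beta> x"
    and \<sigma>: "Linf \<Omega> \<sigma>" and \<beta>: "\<And>i. W1inf \<Omega> (\<lambda>x. \<beta> x $ i)"
    and elliptic: "0 < k\<^sub>m\<^sub>i\<^sub>n" "\<And>x \<xi>. x \<in> \<Omega> \<Longrightarrow> k\<^sub>m\<^sub>i\<^sub>n * (norm \<xi>)\<^sup>2 \<le> \<xi> \<bullet> (K x *v \<xi>)"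
    and react: "AE x in lebesgue_on \<Omega>. \<sigma>\<^sub>0 \<le> \<sigma> x + 1 / 2 * weak_div \<Omega> \<beta> x"
    and inflow: "\<And>x. x \<in> \<Gamma>\<^sub>D \<Longrightarrow> x \<in> flat_boundary \<Omega> \<Longrightarrow> b x \<bullet> outward_normal \<Omega> x \<le> 0"
      "\<And>x. x \<in> \<Gamma>\<^sub>N \<Longrightarrow> x \<in> flat_boundary \<Omega> \<Longrightarrow> 0 \<le> b x \<bullet> outward_normal \<Omega> x"
    and size: "\<And>T e. T \<in> \<T> \<Longrightarrow> e \<in> facets T \<Longrightarrow> 0 < facet_size \<T> e \<and> facet_size \<T> e \<le> diameter T"
    and N: "\<And>T. T \<in> \<T> \<Longrightarrow> card (facets T) \<le> N"
    and trace: "0 < C\<^sub>t\<^sub>r" "\<And>T w. T \<in> \<T> \<Longrightarrow> w \<in> poly_space p \<Longrightarrow>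
      (\<Sum>e\<in>facets T. facet_integral e (\<lambda>x. (w x)\<^sup>2)) \<le> C\<^sub>t\<^sub>r / diameter T * (LINT x|lebesgue_on T. (w x)\<^sup>2)"
begin

lemma open_element: "T \<in> \<T> \<Longrightarrow> open T" and bounded_element: "T \<in> \<T> \<Longrightarrow> bounded T"
  using polytopal.open_U[OF element_polytopal] polytopal.bounded_U[OF element_polytopal] by blast+

lemma q_cont: "T \<in> \<T> \<Longrightarrow> continuous_on S (q T)" "T \<in> \<T> \<Longrightarrow> continuous_on S (grad (q T))"
  using poly_space_C1(2,3)[OF q] continuous_on_subset by blast+

lemma grad_v: "T \<in> \<T> \<Longrightarrow> x \<in> T \<Longrightarrow> grad v x = grad (q T) x"
  using grad_cong_open[OF open_element] vq by blast

lemma closure_element: "T \<in> \<T> \<Longrightarrow> closure T \<subseteq> closure \<Omega>"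
  using closure_mono element_subset by blast

lemma AE_element:
  assumes "AE x in lebesgue_on \<Omega>. P x" "T \<in> \<T>"
  shows "AE x in lebesgue_on T. P x"
proof -
  have "AE x in lebesgue. x \<in> \<Omega> \<longrightarrow> P x" using assms(1) \<Omega>.open_U by (simp add: AE_restrict_space_iff)
  then have "AE x in lebesgue. x \<in> T \<longrightarrow> P x" by eventually_elim (use element_subset[OF assms(2)] in blast)
  then show ?thesis using open_element[OF assms(2)] by (simp add: AE_restrict_space_iff)
qed

lemma AE_on_element:
  assumes "T \<in> \<T>" "AE x in lebesgue_on T. P x" "\<And>x. x \<in> T \<Longrightarrow> P x \<Longrightarrow> Q x"
  shows "AE x in lebesgue_on T. Q x"
proof -
  have "AE x in lebesgue. x \<in> T \<longrightarrow> P x" using assms(2) open_element[OF assms(1)] by (simp add: AE_restrict_space_iff)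
  then have "AE x in lebesgue. x \<in> T \<longrightarrow> Q x" by eventually_elim (use assms(3) in blast)
  then show ?thesis using open_element[OF assms(1)] by (simp add: AE_restrict_space_iff)
qed

lemma Kt_continuous:
  assumes "T \<in> \<T>" "S \<subseteq> closure T" "continuous_on S g"
  shows "continuous_on S (\<lambda>x. Kt T x *v g x)"
proof -
  have k: "continuous_on S (\<lambda>x. Kt T x $ i $ j)" for i j
    using continuous_on_subset[OF Kt(1)[OF assms(1)] assms(2)] by (intro continuous_intros)
  show ?thesis unfolding matrix_vector_mult_def
    by (intro continuous_on_vec_lambda continuous_intros k assms(3))
qed

lemma cont_rep_v: "T \<in> \<T> \<Longrightarrow> x \<in> closure T \<Longrightarrow> cont_rep T v x = q T x"
  by (rule cont_rep_eq[OF open_element q_cont(1)])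
    (auto intro!: AE_I2 simp: space_restrict_space vq)

lemma cont_rep_flux:
  assumes T: "T \<in> \<T>" and x: "x \<in> closure T"
  shows "cont_rep T (\<lambda>y. K y *v grad v y) x = Kt T x *v grad (q T) x"
proof (rule cont_rep_eq[OF open_element[OF T] Kt_continuous[OF T order_refl q_cont(2)[OF T]] _ x])
  show "AE x in lebesgue_on T. Kt T x *v grad (q T) x = K x *v grad v x"
    by (rule AE_on_element[OF T Kt(2)[OF T]]) (simp add: grad_v[OF T])
qed

lemma cont_rep_advected:
  assumes T: "T \<in> \<T>" and x: "x \<in> closure T"
  shows "cont_rep T (\<lambda>y. v y *\<^sub>R \<beta> y) x = q T x *\<^sub>R b x"
proof (rule cont_rep_eq[OF open_element[OF T] _ _ x])
  show "continuous_on (closure T) (\<lambda>x. q T x *\<^sub>R b x)"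
    by (intro continuous_intros q_cont T continuous_on_subset[OF b(1) closure_element[OF T]])
  show "AE x in lebesgue_on T. q T x *\<^sub>R b x = v x *\<^sub>R \<beta> x"
    by (rule AE_on_element[OF T AE_element[OF b(2) T]]) (simp add: vq[OF T])
qed

lemma cont_rep_\<beta>: "x \<in> closure \<Omega> \<Longrightarrow> cont_rep \<Omega> \<beta> x = b x"
  by (rule cont_rep_eq[OF \<Omega>.open_U b])

lemma facet_flat: "T \<in> \<T> \<Longrightarrow> e \<in> facets T \<Longrightarrow> \<exists>d. flat_piece e (normal_on T e) d"
  using polytopal.facet_props(1)[OF element_polytopal] by blast

lemma facet_closure: "T \<in> \<T> \<Longrightarrow> e \<in> facets T \<Longrightarrow> closure e \<subseteq> closure T"
  using polytopal.facet_props(5)[OF element_polytopal] by (metis closure_minimal closed_closure frontier_def Diff_subset order_trans)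

lemma facet_in_closure: "T \<in> \<T> \<Longrightarrow> e \<in> facets T \<Longrightarrow> x \<in> e \<Longrightarrow> x \<in> closure T"
  using facet_closure closure_subset by blast

lemma facet_cont_bdd:
  assumes "T \<in> \<T>" "e \<in> facets T" "continuous_on (closure e) f"
  shows "cont_bdd e f"
proof -
  have "bounded (closure e)" using facet_closure[OF assms(1,2)] bounded_closure[OF bounded_element[OF assms(1)]] bounded_subset by blast
  then show ?thesis using cont_bdd_compact[OF assms(3) _ closure_subset] by (simp add: compact_eq_bounded_closed)
qed

lemma b_cont: "T \<in> \<T> \<Longrightarrow> e \<in> facets T \<Longrightarrow> continuous_on (closure e) b"
  using facet_closure closure_element continuous_on_subset[OF b(1)] by (metis order_trans)

lemma jump_eq:
  assumes "x \<in> e"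
  shows "jump \<T> e v x = (\<Sum>T\<in>adjacent \<T> e. q T x *\<^sub>R normal_on T e)"
  unfolding jump_def
proof (rule sum.cong[OF refl])
  fix T assume "T \<in> adjacent \<T> e"
  then have T: "T \<in> \<T>" "e \<in> facets T" by (auto simp: adjacent_def)
  then show "cont_rep T v x *\<^sub>R outward_normal T x = q T x *\<^sub>R normal_on T e"
    using cont_rep_v[OF T(1) facet_in_closure[OF T assms]] polytopal.facet_props(3)[OF element_polytopal[OF T(1)] T(2) assms] by simp
qed

lemma flux_average_eq:
  assumes "x \<in> e"
  shows "average \<T> e (\<lambda>y. K y *v grad v y) x
    = (1 / real (card (adjacent \<T> e))) *\<^sub>R (\<Sum>T\<in>adjacent \<T> e. Kt T x *v grad (q T) x)"
proof -
  have "(\<Sum>T\<in>adjacent \<T> e. cont_rep T (\<lambda>y. K y *v grad v y) x) = (\<Sum>T\<in>adjacent \<T> e. Kt T x *v grad (q T) x)"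
  proof (rule sum.cong[OF refl])
    fix T assume "T \<in> adjacent \<T> e"
    then have T: "T \<in> \<T>" "e \<in> facets T" by (auto simp: adjacent_def)
    then show "cont_rep T (\<lambda>y. K y *v grad v y) x = Kt T x *v grad (q T) x"
      by (intro cont_rep_flux facet_in_closure[OF T assms])
  qed
  then show ?thesis by (simp add: average_def)
qed

lemma facet_normal_abs:
  assumes "T \<in> \<T>" "e \<in> facets T"
  shows "\<bar>w \<bullet> facet_normal e\<bar> = \<bar>w \<bullet> normal_on T e\<bar>"
proof -
  obtain d where "flat_piece e (normal_on T e) d" using facet_flat[OF assms] by blast
  then show ?thesis using flat_piece.facet_normal_eq by fastforce
qed

definition flux_facet :: "(real^'n) set \<Rightarrow> real" where
  "flux_facet e = facet_integral e (\<lambda>x. average \<T> e (\<lambda>y. K y *v grad v y) x \<bullet> jump \<T> e v x)"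

definition jump_facet :: "(real^'n) set \<Rightarrow> real" where
  "jump_facet e = facet_integral e (\<lambda>x. (norm (jump \<T> e v x))\<^sup>2)"

lemma jump_facet_nonneg: "0 \<le> jump_facet e"
  unfolding jump_facet_def by (rule facet_integral_nonneg) simp

text \<open>Interior and boundary facets are treated together: the average over one or two elements
  is bounded by \<open>\<kappa>\<close> times the mean gradient norm, whose square is at most the
  sum of squares, and Young's inequality separates it from the jump.\<close>

lemma flux_facet_bound:
  assumes T0: "T0 \<in> \<T>" "e \<in> facets T0" and \<theta>: "0 < \<theta>"
  shows "\<bar>flux_facet e\<bar> \<le> \<kappa> / 2 * (\<theta> * facet_size \<T> e * (\<Sum>T\<in>adjacent \<T> e. facet_integral e (\<lambda>x. (norm (grad (q T) x))\<^sup>2))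
      + 1 / (\<theta> * facet_size \<T> e) * jump_facet e)"
proof -
  let ?A = "adjacent \<T> e" and ?h = "facet_size \<T> e"
  have h: "0 < ?h" using size[OF T0] by simp
  obtain d where "flat_piece e (normal_on T0 e) d" using facet_flat[OF T0] by blast
  then interpret flat_piece e "normal_on T0 e" d .
  have A: "finite ?A" "card ?A > 0"
    using T0 finite_mesh by (auto simp: card_gt_0_iff adjacent_def)
  define J where "J x = (\<Sum>T\<in>?A. q T x *\<^sub>R normal_on T e)" for x
  define a where "a x = (1 / real (card ?A)) *\<^sub>R (\<Sum>T\<in>?A. Kt T x *v grad (q T) x)" for x
  define R where "R x = \<kappa> / 2 * (\<theta> * ?h * (\<Sum>T\<in>?A. (norm (grad (q T) x))\<^sup>2)) + \<kappa> / 2 * (1 / (\<theta> * ?h)) * (norm (J x))\<^sup>2" for x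
  have point: "\<bar>a x \<bullet> J x\<bar> \<le> R x" if x: "x \<in> e" for x
  proof -
    \<comment> \<open>The mean of the gradient norms over the adjacent elements.\<close>
    define m where "m = (1 / real (card ?A)) * (\<Sum>T\<in>?A. norm (grad (q T) x))"
    have m0: "0 \<le> m" unfolding m_def by (intro mult_nonneg_nonneg sum_nonneg) auto
    have "norm (\<Sum>T\<in>?A. Kt T x *v grad (q T) x) \<le> (\<Sum>T\<in>?A. \<kappa> * norm (grad (q T) x))"
    proof (rule order_trans[OF norm_sum], rule sum_mono)
      fix T assume "T \<in> ?A"
      then have T: "T \<in> \<T>" "e \<in> facets T" by (auto simp: adjacent_def)
      then show "norm (Kt T x *v grad (q T) x) \<le> \<kappa> * norm (grad (q T) x)"
        by (intro \<kappa>(2) facet_in_closure[OF T x])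
    qed
    then have "norm (a x) \<le> \<kappa> * m"
      using A by (simp add: a_def m_def sum_distrib_left[symmetric] divide_right_mono)
    then have 1: "\<bar>a x \<bullet> J x\<bar> \<le> \<kappa> * m * norm (J x)"
      using Cauchy_Schwarz_ineq2[of "a x" "J x"] mult_right_mono[of "norm (a x)" "\<kappa> * m" "norm (J x)"] by simp
    have "m\<^sup>2 = (1 / real (card ?A))\<^sup>2 * (\<Sum>T\<in>?A. norm (grad (q T) x))\<^sup>2" unfolding m_def by (rule power_mult_distrib)
    also have "\<dots> \<le> (1 / real (card ?A))\<^sup>2 * ((\<Sum>T\<in>?A. (norm (grad (q T) x))\<^sup>2) * real (card ?A))"
      by (intro mult_left_mono sum_squared_le_sum_of_squares) auto
    also have "\<dots> = (\<Sum>T\<in>?A. (norm (grad (q T) x))\<^sup>2) / real (card ?A)" using A by (simp add: power2_eq_square)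
    also have "\<dots> \<le> (\<Sum>T\<in>?A. (norm (grad (q T) x))\<^sup>2) / 1"
      using A by (intro divide_left_mono sum_nonneg) auto
    finally have m2: "m\<^sup>2 \<le> (\<Sum>T\<in>?A. (norm (grad (q T) x))\<^sup>2)" by simp
    define t where "t = \<theta> * ?h"
    have t: "0 < t" using \<theta> h by (simp add: t_def)
    \<comment> \<open>Young's inequality with weight \<open>t\<close>, in the form of a nonnegative
      square.\<close>
    have "0 \<le> (t * m - norm (J x))\<^sup>2 / t" using t by simp
    also have "(t * m - norm (J x))\<^sup>2 / t = t * m\<^sup>2 + 1 / t * (norm (J x))\<^sup>2 - 2 * (m * norm (J x))"
      using t by (simp add: power2_eq_square field_simps)
    finally have "m * norm (J x) \<le> 1 / 2 * (t * m\<^sup>2 + 1 / t * (norm (J x))\<^sup>2)" by simp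
    also have "\<dots> \<le> 1 / 2 * (t * (\<Sum>T\<in>?A. (norm (grad (q T) x))\<^sup>2) + 1 / t * (norm (J x))\<^sup>2)"
      using m2 t by (intro mult_left_mono add_mono) auto
    finally have "\<kappa> * (m * norm (J x)) \<le> \<kappa> * (1 / 2 * (t * (\<Sum>T\<in>?A. (norm (grad (q T) x))\<^sup>2) + 1 / t * (norm (J x))\<^sup>2))"
      using \<kappa>(1) by (rule mult_left_mono)
    also have "\<dots> = R x" unfolding R_def t_def by (simp add: distrib_left)
    finally show ?thesis using 1 by (simp add: mult.assoc)
  qed
  have Ac: "closure e \<subseteq> closure T" "T \<in> \<T>" if "T \<in> ?A" for T using facet_closure that by (auto simp: adjacent_def)
  have contJ: "continuous_on (closure e) J"
    unfolding J_def by (intro continuous_intros q_cont Ac)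
  have cbJ: "cont_bdd e (\<lambda>x. (norm (J x))\<^sup>2)" by (intro facet_cont_bdd[OF T0] continuous_intros contJ)
  have conta: "continuous_on (closure e) a"
    unfolding a_def by (intro continuous_intros Kt_continuous q_cont Ac)
  have cbg: "cont_bdd e (\<lambda>x. (norm (grad (q T) x))\<^sup>2)" if "T \<in> ?A" for T
    by (intro facet_cont_bdd[OF T0] continuous_intros q_cont Ac that)
  have cbs: "cont_bdd e (\<lambda>x. \<Sum>T\<in>?A. (norm (grad (q T) x))\<^sup>2)"
    by (intro facet_cont_bdd[OF T0] continuous_intros q_cont Ac)
  have cbR: "cont_bdd e R" unfolding R_def
    by (intro cont_bdd_add cont_bdd_cmult cbs cbJ)
  have cba: "cont_bdd e (\<lambda>x. a x \<bullet> J x)" by (intro facet_cont_bdd[OF T0] continuous_intros conta contJ)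
  have fsum: "facet_integral e (\<lambda>x. \<Sum>T\<in>B. (norm (grad (q T) x))\<^sup>2) = (\<Sum>T\<in>B. facet_integral e (\<lambda>x. (norm (grad (q T) x))\<^sup>2))"
    if "B \<subseteq> ?A" for B
    using finite_subset[OF that A(1)] that
  proof (induction B rule: finite_induct)
    case empty
    show ?case using facet_integral_cmult[of e 0 "\<lambda>_. 0"] by simp
  next
    case (insert T B)
    have "cont_bdd e (\<lambda>x. \<Sum>T\<in>B. (norm (grad (q T) x))\<^sup>2)"
      by (intro facet_cont_bdd[OF T0] continuous_intros q_cont) (use insert.prems in \<open>auto simp: adjacent_def\<close>)
    then show ?case using insert facet_integral_add[OF cbg] by simp
  qed
  have flux: "flux_facet e = facet_integral e (\<lambda>x. a x \<bullet> J x)" unfolding flux_facet_def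
    by (rule facet_integral_cong) (simp add: flux_average_eq jump_eq a_def J_def)
  have jmp: "jump_facet e = facet_integral e (\<lambda>x. (norm (J x))\<^sup>2)" unfolding jump_facet_def
    by (rule facet_integral_cong) (simp add: jump_eq J_def)
  have "facet_integral e R = \<kappa> / 2 * (\<theta> * ?h * (\<Sum>T\<in>?A. facet_integral e (\<lambda>x. (norm (grad (q T) x))\<^sup>2))) + \<kappa> / 2 * (1 / (\<theta> * ?h)) * jump_facet e"
    unfolding R_def
    by (subst facet_integral_add) (auto intro!: cont_bdd_cmult cbs cbJ simp: facet_integral_cmult fsum jmp simp del: times_divide_eq_left)
  moreover have "facet_integral e (\<lambda>x. a x \<bullet> J x) \<le> facet_integral e R"
    by (rule facet_integral_mono[OF cba cbR]) (use point in \<open>fastforce simp: abs_le_iff\<close>)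
  moreover have "facet_integral e (\<lambda>x. - 1 * (a x \<bullet> J x)) \<le> facet_integral e R"
    by (rule facet_integral_mono[OF cont_bdd_cmult[OF cba] cbR]) (use point in \<open>fastforce simp: abs_le_iff\<close>)
  ultimately show ?thesis unfolding flux facet_integral_cmult by (simp add: abs_le_iff distrib_left)
qed

abbreviation "\<E>\<^sub>I\<^sub>D \<equiv> interior_facets \<T> \<union> boundary_facets \<T> \<Gamma>\<^sub>D"

definition diff_energy :: real where
  "diff_energy = (\<Sum>T\<in>\<T>. LINT x|lebesgue_on T. (K x *v grad v x) \<bullet> grad v x)"

text \<open>The discrete trace inequality applied to each component of the gradient, which is again
  a polynomial of degree at most \<open>p\<close>.\<close>

lemma gradient_trace:
  assumes T: "T \<in> \<T>"
  shows "(\<Sum>e\<in>facets T. facet_integral e (\<lambda>x. (norm (grad (q T) x))\<^sup>2)) \<le> C\<^sub>t\<^sub>r / diameter T * (LINT x|lebesgue_on T. (norm (grad (q T) x))\<^sup>2)"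
proof -
  have n2: "(norm (grad (q T) x))\<^sup>2 = (\<Sum>i\<in>UNIV. (grad (q T) x $ i)\<^sup>2)" for x
    unfolding power2_norm_eq_inner inner_vec_def by (simp add: power2_eq_square)
  have cq: "continuous_on S (\<lambda>x. (grad (q T) x $ i)\<^sup>2)" for S i by (intro continuous_intros q_cont T)
  have "facet_integral e (\<lambda>x. (norm (grad (q T) x))\<^sup>2) = (\<Sum>i\<in>UNIV. facet_integral e (\<lambda>x. (grad (q T) x $ i)\<^sup>2))" if e: "e \<in> facets T" for e
  proof -
    obtain d where "flat_piece e (normal_on T e) d" using facet_flat[OF T e] by blast
    then interpret flat_piece e "normal_on T e" d .
    have "facet_integral e (\<lambda>x. \<Sum>i\<in>I. (grad (q T) x $ i)\<^sup>2) = (\<Sum>i\<in>I. facet_integral e (\<lambda>x. (grad (q T) x $ i)\<^sup>2))" if "finite I" for I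
      using that
    proof (induction I rule: finite_induct)
      case empty
      show ?case using facet_integral_cmult[of e 0 "\<lambda>_. 0"] by simp
    next
      case (insert i I)
      have "cont_bdd e (\<lambda>x. (grad (q T) x $ i)\<^sup>2)" "cont_bdd e (\<lambda>x. \<Sum>i\<in>I. (grad (q T) x $ i)\<^sup>2)"
        by (intro facet_cont_bdd[OF T e] continuous_on_sum cq)+
      then show ?case using insert facet_integral_add by simp
    qed
    then show ?thesis by (simp add: n2)
  qed
  then have "(\<Sum>e\<in>facets T. facet_integral e (\<lambda>x. (norm (grad (q T) x))\<^sup>2))
      = (\<Sum>i\<in>UNIV. \<Sum>e\<in>facets T. facet_integral e (\<lambda>x. (grad (q T) x $ i)\<^sup>2))"
    by (subst sum.swap) simp
  also have "\<dots> \<le> (\<Sum>i\<in>UNIV. C\<^sub>t\<^sub>r / diameter T * (LINT x|lebesgue_on T. (grad (q T) x $ i)\<^sup>2))"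
    by (intro sum_mono trace(2) T poly_space_C1(4)[OF q])
  also have "\<dots> = C\<^sub>t\<^sub>r / diameter T * (\<Sum>i\<in>UNIV. LINT x|lebesgue_on T. (grad (q T) x $ i)\<^sup>2)"
    by (rule sum_distrib_left[symmetric])
  also have "(\<Sum>i\<in>UNIV. LINT x|lebesgue_on T. (grad (q T) x $ i)\<^sup>2) = (LINT x|lebesgue_on T. (norm (grad (q T) x))\<^sup>2)"
    unfolding n2
    by (rule Bochner_Integration.integral_sum[symmetric])
      (intro Linf_integrable Linf_continuous open_element bounded_element T cq)
  finally show ?thesis .
qed

lemma gradient_energy:
  assumes T: "T \<in> \<T>"
  shows "k\<^sub>m\<^sub>i\<^sub>n * (LINT x|lebesgue_on T. (norm (grad (q T) x))\<^sup>2) \<le> (LINT x|lebesgue_on T. (K x *v grad v x) \<bullet> grad v x)"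
proof -
  have gi: "Linf T (\<lambda>x. grad (q T) x $ i)" for i
    by (intro Linf_continuous open_element bounded_element T continuous_intros q_cont)
  have L: "Linf T (\<lambda>x. (K x *v grad (q T) x) \<bullet> grad (q T) x)"
  proof (rule Linf_inner[OF _ gi])
    fix i
    show "Linf T (\<lambda>x. (K x *v grad (q T) x) $ i)"
      unfolding matrix_vector_mult_def by (simp add: Linf_sum Linf_mult K[OF T] gi)
  qed
  have ng: "Linf T (\<lambda>x. (norm (grad (q T) x))\<^sup>2)"
    by (intro Linf_continuous open_element bounded_element T continuous_intros q_cont)
  have "(LINT x|lebesgue_on T. k\<^sub>m\<^sub>i\<^sub>n * (norm (grad (q T) x))\<^sup>2) \<le> (LINT x|lebesgue_on T. (K x *v grad (q T) x) \<bullet> grad (q T) x)"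
  proof (rule integral_mono)
    show "integrable (lebesgue_on T) (\<lambda>x. k\<^sub>m\<^sub>i\<^sub>n * (norm (grad (q T) x))\<^sup>2)"
      by (intro integrable_mult_right Linf_integrable ng open_element bounded_element T)
    show "integrable (lebesgue_on T) (\<lambda>x. (K x *v grad (q T) x) \<bullet> grad (q T) x)"
      by (intro Linf_integrable L open_element bounded_element T)
    fix x assume "x \<in> space (lebesgue_on T)"
    then have "x \<in> \<Omega>" using element_subset[OF T] by (auto simp: space_restrict_space)
    from elliptic(2)[OF this, of "grad (q T) x"]
    show "k\<^sub>m\<^sub>i\<^sub>n * (norm (grad (q T) x))\<^sup>2 \<le> (K x *v grad (q T) x) \<bullet> grad (q T) x" by (simp add: inner_commute)
  qed
  also have "\<dots> = (LINT x|lebesgue_on T. (K x *v grad v x) \<bullet> grad v x)"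
    by (intro Bochner_Integration.integral_cong refl) (auto simp: space_restrict_space grad_v[OF T])
  finally show ?thesis by simp
qed

lemma diff_energy_nonneg: "0 \<le> diff_energy"
  unfolding diff_energy_def
proof (rule sum_nonneg)
  fix T assume T: "T \<in> \<T>"
  have "0 \<le> k\<^sub>m\<^sub>i\<^sub>n * (LINT x|lebesgue_on T. (norm (grad (q T) x))\<^sup>2)"
    using elliptic(1) by (intro mult_nonneg_nonneg Bochner_Integration.integral_nonneg) auto
  then show "0 \<le> (LINT x|lebesgue_on T. (K x *v grad v x) \<bullet> grad v x)" using gradient_energy[OF T] by linarith
qed

lemma facet_element:
  assumes "e \<in> \<E>\<^sub>I\<^sub>D"
  obtains T where "T \<in> \<T>" "e \<in> facets T"
  using assms by (auto simp: interior_facets_def boundary_facets_def)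

text \<open>The gradient part carries \<open>\<theta> * facet_size \<T> e\<close>, and the size
  cancels the inverse diameter of the trace inequality. It then costs at most
  \<open>\<theta> * C / k\<^sub>m\<^sub>i\<^sub>n\<close> times the energy, while the jump part
  costs \<open>1 / (\<theta> * \<gamma>)\<close> times the penalty. Equating the two factors gives
  their common value \<open>s\<close>.\<close>

lemma flux_bound:
  assumes \<gamma>: "0 < \<gamma>"
  shows "\<bar>\<Sum>e\<in>\<E>\<^sub>I\<^sub>D. flux_facet e\<bar> \<le> \<kappa> / 2 * sqrt (real N * C\<^sub>t\<^sub>r / (\<gamma> * k\<^sub>m\<^sub>i\<^sub>n)) * (diff_energy + (\<Sum>e\<in>\<E>\<^sub>I\<^sub>D. \<gamma> / facet_size \<T> e * jump_facet e))"
proof (cases "N = 0")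
  \<comment> \<open>Without facets both sums are empty; this case is separate because
    \<open>\<theta>\<close> is defined by division by
    \<open>real N * C\<^sub>t\<^sub>r\<close>.\<close>
  case True
  have "facets T = {}" if "T \<in> \<T>" for T
    using N[OF that] True polytopal.finite_facets[OF element_polytopal[OF that]] by simp
  then have "\<E>\<^sub>I\<^sub>D = {}" by (auto simp: interior_facets_def boundary_facets_def)
  then show ?thesis using True by simp
next
  case False
  let ?h = "facet_size \<T>"
  let ?g = "\<lambda>T e. facet_integral e (\<lambda>x. (norm (grad (q T) x))\<^sup>2)"
  define C where "C = real N * C\<^sub>t\<^sub>r"
  have C: "C\<^sub>t\<^sub>r \<le> C" "0 < C" using False trace(1) by (simp_all add: C_def)
  define s where "s = sqrt (C / (\<gamma> * k\<^sub>m\<^sub>i\<^sub>n))"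
  have s: "0 < s" using C \<gamma> elliptic(1) by (simp add: s_def)
  have ss: "s * s = C / (\<gamma> * k\<^sub>m\<^sub>i\<^sub>n)" using C \<gamma> elliptic(1) by (simp add: s_def)
  \<comment> \<open>the weight in Young's inequality for which both contributions carry the same factor \<open>s\<close>\<close>
  define \<theta> where "\<theta> = s * k\<^sub>m\<^sub>i\<^sub>n / C"
  have \<theta>: "0 < \<theta>" using s elliptic(1) C by (simp add: \<theta>_def)
  have \<theta>1: "\<theta> * C\<^sub>t\<^sub>r / k\<^sub>m\<^sub>i\<^sub>n \<le> s"
  proof -
    have "\<theta> * C\<^sub>t\<^sub>r / k\<^sub>m\<^sub>i\<^sub>n \<le> \<theta> * C / k\<^sub>m\<^sub>i\<^sub>n" using C \<theta> elliptic(1) by (intro divide_right_mono mult_left_mono) auto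
    then show ?thesis using C elliptic(1) by (simp add: \<theta>_def)
  qed
  have \<theta>2: "1 / \<theta> = s * \<gamma>"
  proof -
    have "s * \<gamma> * \<theta> = (s * s) * \<gamma> * k\<^sub>m\<^sub>i\<^sub>n / C" by (simp add: \<theta>_def)
    also have "\<dots> = 1" using C \<gamma> elliptic(1) by (simp add: ss)
    finally show ?thesis using \<theta> by (simp add: field_simps)
  qed
  have fin: "finite \<E>\<^sub>I\<^sub>D" using finite_facet_sets by blast
  have g0: "0 \<le> ?g T e" for T e by (rule facet_integral_nonneg) simp
  have "\<bar>\<Sum>e\<in>\<E>\<^sub>I\<^sub>D. flux_facet e\<bar> \<le> (\<Sum>e\<in>\<E>\<^sub>I\<^sub>D. \<bar>flux_facet e\<bar>)" by (rule sum_abs)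
  also have "\<dots> \<le> (\<Sum>e\<in>\<E>\<^sub>I\<^sub>D. \<kappa> / 2 * (\<theta> * (\<Sum>T\<in>adjacent \<T> e. ?h e * ?g T e) + s * (\<gamma> / ?h e * jump_facet e)))"
  proof (rule sum_mono)
    fix e assume "e \<in> \<E>\<^sub>I\<^sub>D"
    then obtain T where T: "T \<in> \<T>" "e \<in> facets T" by (rule facet_element)
    have "1 / (\<theta> * ?h e) = s * (\<gamma> / ?h e)" using \<theta>2 by (metis divide_divide_eq_left times_divide_eq_right)
    then show "\<bar>flux_facet e\<bar> \<le> \<kappa> / 2 * (\<theta> * (\<Sum>T\<in>adjacent \<T> e. ?h e * ?g T e) + s * (\<gamma> / ?h e * jump_facet e))"
      using flux_facet_bound[OF T \<theta>] by (simp only: mult.assoc sum_distrib_left)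
  qed
  also have "\<dots> = \<kappa> / 2 * (\<theta> * (\<Sum>e\<in>\<E>\<^sub>I\<^sub>D. \<Sum>T\<in>adjacent \<T> e. ?h e * ?g T e) + s * (\<Sum>e\<in>\<E>\<^sub>I\<^sub>D. \<gamma> / ?h e * jump_facet e))"
    by (simp only: sum_distrib_left[symmetric] sum.distrib)
  also have "\<dots> \<le> \<kappa> / 2 * (s * diff_energy + s * (\<Sum>e\<in>\<E>\<^sub>I\<^sub>D. \<gamma> / ?h e * jump_facet e))"
  proof -
    \<comment> \<open>Adding the nonnegative terms of the remaining facets allows the sum to be
      regrouped by elements.\<close>
    have "(\<Sum>e\<in>\<E>\<^sub>I\<^sub>D. \<Sum>T\<in>adjacent \<T> e. ?h e * ?g T e) \<le> (\<Sum>T\<in>\<T>. \<Sum>e\<in>facets T. ?h e * ?g T e)"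
    proof -
      have "(\<Sum>e\<in>\<E>\<^sub>I\<^sub>D. \<Sum>T\<in>adjacent \<T> e. ?h e * ?g T e)
         = (\<Sum>e\<in>interior_facets \<T>. \<Sum>T\<in>adjacent \<T> e. ?h e * ?g T e) + (\<Sum>e\<in>boundary_facets \<T> \<Gamma>\<^sub>D. \<Sum>T\<in>adjacent \<T> e. ?h e * ?g T e)"
        by (rule sum.union_disjoint) (use finite_facet_sets facet_sets_disjoint in auto)
      moreover have "0 \<le> (\<Sum>e\<in>boundary_facets \<T> \<Gamma>\<^sub>N. \<Sum>T\<in>adjacent \<T> e. ?h e * ?g T e)"
      proof (intro sum_nonneg mult_nonneg_nonneg g0)
        fix e T assume "T \<in> adjacent \<T> e"
        then show "0 \<le> ?h e" using size[of T e] by (auto simp: adjacent_def)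
      qed
      ultimately show ?thesis unfolding sum_over_element_facets by simp
    qed
    also have "\<dots> \<le> (\<Sum>T\<in>\<T>. C\<^sub>t\<^sub>r * (LINT x|lebesgue_on T. (norm (grad (q T) x))\<^sup>2))"
    proof (rule sum_mono)
      fix T assume T: "T \<in> \<T>"
      show "(\<Sum>e\<in>facets T. ?h e * ?g T e) \<le> C\<^sub>t\<^sub>r * (LINT x|lebesgue_on T. (norm (grad (q T) x))\<^sup>2)"
      proof (cases "facets T = {}")
        case True
        then show ?thesis using trace(1) by (simp add: Bochner_Integration.integral_nonneg)
      next
        case False
        then have D: "0 < diameter T" using size[OF T] by (metis all_not_in_conv less_le_trans)
        have "(\<Sum>e\<in>facets T. ?h e * ?g T e) \<le> (\<Sum>e\<in>facets T. diameter T * ?g T e)"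
          using size[OF T] by (intro sum_mono mult_right_mono g0) auto
        also have "\<dots> = diameter T * (\<Sum>e\<in>facets T. ?g T e)" by (rule sum_distrib_left[symmetric])
        also have "\<dots> \<le> diameter T * (C\<^sub>t\<^sub>r / diameter T * (LINT x|lebesgue_on T. (norm (grad (q T) x))\<^sup>2))"
          using D by (intro mult_left_mono gradient_trace T) auto
        finally show ?thesis using D by simp
      qed
    qed
    also have "\<dots> \<le> (\<Sum>T\<in>\<T>. C\<^sub>t\<^sub>r / k\<^sub>m\<^sub>i\<^sub>n * (LINT x|lebesgue_on T. (K x *v grad v x) \<bullet> grad v x))"
    proof (rule sum_mono)
      fix T assume T: "T \<in> \<T>"
      have "C\<^sub>t\<^sub>r / k\<^sub>m\<^sub>i\<^sub>n * (k\<^sub>m\<^sub>i\<^sub>n * (LINT x|lebesgue_on T. (norm (grad (q T) x))\<^sup>2))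
          \<le> C\<^sub>t\<^sub>r / k\<^sub>m\<^sub>i\<^sub>n * (LINT x|lebesgue_on T. (K x *v grad v x) \<bullet> grad v x)"
        using trace(1) elliptic(1) by (intro mult_left_mono gradient_energy T) auto
      then show "C\<^sub>t\<^sub>r * (LINT x|lebesgue_on T. (norm (grad (q T) x))\<^sup>2) \<le> C\<^sub>t\<^sub>r / k\<^sub>m\<^sub>i\<^sub>n * (LINT x|lebesgue_on T. (K x *v grad v x) \<bullet> grad v x)"
        using elliptic(1) by simp
    qed
    also have "\<dots> = C\<^sub>t\<^sub>r / k\<^sub>m\<^sub>i\<^sub>n * diff_energy" unfolding diff_energy_def by (rule sum_distrib_left[symmetric])
    finally have "\<theta> * (\<Sum>e\<in>\<E>\<^sub>I\<^sub>D. \<Sum>T\<in>adjacent \<T> e. ?h e * ?g T e) \<le> \<theta> * (C\<^sub>t\<^sub>r / k\<^sub>m\<^sub>i\<^sub>n * diff_energy)"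
      using \<theta> by (intro mult_left_mono) auto
    also have "\<dots> = (\<theta> * C\<^sub>t\<^sub>r / k\<^sub>m\<^sub>i\<^sub>n) * diff_energy" by simp
    also have "\<dots> \<le> s * diff_energy" using \<theta>1 diff_energy_nonneg by (rule mult_right_mono)
    finally show ?thesis using \<kappa>(1) s by (intro mult_left_mono add_mono) auto
  qed
  also have "\<dots> = \<kappa> / 2 * s * (diff_energy + (\<Sum>e\<in>\<E>\<^sub>I\<^sub>D. \<gamma> / ?h e * jump_facet e))" by (simp add: distrib_left mult.assoc)
  finally show ?thesis by (simp only: s_def C_def)
qed

lemma diffusion_coercive:
  assumes \<gamma>: "0 < \<gamma>" and \<epsilon>: "\<epsilon> \<in> {-1, 0, 1}"
    and \<alpha>: "\<alpha> \<le> alpha_diffusion \<epsilon> \<kappa> N C\<^sub>t\<^sub>r k\<^sub>m\<^sub>i\<^sub>n \<gamma>"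
  shows "\<alpha> * (diff_energy + (\<Sum>e\<in>\<E>\<^sub>I\<^sub>D. \<gamma> / facet_size \<T> e * jump_facet e)) \<le> dg_diffusion \<Gamma>\<^sub>D K \<epsilon> \<gamma> \<T> v v"
proof -
  define J where "J = (\<Sum>e\<in>\<E>\<^sub>I\<^sub>D. \<gamma> / facet_size \<T> e * jump_facet e)"
  define F where "F = (\<Sum>e\<in>\<E>\<^sub>I\<^sub>D. flux_facet e)"
  define s where "s = sqrt (real N * C\<^sub>t\<^sub>r / (\<gamma> * k\<^sub>m\<^sub>i\<^sub>n))"
  have J0: "0 \<le> J" unfolding J_def
  proof (rule sum_nonneg)
    fix e assume "e \<in> \<E>\<^sub>I\<^sub>D"
    then obtain T where "T \<in> \<T>" "e \<in> facets T" by (rule facet_element)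
    then have "0 < facet_size \<T> e" using size by blast
    then show "0 \<le> \<gamma> / facet_size \<T> e * jump_facet e" using \<gamma> jump_facet_nonneg by simp
  qed
  have form: "dg_diffusion \<Gamma>\<^sub>D K \<epsilon> \<gamma> \<T> v v = diff_energy - F + \<epsilon> * F + J"
    unfolding dg_diffusion_def diff_energy_def F_def J_def flux_facet_def jump_facet_def
    by (simp add: inner_commute[of "jump \<T> _ v _" "average \<T> _ _ _"] power2_norm_eq_inner)
  have E0: "0 \<le> diff_energy + J" using J0 diff_energy_nonneg by simp
  have F: "\<bar>F\<bar> \<le> \<kappa> / 2 * s * (diff_energy + J)"
    using flux_bound[OF \<gamma>] by (simp only: F_def J_def s_def)
  have e1: "0 \<le> 1 - \<epsilon>" using \<epsilon> by auto
  have "(1 - \<epsilon>) * F \<le> (1 - \<epsilon>) * (\<kappa> / 2 * s * (diff_energy + J))"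
    using F e1 by (intro mult_left_mono) auto
  \<comment> \<open>The case distinction in \<open>alpha_diffusion\<close> disappears: for
    \<open>\<epsilon> = 1\<close> the factor \<open>1 - \<epsilon>\<close> vanishes.\<close>
  moreover have "alpha_diffusion \<epsilon> \<kappa> N C\<^sub>t\<^sub>r k\<^sub>m\<^sub>i\<^sub>n \<gamma> * (diff_energy + J) = (diff_energy + J) - (1 - \<epsilon>) * (\<kappa> / 2 * s * (diff_energy + J))"
  proof -
    have "alpha_diffusion \<epsilon> \<kappa> N C\<^sub>t\<^sub>r k\<^sub>m\<^sub>i\<^sub>n \<gamma> = 1 - (1 - \<epsilon>) * (\<kappa> / 2 * s)"
      unfolding alpha_diffusion_def s_def[symmetric] by (simp add: field_simps)
    then show ?thesis by (simp only: left_diff_distrib mult_1 mult.assoc)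
  qed
  moreover have "\<alpha> * (diff_energy + J) \<le> alpha_diffusion \<epsilon> \<kappa> N C\<^sub>t\<^sub>r k\<^sub>m\<^sub>i\<^sub>n \<gamma> * (diff_energy + J)"
    using \<alpha> E0 by (rule mult_right_mono)
  moreover have "diff_energy - F + \<epsilon> * F + J = (diff_energy + J) - (1 - \<epsilon>) * F" by (simp add: algebra_simps)
  ultimately show ?thesis unfolding form J_def[symmetric] by linarith
qed

definition upwind_facet :: "(real^'n) set \<Rightarrow> real" where
  "upwind_facet e = facet_integral e (\<lambda>x. \<bar>cont_rep \<Omega> \<beta> x \<bullet> facet_normal e\<bar> * (norm (jump \<T> e v x))\<^sup>2)"

definition outflow :: "(real^'n) set \<Rightarrow> (real^'n) set \<Rightarrow> real" where
  "outflow T e = facet_integral e (\<lambda>x. (b x \<bullet> normal_on T e) * (q T x)\<^sup>2)"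

lemma facet_in_closure_\<Omega>: "T \<in> \<T> \<Longrightarrow> e \<in> facets T \<Longrightarrow> x \<in> e \<Longrightarrow> x \<in> closure \<Omega>"
  using facet_in_closure closure_element by blast

text \<open>\<open>b\<close> has the same value from both sides and the normals are opposite, so the
  averaged flux times the jump is half of (b . n)(q + q')(q - q'), a difference of squares.\<close>

lemma interior_facet_outflow:
  assumes e: "e \<in> interior_facets \<T>"
  shows "1 / 2 * (\<Sum>T\<in>adjacent \<T> e. outflow T e) = facet_integral e (\<lambda>x. average \<T> e (\<lambda>y. v y *\<^sub>R \<beta> y) x \<bullet> jump \<T> e v x)"
proof -
  obtain T T' where T: "T \<in> \<T>" "T' \<in> \<T>" "T \<noteq> T'" "adjacent \<T> e = {T, T'}" "e \<in> facets T" "e \<in> facets T'"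
    and n: "normal_on T' e = - normal_on T e" by (rule adjacent_interior[OF e])
  obtain d where "flat_piece e (normal_on T e) d" using facet_flat[OF T(1,5)] by blast
  then interpret flat_piece e "normal_on T e" d .
  let ?n = "normal_on T e"
  have cb: "cont_bdd e (\<lambda>x. (b x \<bullet> w) * (q S x)\<^sup>2)" if "S \<in> \<T>" for w S
    by (intro facet_cont_bdd[OF T(1,5)] continuous_intros b_cont[OF T(1,5)] q_cont that)
  have "facet_integral e (\<lambda>x. average \<T> e (\<lambda>y. v y *\<^sub>R \<beta> y) x \<bullet> jump \<T> e v x)
     = facet_integral e (\<lambda>x. 1 / 2 * ((b x \<bullet> ?n) * (q T x)\<^sup>2 + (b x \<bullet> normal_on T' e) * (q T' x)\<^sup>2))"
  proof (rule facet_integral_cong)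
    fix x assume x: "x \<in> e"
    have avg: "average \<T> e (\<lambda>y. v y *\<^sub>R \<beta> y) x = (1 / 2) *\<^sub>R (q T x *\<^sub>R b x + q T' x *\<^sub>R b x)"
      using T(3) cont_rep_advected[OF T(1) facet_in_closure[OF T(1,5) x]] cont_rep_advected[OF T(2) facet_in_closure[OF T(2,6) x]]
      by (simp add: average_def T(4))
    have jmp: "jump \<T> e v x = (q T x - q T' x) *\<^sub>R ?n"
      using T(3) by (simp add: jump_eq[OF x] T(4) n algebra_simps)
    show "average \<T> e (\<lambda>y. v y *\<^sub>R \<beta> y) x \<bullet> jump \<T> e v x
       = 1 / 2 * ((b x \<bullet> ?n) * (q T x)\<^sup>2 + (b x \<bullet> normal_on T' e) * (q T' x)\<^sup>2)"
      unfolding avg jmp by (simp add: n inner_add_left power2_eq_square algebra_simps)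
  qed
  also have "\<dots> = 1 / 2 * (outflow T e + outflow T' e)"
    unfolding facet_integral_cmult outflow_def by (subst facet_integral_add[OF cb cb]) (use T in auto)
  finally show ?thesis using T(3) by (simp add: T(4))
qed

lemma boundary_facet_values:
  assumes T: "T \<in> \<T>" "e \<in> facets T" and adj: "adjacent \<T> e = {T}" and x: "x \<in> e"
  shows "(norm (jump \<T> e v x))\<^sup>2 = (q T x)\<^sup>2" "average \<T> e v x = q T x"
    "\<bar>cont_rep \<Omega> \<beta> x \<bullet> facet_normal e\<bar> = \<bar>b x \<bullet> normal_on T e\<bar>"
proof -
  show "(norm (jump \<T> e v x))\<^sup>2 = (q T x)\<^sup>2"
    using normal_on_nonzero[OF T] by (simp add: jump_eq[OF x] adj power_mult_distrib)
  show "average \<T> e v x = q T x" using cont_rep_v[OF T(1) facet_in_closure[OF T x]] by (simp add: average_def adj)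
  show "\<bar>cont_rep \<Omega> \<beta> x \<bullet> facet_normal e\<bar> = \<bar>b x \<bullet> normal_on T e\<bar>"
    using cont_rep_\<beta>[OF facet_in_closure_\<Omega>[OF T x]] facet_normal_abs[OF T] by simp
qed

lemma dirichlet_facet_outflow:
  assumes e: "e \<in> boundary_facets \<T> \<Gamma>\<^sub>D"
  shows "(\<Sum>T\<in>adjacent \<T> e. outflow T e) = - upwind_facet e"
proof -
  obtain T where T: "T \<in> \<T>" "e \<in> facets T" "e \<subseteq> frontier \<Omega>" "adjacent \<T> e = {T}" "e \<notin> interior_facets \<T>"
    by (rule boundary_facetE[OF disjI1[OF e]])
  have "upwind_facet e = facet_integral e (\<lambda>x. - 1 * ((b x \<bullet> normal_on T e) * (q T x)\<^sup>2))"
    unfolding upwind_facet_def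
  proof (rule facet_integral_cong)
    fix x assume x: "x \<in> e"
    have "x \<in> \<Gamma>\<^sub>D" using e x by (auto simp: boundary_facets_def)
    moreover have "x \<in> flat_boundary \<Omega>" using frontier_facet_normal(1)[OF T(1-3) x] unfolding flat_boundary_iff by blast
    ultimately have "b x \<bullet> normal_on T e \<le> 0" using inflow(1) frontier_facet_normal(2)[OF T(1-3) x] by metis
    then show "\<bar>cont_rep \<Omega> \<beta> x \<bullet> facet_normal e\<bar> * (norm (jump \<T> e v x))\<^sup>2 = - 1 * ((b x \<bullet> normal_on T e) * (q T x)\<^sup>2)"
      by (simp add: boundary_facet_values[OF T(1,2,4) x])
  qed
  then show ?thesis unfolding facet_integral_cmult by (simp add: T(4) outflow_def)
qed

lemma neumann_facet_outflow:
  assumes e: "e \<in> boundary_facets \<T> \<Gamma>\<^sub>N"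
  shows "(\<Sum>T\<in>adjacent \<T> e. outflow T e) = upwind_facet e"
    "facet_integral e (\<lambda>x. (cont_rep \<Omega> \<beta> x \<bullet> outward_normal \<Omega> x) * average \<T> e v x * average \<T> e v x) = upwind_facet e"
proof -
  obtain T where T: "T \<in> \<T>" "e \<in> facets T" "e \<subseteq> frontier \<Omega>" "adjacent \<T> e = {T}" "e \<notin> interior_facets \<T>"
    by (rule boundary_facetE[OF disjI2[OF e]])
  have sgn: "0 \<le> b x \<bullet> normal_on T e" if x: "x \<in> e" for x
  proof -
    have "x \<in> \<Gamma>\<^sub>N" using e x by (auto simp: boundary_facets_def)
    moreover have "x \<in> flat_boundary \<Omega>" using frontier_facet_normal(1)[OF T(1-3) x] unfolding flat_boundary_iff by blast
    ultimately show ?thesis using inflow(2) frontier_facet_normal(2)[OF T(1-3) x] by metis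
  qed
  have up: "upwind_facet e = outflow T e"
    unfolding upwind_facet_def outflow_def
    by (rule facet_integral_cong) (simp add: boundary_facet_values[OF T(1,2,4)] sgn)
  then show "(\<Sum>T\<in>adjacent \<T> e. outflow T e) = upwind_facet e" by (simp add: T(4))
  show "facet_integral e (\<lambda>x. (cont_rep \<Omega> \<beta> x \<bullet> outward_normal \<Omega> x) * average \<T> e v x * average \<T> e v x) = upwind_facet e"
    unfolding up outflow_def
    by (rule facet_integral_cong)
      (simp add: boundary_facet_values[OF T(1,2,4)] frontier_facet_normal(2)[OF T(1-3)] cont_rep_\<beta>[OF facet_in_closure_\<Omega>[OF T(1,2)]] power2_eq_square)
qed

text \<open>The elements are disjoint and cover the domain up to their frontiers, which are
  null.\<close>

lemma L2_norm_elements: "(LINT x|lebesgue_on \<Omega>. (v x)\<^sup>2) = (\<Sum>T\<in>\<T>. LINT x|lebesgue_on T. (q T x)\<^sup>2)"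
proof -
  have int: "integrable lebesgue (\<lambda>x. indicator T x *\<^sub>R (q T x)\<^sup>2)" if T: "T \<in> \<T>" for T
  proof -
    have "integrable (lebesgue_on T) (\<lambda>x. (q T x)\<^sup>2)"
      by (intro Linf_integrable Linf_continuous open_element bounded_element T continuous_intros q_cont)
    then show ?thesis using open_element[OF T] by (simp add: integrable_restrict_space)
  qed
  have eq: "AE x in lebesgue. (\<Sum>T\<in>\<T>. indicator T x *\<^sub>R (q T x)\<^sup>2) = indicator \<Omega> x *\<^sub>R (v x)\<^sup>2"
    using AE_in_element
  proof eventually_elim
    fix x assume x: "x \<in> \<Omega> \<longrightarrow> x \<in> \<Union>\<T>"
    show "(\<Sum>T\<in>\<T>. indicator T x *\<^sub>R (q T x)\<^sup>2) = indicator \<Omega> x *\<^sub>R (v x)\<^sup>2"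
    proof (cases "x \<in> \<Omega>")
      case True
      then obtain T where T: "T \<in> \<T>" "x \<in> T" using x by blast
      have "(\<Sum>S\<in>\<T>. indicator S x *\<^sub>R (q S x)\<^sup>2) = (\<Sum>S\<in>{T}. indicator S x *\<^sub>R (q S x)\<^sup>2)"
        by (rule sum.mono_neutral_right) (use T finite_mesh elements_disjoint in \<open>auto simp: indicator_def\<close>)
      then show ?thesis using T True vq[OF T] by simp
    next
      case False
      then have "x \<notin> T" if "T \<in> \<T>" for T using element_subset[OF that] by blast
      then show ?thesis using False by simp
    qed
  qed
  have "(LINT x|lebesgue_on \<Omega>. (v x)\<^sup>2) = (LINT x|lebesgue. indicator \<Omega> x *\<^sub>R (v x)\<^sup>2)"
    using \<Omega>.open_U by (intro integral_restrict_space) simp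
  also have "\<dots> = (LINT x|lebesgue. (\<Sum>T\<in>\<T>. indicator T x *\<^sub>R (q T x)\<^sup>2))"
  proof (rule integral_cong_AE)
    have m: "(\<lambda>x. \<Sum>T\<in>\<T>. indicator T x *\<^sub>R (q T x)\<^sup>2) \<in> borel_measurable lebesgue"
      by (intro borel_measurable_sum borel_measurable_integrable int)
    then show "(\<lambda>x. \<Sum>T\<in>\<T>. indicator T x *\<^sub>R (q T x)\<^sup>2) \<in> borel_measurable lebesgue" .
    \<comment> \<open>The values of \<open>v\<close> on element frontiers are arbitrary, so
      measurability is inferred from the almost everywhere equality by completeness of the Lebesgue
      measure.\<close>
    show "(\<lambda>x. indicator \<Omega> x *\<^sub>R (v x)\<^sup>2) \<in> borel_measurable lebesgue"
      by (rule borel_measurable_AE[OF m eq])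
    show "AE x in lebesgue. indicator \<Omega> x *\<^sub>R (v x)\<^sup>2 = (\<Sum>T\<in>\<T>. indicator T x *\<^sub>R (q T x)\<^sup>2)"
      using eq by eventually_elim simp
  qed
  also have "\<dots> = (\<Sum>T\<in>\<T>. LINT x|lebesgue. indicator T x *\<^sub>R (q T x)\<^sup>2)"
    by (rule Bochner_Integration.integral_sum) (rule int)
  also have "\<dots> = (\<Sum>T\<in>\<T>. LINT x|lebesgue_on T. (q T x)\<^sup>2)"
    by (intro sum.cong refl integral_restrict_space[symmetric]) (use open_element in simp)
  finally show ?thesis .
qed

text \<open>Bookkeeping of the boundary terms with upwind sums U_I, U_D, U_N. Integration by parts
  leaves minus half the total outflow, that is, minus the averaged interior fluxes, + U_D / 2 and -
  U_N / 2. The form contributes the averaged fluxes, U_I / 2 and the full Neumann term U_N, so half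
  of each sum remains.\<close>

lemma advection_reaction_coercive:
  "\<sigma>\<^sub>0 * (LINT x|lebesgue_on \<Omega>. (v x)\<^sup>2) + 1 / 2 * (\<Sum>e\<in>\<E>\<^sub>I\<^sub>D \<union> boundary_facets \<T> \<Gamma>\<^sub>N. upwind_facet e)
    \<le> dg_advection_reaction \<Omega> \<Gamma>\<^sub>N \<beta> \<sigma> \<T> v v"
proof -
  let ?I = "interior_facets \<T>" and ?D = "boundary_facets \<T> \<Gamma>\<^sub>D" and ?N = "boundary_facets \<T> \<Gamma>\<^sub>N"
  define G where "G i = (SOME g. is_weak_partial \<Omega> i (\<lambda>y. \<beta> y $ i) g)" for i
  have G: "is_weak_partial \<Omega> i (\<lambda>x. \<beta> x $ i) (G i)" for i
  proof -
    have "\<exists>g. is_weak_partial \<Omega> i (\<lambda>y. \<beta> y $ i) g" using \<beta>[of i] unfolding W1inf_def by blast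
    then show ?thesis unfolding G_def by (rule someI_ex)
  qed
  have wd: "weak_div \<Omega> \<beta> x = (\<Sum>i\<in>UNIV. G i x)" for x by (simp add: weak_div_def G_def)
  have green: "\<sigma>\<^sub>0 * (LINT x|lebesgue_on T. (q T x)\<^sup>2) - 1 / 2 * (\<Sum>e\<in>facets T. outflow T e)
     \<le> (LINT x|lebesgue_on T. \<sigma> x * v x * v x) - (LINT x|lebesgue_on T. v x * (\<beta> x \<bullet> grad v x))" if T: "T \<in> \<T>" for T
  proof -
    interpret T: polytopal T by (rule element_polytopal[OF T])
    have "\<sigma>\<^sub>0 * (LINT x|lebesgue_on T. (q T x)\<^sup>2) - 1 / 2 * (\<Sum>e\<in>facets T. facet_integral e (\<lambda>x. (b x \<bullet> normal_on T e) * (q T x)\<^sup>2))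
      \<le> (LINT x|lebesgue_on T. \<sigma> x * (q T x)\<^sup>2) - (LINT x|lebesgue_on T. q T x * (\<beta> x \<bullet> grad (q T) x))"
    proof (rule T.green_inequality[OF contract[OF T] \<Omega>.open_U \<Omega>.bounded_U element_subset[OF T] \<sigma> _ G])
      show "Linf \<Omega> (\<lambda>x. \<beta> x $ i)" for i using \<beta> by (simp add: W1inf_def)
      show "AE x in lebesgue_on \<Omega>. \<sigma>\<^sub>0 \<le> \<sigma> x + 1 / 2 * (\<Sum>i\<in>UNIV. G i x)" using react by (simp only: wd)
      show "continuous_on (closure T) b" by (rule continuous_on_subset[OF b(1) closure_element[OF T]])
      show "AE x in lebesgue_on T. b x = \<beta> x" by (rule AE_element[OF b(2) T])
      show "q T \<in> poly_space p" by (rule q[OF T])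
    qed
    moreover have "(LINT x|lebesgue_on T. \<sigma> x * (q T x)\<^sup>2) = (LINT x|lebesgue_on T. \<sigma> x * v x * v x)"
      by (intro Bochner_Integration.integral_cong refl) (auto simp: space_restrict_space vq[OF T] power2_eq_square)
    moreover have "(LINT x|lebesgue_on T. q T x * (\<beta> x \<bullet> grad (q T) x)) = (LINT x|lebesgue_on T. v x * (\<beta> x \<bullet> grad v x))"
      by (intro Bochner_Integration.integral_cong refl) (auto simp: space_restrict_space vq[OF T] grad_v[OF T])
    ultimately show ?thesis by (simp add: outflow_def)
  qed
  have "\<sigma>\<^sub>0 * (\<Sum>T\<in>\<T>. LINT x|lebesgue_on T. (q T x)\<^sup>2) - 1 / 2 * (\<Sum>T\<in>\<T>. \<Sum>e\<in>facets T. outflow T e)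
     \<le> (\<Sum>T\<in>\<T>. LINT x|lebesgue_on T. \<sigma> x * v x * v x) - (\<Sum>T\<in>\<T>. LINT x|lebesgue_on T. v x * (\<beta> x \<bullet> grad v x))"
    unfolding sum_distrib_left sum_subtractf[symmetric] by (rule sum_mono) (use green in \<open>simp add: sum_distrib_left\<close>)
  moreover have "1 / 2 * (\<Sum>T\<in>\<T>. \<Sum>e\<in>facets T. outflow T e)
     = (\<Sum>e\<in>?I. facet_integral e (\<lambda>x. average \<T> e (\<lambda>y. v y *\<^sub>R \<beta> y) x \<bullet> jump \<T> e v x))
       - 1 / 2 * (\<Sum>e\<in>?D. upwind_facet e) + 1 / 2 * (\<Sum>e\<in>?N. upwind_facet e)"
  proof -
    have "1 / 2 * (\<Sum>e\<in>?I. \<Sum>T\<in>adjacent \<T> e. outflow T e) = (\<Sum>e\<in>?I. facet_integral e (\<lambda>x. average \<T> e (\<lambda>y. v y *\<^sub>R \<beta> y) x \<bullet> jump \<T> e v x))"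
      by (subst sum_distrib_left) (intro sum.cong refl interior_facet_outflow)
    moreover have "(\<Sum>e\<in>?D. \<Sum>T\<in>adjacent \<T> e. outflow T e) = - (\<Sum>e\<in>?D. upwind_facet e)"
      unfolding sum_negf[symmetric] by (intro sum.cong refl dirichlet_facet_outflow)
    moreover have "(\<Sum>e\<in>?N. \<Sum>T\<in>adjacent \<T> e. outflow T e) = (\<Sum>e\<in>?N. upwind_facet e)"
      by (intro sum.cong refl neumann_facet_outflow(1))
    ultimately show ?thesis unfolding sum_over_element_facets by simp
  qed
  moreover have "(\<Sum>e\<in>\<E>\<^sub>I\<^sub>D \<union> ?N. upwind_facet e) = (\<Sum>e\<in>?I. upwind_facet e) + (\<Sum>e\<in>?D. upwind_facet e) + (\<Sum>e\<in>?N. upwind_facet e)"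
  proof -
    have "(\<Sum>e\<in>\<E>\<^sub>I\<^sub>D \<union> ?N. upwind_facet e) = (\<Sum>e\<in>\<E>\<^sub>I\<^sub>D. upwind_facet e) + (\<Sum>e\<in>?N. upwind_facet e)"
      by (rule sum.union_disjoint) (use finite_facet_sets facet_sets_disjoint in auto)
    also have "(\<Sum>e\<in>\<E>\<^sub>I\<^sub>D. upwind_facet e) = (\<Sum>e\<in>?I. upwind_facet e) + (\<Sum>e\<in>?D. upwind_facet e)"
      by (rule sum.union_disjoint) (use finite_facet_sets facet_sets_disjoint in auto)
    finally show ?thesis .
  qed
  moreover have "(\<Sum>e\<in>?N. facet_integral e (\<lambda>x. (cont_rep \<Omega> \<beta> x \<bullet> outward_normal \<Omega> x) * average \<T> e v x * average \<T> e v x)) = (\<Sum>e\<in>?N. upwind_facet e)"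
    by (intro sum.cong refl neumann_facet_outflow(2))
  moreover have "(\<Sum>e\<in>?I. facet_integral e (\<lambda>x. \<bar>cont_rep \<Omega> \<beta> x \<bullet> facet_normal e\<bar> * (jump \<T> e v x \<bullet> jump \<T> e v x))) = (\<Sum>e\<in>?I. upwind_facet e)"
    by (simp add: upwind_facet_def power2_norm_eq_inner)
  ultimately show ?thesis unfolding dg_advection_reaction_def L2_norm_elements by (simp add: algebra_simps)
qed

lemma upwind_facet_nonneg: "0 \<le> upwind_facet e"
  unfolding upwind_facet_def by (rule facet_integral_nonneg) simp

theorem dg_coercive:
  assumes \<gamma>: "0 < \<gamma>" and \<epsilon>: "\<epsilon> \<in> {-1, 0, 1}"
    and \<alpha>: "\<alpha> \<le> 1" "\<alpha> \<le> \<sigma>\<^sub>0" "\<alpha> \<le> alpha_diffusion \<epsilon> \<kappa> N C\<^sub>t\<^sub>r k\<^sub>m\<^sub>i\<^sub>n \<gamma>"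
  shows "\<alpha> * dg_norm_sq \<Omega> \<Gamma>\<^sub>D \<Gamma>\<^sub>N K \<beta> \<gamma> \<T> v \<le> dg_form \<Omega> \<Gamma>\<^sub>D \<Gamma>\<^sub>N K \<beta> \<sigma> \<epsilon> \<gamma> \<T> v v"
proof -
  let ?U = "\<Sum>e\<in>\<E>\<^sub>I\<^sub>D \<union> boundary_facets \<T> \<Gamma>\<^sub>N. upwind_facet e" and ?V = "LINT x|lebesgue_on \<Omega>. (v x)\<^sup>2"
  have "0 \<le> ?V" by (rule Bochner_Integration.integral_nonneg) simp
  then have "\<alpha> * ?V \<le> \<sigma>\<^sub>0 * ?V" using \<alpha>(2) by (intro mult_right_mono)
  moreover have "0 \<le> ?U" by (intro sum_nonneg upwind_facet_nonneg)
  then have "\<alpha> * ?U \<le> 1 * ?U" using \<alpha>(1) by (intro mult_right_mono)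
  moreover have "dg_norm_sq \<Omega> \<Gamma>\<^sub>D \<Gamma>\<^sub>N K \<beta> \<gamma> \<T> v
      = (diff_energy + (\<Sum>e\<in>\<E>\<^sub>I\<^sub>D. \<gamma> / facet_size \<T> e * jump_facet e)) + ?V + 1 / 2 * ?U"
    unfolding dg_norm_sq_def diff_energy_def jump_facet_def upwind_facet_def ..
  ultimately show ?thesis
    using advection_reaction_coercive diffusion_coercive[OF \<gamma> \<epsilon> \<alpha>(3)] unfolding dg_form_def by (simp add: distrib_left)
qed

end

section \<open>From the hypotheses on the mesh sequence to the estimate on one mesh\<close>

lemma diameter_open_pos:
  fixes T :: "'a::euclidean_space set"
  assumes "open T" "bounded T" "T \<noteq> {}"
  shows "0 < diameter T"
proof -
  obtain x where x: "x \<in> T" using assms(3) by blast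
  then obtain e where e: "e > 0" "ball x e \<subseteq> T" using assms(1) openE by blast
  obtain i :: 'a where i: "i \<in> Basis" using nonempty_Basis by blast
  have "x + (e / 2) *\<^sub>R i \<in> T" using e i by (intro subsetD[OF e(2)]) (simp add: dist_norm)
  then have "dist x (x + (e / 2) *\<^sub>R i) \<le> diameter T" by (intro diameter_bounded_bound assms(2) x)
  then show ?thesis using e i by (simp add: dist_norm)
qed

text \<open>The facet size is a diameter or a minimum of diameters, hence nonnegative, and it cannot
  be 0 because it controls the positive diameter of the element. The definition covers dimension
  one, where the minimum over adjacent elements is at most the diameter of \<open>T\<close>.\<close>

lemma (in conforming) facet_size_bounds:
  assumes T: "T \<in> \<T>" "e \<in> facets T" and graded: "diameter T \<le> C * facet_size \<T> e"
  shows "0 < facet_size \<T> e" "facet_size \<T> e \<le> diameter T"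
proof -
  interpret T: polytopal T by (rule element_polytopal[OF T(1)])
  have eT: "e \<subseteq> closure T" using T.facet_props(5)[OF T(2)] by (auto simp: frontier_def)
  have be: "bounded e" using bounded_subset[OF bounded_closure[OF T.bounded_U] eT] .
  have fin: "finite (diameter ` adjacent \<T> e)" and mem: "diameter T \<in> diameter ` adjacent \<T> e"
    using finite_mesh T by (auto simp: adjacent_def)
  have "0 \<le> diameter S" if "S \<in> adjacent \<T> e" for S
    using polytopal.bounded_U[OF element_polytopal] that by (auto simp: adjacent_def intro: diameter_ge_0)
  then have "0 \<le> Min (diameter ` adjacent \<T> e)"
    using fin mem by (subst Min_ge_iff) auto
  then have nn: "0 \<le> facet_size \<T> e" using diameter_ge_0[OF be] by (simp add: facet_size_def)
  have "0 < diameter T" by (rule diameter_open_pos[OF T.open_U T.bounded_U T.nonempty_U])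
  then have "facet_size \<T> e \<noteq> 0" using graded by auto
  then show "0 < facet_size \<T> e" using nn by simp
  have "diameter e \<le> diameter (closure T)" by (rule diameter_subset[OF eT bounded_closure[OF T.bounded_U]])
  then show "facet_size \<T> e \<le> diameter T"
    using Min_le[OF fin mem] by (simp add: facet_size_def diameter_closure[OF T.bounded_U])
qed

lemma AE_bound_closure:
  fixes g :: "real^'n \<Rightarrow> real"
  assumes "open T" "continuous_on (closure T) g" "AE x in lebesgue_on T. g x \<le> c" "x \<in> closure T"
  shows "g x \<le> c"
proof -
  \<comment> \<open>The inequality is rewritten as an equation between continuous functions, which
    extends from almost everywhere to the closure.\<close>
  have "max (g x) c = c"
    by (rule continuous_AE_eq_closure[OF assms(1) _ _ _ assms(4), where G'="\<lambda>_. c"])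
      (use assms(2,3) in \<open>auto intro!: continuous_intros elim: eventually_mono\<close>)
  then show ?thesis by simp
qed

text \<open>Both positive thresholds come from squaring: with a = (1 - \<epsilon>) \<kappa> / 2,
  positivity means that a times the square root is below 1, that is, a squared times N C / k is
  below \<gamma>. This is the threshold, with a = \<kappa> / 2 for \<epsilon> = 0 and a = \<kappa>
  for \<epsilon> = -1.\<close>

lemma alpha_diffusion_pos:
  assumes \<gamma>: "\<gamma> > gamma_threshold \<epsilon> \<kappa> N C k" and \<epsilon>: "\<epsilon> \<in> {-1, 0, 1}" and pos: "0 < C" "0 < k" "0 \<le> \<kappa>"
  shows "0 < \<gamma>" "0 < alpha_diffusion \<epsilon> \<kappa> N C k \<gamma>"
proof -
  define y where "y = real N * C / k"
  have y: "0 \<le> y" using pos by (simp add: y_def)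
  have "0 \<le> gamma_threshold \<epsilon> \<kappa> N C k" using pos by (simp add: gamma_threshold_def)
  then show g0: "0 < \<gamma>" using \<gamma> by linarith
  have sq: "a * sqrt (real N * C / (\<gamma> * k)) < 1" if a: "a\<^sup>2 * y < \<gamma>" for a
  proof (rule power2_less_imp_less)
    have "(a * sqrt (real N * C / (\<gamma> * k)))\<^sup>2 = a\<^sup>2 * y / \<gamma>"
      using g0 pos by (simp add: power_mult_distrib y_def)
    then show "(a * sqrt (real N * C / (\<gamma> * k)))\<^sup>2 < 1\<^sup>2" using a g0 by simp
  qed simp
  consider "\<epsilon> = 1" | "\<epsilon> = 0" | "\<epsilon> = -1" using \<epsilon> by blast
  then show "0 < alpha_diffusion \<epsilon> \<kappa> N C k \<gamma>"
  proof cases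
    case 1 then show ?thesis by (simp add: alpha_diffusion_def)
  next
    case 2
    have "(\<kappa> / 2)\<^sup>2 * y = gamma_threshold \<epsilon> \<kappa> N C k" using 2 by (simp add: gamma_threshold_def y_def power_divide)
    then have "(\<kappa> / 2)\<^sup>2 * y < \<gamma>" using \<gamma> by simp
    from sq[OF this] 2 show ?thesis by (simp add: alpha_diffusion_def)
  next
    case 3
    have "\<kappa>\<^sup>2 * y = gamma_threshold \<epsilon> \<kappa> N C k" using 3 by (simp add: gamma_threshold_def y_def)
    then have "\<kappa>\<^sup>2 * y < \<gamma>" using \<gamma> by simp
    from sq[OF this] 3 show ?thesis by (simp add: alpha_diffusion_def)
  qed
qed

theorem lemma4p2p3:
  fixes \<Omega> \<Gamma>\<^sub>D \<Gamma>\<^sub>N :: "(real^'n) set"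
    and K :: "real^'n \<Rightarrow> real^'n^'n"
    and \<beta> :: "real^'n \<Rightarrow> real^'n"
    and \<sigma> :: "real^'n \<Rightarrow> real"
    and \<M> :: "nat \<Rightarrow> (real^'n) set set"
    and V :: "nat \<Rightarrow> (real^'n \<Rightarrow> real) set"
    and p :: nat
    and k\<^sub>m\<^sub>i\<^sub>n \<sigma>\<^sub>0 C\<^sub>s\<^sub>r C\<^sub>g r C\<^sub>t\<^sub>r \<epsilon> :: real
  assumes domain: "open_polytope \<Omega>" "lipschitz_domain \<Omega>"
    and boundary: "frontier \<Omega> = \<Gamma>\<^sub>D \<union> \<Gamma>\<^sub>N" "\<Gamma>\<^sub>D \<inter> \<Gamma>\<^sub>N = {}" "\<Gamma>\<^sub>D \<noteq> {}"
    and K: "Linf \<Omega> K" "\<And>n T i j. T \<in> \<M> n \<Longrightarrow> W1inf T (\<lambda>x. K x $ i $ j)"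
    and \<beta>: "\<And>i. W1inf \<Omega> (\<lambda>x. \<beta> x $ i)"
    and \<sigma>: "Linf \<Omega> \<sigma>"
    and elliptic: "k\<^sub>m\<^sub>i\<^sub>n > 0" "\<And>x \<xi>. x \<in> \<Omega> \<Longrightarrow> \<xi> \<bullet> (K x *v \<xi>) \<ge> k\<^sub>m\<^sub>i\<^sub>n * (norm \<xi>)\<^sup>2"
    and reaction: "\<sigma>\<^sub>0 > 0" "AE x in lebesgue_on \<Omega>. \<sigma> x + 1 / 2 * weak_div \<Omega> \<beta> x \<ge> \<sigma>\<^sub>0"
    and inflow: "\<not> (AE x in lebesgue_on \<Omega>. \<beta> x = 0) \<Longrightarrow>
        \<Gamma>\<^sub>D \<inter> flat_boundary \<Omega> =
          {x \<in> flat_boundary \<Omega>. cont_rep \<Omega> \<beta> x \<bullet> outward_normal \<Omega> x < 0} \<and>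
        \<Gamma>\<^sub>N \<inter> flat_boundary \<Omega> =
          {x \<in> flat_boundary \<Omega>. cont_rep \<Omega> \<beta> x \<bullet> outward_normal \<Omega> x \<ge> 0}"
    and mesh: "\<And>n. conforming_mesh \<Omega> (\<M> n)"
    and shape_regular: "\<And>n T. T \<in> \<M> n \<Longrightarrow> diameter T \<le> C\<^sub>s\<^sub>r * inradius T"
    and graded: "\<And>n T e. T \<in> \<M> n \<Longrightarrow> e \<in> facets T \<Longrightarrow> diameter T \<le> C\<^sub>g * facet_size (\<M> n) e"
    and star: "0 < r" "r \<le> 1 / 2"
        "\<And>n T. T \<in> \<M> n \<Longrightarrow> \<exists>c\<in>T. star_shaped_wrt T (ball c (r * diameter T))"
    and facets_resolve: "\<And>n T e. T \<in> \<M> n \<Longrightarrow> e \<in> facets T \<Longrightarrow> e \<subseteq> frontier \<Omega> \<Longrightarrow>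
        e \<subseteq> \<Gamma>\<^sub>D \<or> e \<subseteq> \<Gamma>\<^sub>N"
    and constant_sign: "\<And>n T e. T \<in> \<M> n \<Longrightarrow> e \<in> facets T \<Longrightarrow>
        (\<forall>x\<in>e. cont_rep \<Omega> \<beta> x \<bullet> facet_normal e \<ge> 0) \<or>
        (\<forall>x\<in>e. cont_rep \<Omega> \<beta> x \<bullet> facet_normal e \<le> 0)"
    and facets_bounded: "bdd_above {card (facets T) | T n. T \<in> \<M> n}"
    and trace: "C\<^sub>t\<^sub>r > 0" "\<And>n T v. T \<in> \<M> n \<Longrightarrow> v \<in> poly_space p \<Longrightarrow>
        (\<Sum>e\<in>facets T. facet_integral e (\<lambda>x. (v x)\<^sup>2))
          \<le> C\<^sub>t\<^sub>r / diameter T * (LINT x|lebesgue_on T. (v x)\<^sup>2)"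
    and V: "\<And>n. V n \<subseteq> broken_poly_space p (\<M> n)"
    and \<epsilon>: "\<epsilon> \<in> {-1, 0, 1}"
  shows "\<forall>\<gamma> > gamma_threshold \<epsilon> (Linf_norm_matrix \<Omega> K) (max_facets \<M>) C\<^sub>t\<^sub>r k\<^sub>m\<^sub>i\<^sub>n.
    \<exists>\<alpha> > 0.
      \<alpha> = Min {1, \<sigma>\<^sub>0,
        alpha_diffusion \<epsilon> (Linf_norm_matrix \<Omega> K) (max_facets \<M>) C\<^sub>t\<^sub>r k\<^sub>m\<^sub>i\<^sub>n \<gamma>} \<and>
      (\<forall>n. \<forall>v \<in> V n.
        dg_form \<Omega> \<Gamma>\<^sub>D \<Gamma>\<^sub>N K \<beta> \<sigma> \<epsilon> \<gamma> (\<M> n) v v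
          \<ge> \<alpha> * dg_norm_sq \<Omega> \<Gamma>\<^sub>D \<Gamma>\<^sub>N K \<beta> \<gamma> (\<M> n) v)"
proof (intro allI impI)
  fix \<gamma> assume \<gamma>: "\<gamma> > gamma_threshold \<epsilon> (Linf_norm_matrix \<Omega> K) (max_facets \<M>) C\<^sub>t\<^sub>r k\<^sub>m\<^sub>i\<^sub>n"
  define \<kappa> where "\<kappa> = Linf_norm_matrix \<Omega> K"
  define N where "N = max_facets \<M>"
  interpret \<Omega>: polytopal \<Omega> using domain(1) by unfold_locales
  note \<kappa>b = Linf_norm_matrix_bound[OF \<Omega>.open_U \<Omega>.nonempty_U K(1), folded \<kappa>_def]
  note pos = alpha_diffusion_pos[OF \<gamma>[folded \<kappa>_def N_def] \<epsilon> trace(1) elliptic(1) \<kappa>b(2)]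
  define \<alpha> where "\<alpha> = Min {1, \<sigma>\<^sub>0, alpha_diffusion \<epsilon> \<kappa> N C\<^sub>t\<^sub>r k\<^sub>m\<^sub>i\<^sub>n \<gamma>}"
  have \<alpha>: "0 < \<alpha>" "\<alpha> \<le> 1" "\<alpha> \<le> \<sigma>\<^sub>0" "\<alpha> \<le> alpha_diffusion \<epsilon> \<kappa> N C\<^sub>t\<^sub>r k\<^sub>m\<^sub>i\<^sub>n \<gamma>"
    using pos(2) reaction(1) by (auto simp: \<alpha>_def)
  have "\<exists>B. continuous_on (closure \<Omega>) B \<and> (AE x in lebesgue_on \<Omega>. B x = \<beta> x $ i)" for i
    by (rule lipschitz_domain_rep[OF domain(2) \<Omega>.bounded_U \<beta>])
  then obtain B where B: "\<And>i. continuous_on (closure \<Omega>) (B i)" "\<And>i. AE x in lebesgue_on \<Omega>. B i x = \<beta> x $ i" by metis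
  define b where "b x = (\<chi> i. B i x)" for x
  have bc: "continuous_on (closure \<Omega>) b" unfolding b_def by (intro continuous_on_vec_lambda B)
  have bae: "AE x in lebesgue_on \<Omega>. b x = \<beta> x"
    using eventually_all_finite[OF B(2)] by eventually_elim (simp add: b_def vec_eq_iff)
  have b_rep: "cont_rep \<Omega> \<beta> x = b x" if "x \<in> flat_boundary \<Omega>" for x
    by (rule cont_rep_eq[OF \<Omega>.open_U bc bae]) (use that in \<open>auto simp: flat_boundary_def frontier_def\<close>)
  have sign: "(x \<in> \<Gamma>\<^sub>D \<longrightarrow> b x \<bullet> outward_normal \<Omega> x \<le> 0) \<and> (x \<in> \<Gamma>\<^sub>N \<longrightarrow> 0 \<le> b x \<bullet> outward_normal \<Omega> x)"
    if x: "x \<in> flat_boundary \<Omega>" for x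
  proof (cases "AE x in lebesgue_on \<Omega>. \<beta> x = 0")
    \<comment> \<open>The inflow condition is imposed only for a nontrivial field. If
      \<open>\<beta>\<close> vanishes almost everywhere, so does its continuous representative
      everywhere on the closure, and both signs are trivial.\<close>
    case True
    have "AE x in lebesgue_on \<Omega>. b x = 0" using True bae by eventually_elim simp
    then have "b x = 0"
      by (intro continuous_AE_eq_closure[OF \<Omega>.open_U bc continuous_on_const]) (use x in \<open>auto simp: flat_boundary_def frontier_def\<close>)
    then show ?thesis by simp
  next
    case False
    note inflow[OF this]
    then have "x \<in> \<Gamma>\<^sub>D \<Longrightarrow> b x \<bullet> outward_normal \<Omega> x < 0" "x \<in> \<Gamma>\<^sub>N \<Longrightarrow> 0 \<le> b x \<bullet> outward_normal \<Omega> x"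
      unfolding b_rep[OF x, symmetric] using x by blast+
    then show ?thesis by (auto simp: less_imp_le)
  qed
  have "\<alpha> * dg_norm_sq \<Omega> \<Gamma>\<^sub>D \<Gamma>\<^sub>N K \<beta> \<gamma> (\<M> n) v \<le> dg_form \<Omega> \<Gamma>\<^sub>D \<Gamma>\<^sub>N K \<beta> \<sigma> \<epsilon> \<gamma> (\<M> n) v v" if v: "v \<in> V n" for n v
  proof -
    interpret conforming \<Omega> \<Gamma>\<^sub>D \<Gamma>\<^sub>N "\<M> n"
      using domain boundary(1,2) mesh facets_resolve by unfold_locales auto
    have op: "open T" "bounded T" "T \<noteq> {}" "T \<subseteq> \<Omega>" if "T \<in> \<M> n" for T
      using polytopal.open_U polytopal.bounded_U polytopal.nonempty_U element_polytopal[OF that] element_subset[OF that] by blast+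
    have "\<forall>T\<in>\<M> n. \<exists>q\<in>poly_space p. \<forall>x\<in>T. v x = q x" using V v unfolding broken_poly_space_def by blast
    then obtain q where q: "\<And>T. T \<in> \<M> n \<Longrightarrow> q T \<in> poly_space p" "\<And>T x. T \<in> \<M> n \<Longrightarrow> x \<in> T \<Longrightarrow> v x = q T x" by metis
    obtain c where c: "\<And>T. T \<in> \<M> n \<Longrightarrow> star_shaped_wrt T (ball (c T) (r * diameter T))" using star(3)[of _ n] by metis
    have rd: "0 < r * diameter T" if "T \<in> \<M> n" for T using diameter_open_pos[OF op(1-3)[OF that]] star(1) by simp
    \<comment> \<open>\<open>K\<close> is regular on single elements only, so its representative is
      chosen entry by entry on each element; star-shapedness provides its continuity up to the
      boundary.\<close>
    define A where "A T i j = (SOME G. continuous_on (closure T) G \<and> (AE x in lebesgue_on T. G x = K x $ i $ j))" for T i j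
    have A: "continuous_on (closure T) (A T i j) \<and> (AE x in lebesgue_on T. A T i j x = K x $ i $ j)" if T: "T \<in> \<M> n" for T i j
      unfolding A_def by (rule someI_ex[OF star_shaped_rep[OF op(1,2)[OF T] rd[OF T] c[OF T] K(2)[OF T]]])
    define Kt where "Kt T x = (\<chi> i j. A T i j x)" for T x
    have Ktc: "continuous_on (closure T) (Kt T)" if "T \<in> \<M> n" for T
      unfolding Kt_def using A that by (intro continuous_on_vec_lambda) blast
    have Ktae: "AE x in lebesgue_on T. Kt T x = K x" if T: "T \<in> \<M> n" for T
    proof -
      have "AE x in lebesgue_on T. \<forall>i j. A T i j x = K x $ i $ j"
        by (intro eventually_all_finite) (use A T in blast)
      then show ?thesis by eventually_elim (simp add: Kt_def vec_eq_iff)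
    qed
    \<comment> \<open>The spectral bound on \<open>K\<close> holds almost everywhere, but it is
      needed on facets, which are null; continuity of the representative carries it there.\<close>
    have Ktb: "norm (Kt T x *v \<xi>) \<le> \<kappa> * norm \<xi>" if T: "T \<in> \<M> n" and x: "x \<in> closure T" for T x \<xi>
    proof (rule AE_bound_closure[OF op(1)[OF T] _ _ x])
      have "continuous_on (closure T) (\<lambda>x. Kt T x $ i $ j)" for i j by (intro continuous_intros Ktc T)
      then show "continuous_on (closure T) (\<lambda>x. norm (Kt T x *v \<xi>))"
        unfolding matrix_vector_mult_def
        by (intro continuous_on_norm continuous_on_vec_lambda continuous_on_sum continuous_on_mult continuous_on_const)
      have "AE x in lebesgue. x \<in> \<Omega> \<longrightarrow> (\<forall>\<xi>. norm (K x *v \<xi>) \<le> \<kappa> * norm \<xi>)" using \<kappa>b(1) \<Omega>.open_U by (simp add: AE_restrict_space_iff)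
      then have "AE x in lebesgue. x \<in> T \<longrightarrow> (\<forall>\<xi>. norm (K x *v \<xi>) \<le> \<kappa> * norm \<xi>)" by eventually_elim (use op(4)[OF T] in blast)
      then have "AE x in lebesgue_on T. \<forall>\<xi>. norm (K x *v \<xi>) \<le> \<kappa> * norm \<xi>" using op(1)[OF T] by (simp add: AE_restrict_space_iff)
      with Ktae[OF T] show "AE x in lebesgue_on T. norm (Kt T x *v \<xi>) \<le> \<kappa> * norm \<xi>" by eventually_elim simp
    qed
    \<comment> \<open>The supremum defining \<open>max_facets\<close> is an upper bound because the
      facet numbers of the mesh sequence are bounded.\<close>
    have card: "card (facets T) \<le> N" if "T \<in> \<M> n" for T
      unfolding N_def max_facets_def by (rule cSup_upper[OF _ facets_bounded]) (use that in blast)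
    have contract: "x + t *\<^sub>R (c T - x) \<in> T" if "T \<in> \<M> n" "x \<in> closure T" "0 < t" "t \<le> 1" for T x t
      by (rule star_shaped_contract[OF op(1)[OF that(1)] rd[OF that(1)] c[OF that(1)] that(2-4)])
    have KL: "Linf T (\<lambda>x. K x $ i $ j)" if "T \<in> \<M> n" for T i j
      using K(2)[OF that] unfolding W1inf_def by blast
    have size: "0 < facet_size (\<M> n) e \<and> facet_size (\<M> n) e \<le> diameter T" if "T \<in> \<M> n" "e \<in> facets T" for T e
      using facet_size_bounds[OF that graded[OF that]] by blast
    have signD: "b x \<bullet> outward_normal \<Omega> x \<le> 0" if "x \<in> \<Gamma>\<^sub>D" "x \<in> flat_boundary \<Omega>" for x using sign that by blast
    have signN: "0 \<le> b x \<bullet> outward_normal \<Omega> x" if "x \<in> \<Gamma>\<^sub>N" "x \<in> flat_boundary \<Omega>" for x using sign that by blast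
    interpret dg_function \<Omega> \<Gamma>\<^sub>D \<Gamma>\<^sub>N "\<M> n" K \<beta> \<sigma> k\<^sub>m\<^sub>i\<^sub>n \<sigma>\<^sub>0 C\<^sub>t\<^sub>r \<kappa> p N v q Kt b c
      by unfold_locales (fact q contract KL Ktc Ktae \<kappa>b(2) Ktb bc bae \<sigma> \<beta> elliptic reaction(2) signD signN size card trace)+
    show ?thesis by (rule dg_coercive[OF pos(1) \<epsilon> \<alpha>(2-4)])
  qed
  then show "\<exists>\<alpha>>0. \<alpha> = Min {1, \<sigma>\<^sub>0, alpha_diffusion \<epsilon> (Linf_norm_matrix \<Omega> K) (max_facets \<M>) C\<^sub>t\<^sub>r k\<^sub>m\<^sub>i\<^sub>n \<gamma>} \<and>
      (\<forall>n. \<forall>v \<in> V n. dg_form \<Omega> \<Gamma>\<^sub>D \<Gamma>\<^sub>N K \<beta> \<sigma> \<epsilon> \<gamma> (\<M> n) v v \<ge> \<alpha> * dg_norm_sq \<Omega> \<Gamma>\<^sub>D \<Gamma>\<^sub>N K \<beta> \<gamma> (\<M> n) v)"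
    using \<alpha>(1) unfolding \<alpha>_def \<kappa>_def N_def by blast
qed

end
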